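(* Let $f:Y\to X$ be a nonconstant holomorphic map of compact connected Riemann surfaces, let $E_*$ be a parabolic vector bundle on $(X,D)$, let $L_*$ be a parabolic line bundle of parabolic degree $0$ on $(X,D)$, and let $\phi$ be an $L_*$-valued parabolic symplectic (respectively, parabolic orthogonal) structure on $E_*$. Let $\nabla$ be a quasiparabolic connection on the parabolic symplectic (respectively, parabolic orthogonal) vector bundle $(E_*,\phi)$. Then the pulled back connection $f^*\nabla$ is a quasiparabolic connection on the pulled back $f^*L_*$-valued parabolic symplectic (respectively, parabolic orthogonal) vector bundle $(f^*E_*,f^*\phi)$ on $Y$.
   Context: **Parabolic bundles.** $X$ is a compact connected Riemann surface, $D=\{x_1,\dots,x_\ell\}\subset X$ a finite subset (also a reduced divisor), $K_X(D)=K_X\otimes\mathcal O_X(D)$. A parabolic vector bundle $E_*$ on $(X,D)$ is a holomorphic vector bundle $E$ on $X$ with, for each $i$, a filtration $E_{x_i}=E_i^1\supsetneq\cdots\supsetneq E_i^{n_i}\supsetneq E_i^{n_i+1}=0$ and weights $0\le\alpha_{i,1}<\cdots<\alpha_{i,n_i}<1$. Parabolic degree: $\deg E+\sum_{i,j}\alpha_{i,j}\dim(E_i^j/E_i^{j+1})$. Equivalently: for $x=x_i$ with local coordinate $z$ and $t\in[0,1)$, $E_{x,t}$ is the module of germs $s$ of sections of $E$ at $x$ with $s(x)\in E_i^j$, $j$ the smallest index with $\alpha_{i,j}\ge t$ ($j=n_i+1$ if none); $E_{x,t+1}=zE_{x,t}$ for all $t\in\mathbb R$. The $t=0$ terms recover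 $E$ and the jumps recover the weights. Homomorphisms are bundle maps with $E_{x,t}\to E'_{x,t}$. $(E_*\otimes E'_* )_{x,t}=\sum_{a+b=t}E_{x,a}\otimes E'_{x,b}$; $(E_*^* )_{x,t}$ consists of germs of meromorphic functionals (poles only at $x$) mapping $E_{x,a}$ to $z^{\lceil a+t\rceil}\mathcal O_{X,x}$ for all $a$. **Structures.** For $L_*$ a parabolic line bundle of parabolic degree $0$, a homomorphism $\phi:E_*\otimes E_*\to L_*$ is an $L_*$-valued parabolic orthogonal (respectively, symplectic) structure if $\phi|_{X\setminus D}$ is symmetric (respectively, anti-symmetric) and $\widehat\phi:E_*\to E_*^*\otimes L_*$, $u\mapsto\phi(u\otimes\cdot)$, is an isomorphism of parabolic vector bundles. **Connections.** A quasiparabolic connection on $E_*$ is a logarithmic connection $\nabla:E\to E\otimes K_X(D)$ with $\mathrm{Res}(\nabla,x_i)(E_i^j)\subset E_i^j$ for all $i,j$. For $L_*$ of parabolic degree $0$ with weights $\beta_i$ at $x_i$, $D_L$ is the unique logarithmic connection on $L$ with unitary monodromy and $\mathrm{Res}(D_L,x_i)=\beta_i$. A quasiparabolic connection on $(E_*,\phi)$ is a quasiparabolic connection $\nabla$ on $E_*$ compatible with $\phi$: $(\phi\otimes\mathrm{Id})(\nabla u\otimes v)+(\phi\otimes\mathrm{Id})(u\otimes\nabla v)=D_L(\phi(u\otimes v))$ for all local sections $u,v$ of $E$. The same definitions are used on $Y$. **Pullback.** Let $B=f^{-1}(D)_{\rm red}\subset Y$. The parabolic bundle $f^*E_*$ on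 $(Y,B)$ restricts to $f^*(E|_{X\setminus D})$ on $Y\setminus B$, and for $y\in B$ with local coordinate $w$ and multiplicity $m_y$ of $f$ at $y$, $(f^*E_* )_{y,s}$ is the $\mathcal O_{Y,y}$-module generated by $w^kf^*u$ with $u\in E_{f(y),t}$, $k\in\mathbb Z$, $t\in\mathbb R$, $m_yt+k\ge s$. $f^*\phi:f^*E_*\otimes f^*E_*\to f^*L_*$ is the $f^*L_*$-valued structure extending the usual pullback of $\phi|_{X\setminus D}$, and $f^*\nabla$ is the quasiparabolic connection on $f^*E_*$ extending the usual pullback of $\nabla|_{X\setminus D}$. *)

theory Defs
  imports "HOL-Complex_Analysis.Complex_Analysis"
begin

section \<open>Riemann surfaces and holomorphic functions\<close>

text \<open>
  The underlying space of a Riemann surface is the universe of a type of class \<open>t2_space\<close>; the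
  complex structure is a holomorphic atlas of charts \<open>(U, z)\<close>, \<open>z\<close> being relevant on \<open>U\<close> only.
\<close>

type_synonym 'x chart = "'x set \<times> ('x \<Rightarrow> complex)"

definition riemann_surface :: "'x::t2_space chart set \<Rightarrow> bool" where
  "riemann_surface X \<longleftrightarrow>
     (\<Union>(U, z)\<in>X. U) = UNIV \<and>
     (\<forall>(U, z)\<in>X. open U \<and> open (z ` U) \<and> homeomorphism U (z ` U) z (inv_into U z)) \<and>
     (\<forall>(U, z)\<in>X. \<forall>(U', z')\<in>X. (z' \<circ> inv_into U z) holomorphic_on z ` (U \<inter> U'))"

definition compact_connected_riemann_surface :: "'x::t2_space chart set \<Rightarrow> bool" where
  "compact_connected_riemann_surface X \<longleftrightarrow>
     riemann_surface X \<and> compact (UNIV :: 'x set) \<and> connected (UNIV :: 'x set)"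

definition holo :: "'x::t2_space chart set \<Rightarrow> 'x set \<Rightarrow> ('x \<Rightarrow> complex) \<Rightarrow> bool" where
  "holo X W h \<longleftrightarrow>
     open W \<and> (\<forall>(U, z)\<in>X. (h \<circ> inv_into U z) holomorphic_on z ` (U \<inter> W))"

definition holo_germ :: "'x::t2_space chart set \<Rightarrow> 'x \<Rightarrow> ('x \<Rightarrow> complex) \<Rightarrow> bool" where
  "holo_germ X x h \<longleftrightarrow> (\<exists>W. x \<in> W \<and> holo X W h)"

text \<open>\<open>chart_deriv (U, z) h p\<close> is \<open>dh/dz\<close> at \<open>p \<in> U\<close>.\<close>

definition chart_deriv :: "'x chart \<Rightarrow> ('x \<Rightarrow> complex) \<Rightarrow> 'x \<Rightarrow> complex" where
  "chart_deriv c h p = deriv (h \<circ> inv_into (fst c) (snd c)) (snd c p)"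

definition chart_at :: "'x chart set \<Rightarrow> 'x \<Rightarrow> 'x chart" where
  "chart_at X x = (SOME c. c \<in> X \<and> x \<in> fst c)"

text \<open>A local coordinate at \<open>x\<close>, vanishing at \<open>x\<close>.\<close>

definition coord :: "'x chart set \<Rightarrow> 'x \<Rightarrow> 'x \<Rightarrow> complex" where
  "coord X x p = snd (chart_at X x) p - snd (chart_at X x) x"

text \<open>Order at \<open>x\<close> of a function that is meromorphic near \<open>x\<close>.\<close>

definition order_at :: "'x chart set \<Rightarrow> ('x \<Rightarrow> complex) \<Rightarrow> 'x \<Rightarrow> int" where
  "order_at X h x =
     (let (U, z) = chart_at X x in zorder (h \<circ> inv_into U z) (z x))"

definition holo_map ::
  "'y::t2_space chart set \<Rightarrow> 'x::t2_space chart set \<Rightarrow> ('y \<Rightarrow> 'x) \<Rightarrow> bool" where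
  "holo_map Y X f \<longleftrightarrow>
     continuous_on UNIV f \<and> (\<forall>(U, z)\<in>X. holo Y (f -` U) (z \<circ> f))"

definition ramification ::
  "'y chart set \<Rightarrow> 'x chart set \<Rightarrow> ('y \<Rightarrow> 'x) \<Rightarrow> 'y \<Rightarrow> int" where
  "ramification Y X f y = order_at Y (\<lambda>p. coord X (f y) (f p)) y"


section \<open>Holomorphic vector bundles\<close>

text \<open>
  Choosing a basis of every single fibre, one may take all fibres of a bundle of rank \<open>CARD('r)\<close>
  to be \<open>complex ^ 'r\<close> as vector spaces.  This says nothing about the topology or the holomorphic
  structure of the total space: these are given by a set of trivializations \<open>(U, g)\<close>, where the
  invertible matrix \<open>g p\<close> maps the fibre at \<open>p \<in> U\<close> to its coordinates.  No continuity of \<open>g\<close>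
  is required, only that the transition matrices be holomorphic.  So a section is a function into
  \<open>complex ^ 'r\<close>, and the columns of \<open>matrix_inv (g p)\<close> form a holomorphic frame over \<open>U\<close>.
\<close>

type_synonym ('x, 'r) bundle_atlas = "('x set \<times> ('x \<Rightarrow> complex ^ 'r ^ 'r)) set"

definition vector_bundle ::
  "'x::t2_space chart set \<Rightarrow> 'x set \<Rightarrow> ('x, 'r::finite) bundle_atlas \<Rightarrow> bool" where
  "vector_bundle X S T \<longleftrightarrow>
     (\<Union>(U, g)\<in>T. U) = S \<and>
     (\<forall>(U, g)\<in>T. open U \<and> (\<forall>p\<in>U. invertible (g p))) \<and>
     (\<forall>(U, g)\<in>T. \<forall>(U', g')\<in>T. \<forall>i j.
        holo X (U \<inter> U') (\<lambda>p. (g' p ** matrix_inv (g p)) $ i $ j))"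

definition holo_section ::
  "'x::t2_space chart set \<Rightarrow> ('x, 'r::finite) bundle_atlas \<Rightarrow> 'x set \<Rightarrow> ('x \<Rightarrow> complex ^ 'r) \<Rightarrow> bool"
where
  "holo_section X T W s \<longleftrightarrow>
     open W \<and> (\<forall>(U, g)\<in>T. \<forall>i. holo X (U \<inter> W) (\<lambda>p. (g p *v s p) $ i))"

definition triv_at ::
  "('x, 'r::finite) bundle_atlas \<Rightarrow> 'x \<Rightarrow> 'x set \<times> ('x \<Rightarrow> complex ^ 'r ^ 'r)" where
  "triv_at T x = (SOME c. c \<in> T \<and> x \<in> fst c)"

text \<open>
  The degree of a line bundle is the degree of the divisor of a meromorphic section \<open>s\<close> that is
  not identically zero; the finite set \<open>P\<close> contains all zeros and poles of \<open>s\<close>.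
\<close>

definition has_degree ::
  "'x::t2_space chart set \<Rightarrow> ('x, 1) bundle_atlas \<Rightarrow> int \<Rightarrow> bool" where
  "has_degree X T d \<longleftrightarrow>
     (\<exists>s P. finite P \<and> holo_section X T (- P) s \<and> (\<forall>p. p \<notin> P \<longrightarrow> s p \<noteq> 0) \<and>
        (\<forall>x\<in>P. \<exists>(n::nat) W u. x \<in> W \<and> holo_section X T W u \<and>
           (\<forall>\<^sub>F p in at x. coord X x p ^ n *s s p = u p)) \<and>
        d = (\<Sum>x\<in>P. order_at X (\<lambda>p. (snd (triv_at T x) p *v s p) $ 1) x))"


section \<open>Parabolic bundles\<close>

text \<open>
  A flagged bundle consists of a holomorphic bundle on \<open>X\<close>, the lengths \<open>steps x\<close>, the flags
  \<open>flag x 1 \<supset> \<dots> \<supset> flag x (steps x + 1) = 0\<close> and the weights \<open>wt x 1 < \<dots> < wt x (steps x)\<close>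
  at the parabolic points \<open>x\<close>.
\<close>

record ('x, 'r) flagged_bundle =
  triv :: "('x, 'r) bundle_atlas"
  steps :: "'x \<Rightarrow> nat"
  flag :: "'x \<Rightarrow> nat \<Rightarrow> (complex ^ 'r) set"
  wt :: "'x \<Rightarrow> nat \<Rightarrow> real"

definition flagged_bundle ::
  "'x::t2_space chart set \<Rightarrow> 'x set \<Rightarrow> ('x, 'r::finite) flagged_bundle \<Rightarrow> bool" where
  "flagged_bundle X D V \<longleftrightarrow>
     finite D \<and> vector_bundle X UNIV (triv V) \<and>
     (\<forall>x\<in>D. 1 \<le> steps V x \<and>
        flag V x 1 = UNIV \<and> flag V x (steps V x + 1) = {0} \<and>
        (\<forall>j\<in>{1..steps V x + 1}. vec.subspace (flag V x j)) \<and>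
        (\<forall>j\<in>{1..steps V x}. flag V x (j + 1) \<subset> flag V x j) \<and>
        (\<forall>j\<in>{1..steps V x}. 0 \<le> wt V x j \<and> wt V x j < 1) \<and>
        strict_mono_on {1..steps V x} (wt V x))"

text \<open>
  The modules \<open>E\<^bsub>x,t\<^esub>\<close>.  Germs at \<open>x\<close> are represented by functions that are relevant
  only on small punctured neighbourhoods of \<open>x\<close>, i.e. up to equality eventually in \<open>at x\<close>; a germ
  of a section on a full neighbourhood is determined by its restriction to punctured ones.
\<close>

definition flag_index :: "('x, 'r::finite) flagged_bundle \<Rightarrow> 'x \<Rightarrow> real \<Rightarrow> nat" where
  "flag_index V x t = (LEAST j. 1 \<le> j \<and> (j \<le> steps V x \<longrightarrow> t \<le> wt V x j))"

definition flag_germs ::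
  "'x::t2_space chart set \<Rightarrow> ('x, 'r::finite) flagged_bundle \<Rightarrow> 'x \<Rightarrow> real \<Rightarrow> ('x \<Rightarrow> complex ^ 'r) set"
where
  "flag_germs X V x t =
     {s. \<exists>W u. x \<in> W \<and> holo_section X (triv V) W u \<and> u x \<in> flag V x (flag_index V x (frac t)) \<and>
         (\<forall>\<^sub>F p in at x. s p = (coord X x p powi \<lfloor>t\<rfloor>) *s u p)}"

text \<open>
  Parabolic bundles are handled through the equivalent description by their restriction to
  \<open>X - D\<close> (trivializations \<open>atlas\<close> over \<open>- D\<close>) together with the modules \<open>E\<^bsub>x,t\<^esub>\<close>
  for \<open>x \<in> D\<close>, because tensor products, duals and pullbacks are defined in these terms.
  Such data are a parabolic bundle iff they come from a holomorphic bundle on \<open>X\<close> with flags and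
  weights.  That flagged bundle is determined uniquely up to a unique isomorphism which is the
  identity over \<open>X - D\<close> (its fibres over \<open>D\<close> are a matter of labelling), so quantifying
  existentially over it below makes no choice.
\<close>

record ('x, 'r) filtered_bundle =
  atlas :: "('x, 'r) bundle_atlas"
  germs :: "'x \<Rightarrow> real \<Rightarrow> ('x \<Rightarrow> complex ^ 'r) set"

definition presents ::
  "'x::t2_space chart set \<Rightarrow> 'x set \<Rightarrow> ('x, 'r::finite) flagged_bundle \<Rightarrow> ('x, 'r) filtered_bundle \<Rightarrow> bool"
where
  "presents X D V E \<longleftrightarrow>
     flagged_bundle X D V \<and> vector_bundle X (- D) (atlas E) \<and>
     (\<forall>W s. W \<subseteq> - D \<longrightarrow> (holo_section X (triv V) W s \<longleftrightarrow> holo_section X (atlas E) W s)) \<and>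
     (\<forall>x\<in>D. \<forall>t. germs E x t = flag_germs X V x t)"

definition parabolic_bundle ::
  "'x::t2_space chart set \<Rightarrow> 'x set \<Rightarrow> ('x, 'r::finite) filtered_bundle \<Rightarrow> bool" where
  "parabolic_bundle X D E \<longleftrightarrow> (\<exists>V. presents X D V E)"

definition weight_sum :: "'x set \<Rightarrow> ('x, 'r::finite) flagged_bundle \<Rightarrow> real" where
  "weight_sum D V =
     (\<Sum>x\<in>D. \<Sum>j=1..steps V x.
        wt V x j * (real (vec.dim (flag V x j)) - real (vec.dim (flag V x (j + 1)))))"

definition parabolic_line_bundle_deg0 ::
  "'x::t2_space chart set \<Rightarrow> 'x set \<Rightarrow> ('x, 1) filtered_bundle \<Rightarrow> bool" where
  "parabolic_line_bundle_deg0 X D L \<longleftrightarrow>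
     (\<exists>V d. presents X D V L \<and> has_degree X (triv V) d \<and> of_int d + weight_sum D V = 0)"

text \<open>
  A homomorphism of parabolic bundles is given by its restriction to \<open>X - D\<close> (the values of
  \<open>\<psi>\<close> on \<open>D\<close> are irrelevant): since it maps \<open>E\<^bsub>x,0\<^esub>\<close> to \<open>E'\<^bsub>x,0\<^esub>\<close>, it extends uniquely to the
  underlying bundles on \<open>X\<close>.
\<close>

definition parabolic_hom ::
  "'x::t2_space chart set \<Rightarrow> 'x set \<Rightarrow> ('x, 'r::finite) filtered_bundle \<Rightarrow> ('x, 's::finite) filtered_bundle
     \<Rightarrow> ('x \<Rightarrow> complex ^ 'r ^ 's) \<Rightarrow> bool" where
  "parabolic_hom X D E E' \<psi> \<longleftrightarrow>
     (\<forall>W s. W \<subseteq> - D \<longrightarrow> holo_section X (atlas E) W s \<longrightarrow>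
        holo_section X (atlas E') W (\<lambda>p. \<psi> p *v s p)) \<and>
     (\<forall>x\<in>D. \<forall>t. \<forall>s\<in>germs E x t. (\<lambda>p. \<psi> p *v s p) \<in> germs E' x t)"

definition parabolic_iso ::
  "'x::t2_space chart set \<Rightarrow> 'x set \<Rightarrow> ('x, 'r::finite) filtered_bundle \<Rightarrow> ('x, 's::finite) filtered_bundle
     \<Rightarrow> ('x \<Rightarrow> complex ^ 'r ^ 's) \<Rightarrow> bool" where
  "parabolic_iso X D E E' \<psi> \<longleftrightarrow>
     parabolic_hom X D E E' \<psi> \<and>
     (\<exists>\<eta>. parabolic_hom X D E' E \<eta> \<and>
        (\<forall>p. p \<notin> D \<longrightarrow> \<eta> p ** \<psi> p = mat 1 \<and> \<psi> p ** \<eta> p = mat 1))"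

definition tensor_vec :: "complex ^ 'r \<Rightarrow> complex ^ 's \<Rightarrow> complex ^ ('r \<times> 's)" where
  "tensor_vec u v = (\<chi> ij. u $ fst ij * v $ snd ij)"

definition tensor_mat ::
  "complex ^ 'r ^ 'r \<Rightarrow> complex ^ 's ^ 's \<Rightarrow> complex ^ ('r \<times> 's) ^ ('r \<times> 's)" where
  "tensor_mat g g' = (\<chi> ij kl. g $ fst ij $ fst kl * g' $ snd ij $ snd kl)"

definition parabolic_tensor ::
  "('x::t2_space, 'r::finite) filtered_bundle \<Rightarrow> ('x, 's::finite) filtered_bundle
     \<Rightarrow> ('x, 'r \<times> 's) filtered_bundle" where
  "parabolic_tensor E E' =
     \<lparr>atlas = {(U \<inter> U', \<lambda>p. tensor_mat (g p) (g' p)) | U g U' g'. (U, g) \<in> atlas E \<and> (U', g') \<in> atlas E'},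
      germs = (\<lambda>x t. {s. \<exists>(N::nat) a u v.
         (\<forall>k<N. u k \<in> germs E x (a k) \<and> v k \<in> germs E' x (t - a k)) \<and>
         (\<forall>\<^sub>F p in at x. s p = (\<Sum>k<N. tensor_vec (u k p) (v k p)))})\<rparr>"

text \<open>
  The dual fibre is \<open>complex ^ 'r\<close> with the pairing \<open>\<Sum>i. \<xi> $ i * v $ i\<close>.  That a holomorphic
  functional on a punctured neighbourhood of \<open>x\<close> is meromorphic at \<open>x\<close> is implied by the case
  \<open>a = 0\<close> of the condition on its values.
\<close>

definition pairing :: "complex ^ 'r \<Rightarrow> complex ^ 'r \<Rightarrow> complex" where
  "pairing \<xi> v = (\<Sum>i\<in>UNIV. \<xi> $ i * v $ i)"

definition parabolic_dual ::
  "'x::t2_space chart set \<Rightarrow> ('x, 'r::finite) filtered_bundle \<Rightarrow> ('x, 'r) filtered_bundle" where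
  "parabolic_dual X E =
     (let T = {(U, \<lambda>p. transpose (matrix_inv (g p))) | U g. (U, g) \<in> atlas E} in
      \<lparr>atlas = T,
       germs = (\<lambda>x t. {\<xi>. (\<exists>W. open W \<and> x \<in> W \<and> holo_section X T (W - {x}) \<xi>) \<and>
         (\<forall>a. \<forall>s\<in>germs E x a. \<exists>h. holo_germ X x h \<and>
            (\<forall>\<^sub>F p in at x. pairing (\<xi> p) (s p) = (coord X x p powi \<lceil>a + t\<rceil>) * h p))})\<rparr>)"


section \<open>Orthogonal and symplectic structures\<close>

text \<open>The map \<open>u \<mapsto> \<phi>(u \<otimes> \<cdot>)\<close> from \<open>E\<close> to \<open>E\<^sup>* \<otimes> L\<close>, in matrix form.\<close>

definition adjoint_form ::
  "('x \<Rightarrow> complex ^ ('r \<times> 'r) ^ 1) \<Rightarrow> 'x \<Rightarrow> complex ^ 'r ^ ('r \<times> 1)" where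
  "adjoint_form \<phi> p = (\<chi> jl i. \<phi> p $ snd jl $ (i, fst jl))"

definition nondegenerate_form ::
  "'x::t2_space chart set \<Rightarrow> 'x set \<Rightarrow> ('x, 'r::finite) filtered_bundle \<Rightarrow> ('x, 1) filtered_bundle
     \<Rightarrow> ('x \<Rightarrow> complex ^ ('r \<times> 'r) ^ 1) \<Rightarrow> bool" where
  "nondegenerate_form X D E L \<phi> \<longleftrightarrow>
     parabolic_hom X D (parabolic_tensor E E) L \<phi> \<and>
     parabolic_iso X D E (parabolic_tensor (parabolic_dual X E) L) (adjoint_form \<phi>)"

definition orthogonal_structure ::
  "'x::t2_space chart set \<Rightarrow> 'x set \<Rightarrow> ('x, 'r::finite) filtered_bundle \<Rightarrow> ('x, 1) filtered_bundle
     \<Rightarrow> ('x \<Rightarrow> complex ^ ('r \<times> 'r) ^ 1) \<Rightarrow> bool" where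
  "orthogonal_structure X D E L \<phi> \<longleftrightarrow>
     parabolic_bundle X D E \<and> parabolic_line_bundle_deg0 X D L \<and> nondegenerate_form X D E L \<phi> \<and>
     (\<forall>p u v. p \<notin> D \<longrightarrow> \<phi> p *v tensor_vec u v = \<phi> p *v tensor_vec v u)"

definition symplectic_structure ::
  "'x::t2_space chart set \<Rightarrow> 'x set \<Rightarrow> ('x, 'r::finite) filtered_bundle \<Rightarrow> ('x, 1) filtered_bundle
     \<Rightarrow> ('x \<Rightarrow> complex ^ ('r \<times> 'r) ^ 1) \<Rightarrow> bool" where
  "symplectic_structure X D E L \<phi> \<longleftrightarrow>
     parabolic_bundle X D E \<and> parabolic_line_bundle_deg0 X D L \<and> nondegenerate_form X D E L \<phi> \<and>
     (\<forall>p u v. p \<notin> D \<longrightarrow> \<phi> p *v tensor_vec u v = - (\<phi> p *v tensor_vec v u))"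


section \<open>Connections\<close>

text \<open>
  \<open>nab (U, z) s p\<close> is the coefficient of \<open>dz\<close> in \<open>(\<nabla>s)(p)\<close>, for \<open>p \<in> U\<close> and a section \<open>s\<close>
  that is holomorphic near \<open>p\<close>.  The last clause is the transformation rule for coefficients of
  one-forms, so that \<open>\<nabla>s\<close> is a section of \<open>E \<otimes> K\<close>.
\<close>

type_synonym ('x, 'r) connection = "'x chart \<Rightarrow> ('x \<Rightarrow> complex ^ 'r) \<Rightarrow> 'x \<Rightarrow> complex ^ 'r"

definition holo_connection ::
  "'x::t2_space chart set \<Rightarrow> 'x set \<Rightarrow> ('x, 'r::finite) bundle_atlas \<Rightarrow> ('x, 'r) connection \<Rightarrow> bool"
where
  "holo_connection X S T nab \<longleftrightarrow>
     (\<forall>W s. W \<subseteq> S \<longrightarrow> holo_section X T W s \<longrightarrow>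
        (\<forall>c\<in>X. holo_section X T (W \<inter> fst c) (nab c s)) \<and>
        (\<forall>s'. (\<forall>p\<in>W. s' p = s p) \<longrightarrow>
           (\<forall>c\<in>X. \<forall>p\<in>W \<inter> fst c. nab c s' p = nab c s p)) \<and>
        (\<forall>s'. holo_section X T W s' \<longrightarrow>
           (\<forall>c\<in>X. \<forall>p\<in>W \<inter> fst c. nab c (\<lambda>q. s q + s' q) p = nab c s p + nab c s' p)) \<and>
        (\<forall>h. holo X W h \<longrightarrow>
           (\<forall>c\<in>X. \<forall>p\<in>W \<inter> fst c.
              nab c (\<lambda>q. h q *s s q) p = chart_deriv c h p *s s p + h p *s nab c s p)) \<and>
        (\<forall>c\<in>X. \<forall>c'\<in>X. \<forall>p\<in>W \<inter> fst c \<inter> fst c'.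
           nab c' s p = chart_deriv c' (snd c) p *s nab c s p))"

text \<open>
  A logarithmic connection on a bundle \<open>T\<close> over \<open>X\<close> is given by a connection over \<open>X - D\<close>
  (which determines it).  The second clause says that \<open>\<nabla>s\<close> is a section of
  \<open>E \<otimes> K(D)\<close> for every section \<open>s\<close> of \<open>E\<close> near \<open>x \<in> D\<close>.
\<close>

definition log_connection ::
  "'x::t2_space chart set \<Rightarrow> 'x set \<Rightarrow> ('x, 'r::finite) bundle_atlas \<Rightarrow> ('x, 'r) connection \<Rightarrow> bool"
where
  "log_connection X D T nab \<longleftrightarrow>
     holo_connection X (- D) T nab \<and>
     (\<forall>x\<in>D. \<forall>W s. x \<in> W \<longrightarrow> holo_section X T W s \<longrightarrow>
        (\<exists>W' s'. x \<in> W' \<and> holo_section X T W' s' \<and>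
           (\<forall>\<^sub>F p in at x. s' p = coord X x p *s nab (chart_at X x) s p)))"

definition residue_map ::
  "'x::t2_space chart set \<Rightarrow> ('x, 'r::finite) bundle_atlas \<Rightarrow> ('x, 'r) connection
     \<Rightarrow> 'x \<Rightarrow> complex ^ 'r \<Rightarrow> complex ^ 'r" where
  "residue_map X T nab x v =
     (THE v'. \<exists>W s s'. x \<in> W \<and> holo_section X T W s \<and> holo_section X T W s' \<and>
        (\<forall>\<^sub>F p in at x. s' p = coord X x p *s nab (chart_at X x) s p) \<and> s x = v \<and> s' x = v')"

definition quasiparabolic_connection ::
  "'x::t2_space chart set \<Rightarrow> 'x set \<Rightarrow> ('x, 'r::finite) filtered_bundle \<Rightarrow> ('x, 'r) connection \<Rightarrow> bool"
where
  "quasiparabolic_connection X D E nab \<longleftrightarrow>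
     (\<exists>V. presents X D V E \<and> log_connection X D (triv V) nab \<and>
        (\<forall>x\<in>D. \<forall>j\<in>{1..steps V x}. residue_map X (triv V) nab x ` flag V x j \<subseteq> flag V x j))"

text \<open>Parallel transport along a path \<open>\<gamma>\<close> in \<open>S\<close>.\<close>

definition parallel_along ::
  "'x::t2_space chart set \<Rightarrow> 'x set \<Rightarrow> ('x, 'r::finite) bundle_atlas \<Rightarrow> ('x, 'r) connection
     \<Rightarrow> (real \<Rightarrow> 'x) \<Rightarrow> (real \<Rightarrow> complex ^ 'r) \<Rightarrow> bool" where
  "parallel_along X S T nab \<gamma> \<sigma> \<longleftrightarrow>
     (\<forall>t\<in>{0..1}. \<exists>W s. \<gamma> t \<in> W \<and> W \<subseteq> S \<and> holo_section X T W s \<and>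
        (\<forall>c\<in>X. \<forall>p\<in>W \<inter> fst c. nab c s p = 0) \<and>
        (\<exists>e>0. \<forall>t'\<in>{0..1}. \<bar>t' - t\<bar> < e \<longrightarrow> \<gamma> t' \<in> W \<and> \<sigma> t' = s (\<gamma> t')))"

text \<open>
  On a one-dimensional fibre the monodromy is multiplication by a scalar \<open>c\<close>; it is unitary iff
  \<open>\<bar>c\<bar> = 1\<close>, i.e. iff it preserves any given norm of that fibre.
\<close>

definition unitary_monodromy ::
  "'x::t2_space chart set \<Rightarrow> 'x set \<Rightarrow> ('x, 1) bundle_atlas \<Rightarrow> ('x, 1) connection \<Rightarrow> bool" where
  "unitary_monodromy X S T nab \<longleftrightarrow>
     (\<forall>\<gamma> \<sigma>. path \<gamma> \<longrightarrow> path_image \<gamma> \<subseteq> S \<longrightarrow> pathstart \<gamma> = pathfinish \<gamma> \<longrightarrow>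
        parallel_along X S T nab \<gamma> \<sigma> \<longrightarrow> norm (\<sigma> 1) = norm (\<sigma> 0))"

text \<open>
  The connection \<open>D\<^sub>L\<close> on a parabolic line bundle of parabolic degree \<open>0\<close>.  It is unique as an
  operator on holomorphic sections; only its irrelevant values on other functions are arbitrary.
  For this reason it is characterized by a predicate.
\<close>

definition canonical_connection ::
  "'x::t2_space chart set \<Rightarrow> 'x set \<Rightarrow> ('x, 1) filtered_bundle \<Rightarrow> ('x, 1) connection \<Rightarrow> bool" where
  "canonical_connection X D L nab \<longleftrightarrow>
     (\<exists>V. presents X D V L \<and> log_connection X D (triv V) nab \<and>
        (\<forall>x\<in>D. \<forall>v. residue_map X (triv V) nab x v = complex_of_real (wt V x 1) *s v)) \<and>
     unitary_monodromy X (- D) (atlas L) nab"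

text \<open>
  Compatibility need only be required over \<open>X - D\<close>: both sides are meromorphic, so equality
  extends over \<open>D\<close>.
\<close>

definition compatible_connection ::
  "'x::t2_space chart set \<Rightarrow> 'x set \<Rightarrow> ('x, 'r::finite) filtered_bundle
     \<Rightarrow> ('x \<Rightarrow> complex ^ ('r \<times> 'r) ^ 1) \<Rightarrow> ('x, 'r) connection \<Rightarrow> ('x, 1) connection \<Rightarrow> bool" where
  "compatible_connection X D E \<phi> nab nabL \<longleftrightarrow>
     (\<forall>W u v. W \<subseteq> - D \<longrightarrow> holo_section X (atlas E) W u \<longrightarrow> holo_section X (atlas E) W v \<longrightarrow>
        (\<forall>c\<in>X. \<forall>p\<in>W \<inter> fst c.
           \<phi> p *v tensor_vec (nab c u p) (v p) + \<phi> p *v tensor_vec (u p) (nab c v p)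
             = nabL c (\<lambda>q. \<phi> q *v tensor_vec (u q) (v q)) p))"

definition quasiparabolic_connection_on ::
  "'x::t2_space chart set \<Rightarrow> 'x set \<Rightarrow> ('x, 'r::finite) filtered_bundle \<Rightarrow> ('x, 1) filtered_bundle
     \<Rightarrow> ('x \<Rightarrow> complex ^ ('r \<times> 'r) ^ 1) \<Rightarrow> ('x, 'r) connection \<Rightarrow> bool" where
  "quasiparabolic_connection_on X D E L \<phi> nab \<longleftrightarrow>
     quasiparabolic_connection X D E nab \<and>
     (\<exists>nabL. canonical_connection X D L nabL \<and> compatible_connection X D E \<phi> nab nabL)"


section \<open>Pullback\<close>

text \<open>The fibre at \<open>y\<close> of the pulled back bundle is the fibre at \<open>f y\<close> of the given one.\<close>

definition pullback_bundle ::
  "'y::t2_space chart set \<Rightarrow> 'x::t2_space chart set \<Rightarrow> ('y \<Rightarrow> 'x)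
     \<Rightarrow> ('x, 'r::finite) filtered_bundle \<Rightarrow> ('y, 'r) filtered_bundle" where
  "pullback_bundle Y X f E =
     \<lparr>atlas = {(f -` U, g \<circ> f) | U g. (U, g) \<in> atlas E},
      germs = (\<lambda>y b. {s. \<exists>(N::nat) h k t u.
         (\<forall>i<N. holo_germ Y y (h i) \<and> u i \<in> germs E (f y) (t i) \<and>
            b \<le> of_int (ramification Y X f y) * t i + of_int (k i)) \<and>
         (\<forall>\<^sub>F p in at y. s p = (\<Sum>i<N. (h i p * coord Y y p powi k i) *s u i (f p)))})\<rparr>"

definition pullback_form ::
  "('y \<Rightarrow> 'x) \<Rightarrow> ('x \<Rightarrow> complex ^ ('r \<times> 'r) ^ 1) \<Rightarrow> 'y \<Rightarrow> complex ^ ('r \<times> 'r) ^ 1" where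
  "pullback_form f \<phi> = \<phi> \<circ> f"

text \<open>
  Over \<open>Y - f\<^sup>-\<^sup>1(D)\<close>, with a holomorphic frame \<open>e\<^sub>i\<close> of \<open>E\<close> near \<open>f y\<close>, a chart \<open>z\<close> at \<open>f y\<close> and
  \<open>s = (\<Sum>i. a\<^sub>i *s (e\<^sub>i \<circ> f))\<close>, the pulled back connection is
  \<open>f\<^sup>*\<nabla> s = (\<Sum>i. da\<^sub>i *s (e\<^sub>i \<circ> f) + a\<^sub>i *s f\<^sup>*(\<nabla> e\<^sub>i))\<close>.
  This does not depend on the frame or on \<open>z\<close>.
\<close>

definition pullback_connection ::
  "'x::t2_space chart set \<Rightarrow> ('y \<Rightarrow> 'x) \<Rightarrow> ('x, 'r::finite) filtered_bundle
     \<Rightarrow> ('x, 'r) connection \<Rightarrow> ('y, 'r) connection" where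
  "pullback_connection X f E nab c s y =
     (let g = snd (triv_at (atlas E) (f y));
          e = (\<lambda>i p. column i (matrix_inv (g p)));
          a = (\<lambda>i q. (g (f q) *v s q) $ i);
          cX = chart_at X (f y)
      in \<Sum>i\<in>UNIV. chart_deriv c (a i) y *s e i (f y)
           + (a i y * chart_deriv c (snd cX \<circ> f) y) *s nab cX (e i) (f y))"

end

(*
  A parabolic bundle is, near a parabolic point x, a direct sum of lines: in suitable local
  coordinates E_{x,t} consists of the germs whose i-th component lies in z^ceil(t - alpha_i) O.
  In this form tensor products, duals and pullbacks only change the weights (to alpha_i + alpha'_j,
  -alpha_i and m alpha_i), and a homomorphism is a matrix with (i,j) entry of order at least
  alpha_j - alpha'_i; so the structure phi and the inverse of the induced isomorphism
  E -> E^* (x) L pull back.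

  A connection is logarithmic with residues preserving the flags iff the operator z nabla_{d/dz}
  preserves every E_{x,t}.  With z o f = w^m u for a unit u, the logarithmic derivative of z o f is
  m dw/w up to a holomorphic form, so the condition is inherited by the pullback.  For line bundles
  the residue is the weight iff z nabla_{d/dz} - t maps E_{x,t} into E_{x,t'} for some t' > t, which
  is inherited as well, and the monodromy of the pullback along a loop is the monodromy along its
  image.  Hence the pullback of D_L is the canonical connection of the pullback of L.  Finally the
  parabolic degree is multiplied by the degree of f, since the number of preimages, counted with
  multiplicity, is locally constant.
*)
theory Submission
  imports Defs
begin

section \<open>Germs of holomorphic functions\<close>

text \<open>The pulled back bundle is given only by modules of germs: no flagged bundle presenting
  it is at hand, and the numbers \<open>m \<alpha> i\<close> leave the interval [0,1). This shapes
  the proof. The weights of a splitting are arbitrary reals, flags are never pulled back, and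
  weights are normalized only where a flagged bundle has to be produced. For the same reason the two
  residue conditions are rewritten as statements about the modules alone. The arithmetic of weights
  rests on \<lceil>a + b\<rceil> \<le> \<lceil>a\<rceil> + \<lceil>b\<rceil>, and \<lceil>m
  a\<rceil> \<le> m \<lceil>a\<rceil> for integers m > 0. These give one inclusion between modules;
  the other one holds because the i-th frame vector is itself a germ of parameter
  \<open>\<alpha> i\<close>. For line bundles, equality of residue and weight is encoded as a strict
  gain t' > t. An element of a pulled back module is a finite sum of generators, so the separate
  gains of its terms have a common positive bound.\<close>

abbreviation ich :: "'x chart \<Rightarrow> complex \<Rightarrow> 'x" where
  "ich c \<equiv> inv_into (fst c) (snd c)"

text \<open>Removing \<open>x\<close> from an open set leaves an open set. Hence an identity between
  germs on punctured neighbourhoods holds near each point p of such a neighbourhood and may be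
  differentiated at p. This is how relations given only \<open>at x\<close> enter computations with
  connections.\<close>

lemma eventually_at_nhds:
  fixes x :: "'a::t1_space"
  assumes "eventually P (at x)"
  shows "\<forall>\<^sub>F p in at x. p \<noteq> x \<and> eventually P (nhds p)"
proof -
  obtain S where S: "open S" "x \<in> S" "\<And>p. p \<in> S \<Longrightarrow> p \<noteq> x \<Longrightarrow> P p"
    using assms unfolding eventually_at_topological by blast
  have "open (S - {x})" using S(1) by (simp add: open_delete)
  then have "p \<in> S \<Longrightarrow> p \<noteq> x \<Longrightarrow> eventually P (nhds p)" for p
    unfolding eventually_nhds using S(3) by (intro exI[of _ "S - {x}"]) auto
  then show ?thesis unfolding eventually_at_topological using S(1,2) by blast
qed

lemma eventually_notin_finite:
  fixes x :: "'a::t1_space"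
  assumes "finite D"
  shows "\<forall>\<^sub>F p in at x. p \<notin> D"
proof -
  have "\<forall>\<^sub>F p in nhds x. p \<in> - (D - {x})"
    using assms by (intro eventually_nhds_in_open open_Compl finite_imp_closed) auto
  then show ?thesis unfolding eventually_at_filter by eventually_elim auto
qed

lemma eventually_nhds_at: "eventually P (nhds x) \<Longrightarrow> eventually P (at x)"
  by (simp add: eventually_at_filter eventually_mono)

section \<open>Charts and neighbourhood filters\<close>

context
  fixes X :: "'x::t2_space chart set"
  assumes RS: "riemann_surface X"
begin

lemma chart_props:
  assumes "c \<in> X"
  shows "open (fst c)" "open (snd c ` fst c)" "homeomorphism (fst c) (snd c ` fst c) (snd c) (ich c)"
  using RS assms unfolding riemann_surface_def by (auto simp: case_prod_unfold)

lemma ich_chart: "c \<in> X \<Longrightarrow> p \<in> fst c \<Longrightarrow> ich c (snd c p) = p"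
  using chart_props(3) by (auto simp: homeomorphism_def)

lemma chart_ich:
  assumes "w \<in> snd c ` fst c"
  shows "snd c (ich c w) = w" "ich c w \<in> fst c"
  using assms by (auto intro: f_inv_into_f inv_into_into)

lemma chart_at_props: "chart_at X p \<in> X" "p \<in> fst (chart_at X p)"
proof -
  have "\<exists>c. c \<in> X \<and> p \<in> fst c"
    using RS unfolding riemann_surface_def by force
  from someI_ex[OF this] show "chart_at X p \<in> X" "p \<in> fst (chart_at X p)"
    unfolding chart_at_def by auto
qed

lemma tendsto_chart: "c \<in> X \<Longrightarrow> p \<in> fst c \<Longrightarrow> (snd c \<longlongrightarrow> snd c p) (nhds p)"
  using chart_props[of c] unfolding homeomorphism_def
  by (metis continuous_on_eq_continuous_at isCont_def tendsto_at_iff_tendsto_nhds)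

lemma tendsto_ich: "c \<in> X \<Longrightarrow> p \<in> fst c \<Longrightarrow> (ich c \<longlongrightarrow> p) (nhds (snd c p))"
  using chart_props[of c] ich_chart[of c p] unfolding homeomorphism_def
  by (metis continuous_on_eq_continuous_at isCont_def tendsto_at_iff_tendsto_nhds image_eqI)

lemma eventually_chart_domain: "c \<in> X \<Longrightarrow> p \<in> fst c \<Longrightarrow> \<forall>\<^sub>F q in nhds p. q \<in> fst c"
  using chart_props(1) eventually_nhds_in_open by blast

lemma eventually_chart_image:
  "c \<in> X \<Longrightarrow> p \<in> fst c \<Longrightarrow> \<forall>\<^sub>F w in nhds (snd c p). w \<in> snd c ` fst c"
  using chart_props(2) by (intro eventually_nhds_in_open) auto

text \<open>A chart and its inverse are continuous, so neighbourhood filters correspond in both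
  directions. Together with the punctured version below, this moves every local question to the
  complex plane.\<close>

lemma eventually_nhds_chart:
  assumes "c \<in> X" "p \<in> fst c"
  shows "eventually P (nhds p) \<longleftrightarrow> (\<forall>\<^sub>F w in nhds (snd c p). P (ich c w))"
proof
  assume "eventually P (nhds p)"
  then show "\<forall>\<^sub>F w in nhds (snd c p). P (ich c w)"
    using tendsto_ich[OF assms] by (rule eventually_compose_filterlim)
next
  assume "\<forall>\<^sub>F w in nhds (snd c p). P (ich c w)"
  then have "\<forall>\<^sub>F q in nhds p. P (ich c (snd c q))"
    using tendsto_chart[OF assms] by (rule eventually_compose_filterlim)
  then show "eventually P (nhds p)"
    using eventually_chart_domain[OF assms]
    by eventually_elim (use ich_chart[OF assms(1)] in auto)
qed

lemma eventually_at_chart: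
  assumes "c \<in> X" "p \<in> fst c"
  shows "eventually P (at p) \<longleftrightarrow> (\<forall>\<^sub>F w in at (snd c p). P (ich c w))"
proof -
  have "\<forall>\<^sub>F w in nhds (snd c p). (ich c w \<noteq> p) = (w \<noteq> snd c p)"
    using eventually_chart_image[OF assms]
  proof eventually_elim
    case (elim w)
    then obtain q where "q \<in> fst c" "w = snd c q" by blast
    then show ?case using ich_chart[OF assms(1)] assms(2) by metis
  qed
  then show ?thesis
    unfolding eventually_at_filter eventually_nhds_chart[OF assms]
    by (intro iffI) (auto elim: eventually_elim2)
qed

text \<open>The plane has no isolated points. It is this that makes limits along punctured
  neighbourhoods unique, and hence values at \<open>x\<close> determined by germs off
  \<open>x\<close>.\<close>

lemma at_nontrivial: "at (p::'x) \<noteq> bot"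
  using eventually_at_chart[where P = "\<lambda>_. False" and p = p, OF chart_at_props]
  by (simp add: eventually_False)

lemma open_chart_image:
  assumes "c \<in> X" "open W"
  shows "open (snd c ` (fst c \<inter> W))"
proof -
  have "snd c ` (fst c \<inter> W) = snd c ` fst c \<inter> ich c -` W"
    using ich_chart[OF assms(1)] by (auto simp: image_iff) 
  moreover have "open (snd c ` fst c \<inter> ich c -` W)"
    using chart_props[OF assms(1)] assms(2) unfolding homeomorphism_def
    by (intro continuous_open_preimage) auto
  ultimately show ?thesis by simp
qed

section \<open>Holomorphic germs\<close>

lemma transition_analytic:
  assumes "c \<in> X" "c' \<in> X" "p \<in> fst c" "p \<in> fst c'"
  shows "(snd c' \<circ> ich c) analytic_on {snd c p}"
proof (rule holomorphic_on_imp_analytic_at)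
  show "(snd c' \<circ> ich c) holomorphic_on snd c ` (fst c \<inter> fst c')"
    using RS assms(1,2) unfolding riemann_surface_def by (auto simp: case_prod_unfold)
  show "open (snd c ` (fst c \<inter> fst c'))"
    using open_chart_image[OF assms(1) chart_props(1)[OF assms(2)]] .
qed (use assms in auto)

lemma analytic_change_chart:
  assumes "c \<in> X" "c' \<in> X" "p \<in> fst c" "p \<in> fst c'" "(h \<circ> ich c) analytic_on {snd c p}"
  shows "(h \<circ> ich c') analytic_on {snd c' p}"
proof -
  have "((h \<circ> ich c) \<circ> (snd c \<circ> ich c')) analytic_on {snd c' p}"
    using transition_analytic[OF assms(2,1,4,3)] assms(5) ich_chart[OF assms(2,4)]
    by (intro analytic_on_compose) auto
  also have "?this \<longleftrightarrow> ?thesis"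
  proof (rule analytic_at_cong)
    have "\<forall>\<^sub>F q in nhds p. ich c (snd c q) = q"
      using eventually_chart_domain[OF assms(1,3)]
      by eventually_elim (use ich_chart[OF assms(1)] in auto)
    then show "\<forall>\<^sub>F w in nhds (snd c' p). ((h \<circ> ich c) \<circ> (snd c \<circ> ich c')) w = (h \<circ> ich c') w"
      unfolding eventually_nhds_chart[OF assms(2,4)] by eventually_elim simp
  qed simp
  finally show ?thesis .
qed

text \<open>Transition maps are holomorphic, so analyticity in one chart gives it in all of them.
  The closure properties of germs below are inherited from analytic functions in the fixed chart
  \<open>chart_at\<close>.\<close>

lemma holo_germ_iff:
  assumes "c \<in> X" "x \<in> fst c"
  shows "holo_germ X x h \<longleftrightarrow> (h \<circ> ich c) analytic_on {snd c x}"
proof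
  assume "holo_germ X x h"
  then obtain W where W: "x \<in> W" "holo X W h" by (auto simp: holo_germ_def)
  show "(h \<circ> ich c) analytic_on {snd c x}"
  proof (rule holomorphic_on_imp_analytic_at)
    show "(h \<circ> ich c) holomorphic_on snd c ` (fst c \<inter> W)"
      using W(2) assms unfolding holo_def by (auto simp: case_prod_unfold)
    show "open (snd c ` (fst c \<inter> W))"
      using W(2) open_chart_image[OF assms(1)] by (auto simp: holo_def)
  qed (use W assms in auto)
next
  assume "(h \<circ> ich c) analytic_on {snd c x}"
  then obtain S where S: "open S" "snd c x \<in> S" "(h \<circ> ich c) holomorphic_on S"
    by (auto simp: analytic_at)
  define W where "W = fst c \<inter> snd c -` S"
  have "open W" unfolding W_def
    using chart_props[OF assms(1)] S(1) unfolding homeomorphism_def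
    by (intro continuous_open_preimage) auto
  have an: "(h \<circ> ich c) analytic_on {snd c p}" if "p \<in> W" for p
    using S that by (auto simp: W_def analytic_at)
  have "holo X W h" unfolding holo_def
  proof (intro conjI ballI, fact, clarify)
    fix U z assume c': "(U, z) \<in> X"
    have "(h \<circ> inv_into U z) analytic_on {z p}" if "p \<in> U \<inter> W" for p
      using analytic_change_chart[OF assms(1) c', of p h] an that by (auto simp: W_def)
    then show "(h \<circ> inv_into U z) holomorphic_on z ` (U \<inter> W)"
      by (intro analytic_imp_holomorphic) (subst analytic_on_analytic_at, auto)
  qed
  moreover have "x \<in> W" using assms(2) S(2) by (simp add: W_def)
  ultimately show "holo_germ X x h" unfolding holo_germ_def by blast
qed

lemma holo_iff: "holo X W h \<longleftrightarrow> open W \<and> (\<forall>x\<in>W. holo_germ X x h)"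
proof
  assume "holo X W h"
  then show "open W \<and> (\<forall>x\<in>W. holo_germ X x h)"
    by (auto simp: holo_germ_def holo_def)
next
  assume *: "open W \<and> (\<forall>x\<in>W. holo_germ X x h)"
  show "holo X W h" unfolding holo_def
  proof (intro conjI ballI, use * in blast, clarify)
    fix U z assume c: "(U, z) \<in> X"
    have "(h \<circ> inv_into U z) analytic_on {z p}" if "p \<in> U \<inter> W" for p
      using holo_germ_iff[OF c, of p h] * that by auto
    then show "(h \<circ> inv_into U z) holomorphic_on z ` (U \<inter> W)"
      by (intro analytic_imp_holomorphic) (subst analytic_on_analytic_at, auto)
  qed
qed

lemma holo_germ_cong:
  assumes "\<forall>\<^sub>F p in nhds x. h p = k p"
  shows "holo_germ X x h \<longleftrightarrow> holo_germ X x k"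
  unfolding holo_germ_iff[OF chart_at_props]
  by (rule analytic_at_cong) (use assms[unfolded eventually_nhds_chart[OF chart_at_props]] in auto)

lemma holo_germ_eventually:
  assumes "holo_germ X x h" shows "\<forall>\<^sub>F p in nhds x. holo_germ X p h"
  using assms unfolding holo_germ_def eventually_nhds by (metis holo_def)

lemma holo_germ_const [simp]: "holo_germ X x (\<lambda>p. a)"
  unfolding holo_germ_iff[OF chart_at_props] by (simp add: o_def)

lemma holo_germ_add: "holo_germ X x h \<Longrightarrow> holo_germ X x k \<Longrightarrow> holo_germ X x (\<lambda>p. h p + k p)"
  unfolding holo_germ_iff[OF chart_at_props] by (auto simp: o_def intro: analytic_intros)

lemma holo_germ_diff: "holo_germ X x h \<Longrightarrow> holo_germ X x k \<Longrightarrow> holo_germ X x (\<lambda>p. h p - k p)"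
  unfolding holo_germ_iff[OF chart_at_props] by (auto simp: o_def intro: analytic_intros)

lemma holo_germ_mult: "holo_germ X x h \<Longrightarrow> holo_germ X x k \<Longrightarrow> holo_germ X x (\<lambda>p. h p * k p)"
  unfolding holo_germ_iff[OF chart_at_props] by (auto simp: o_def intro: analytic_intros)

lemma holo_germ_inverse: "holo_germ X x h \<Longrightarrow> h x \<noteq> 0 \<Longrightarrow> holo_germ X x (\<lambda>p. inverse (h p))"
  unfolding holo_germ_iff[OF chart_at_props]
  by (auto simp: o_def ich_chart[OF chart_at_props] intro: analytic_intros)

lemma holo_germ_sum: "(\<And>i. i \<in> I \<Longrightarrow> holo_germ X x (h i)) \<Longrightarrow> holo_germ X x (\<lambda>p. \<Sum>i\<in>I. h i p)"
  by (induction I rule: infinite_finite_induct) (auto intro: holo_germ_add)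

lemma holo_germ_power: "holo_germ X x h \<Longrightarrow> holo_germ X x (\<lambda>p. h p ^ n)"
  by (induction n) (auto intro: holo_germ_mult)

lemma holo_germ_powi:
  assumes "holo_germ X x h" "h x \<noteq> 0 \<or> n \<ge> 0"
  shows "holo_germ X x (\<lambda>p. h p powi n)"
proof (cases "n \<ge> 0")
  case True
  then show ?thesis using assms(1) holo_germ_power by (simp add: power_int_def)
next
  case False
  then show ?thesis using holo_germ_power[OF holo_germ_inverse[OF assms(1)]] assms(2)
    by (simp add: power_int_def)
qed

lemma holo_germ_tendsto:
  assumes "holo_germ X x h" shows "(h \<longlongrightarrow> h x) (nhds x)"
proof -
  let ?c = "chart_at X x"
  have "isCont (h \<circ> ich ?c) (snd ?c x)"
    using assms holo_germ_iff[OF chart_at_props] analytic_at_imp_isCont by blast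
  then have "((h \<circ> ich ?c) \<longlongrightarrow> (h \<circ> ich ?c) (snd ?c x)) (nhds (snd ?c x))"
    unfolding isCont_def tendsto_at_iff_tendsto_nhds .
  then have "((h \<circ> ich ?c) \<longlongrightarrow> h x) (nhds (snd ?c x))"
    using ich_chart[OF chart_at_props] by simp
  then have "((\<lambda>p. (h \<circ> ich ?c) (snd ?c p)) \<longlongrightarrow> h x) (nhds x)"
    using tendsto_chart[OF chart_at_props] by (rule filterlim_compose)
  moreover have "\<forall>\<^sub>F p in nhds x. (h \<circ> ich ?c) (snd ?c p) = h p"
    using eventually_chart_domain[OF chart_at_props]
    by eventually_elim (use ich_chart chart_at_props(1) in auto)
  ultimately show ?thesis by (simp add: filterlim_cong)
qed

lemma holo_germ_eventually_nonzero:
  "holo_germ X x h \<Longrightarrow> h x \<noteq> 0 \<Longrightarrow> \<forall>\<^sub>F p in nhds x. h p \<noteq> 0"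
  by (rule tendsto_imp_eventually_ne[OF holo_germ_tendsto])

text \<open>Holomorphic germs are continuous and punctured neighbourhoods are nonempty, so the value
  at \<open>x\<close> is a limit determined off \<open>x\<close>.\<close>

lemma holo_germ_at_eqD:
  assumes "holo_germ X x h" "holo_germ X x k" "\<forall>\<^sub>F p in at x. h p = k p"
  shows "h x = k x" "\<forall>\<^sub>F p in nhds x. h p = k p"
proof -
  have "(h \<longlongrightarrow> h x) (at x)" "(k \<longlongrightarrow> k x) (at x)"
    using assms(1,2) holo_germ_tendsto tendsto_at_iff_tendsto_nhds by blast+
  then show "h x = k x"
    using assms(3) tendsto_cong tendsto_unique[OF at_nontrivial] by metis
  then show "\<forall>\<^sub>F p in nhds x. h p = k p"
    using assms(3) unfolding eventually_at_filter by (auto elim: eventually_mono)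
qed

lemma holo_germ_chart: "c \<in> X \<Longrightarrow> x \<in> fst c \<Longrightarrow> holo_germ X x (snd c)"
  unfolding holo_germ_iff[OF chart_at_props]
  by (rule transition_analytic[OF chart_at_props(1) _ chart_at_props(2)])

section \<open>Derivatives in a chart\<close>

lemma chart_deriv_eqI:
  assumes "c \<in> X" "p \<in> fst c" "\<forall>\<^sub>F q in nhds p. h q = k q"
  shows "chart_deriv c h p = chart_deriv c k p"
  unfolding chart_deriv_def
  by (rule deriv_cong_ev) (use assms(3)[unfolded eventually_nhds_chart[OF assms(1,2)]] in auto)

lemma holo_germ_chart_deriv:
  assumes "c \<in> X" "x \<in> fst c" "holo_germ X x h"
  shows "holo_germ X x (chart_deriv c h)"
proof -
  have "deriv (h \<circ> ich c) analytic_on {snd c x}"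
    using assms holo_germ_iff analytic_deriv by blast
  also have "?this \<longleftrightarrow> (chart_deriv c h \<circ> ich c) analytic_on {snd c x}"
  proof (rule analytic_at_cong)
    show "\<forall>\<^sub>F w in nhds (snd c x). deriv (h \<circ> ich c) w = (chart_deriv c h \<circ> ich c) w"
      using eventually_chart_image[OF assms(1,2)]
      by eventually_elim (auto simp: chart_deriv_def chart_ich ich_chart[OF assms(1)])
  qed simp
  finally show ?thesis using holo_germ_iff[OF assms(1,2)] by simp
qed

lemma chart_deriv_const [simp]: "chart_deriv c (\<lambda>p. a) p = 0"
  by (simp add: chart_deriv_def o_def)

lemma chart_deriv_add:
  assumes "c \<in> X" "p \<in> fst c" "holo_germ X p h" "holo_germ X p k"
  shows "chart_deriv c (\<lambda>q. h q + k q) p = chart_deriv c h p + chart_deriv c k p"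
  using assms(3,4) unfolding holo_germ_iff[OF assms(1,2)]
  by (simp add: chart_deriv_def o_def complex_derivative_add_at)

lemma chart_deriv_mult:
  assumes "c \<in> X" "p \<in> fst c" "holo_germ X p h" "holo_germ X p k"
  shows "chart_deriv c (\<lambda>q. h q * k q) p = chart_deriv c h p * k p + h p * chart_deriv c k p"
  using assms(3,4) unfolding holo_germ_iff[OF assms(1,2)]
  by (simp add: chart_deriv_def o_def complex_derivative_mult_at ich_chart[OF assms(1,2)])

lemma chart_deriv_diff:
  assumes "c \<in> X" "p \<in> fst c" "holo_germ X p h" "holo_germ X p k"
  shows "chart_deriv c (\<lambda>q. h q - k q) p = chart_deriv c h p - chart_deriv c k p"
  using assms(3,4) unfolding holo_germ_iff[OF assms(1,2)]
  by (simp add: chart_deriv_def o_def complex_derivative_diff_at)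

lemma chart_deriv_compose:
  assumes "c \<in> X" "p \<in> fst c" "holo_germ X p h" "F analytic_on {h p}"
  shows "chart_deriv c (\<lambda>q. F (h q)) p = deriv F (h p) * chart_deriv c h p"
proof -
  have "(F \<circ> (h \<circ> ich c) has_field_derivative deriv F (h p) * deriv (h \<circ> ich c) (snd c p)) (at (snd c p))"
    using assms holo_germ_iff[OF assms(1,2)] ich_chart[OF assms(1,2)]
    by (intro DERIV_chain) (auto intro!: analytic_derivI)
  then show ?thesis
    unfolding chart_deriv_def by (simp add: o_def DERIV_imp_deriv)
qed

lemma holo_germ_compose:
  assumes "holo_germ X p h" "F analytic_on {h p}"
  shows "holo_germ X p (\<lambda>q. F (h q))"
  using assms analytic_on_compose[of "h \<circ> ich (chart_at X p)" "{snd (chart_at X p) p}" F]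
  unfolding holo_germ_iff[OF chart_at_props]
  by (simp add: o_def ich_chart[OF chart_at_props])

lemma chart_deriv_powi:
  assumes "c \<in> X" "p \<in> fst c" "holo_germ X p h" "h p \<noteq> 0"
  shows "chart_deriv c (\<lambda>q. h q powi n) p = of_int n * h p powi (n - 1) * chart_deriv c h p"
proof -
  have an: "(\<lambda>w. w powi n) analytic_on {h p}"
    using assms(4) by (auto intro!: analytic_intros)
  have "deriv (\<lambda>w. w powi n) (h p) = of_int n * h p powi (n - 1)"
    using assms(4) by (intro DERIV_imp_deriv) (auto intro!: derivative_eq_intros)
  then show ?thesis using chart_deriv_compose[OF assms(1-3) an] by simp
qed

text \<open>Chain rule for \<open>h\<close> written as a function of \<open>snd c\<close>; it has
  the shape of the transformation rule that \<open>holo_connection\<close> demands.\<close>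

lemma chart_deriv_change:
  assumes "c \<in> X" "c' \<in> X" "p \<in> fst c" "p \<in> fst c'" "holo_germ X p h"
  shows "chart_deriv c' h p = chart_deriv c' (snd c) p * chart_deriv c h p"
proof -
  have "\<forall>\<^sub>F q in nhds p. h q = (h \<circ> ich c) (snd c q)"
    using eventually_chart_domain[OF assms(1,3)]
    by eventually_elim (use ich_chart[OF assms(1)] in auto)
  then have "chart_deriv c' h p = chart_deriv c' (\<lambda>q. (h \<circ> ich c) (snd c q)) p"
    by (rule chart_deriv_eqI[OF assms(2,4)])
  also have "\<dots> = deriv (h \<circ> ich c) (snd c p) * chart_deriv c' (snd c) p"
    using assms holo_germ_iff[OF assms(1,3)]
    by (intro chart_deriv_compose holo_germ_chart) blast+
  finally show ?thesis by (simp add: chart_deriv_def)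
qed

lemma chart_deriv_self:
  assumes "c \<in> X" "p \<in> fst c"
  shows "chart_deriv c (snd c) p = 1"
proof -
  have "\<forall>\<^sub>F w in nhds (snd c p). (snd c \<circ> ich c) w = w"
    using eventually_chart_image[OF assms] by (rule eventually_mono) (simp add: chart_ich)
  then have "deriv (snd c \<circ> ich c) (snd c p) = deriv (\<lambda>w. w) (snd c p)"
    by (rule deriv_cong_ev) simp
  then show ?thesis by (simp add: chart_deriv_def)
qed

section \<open>The local coordinate at a point\<close>

lemma coord_self [simp]: "coord X x x = 0"
  by (simp add: coord_def)

lemma holo_germ_coord: "p \<in> fst (chart_at X x) \<Longrightarrow> holo_germ X p (coord X x)"
  unfolding coord_def[abs_def] by (intro holo_germ_diff holo_germ_chart chart_at_props holo_germ_const)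

lemma coord_nonzero: "p \<in> fst (chart_at X x) \<Longrightarrow> p \<noteq> x \<Longrightarrow> coord X x p \<noteq> 0"
  unfolding coord_def using ich_chart chart_at_props by (metis eq_iff_diff_eq_0)

lemma chart_deriv_coord: "p \<in> fst (chart_at X x) \<Longrightarrow> chart_deriv (chart_at X x) (coord X x) p = 1"
  unfolding coord_def[abs_def]
  by (simp add: chart_deriv_diff chart_at_props holo_germ_chart chart_deriv_self)

lemma eventually_at_coord:
  "\<forall>\<^sub>F p in at x. p \<in> fst (chart_at X x) \<and> coord X x p \<noteq> 0"
  using eventually_nhds_at[OF eventually_chart_domain[OF chart_at_props]] eventually_neq_at_within[of x x UNIV]
  by eventually_elim (use coord_nonzero in auto)

end

text \<open>Stated through a holomorphic cofactor and not through \<open>order_at\<close>, so that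
  the zero germ qualifies for every \<open>n\<close> and sums need no case distinction. Negative
  \<open>n\<close> allows poles, and only values off \<open>x\<close> enter.\<close>

definition ord_ge :: "'x::t2_space chart set \<Rightarrow> 'x \<Rightarrow> int \<Rightarrow> ('x \<Rightarrow> complex) \<Rightarrow> bool" where
  "ord_ge X x n h \<longleftrightarrow> (\<exists>k. holo_germ X x k \<and> (\<forall>\<^sub>F p in at x. h p = coord X x p powi n * k p))"

lemma ord_ge_cong:
  assumes "\<forall>\<^sub>F p in at x. h p = k p"
  shows "ord_ge X x n h \<longleftrightarrow> ord_ge X x n k"
proof -
  have "(\<forall>\<^sub>F p in at x. h p = coord X x p powi n * l p) \<longleftrightarrow> (\<forall>\<^sub>F p in at x. k p = coord X x p powi n * l p)" for l
    using assms by (intro eventually_subst) (auto elim: eventually_mono)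
  then show ?thesis unfolding ord_ge_def by simp
qed

lemma ord_geI: "holo_germ X x k \<Longrightarrow> \<forall>\<^sub>F p in at x. h p = coord X x p powi n * k p \<Longrightarrow> ord_ge X x n h"
  unfolding ord_ge_def by blast

section \<open>Calculus of orders at a point\<close>

context
  fixes X :: "'x::t2_space chart set"
  assumes RS: "riemann_surface X"
begin

lemmas chart_at = chart_at_props[OF RS]

lemma ord_ge_coord: "ord_ge X x n (\<lambda>p. coord X x p powi n)"
  by (rule ord_geI[of _ _ "\<lambda>_. 1"]) (auto simp: holo_germ_const[OF RS])

lemma ord_ge_zero [simp]: "ord_ge X x n (\<lambda>p. 0)"
  by (rule ord_geI[of _ _ "\<lambda>_. 0"]) (auto simp: holo_germ_const[OF RS])

lemma ord_ge_holo_germ: "holo_germ X x h \<Longrightarrow> ord_ge X x 0 h"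
  by (rule ord_geI[of _ _ h]) auto

lemma ord_ge_add: "ord_ge X x n h \<Longrightarrow> ord_ge X x n k \<Longrightarrow> ord_ge X x n (\<lambda>p. h p + k p)"
  unfolding ord_ge_def
proof (elim exE conjE)
  fix a b assume *: "holo_germ X x a" "\<forall>\<^sub>F p in at x. h p = coord X x p powi n * a p"
    "holo_germ X x b" "\<forall>\<^sub>F p in at x. k p = coord X x p powi n * b p"
  show "\<exists>c. holo_germ X x c \<and> (\<forall>\<^sub>F p in at x. h p + k p = coord X x p powi n * c p)"
  proof (intro exI conjI)
    show "holo_germ X x (\<lambda>p. a p + b p)" using * holo_germ_add[OF RS] by blast
    show "\<forall>\<^sub>F p in at x. h p + k p = coord X x p powi n * (a p + b p)"
      using *(2,4) by eventually_elim (simp add: algebra_simps)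
  qed
qed

lemma ord_ge_mult: "ord_ge X x n h \<Longrightarrow> ord_ge X x m k \<Longrightarrow> ord_ge X x (n + m) (\<lambda>p. h p * k p)"
  unfolding ord_ge_def
proof (elim exE conjE)
  fix a b assume *: "holo_germ X x a" "\<forall>\<^sub>F p in at x. h p = coord X x p powi n * a p"
    "holo_germ X x b" "\<forall>\<^sub>F p in at x. k p = coord X x p powi m * b p"
  show "\<exists>c. holo_germ X x c \<and> (\<forall>\<^sub>F p in at x. h p * k p = coord X x p powi (n + m) * c p)"
  proof (intro exI conjI)
    show "holo_germ X x (\<lambda>p. a p * b p)" using * holo_germ_mult[OF RS] by blast
    show "\<forall>\<^sub>F p in at x. h p * k p = coord X x p powi (n + m) * (a p * b p)"
      using *(2,4) eventually_at_coord[OF RS, of x]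
      by eventually_elim (simp add: algebra_simps power_int_add)
  qed
qed

lemma ord_ge_mono:
  assumes "ord_ge X x n h" "m \<le> n"
  shows "ord_ge X x m h"
proof -
  from assms(1) obtain a where a: "holo_germ X x a" "\<forall>\<^sub>F p in at x. h p = coord X x p powi n * a p"
    by (auto simp: ord_ge_def)
  show ?thesis
  proof (rule ord_geI)
    show "holo_germ X x (\<lambda>p. coord X x p powi (n - m) * a p)"
      using assms(2) a(1) chart_at by (intro holo_germ_mult holo_germ_powi holo_germ_coord RS) auto
    show "\<forall>\<^sub>F p in at x. h p = coord X x p powi m * (coord X x p powi (n - m) * a p)"
      using a(2) eventually_at_coord[OF RS, of x]
      by eventually_elim (simp add: mult.assoc[symmetric] power_int_add[symmetric])
  qed
qed

lemma ord_ge_sum: "(\<And>i. i \<in> I \<Longrightarrow> ord_ge X x n (h i)) \<Longrightarrow> ord_ge X x n (\<lambda>p. \<Sum>i\<in>I. h i p)"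
  by (induction I rule: infinite_finite_induct) (auto intro: ord_ge_add)

lemma ord_ge_holo_mult: "holo_germ X x h \<Longrightarrow> ord_ge X x n k \<Longrightarrow> ord_ge X x n (\<lambda>p. h p * k p)"
  using ord_ge_mult[OF ord_ge_holo_germ, of x h n k] by simp

lemma ord_ge_shift: "ord_ge X x n h \<Longrightarrow> ord_ge X x (m + n) (\<lambda>p. coord X x p powi m * h p)"
  using ord_ge_mult[OF ord_ge_coord] by blast

lemma ord_ge_shift_iff: "ord_ge X x (m + n) (\<lambda>p. coord X x p powi m * h p) \<longleftrightarrow> ord_ge X x n h"
proof
  assume "ord_ge X x (m + n) (\<lambda>p. coord X x p powi m * h p)"
  then have "ord_ge X x n (\<lambda>p. coord X x p powi (-m) * (coord X x p powi m * h p))"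
    using ord_ge_shift[of x "m + n" _ "-m"] by simp
  moreover have "\<forall>\<^sub>F p in at x. coord X x p powi (-m) * (coord X x p powi m * h p) = h p"
    using eventually_at_coord[OF RS, of x]
    by eventually_elim (simp add: mult.assoc[symmetric] power_int_add[symmetric])
  ultimately show "ord_ge X x n h" using ord_ge_cong by fast
qed (rule ord_ge_shift)

lemma eventually_coord_germ: "\<forall>\<^sub>F p in at x. holo_germ X p (coord X x) \<and> coord X x p \<noteq> 0"
  using eventually_at_coord[OF RS, of x] by eventually_elim (use holo_germ_coord[OF RS] in auto)

lemma ord_ge_eventually_holo_germ:
  assumes "ord_ge X x n h"
  shows "\<forall>\<^sub>F p in at x. holo_germ X p h"
proof -
  from assms obtain a where a: "holo_germ X x a" "\<forall>\<^sub>F p in at x. h p = coord X x p powi n * a p"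
    by (auto simp: ord_ge_def)
  show ?thesis
    using eventually_at_nhds[OF a(2)] eventually_nhds_at[OF holo_germ_eventually[OF RS a(1)]]
      eventually_coord_germ[of x]
  proof eventually_elim
    case (elim p)
    have "holo_germ X p (\<lambda>p. coord X x p powi n * a p)"
      using elim by (intro holo_germ_mult holo_germ_powi RS) auto
    then show ?case using elim holo_germ_cong[OF RS, of h _ p] by auto
  qed
qed

text \<open>The derivation z d/dz sends z^n a to z^n (n a + z a'). It therefore keeps order bounds,
  while d/dz alone would lower them by one.\<close>

lemma ord_ge_deriv:
  assumes "ord_ge X x n h"
  shows "ord_ge X x n (\<lambda>p. coord X x p * chart_deriv (chart_at X x) h p)"
proof -
  let ?z = "coord X x" and ?d = "chart_deriv (chart_at X x)"
  from assms obtain a where a: "holo_germ X x a" "\<forall>\<^sub>F p in at x. h p = ?z p powi n * a p"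
    by (auto simp: ord_ge_def)
  show ?thesis
  proof (rule ord_geI)
    show "holo_germ X x (\<lambda>p. of_int n * a p + ?z p * ?d a p)"
      using a(1) by (intro holo_germ_add holo_germ_mult holo_germ_const holo_germ_chart_deriv
          holo_germ_coord RS chart_at)
    show "\<forall>\<^sub>F p in at x. ?z p * ?d h p = ?z p powi n * (of_int n * a p + ?z p * ?d a p)"
      using eventually_at_nhds[OF a(2)] eventually_nhds_at[OF holo_germ_eventually[OF RS a(1)]]
        eventually_coord_germ[of x] eventually_at_coord[OF RS, of x]
    proof eventually_elim
      case (elim p)
      have "?d h p = ?d (\<lambda>p. ?z p powi n * a p) p"
        using elim by (intro chart_deriv_eqI[OF RS]) (auto simp: chart_at)
      also have "\<dots> = ?d (\<lambda>p. ?z p powi n) p * a p + ?z p powi n * ?d a p"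
        using elim by (intro chart_deriv_mult[OF RS] holo_germ_powi[OF RS]) (auto simp: chart_at)
      also have "?d (\<lambda>p. ?z p powi n) p = of_int n * ?z p powi (n - 1)"
        using elim chart_deriv_powi[OF RS, of "chart_at X x" p ?z n] chart_deriv_coord[OF RS, of p x]
        by (simp add: chart_at)
      finally have "?z p * ?d h p = of_int n * (?z p * ?z p powi (n - 1)) * a p + ?z p * ?z p powi n * ?d a p"
        by (simp add: algebra_simps)
      also have "?z p * ?z p powi (n - 1) = ?z p powi n"
        using elim power_int_add[of "?z p" 1 "n - 1"] by simp
      finally show ?case by (simp add: algebra_simps)
    qed
  qed
qed

text \<open>A zero can be divided out because the difference quotient extends holomorphically. The
  lemma translates vanishing of a fibre coordinate at \<open>x\<close>, the language of flags, into
  a bound on orders, the language of splittings.\<close>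

lemma ord_ge_1_iff:
  assumes "holo_germ X x h"
  shows "ord_ge X x 1 h \<longleftrightarrow> h x = 0"
proof
  assume "ord_ge X x 1 h"
  then obtain a where a: "holo_germ X x a" "\<forall>\<^sub>F p in at x. h p = coord X x p * a p"
    by (auto simp: ord_ge_def)
  have "h x = coord X x x * a x"
    using a by (intro holo_germ_at_eqD(1)[OF RS assms] holo_germ_mult holo_germ_coord RS chart_at)
  then show "h x = 0" by (simp add: coord_self[OF RS])
next
  assume 0: "h x = 0"
  let ?c = "chart_at X x"
  let ?w = "snd ?c x" and ?F = "h \<circ> ich ?c"
  have an: "?F analytic_on {?w}" using assms holo_germ_iff[OF RS chart_at] by blast
  \<comment> \<open>The difference quotient of \<open>?F\<close> at \<open>?w\<close>, completed by
    the derivative so that it is holomorphic there.\<close>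
  define G where "G w = (if w = ?w then deriv ?F ?w else (?F w - ?F ?w) / (w - ?w))" for w
  have "G analytic_on {?w}"
  proof -
    obtain S where S: "open S" "?w \<in> S" "?F holomorphic_on S" using an by (auto simp: analytic_at)
    then have "G holomorphic_on S"
      unfolding G_def[abs_def] using pole_lemma_open[OF S(3,1)] by simp
    then show ?thesis using S analytic_at by blast
  qed
  then have "holo_germ X x (\<lambda>p. G (snd ?c p))"
    by (rule holo_germ_compose[OF RS holo_germ_chart[OF RS chart_at]])
  moreover have "\<forall>\<^sub>F p in at x. h p = coord X x p powi 1 * G (snd ?c p)"
    using eventually_at_coord[OF RS, of x]
  proof eventually_elim
    case (elim p)
    then have "ich ?c (snd ?c p) = p" "ich ?c ?w = x"
      using ich_chart[OF RS chart_at(1)] chart_at(2) by blast+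
    then show ?case using 0 elim by (simp add: G_def coord_def)
  qed
  ultimately show "ord_ge X x 1 h" by (rule ord_geI)
qed

lemma ord_ge_0_imp:
  assumes "ord_ge X x 0 h"
  obtains k where "holo_germ X x k" "\<forall>\<^sub>F p in at x. h p = k p"
  using assms by (auto simp: ord_ge_def)

lemma order_at_eqI:
  assumes "holo_germ X x k" "k x \<noteq> 0" "\<forall>\<^sub>F p in at x. h p = coord X x p powi n * k p"
  shows "order_at X h x = n"
proof -
  let ?c = "chart_at X x"
  let ?w = "snd ?c x"
  obtain S where S: "open S" "?w \<in> S" "(k \<circ> ich ?c) holomorphic_on S"
    using assms(1) holo_germ_iff[OF RS chart_at] analytic_at by metis
  have "\<forall>\<^sub>F w in at ?w. (h \<circ> ich ?c) w = (k \<circ> ich ?c) w * (w - ?w) powi n"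
    using assms(3)[unfolded eventually_at_chart[OF RS chart_at]]
      eventually_nhds_at[OF eventually_chart_image[OF RS chart_at]]
    by eventually_elim (simp add: coord_def chart_ich[OF RS])
  then obtain T where T: "open T" "?w \<in> T"
    "\<And>w. w \<in> T \<Longrightarrow> w \<noteq> ?w \<Longrightarrow> (h \<circ> ich ?c) w = (k \<circ> ich ?c) w * (w - ?w) powi n"
    unfolding eventually_at_topological by blast
  have "zorder (h \<circ> ich ?c) ?w = n"
  proof (rule zorder_eqI)
    show "open (S \<inter> T)" "?w \<in> S \<inter> T" using S T by auto
    show "(k \<circ> ich ?c) holomorphic_on S \<inter> T" using S(3) holomorphic_on_subset by blast
  qed (use assms(2) T ich_chart[OF RS chart_at] in auto)
  then show ?thesis by (simp add: order_at_def case_prod_unfold)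
qed

lemma holo_germ_factor:
  assumes "holo_germ X x h" "\<not> (\<forall>\<^sub>F p in at x. h p = 0)"
  obtains k n where "holo_germ X x k" "k x \<noteq> 0"
    "\<forall>\<^sub>F p in nhds x. h p = coord X x p ^ n * k p" "order_at X h x = int n"
proof -
  let ?c = "chart_at X x"
  let ?w = "snd ?c x" and ?F = "h \<circ> ich ?c"
  obtain e where e: "e > 0" "?F holomorphic_on ball ?w e"
    using assms(1) holo_germ_iff[OF RS chart_at] analytic_at_ball by metis
  \<comment> \<open>The factorization on the ball excludes the zero function; were \<open>?F\<close>
    zero on the ball, the germ \<open>h\<close> would vanish near \<open>x\<close>.\<close>
  have "\<exists>w\<in>ball ?w e. ?F w \<noteq> 0"
  proof (rule ccontr)
    assume *: "\<not> (\<exists>w\<in>ball ?w e. ?F w \<noteq> 0)"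
    have "\<forall>\<^sub>F w in nhds ?w. w \<in> ball ?w e" using e by (intro eventually_nhds_in_open) auto
    then have "\<forall>\<^sub>F w in nhds ?w. ?F w = 0" by eventually_elim (use * in auto)
    then have "\<forall>\<^sub>F w in at ?w. h (ich ?c w) = 0" by (simp add: eventually_nhds_at)
    then show False using assms(2) eventually_at_chart[OF RS chart_at, where P = "\<lambda>p. h p = 0"] by blast
  qed
  then have "\<exists>r>0. cball ?w r \<subseteq> ball ?w e \<and> zor_poly ?F ?w holomorphic_on cball ?w r \<and>
      (\<forall>w\<in>cball ?w r. ?F w = zor_poly ?F ?w w * (w - ?w) ^ nat (zorder ?F ?w) \<and> zor_poly ?F ?w w \<noteq> 0)"
    using zorder_exist_zero[OF e(2) open_ball connected_ball, of ?w] e(1) centre_in_ball by blast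
  then obtain r where r: "r > 0" "cball ?w r \<subseteq> ball ?w e" "zor_poly ?F ?w holomorphic_on cball ?w r"
    "\<And>w. w \<in> cball ?w r \<Longrightarrow> ?F w = zor_poly ?F ?w w * (w - ?w) ^ nat (zorder ?F ?w) \<and> zor_poly ?F ?w w \<noteq> 0"
    by blast
  define n where "n = nat (zorder ?F ?w)"
  define k where "k p = zor_poly ?F ?w (snd ?c p)" for p
  have an: "zor_poly ?F ?w analytic_on {?w}"
    using r by (intro holomorphic_on_imp_analytic_at[of _ "ball ?w r"]) (auto intro: holomorphic_on_subset)
  have k: "holo_germ X x k"
    unfolding k_def[abs_def] by (rule holo_germ_compose[OF RS holo_germ_chart[OF RS chart_at] an])
  have k0: "k x \<noteq> 0" using r(1) r(4)[of ?w] by (simp add: k_def)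
  have "\<forall>\<^sub>F w in nhds ?w. w \<in> ball ?w r \<and> w \<in> snd ?c ` fst ?c"
    using eventually_nhds_in_open[OF open_ball, of ?w ?w r] r(1) eventually_chart_image[OF RS chart_at, of x]
    by (intro eventually_conj) auto
  then have "\<forall>\<^sub>F w in nhds ?w. h (ich ?c w) = coord X x (ich ?c w) ^ n * k (ich ?c w)"
  proof eventually_elim
    case (elim w)
    then show ?case using r(4)[of w] by (auto simp: coord_def chart_ich[OF RS] k_def n_def)
  qed
  then have ev: "\<forall>\<^sub>F p in nhds x. h p = coord X x p ^ n * k p"
    using eventually_nhds_chart[OF RS chart_at, where P = "\<lambda>p. h p = coord X x p ^ n * k p"] by simp
  then have "order_at X h x = int n"
    using eventually_nhds_at[OF ev] by (intro order_at_eqI[OF k k0]) (simp add: power_int_of_nat)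
  then show thesis using that[OF k k0 ev] by simp
qed

text \<open>Zeros are isolated: a germ that is not zero is a power of the coordinate times a unit,
  and neither factor vanishes off \<open>x\<close>.\<close>

lemma holo_germ_dichotomy:
  assumes "holo_germ X x h" "h x = 0"
  shows "(\<forall>\<^sub>F p in nhds x. h p = 0) \<or> (\<forall>\<^sub>F p in at x. h p \<noteq> 0)"
proof (cases "\<forall>\<^sub>F p in at x. h p = 0")
  case True
  then show ?thesis using holo_germ_at_eqD(2)[OF RS assms(1) holo_germ_const[OF RS, of _ 0]] by blast
next
  case False
  from holo_germ_factor[OF assms(1) this] obtain k n where k: "holo_germ X x k" "k x \<noteq> 0"
    "\<forall>\<^sub>F p in nhds x. h p = coord X x p ^ n * k p" by metis
  have "\<forall>\<^sub>F p in at x. h p \<noteq> 0"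
    using eventually_nhds_at[OF k(3)] eventually_nhds_at[OF holo_germ_eventually_nonzero[OF RS k(1,2)]]
      eventually_at_coord[OF RS, of x]
    by eventually_elim auto
  then show ?thesis by blast
qed

end

section \<open>Pulling back germs along a holomorphic map\<close>

text \<open>Setting of the local statements. Connectedness of \<open>Y\<close> and nonconstancy make
  the fibres discrete; compactness of \<open>Y\<close> is added as a hypothesis where fibres have to
  be finite.\<close>

locale covering =
  fixes X :: "'x::t2_space chart set" and Y :: "'y::t2_space chart set" and f :: "'y \<Rightarrow> 'x"
  assumes RX: "riemann_surface X" and RY: "riemann_surface Y"
    and holo_f: "holo_map Y X f" and connected_Y: "connected (UNIV :: 'y set)"
    and nonconst_f: "\<not> f constant_on UNIV"
begin

abbreviation mult :: "'y \<Rightarrow> int" where "mult y \<equiv> ramification Y X f y"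

lemma tendsto_f: "(f \<longlongrightarrow> f y) (nhds y)"
  using holo_f unfolding holo_map_def
  by (simp add: continuous_on_eq_continuous_at isCont_def flip: tendsto_at_iff_tendsto_nhds)

lemma eventually_nhds_f: "eventually P (nhds (f y)) \<Longrightarrow> \<forall>\<^sub>F q in nhds y. P (f q)"
  using tendsto_f by (rule eventually_compose_filterlim[rotated])

lemma holo_germ_chart_f: "c \<in> X \<Longrightarrow> f y \<in> fst c \<Longrightarrow> holo_germ Y y (snd c \<circ> f)"
  using holo_f holo_iff[OF RY] unfolding holo_map_def by (auto simp: case_prod_unfold)

lemma holo_germ_pull:
  assumes "holo_germ X (f y) h"
  shows "holo_germ Y y (h \<circ> f)"
proof -
  let ?c = "chart_at X (f y)"
  have "holo_germ Y y (\<lambda>q. (h \<circ> ich ?c) ((snd ?c \<circ> f) q))"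
    by (rule holo_germ_compose[OF RY holo_germ_chart_f])
       (use holo_germ_iff[OF RX chart_at[OF RX]] assms chart_at[OF RX] in \<open>simp_all add: o_def\<close>)
  also have "?this \<longleftrightarrow> ?thesis"
  proof (rule holo_germ_cong[OF RY])
    show "\<forall>\<^sub>F q in nhds y. (h \<circ> ich ?c) ((snd ?c \<circ> f) q) = (h \<circ> f) q"
      using eventually_nhds_f[OF eventually_chart_domain[OF RX chart_at[OF RX]]]
      by eventually_elim (use ich_chart[OF RX chart_at(1)[OF RX]] in auto)
  qed
  finally show ?thesis .
qed

lemma chart_deriv_pull:
  assumes "c \<in> X" "f y \<in> fst c" "c' \<in> Y" "y \<in> fst c'" "holo_germ X (f y) h"
  shows "chart_deriv c' (h \<circ> f) y = chart_deriv c h (f y) * chart_deriv c' (snd c \<circ> f) y"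
proof -
  have "\<forall>\<^sub>F q in nhds y. (h \<circ> f) q = (h \<circ> ich c) ((snd c \<circ> f) q)"
    using eventually_nhds_f[OF eventually_chart_domain[OF RX assms(1,2)]]
    by eventually_elim (use ich_chart[OF RX assms(1)] in auto)
  then have "chart_deriv c' (h \<circ> f) y = chart_deriv c' (\<lambda>q. (h \<circ> ich c) ((snd c \<circ> f) q)) y"
    by (rule chart_deriv_eqI[OF RY assms(3,4)])
  also have "\<dots> = deriv (h \<circ> ich c) ((snd c \<circ> f) y) * chart_deriv c' (snd c \<circ> f) y"
    by (rule chart_deriv_compose[OF RY assms(3,4) holo_germ_chart_f[OF assms(1,2)]])
       (use holo_germ_iff[OF RX assms(1,2)] assms(5) in \<open>simp add: o_def\<close>)
  finally show ?thesis by (simp add: chart_deriv_def)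
qed

lemma holo_germ_coord_f: "holo_germ Y y (coord X (f y) \<circ> f)"
  by (intro holo_germ_pull holo_germ_coord[OF RX] chart_at RX)

section \<open>Discreteness of the fibres\<close>

lemma eventually_coord_f:
  "\<forall>\<^sub>F q in nhds y. coord X x (f q) = 0 \<longleftrightarrow> f q = x" if "f y = x" for y
  using eventually_nhds_f[OF eventually_chart_domain[OF RX chart_at[OF RX]], of y]
  by eventually_elim (use coord_nonzero[OF RX] coord_self[OF RX] that in metis)

lemma fibre_dichotomy:
  assumes "f y = x"
  shows "(\<forall>\<^sub>F q in nhds y. f q = x) \<or> (\<forall>\<^sub>F q in at y. f q \<noteq> x)"
  using holo_germ_dichotomy[OF RY holo_germ_coord_f[of y]]
proof
  show "(coord X (f y) \<circ> f) y = 0" by (simp add: coord_self[OF RX])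
next
  assume "\<forall>\<^sub>F p in nhds y. (coord X (f y) \<circ> f) p = 0"
  then have "\<forall>\<^sub>F q in nhds y. f q = x"
    using eventually_coord_f[OF assms] by eventually_elim (use assms in simp)
  then show ?thesis by blast
next
  assume "\<forall>\<^sub>F p in at y. (coord X (f y) \<circ> f) p \<noteq> 0"
  then have "\<forall>\<^sub>F q in at y. f q \<noteq> x"
    using eventually_nhds_at[OF eventually_coord_f[OF assms]] by eventually_elim (use assms in simp)
  then show ?thesis by blast
qed

text \<open>Identity theorem. The set \<open>A\<close> of points near which \<open>f\<close> takes
  the constant value \<open>f y\<close> is open, and by the dichotomy at each point so is its
  complement. If the claim failed, \<open>A\<close> would contain \<open>y\<close>, hence be
  everything, and \<open>f\<close> would be constant.\<close>

lemma eventually_f_neq: "\<forall>\<^sub>F q in at y. f q \<noteq> f y"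
proof (rule ccontr)
  assume *: "\<not> (\<forall>\<^sub>F q in at y. f q \<noteq> f y)"
  define A where "A = {p. \<forall>\<^sub>F q in nhds p. f q = f y}"
  have "open A"
    unfolding A_def
  proof (rule open_subopen[THEN iffD2], clarify)
    fix p assume "\<forall>\<^sub>F q in nhds p. f q = f y"
    then obtain S where "open S" "p \<in> S" "\<forall>q\<in>S. f q = f y" unfolding eventually_nhds by blast
    then show "\<exists>T. open T \<and> p \<in> T \<and> T \<subseteq> {p. \<forall>\<^sub>F q in nhds p. f q = f y}"
      unfolding eventually_nhds by (intro exI[of _ S]) blast
  qed
  moreover have "open (- A)"
  proof (rule open_subopen[THEN iffD2], clarify)
    fix p assume p: "p \<notin> A"
    have "\<forall>\<^sub>F q in at p. f q \<noteq> f y"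
    proof (cases "f p = f y")
      case True
      then show ?thesis using fibre_dichotomy[OF True] p by (auto simp: A_def)
    next
      case False
      then show ?thesis
        by (intro eventually_nhds_at tendsto_imp_eventually_ne[OF tendsto_f])
    qed
    then obtain S where S: "open S" "p \<in> S" "\<And>q. q \<in> S \<Longrightarrow> q \<noteq> p \<Longrightarrow> f q \<noteq> f y"
      unfolding eventually_at_topological by blast
    have "S \<subseteq> - A"
    proof (clarify)
      fix q assume "q \<in> S" "q \<in> A"
      then have "f q = f y" unfolding A_def using eventually_nhds_x_imp_x by blast
      then show False using S(3) \<open>q \<in> S\<close> \<open>q \<in> A\<close> p by blast
    qed
    then show "\<exists>T. open T \<and> p \<in> T \<and> T \<subseteq> - A" using S by blast
  qed
  moreover have "y \<in> A" using fibre_dichotomy[of y "f y"] * by (auto simp: A_def)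
  ultimately have "A = UNIV"
    using connected_Y unfolding connected_def by blast
  then have "\<forall>p. f p = f y" unfolding A_def using eventually_nhds_x_imp_x by blast
  then show False using nonconst_f by (auto simp: constant_on_def)
qed

text \<open>Since \<open>f\<close> avoids the value \<open>f y\<close> on a punctured neighbourhood
  of \<open>y\<close>, germs on punctured neighbourhoods of \<open>f y\<close> can be pulled
  back.\<close>

lemma eventually_at_f:
  assumes "eventually P (at (f y))" shows "\<forall>\<^sub>F q in at y. P (f q)"
proof -
  have "\<forall>\<^sub>F x in nhds (f y). x \<noteq> f y \<longrightarrow> P x"
    using assms by (simp add: eventually_at_filter)
  from eventually_nhds_at[OF eventually_nhds_f[OF this]] eventually_f_neq
  show ?thesis by eventually_elim simp
qed

section \<open>The map in local coordinates\<close>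

lemma coord_f_factor:
  obtains u where "holo_germ Y y u" "u y \<noteq> 0" "mult y > 0"
    "\<forall>\<^sub>F q in nhds y. coord X (f y) (f q) = coord Y y q ^ nat (mult y) * u q"
proof -
  have "\<not> (\<forall>\<^sub>F q in at y. (coord X (f y) \<circ> f) q = 0)"
  proof
    assume "\<forall>\<^sub>F q in at y. (coord X (f y) \<circ> f) q = 0"
    then have "\<forall>\<^sub>F q in at y. False"
      using eventually_f_neq eventually_nhds_at[OF eventually_coord_f[OF refl]] by eventually_elim auto
    then show False using at_nontrivial[OF RY] eventually_False by blast
  qed
  from holo_germ_factor[OF RY holo_germ_coord_f this] obtain k n where k: "holo_germ Y y k" "k y \<noteq> 0"
    "\<forall>\<^sub>F p in nhds y. (coord X (f y) \<circ> f) p = coord Y y p ^ n * k p"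
    "order_at Y (coord X (f y) \<circ> f) y = int n" by metis
  have m: "mult y = int n" using k(4) by (simp add: ramification_def o_def)
  \<comment> \<open>With exponent 0, evaluation at \<open>y\<close> would give
    \<open>k y = 0\<close>, because the coordinate at \<open>f y\<close> vanishes there.\<close>
  have "n > 0"
    using eventually_nhds_x_imp_x[OF k(3)] k(2) by (cases n) (auto simp: coord_self[OF RX])
  then show thesis using that[OF k(1,2)] k(3) m by simp
qed

lemma mult_pos: "mult y > 0"
  using coord_f_factor[of y] by blast

text \<open>In the local form w^m u the factor \<open>u\<close> is a unit, so it may be raised to
  negative powers as well: poles and zeros both have their order multiplied by
  \<open>mult y\<close>.\<close>

lemma ord_ge_pull:
  assumes "ord_ge X (f y) n h"
  shows "ord_ge Y y (mult y * n) (h \<circ> f)"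
proof -
  from assms obtain a where a: "holo_germ X (f y) a" "\<forall>\<^sub>F p in at (f y). h p = coord X (f y) p powi n * a p"
    by (auto simp: ord_ge_def)
  obtain u where u: "holo_germ Y y u" "u y \<noteq> 0" "mult y > 0"
    "\<forall>\<^sub>F q in nhds y. coord X (f y) (f q) = coord Y y q ^ nat (mult y) * u q"
    by (rule coord_f_factor)
  show ?thesis
  proof (rule ord_geI)
    show "holo_germ Y y (\<lambda>q. u q powi n * (a \<circ> f) q)"
      using u(1,2) a(1) by (intro holo_germ_mult holo_germ_powi holo_germ_pull RY) auto
    show "\<forall>\<^sub>F q in at y. (h \<circ> f) q = coord Y y q powi (mult y * n) * (u q powi n * (a \<circ> f) q)"
      using eventually_at_f[OF a(2)] eventually_nhds_at[OF u(4)]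
    proof eventually_elim
      case (elim q)
      have "coord Y y q ^ nat (mult y) = coord Y y q powi mult y"
        using u(3) by (simp add: power_int_def)
      then show ?case using elim by (simp add: power_int_mult_distrib power_int_mult)
    qed
  qed
qed

text \<open>The function \<open>v\<close> is the factor by which the Euler operators z d/dz and w
  d/dw differ under pullback. Its value at \<open>y\<close> is what multiplies residues, just as
  weights are multiplied.\<close>

lemma coord_f_log_deriv:
  obtains v where "holo_germ Y y v" "v y = of_int (mult y)"
    "\<forall>\<^sub>F q in at y. coord Y y q * chart_deriv (chart_at Y y) (coord X (f y) \<circ> f) q
        = v q * coord X (f y) (f q)"
proof -
  let ?w = "coord Y y" and ?d = "chart_deriv (chart_at Y y)" and ?m = "nat (mult y)"
  obtain u where u: "holo_germ Y y u" "u y \<noteq> 0" "mult y > 0"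
    "\<forall>\<^sub>F q in nhds y. coord X (f y) (f q) = ?w q ^ ?m * u q"
    by (rule coord_f_factor)
  \<comment> \<open>Multiplying the logarithmic derivative of w^m u by w gives m + w u'/u.\<close>
  define v where "v q = of_int (mult y) + ?w q * (?d u q * inverse (u q))" for q
  have "holo_germ Y y v"
    unfolding v_def[abs_def] using u(1,2)
    by (intro holo_germ_add holo_germ_mult holo_germ_const holo_germ_coord holo_germ_chart_deriv
        holo_germ_inverse RY chart_at) auto
  moreover have "v y = of_int (mult y)" by (simp add: v_def coord_self[OF RY])
  moreover have "\<forall>\<^sub>F q in at y. ?w q * ?d (coord X (f y) \<circ> f) q = v q * coord X (f y) (f q)"
    using eventually_at_nhds[OF eventually_nhds_at[OF u(4)]]
      eventually_nhds_at[OF holo_germ_eventually[OF RY u(1)]]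
      eventually_nhds_at[OF holo_germ_eventually_nonzero[OF RY u(1,2)]]
      eventually_coord_germ[OF RY, of y] eventually_at_coord[OF RY, of y]
  proof eventually_elim
    case (elim q)
    then have q: "q \<in> fst (chart_at Y y)" "?w q \<noteq> 0" by auto
    have eq: "coord X (f y) (f q) = ?w q powi mult y * u q"
      using eventually_nhds_x_imp_x[of _ q] elim(1) u(3) by (auto simp: power_int_def)
    have "?d (coord X (f y) \<circ> f) q = ?d (\<lambda>q. ?w q powi mult y * u q) q"
      using elim u(3) by (intro chart_deriv_eqI[OF RY chart_at(1)[OF RY] q(1)]) (auto simp: power_int_def)
    also have "\<dots> = ?d (\<lambda>q. ?w q powi mult y) q * u q + ?w q powi mult y * ?d u q"
      using elim by (intro chart_deriv_mult[OF RY chart_at(1)[OF RY] q(1)] holo_germ_powi[OF RY]) auto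
    also have "?d (\<lambda>q. ?w q powi mult y) q = of_int (mult y) * ?w q powi (mult y - 1)"
      using elim chart_deriv_powi[OF RY chart_at(1)[OF RY] q(1), of ?w "mult y"] chart_deriv_coord[OF RY q(1)]
      by simp
    also have "?w q powi mult y = ?w q * ?w q powi (mult y - 1)"
      using q(2) power_int_add[of "?w q" 1 "mult y - 1"] by simp
    finally have D: "?d (coord X (f y) \<circ> f) q = of_int (mult y) * ?w q powi (mult y - 1) * u q
        + ?w q * ?w q powi (mult y - 1) * ?d u q" .
    have "?w q powi mult y = ?w q * ?w q powi (mult y - 1)"
      using q(2) power_int_add[of "?w q" 1 "mult y - 1"] by simp
    then show ?case unfolding eq D v_def using elim(3) by (simp add: field_simps)
  qed
  ultimately show thesis using that by blast
qed

end

section \<open>Sections and split filtrations\<close>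

lemma matrix_inv_works:
  assumes "invertible A"
  shows "A ** matrix_inv A = mat 1" "matrix_inv A ** A = mat 1"
proof -
  have "\<exists>B. A ** B = mat 1 \<and> B ** A = mat 1" using assms by (simp add: invertible_def)
  from someI_ex[OF this] show "A ** matrix_inv A = mat 1" "matrix_inv A ** A = mat 1"
    unfolding matrix_inv_def by auto
qed

lemma matrix_inv_eqI:
  fixes A :: "'a::field ^ 'n::finite ^ 'n"
  assumes "B ** A = mat 1"
  shows "matrix_inv A = B" "invertible A"
proof -
  show "invertible A" using assms matrix_left_right_inverse[of B A] by (auto simp: invertible_def)
  then have "matrix_inv A = (B ** A) ** matrix_inv A" using assms by simp
  also have "\<dots> = B" using matrix_inv_works[OF \<open>invertible A\<close>] by (simp flip: matrix_mul_assoc)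
  finally show "matrix_inv A = B" .
qed

lemma matrix_inv_vector [simp]:
  assumes "invertible A"
  shows "A *v (matrix_inv A *v v) = v" "matrix_inv A *v (A *v v) = v"
  using matrix_inv_works[OF assms] by (simp_all add: matrix_vector_mul_assoc)

lemma matrix_vector_axis [simp]: "(A *v axis j 1) $ i = (A :: 'a::comm_ring_1 ^ 'n::finite ^ 'm) $ i $ j"
  by (simp add: matrix_vector_mult_def axis_def if_distrib cong: if_cong)

lemma matrix_vector_sum: "A *v (\<Sum>i\<in>I. v i) = (\<Sum>i\<in>I. A *v (v i :: 'a::comm_ring_1 ^ 'n::finite))"
  by (induction I rule: infinite_finite_induct) (auto simp: matrix_vector_right_distrib)

lemma vec_eq_sum_axis:
  fixes v :: "'a::comm_ring_1 ^ 'n::finite"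
  shows "v = (\<Sum>i\<in>UNIV. v $ i *s axis i 1)"
  by (simp add: vec_eq_iff axis_def if_distrib cong: if_cong)

text \<open>Tensor and pullback germs are defined by sums over \<open>k < N\<close>, frames are
  indexed by a finite type; an enumeration of the type connects the two.\<close>

lemma sum_nat_enum:
  obtains b :: "nat \<Rightarrow> 'i::finite" where
    "\<And>F :: 'i \<Rightarrow> 'a::comm_monoid_add. (\<Sum>i\<in>UNIV. F i) = (\<Sum>k<CARD('i). F (b k))"
proof -
  obtain b :: "nat \<Rightarrow> 'i" where "bij_betw b {0..<CARD('i)} UNIV"
    using ex_bij_betw_nat_finite[of "UNIV :: 'i set"] by auto
  then have "(\<Sum>i\<in>UNIV. F i) = (\<Sum>k<CARD('i). F (b k))" for F :: "'i \<Rightarrow> 'a"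
    using sum.reindex_bij_betw[of b "{0..<CARD('i)}" UNIV F] by (simp add: lessThan_atLeast0)
  then show thesis using that by blast
qed

lemma ord_ge_transfer: "ord_ge X x n h \<Longrightarrow> \<forall>\<^sub>F p in at x. h p = k p \<Longrightarrow> ord_ge X x n k"
  using ord_ge_cong by blast

definition hvec :: "'x::t2_space chart set \<Rightarrow> 'x \<Rightarrow> ('x \<Rightarrow> complex ^ 'n) \<Rightarrow> bool" where
  "hvec X x v \<longleftrightarrow> (\<forall>i. holo_germ X x (\<lambda>p. v p $ i))"

definition hmat :: "'x::t2_space chart set \<Rightarrow> 'x \<Rightarrow> ('x \<Rightarrow> complex ^ 'n ^ 'm) \<Rightarrow> bool" where
  "hmat X x M \<longleftrightarrow> (\<forall>i j. holo_germ X x (\<lambda>p. M p $ i $ j))"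

text \<open>Section germs at \<open>x\<close>, tested on the trivializations whose domain contains
  \<open>x\<close>. Outside the base of the bundle the condition is vacuous, which explains the
  hypothesis \<open>p \<in> S\<close> in several lemmas.\<close>

definition sgerm :: "'x::t2_space chart set \<Rightarrow> ('x, 'r::finite) bundle_atlas \<Rightarrow> 'x \<Rightarrow> ('x \<Rightarrow> complex ^ 'r) \<Rightarrow> bool" where
  "sgerm X T x s \<longleftrightarrow> (\<forall>(U, g)\<in>T. x \<in> U \<longrightarrow> hvec X x (\<lambda>p. g p *v s p))"

text \<open>\<open>\<gamma>\<close> is a holomorphic trivialization near \<open>p\<close>.\<close>

definition compat :: "'x::t2_space chart set \<Rightarrow> ('x, 'r::finite) bundle_atlas \<Rightarrow> 'x \<Rightarrow> ('x \<Rightarrow> complex ^ 'r ^ 'r) \<Rightarrow> bool" where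
  "compat X T p \<gamma> \<longleftrightarrow> (\<forall>\<^sub>F q in nhds p. invertible (\<gamma> q)) \<and>
     (\<exists>(U, g)\<in>T. p \<in> U \<and> hmat X p (\<lambda>q. \<gamma> q ** matrix_inv (g q)) \<and> hmat X p (\<lambda>q. g q ** matrix_inv (\<gamma> q)))"

text \<open>
  The filtration splits: in the coordinates \<open>\<gamma>\<close>, the module \<open>E\<^bsub>x,t\<^esub>\<close> is the sum of the lines
  \<open>z\<^bsup>\<lceil>t - \<alpha> i\<rceil>\<^esup> \<O>\<close>.  In this form tensor products, duals and pullbacks are computed on weights.
\<close>

definition splits :: "'x::t2_space chart set \<Rightarrow> ('x, 'r::finite) filtered_bundle \<Rightarrow> 'x
    \<Rightarrow> ('x \<Rightarrow> complex ^ 'r ^ 'r) \<Rightarrow> ('r \<Rightarrow> real) \<Rightarrow> bool" where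
  "splits X E x \<gamma> \<alpha> \<longleftrightarrow> (\<forall>\<^sub>F p in at x. compat X (atlas E) p \<gamma>) \<and>
     (\<forall>t s. s \<in> germs E x t \<longleftrightarrow> (\<forall>i. ord_ge X x \<lceil>t - \<alpha> i\<rceil> (\<lambda>p. (\<gamma> p *v s p) $ i)))"

context
  fixes X :: "'x::t2_space chart set"
  assumes RS: "riemann_surface X"
begin

lemma hvec_cong: "\<forall>\<^sub>F p in nhds x. v p = w p \<Longrightarrow> hvec X x v \<longleftrightarrow> hvec X x w"
  unfolding hvec_def by (intro iff_allI holo_germ_cong[OF RS]) (auto elim: eventually_mono)

lemma hmat_cong: "\<forall>\<^sub>F p in nhds x. M p = N p \<Longrightarrow> hmat X x M \<longleftrightarrow> hmat X x N"
  unfolding hmat_def by (intro iff_allI holo_germ_cong[OF RS]) (auto elim: eventually_mono)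

lemma hvec_transfer: "hvec X x v \<Longrightarrow> \<forall>\<^sub>F p in nhds x. v p = w p \<Longrightarrow> hvec X x w"
  and hmat_transfer: "hmat X x M \<Longrightarrow> \<forall>\<^sub>F p in nhds x. M p = N p \<Longrightarrow> hmat X x N"
  using hvec_cong hmat_cong by metis+

lemma hvec_const [simp]: "hvec X x (\<lambda>p. v)"
  by (simp add: hvec_def holo_germ_const[OF RS])

lemma hmat_const [simp]: "hmat X x (\<lambda>p. M)"
  by (simp add: hmat_def holo_germ_const[OF RS])

lemma hvec_mult: "hmat X x M \<Longrightarrow> hvec X x v \<Longrightarrow> hvec X x (\<lambda>p. M p *v v p)"
  unfolding hvec_def hmat_def matrix_vector_mult_def
  by (auto intro!: holo_germ_sum holo_germ_mult RS)

lemma hmat_mult: "hmat X x M \<Longrightarrow> hmat X x N \<Longrightarrow> hmat X x (\<lambda>p. M p ** N p)"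
  unfolding hmat_def matrix_matrix_mult_def
  by (auto intro!: holo_germ_sum holo_germ_mult RS)

lemma hvec_add: "hvec X x v \<Longrightarrow> hvec X x w \<Longrightarrow> hvec X x (\<lambda>p. v p + w p)"
  unfolding hvec_def by (auto intro!: holo_germ_add RS)

lemma hvec_scale: "holo_germ X x h \<Longrightarrow> hvec X x v \<Longrightarrow> hvec X x (\<lambda>p. h p *s v p)"
  unfolding hvec_def by (auto intro!: holo_germ_mult RS)

lemma hvec_sum: "(\<And>i. i \<in> I \<Longrightarrow> hvec X x (v i)) \<Longrightarrow> hvec X x (\<lambda>p. \<Sum>i\<in>I. v i p)"
  unfolding hvec_def by (auto intro!: holo_germ_sum RS)

section \<open>Frames and sections of a vector bundle\<close>

lemma holo_section_iff:
  assumes "\<And>U g. (U, g) \<in> T \<Longrightarrow> open U"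
  shows "holo_section X T W s \<longleftrightarrow> open W \<and> (\<forall>x\<in>W. sgerm X T x s)"
  unfolding holo_section_def sgerm_def hvec_def holo_iff[OF RS] using assms by fastforce

lemma vector_bundle_iff:
  "vector_bundle X S T \<longleftrightarrow> (\<Union>(U, g)\<in>T. U) = S \<and> (\<forall>(U, g)\<in>T. open U \<and> (\<forall>p\<in>U. invertible (g p))) \<and>
    (\<forall>(U, g)\<in>T. \<forall>(U', g')\<in>T. \<forall>p\<in>U \<inter> U'. hmat X p (\<lambda>q. g' q ** matrix_inv (g q)))"
  unfolding vector_bundle_def hmat_def holo_iff[OF RS] case_prod_unfold
  by (intro conj_cong refl ball_cong) auto

context
  fixes S T
  assumes VB: "vector_bundle X S (T :: ('x, 'r::finite) bundle_atlas)"
begin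

lemma triv_open: "(U, g) \<in> T \<Longrightarrow> open U"
  and triv_invertible: "(U, g) \<in> T \<Longrightarrow> p \<in> U \<Longrightarrow> invertible (g p)"
  and triv_in: "(U, g) \<in> T \<Longrightarrow> p \<in> U \<Longrightarrow> p \<in> S"
  using VB unfolding vector_bundle_iff by auto

lemma triv_transition:
  "(U, g) \<in> T \<Longrightarrow> (U', g') \<in> T \<Longrightarrow> p \<in> U \<Longrightarrow> p \<in> U' \<Longrightarrow> hmat X p (\<lambda>q. g' q ** matrix_inv (g q))"
  using VB unfolding vector_bundle_iff by blast

lemma triv_ex: "p \<in> S \<Longrightarrow> \<exists>U g. (U, g) \<in> T \<and> p \<in> U"
  using VB unfolding vector_bundle_iff by auto

lemma open_base: "open S"
  using VB unfolding vector_bundle_iff by auto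

lemma section_iff: "holo_section X T W s \<longleftrightarrow> open W \<and> (\<forall>x\<in>W. sgerm X T x s)"
  by (rule holo_section_iff) (rule triv_open)

lemma eventually_triv: "(U, g) \<in> T \<Longrightarrow> p \<in> U \<Longrightarrow> \<forall>\<^sub>F q in nhds p. q \<in> U \<and> invertible (g q)"
  using eventually_nhds_in_open[OF triv_open, of U g p] triv_invertible by (auto elim!: eventually_mono)

lemma triv_compat:
  assumes "(U, g) \<in> T" "p \<in> U" shows "compat X T p g"
  unfolding compat_def using assms eventually_triv[OF assms] triv_transition[OF assms(1,1,2,2)]
  by (auto elim: eventually_mono)

lemma hmat_chain:
  assumes "hmat X p (\<lambda>q. a q ** matrix_inv (b q))" "hmat X p (\<lambda>q. b q ** matrix_inv (c q))"
    "\<forall>\<^sub>F q in nhds p. invertible (b q)"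
  shows "hmat X p (\<lambda>q. a q ** matrix_inv (c q :: complex ^ 'r ^ 'r))"
proof -
  have "\<forall>\<^sub>F q in nhds p. (a q ** matrix_inv (b q)) ** (b q ** matrix_inv (c q)) = a q ** matrix_inv (c q)"
    using assms(3) by eventually_elim (metis matrix_inv_works(2) matrix_mul_assoc matrix_mul_rid)
  with hmat_mult[OF assms(1,2)] show ?thesis by (rule hmat_transfer)
qed

text \<open>\<open>compat\<close> asks for a comparison with one trivialization; composing with
  transition matrices gives it for all of them.\<close>

lemma compat_triv:
  assumes "compat X T p \<gamma>" "(U, g) \<in> T" "p \<in> U"
  shows "hmat X p (\<lambda>q. \<gamma> q ** matrix_inv (g q))" "hmat X p (\<lambda>q. g q ** matrix_inv (\<gamma> q))"
proof -
  obtain U' g' where *: "(U', g') \<in> T" "p \<in> U'" "hmat X p (\<lambda>q. \<gamma> q ** matrix_inv (g' q))"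
    "hmat X p (\<lambda>q. g' q ** matrix_inv (\<gamma> q))" using assms(1) by (auto simp: compat_def)
  have ev: "\<forall>\<^sub>F q in nhds p. invertible (g' q)" using eventually_triv[OF *(1,2)] by (auto elim: eventually_mono)
  show "hmat X p (\<lambda>q. \<gamma> q ** matrix_inv (g q))"
    using *(3) triv_transition[OF assms(2) *(1) assms(3) *(2)] ev by (rule hmat_chain)
  show "hmat X p (\<lambda>q. g q ** matrix_inv (\<gamma> q))"
    using triv_transition[OF *(1) assms(2) *(2) assms(3)] *(4) ev by (rule hmat_chain)
qed

lemma compat_invertible: "compat X T p \<gamma> \<Longrightarrow> invertible (\<gamma> p)"
  unfolding compat_def using eventually_nhds_x_imp_x by blast

lemma compat_base: "compat X T p \<gamma> \<Longrightarrow> p \<in> S"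
  unfolding compat_def using triv_in by blast

lemma compat_change:
  assumes "compat X T p \<gamma>" "compat X T p \<gamma>'"
  shows "hmat X p (\<lambda>q. \<gamma>' q ** matrix_inv (\<gamma> q))"
proof -
  obtain U g where *: "(U, g) \<in> T" "p \<in> U" using assms(1) by (auto simp: compat_def)
  have ev: "\<forall>\<^sub>F q in nhds p. invertible (g q)" using eventually_triv[OF *] by (auto elim: eventually_mono)
  show ?thesis by (rule hmat_chain[OF compat_triv(1)[OF assms(2) *] compat_triv(2)[OF assms(1) *] ev])
qed

lemma hvec_chain:
  assumes "hmat X p (\<lambda>q. a q ** matrix_inv (b q :: complex ^ 'r ^ 'r))" "hvec X p (\<lambda>q. b q *v s q)"
    "\<forall>\<^sub>F q in nhds p. invertible (b q)"
  shows "hvec X p (\<lambda>q. a q *v s q)"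
proof -
  have "\<forall>\<^sub>F q in nhds p. (a q ** matrix_inv (b q)) *v (b q *v s q) = a q *v s q"
    using assms(3) by eventually_elim (simp flip: matrix_vector_mul_assoc)
  with hvec_mult[OF assms(1,2)] show ?thesis by (rule hvec_transfer)
qed

text \<open>Any admissible frame detects holomorphic sections. This permits split coordinates and
  pulled back frames to be used in place of members of the atlas.\<close>

lemma compat_sgerm:
  assumes "compat X T p \<gamma>"
  shows "sgerm X T p s \<longleftrightarrow> hvec X p (\<lambda>q. \<gamma> q *v s q)"
proof
  assume *: "sgerm X T p s"
  obtain U g where U: "(U, g) \<in> T" "p \<in> U" using assms(1) by (auto simp: compat_def)
  have ev: "\<forall>\<^sub>F q in nhds p. invertible (g q)" using eventually_triv[OF U] by (auto elim: eventually_mono)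
  show "hvec X p (\<lambda>q. \<gamma> q *v s q)"
    by (rule hvec_chain[OF compat_triv(1)[OF assms U] _ ev]) (use * U in \<open>auto simp: sgerm_def\<close>)
next
  assume *: "hvec X p (\<lambda>q. \<gamma> q *v s q)"
  have ev: "\<forall>\<^sub>F q in nhds p. invertible (\<gamma> q)" using assms by (auto simp: compat_def)
  show "sgerm X T p s" unfolding sgerm_def
    using hvec_chain[OF compat_triv(2)[OF assms] * ev] by blast
qed

lemma compat_eventually:
  assumes "compat X T p \<gamma>" shows "\<forall>\<^sub>F q in nhds p. compat X T q \<gamma>"
proof -
  obtain U g where *: "(U, g) \<in> T" "p \<in> U" "hmat X p (\<lambda>q. \<gamma> q ** matrix_inv (g q))"
    "hmat X p (\<lambda>q. g q ** matrix_inv (\<gamma> q))" and i: "\<forall>\<^sub>F q in nhds p. invertible (\<gamma> q)"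
    using assms(1) by (auto simp: compat_def)
  have ev: "\<forall>\<^sub>F q in nhds p. hmat X q M" if "hmat X p M" for M :: "'x \<Rightarrow> complex ^ 'r ^ 'r"
    using that holo_germ_eventually[OF RS] unfolding hmat_def by (auto simp: eventually_all_finite)
  show ?thesis
    using ev[OF *(3)] ev[OF *(4)] i[THEN eventually_eventually[THEN iffD2]] eventually_triv[OF *(1,2)]
    by eventually_elim (use * in \<open>auto simp: compat_def\<close>)
qed

lemma sgerm_eventually:
  assumes "sgerm X T p s" "p \<in> S" shows "\<forall>\<^sub>F q in nhds p. sgerm X T q s"
proof -
  obtain U g where *: "(U, g) \<in> T" "p \<in> U" using triv_ex assms by blast
  then have "hvec X p (\<lambda>q. g q *v s q)" using assms(1) by (auto simp: sgerm_def)
  then have "\<forall>\<^sub>F q in nhds p. hvec X q (\<lambda>q. g q *v s q)"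
    using holo_germ_eventually[OF RS] unfolding hvec_def by (auto simp: eventually_all_finite)
  then show ?thesis using compat_eventually[OF triv_compat[OF *]]
    by eventually_elim (simp add: compat_sgerm)
qed

lemma sgerm_cong: "\<forall>\<^sub>F q in nhds p. s q = s' q \<Longrightarrow> sgerm X T p s \<longleftrightarrow> sgerm X T p s'"
  unfolding sgerm_def using hvec_cong[of "\<lambda>q. g q *v s q" "\<lambda>q. g q *v s' q" p for g]
  by (smt (verit, best) case_prodI2 case_prodD eventually_mono)

lemma sgerm_add: "sgerm X T p s \<Longrightarrow> sgerm X T p s' \<Longrightarrow> sgerm X T p (\<lambda>q. s q + s' q)"
  unfolding sgerm_def by (auto simp: matrix_vector_right_distrib intro: hvec_add)

lemma sgerm_scale: "holo_germ X p h \<Longrightarrow> sgerm X T p s \<Longrightarrow> sgerm X T p (\<lambda>q. h q *s s q)"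
  unfolding sgerm_def by (auto simp: vector_scalar_commute intro: hvec_scale)

lemma sgerm_sum: "(\<And>i. i \<in> I \<Longrightarrow> sgerm X T p (s i)) \<Longrightarrow> sgerm X T p (\<lambda>q. \<Sum>i\<in>I. s i q)"
  unfolding sgerm_def by (auto simp: matrix_vector_sum intro!: hvec_sum)

lemma sgerm_frame:
  assumes "compat X T p \<gamma>" shows "sgerm X T p (\<lambda>q. matrix_inv (\<gamma> q) *v v)"
  unfolding compat_sgerm[OF assms]
proof (subst hvec_cong)
  show "\<forall>\<^sub>F q in nhds p. \<gamma> q *v (matrix_inv (\<gamma> q) *v v) = v"
    using assms by (auto simp: compat_def elim: eventually_mono)
qed simp

lemma frame_section:
  assumes "(U, g) \<in> T" shows "holo_section X T U (\<lambda>q. matrix_inv (g q) *v v)"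
  unfolding section_iff using triv_open[OF assms] sgerm_frame triv_compat[OF assms] by blast

end

section \<open>Modules of germs in split coordinates\<close>

lemma germs_splits:
  "splits X E x \<gamma> \<alpha> \<Longrightarrow> s \<in> germs E x t \<longleftrightarrow> (\<forall>i. ord_ge X x \<lceil>t - \<alpha> i\<rceil> (\<lambda>p. (\<gamma> p *v s p) $ i))"
  by (simp add: splits_def)

lemma splits_invertible:
  assumes "splits X E x \<gamma> \<alpha>" shows "\<forall>\<^sub>F p in at x. invertible (\<gamma> p)"
proof -
  have "\<forall>\<^sub>F p in at x. compat X (atlas E) p \<gamma>" using assms by (simp add: splits_def)
  then show ?thesis
    by eventually_elim (auto simp: compat_def intro: eventually_nhds_x_imp_x)
qed

text \<open>With coefficient 1 this says that the i-th frame vector is a germ of parameter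
  \<open>\<alpha> i\<close>. These vectors are the generators from which the inclusions into tensor
  products and pullbacks are obtained, and the test vectors for homomorphisms and duals.\<close>

lemma frame_germ:
  assumes "splits X E x \<gamma> \<alpha>" "ord_ge X x \<lceil>t - \<alpha> i\<rceil> c"
  shows "(\<lambda>p. c p *s (matrix_inv (\<gamma> p) *v axis i 1)) \<in> germs E x t"
  unfolding germs_splits[OF assms(1)]
proof
  fix j
  have "\<forall>\<^sub>F p in at x. (\<gamma> p *v (c p *s (matrix_inv (\<gamma> p) *v axis i 1))) $ j = (if j = i then c p else 0)"
    using splits_invertible[OF assms(1)]
    by eventually_elim (auto simp: vector_scalar_commute axis_def)
  then have "ord_ge X x \<lceil>t - \<alpha> j\<rceil> (\<lambda>p. (\<gamma> p *v (c p *s (matrix_inv (\<gamma> p) *v axis i 1))) $ j)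
      \<longleftrightarrow> ord_ge X x \<lceil>t - \<alpha> j\<rceil> (\<lambda>p. if j = i then c p else 0)"
    by (rule ord_ge_cong)
  then show "ord_ge X x \<lceil>t - \<alpha> j\<rceil> (\<lambda>p. (\<gamma> p *v (c p *s (matrix_inv (\<gamma> p) *v axis i 1))) $ j)"
    using assms(2) by (cases "j = i") (auto simp: ord_ge_zero[OF RS])
qed

lemma germs_cong:
  assumes "splits X E x \<gamma> \<alpha>" "\<forall>\<^sub>F p in at x. s p = s' p"
  shows "s \<in> germs E x t \<longleftrightarrow> s' \<in> germs E x t"
  unfolding germs_splits[OF assms(1)]
  by (intro iff_allI ord_ge_cong) (use assms(2) in \<open>auto elim: eventually_mono\<close>)

lemma germs_add:
  assumes "splits X E x \<gamma> \<alpha>" "s \<in> germs E x t" "s' \<in> germs E x t"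
  shows "(\<lambda>p. s p + s' p) \<in> germs E x t"
  using assms(2,3) unfolding germs_splits[OF assms(1)]
  by (auto simp: matrix_vector_right_distrib intro!: ord_ge_add[OF RS])

lemma germs_scale:
  assumes "splits X E x \<gamma> \<alpha>" "s \<in> germs E x t" "ord_ge X x n h" "b \<le> t + of_int n"
  shows "(\<lambda>p. h p *s s p) \<in> germs E x b"
  unfolding germs_splits[OF assms(1)]
proof
  fix i
  have "ord_ge X x (n + \<lceil>t - \<alpha> i\<rceil>) (\<lambda>p. h p * (\<gamma> p *v s p) $ i)"
    using assms(2,3) unfolding germs_splits[OF assms(1)] by (intro ord_ge_mult[OF RS]) auto
  moreover have "\<lceil>b - \<alpha> i\<rceil> \<le> n + \<lceil>t - \<alpha> i\<rceil>" using assms(4) by linarith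
  ultimately show "ord_ge X x \<lceil>b - \<alpha> i\<rceil> (\<lambda>p. (\<gamma> p *v (h p *s s p)) $ i)"
    using ord_ge_mono[OF RS] by (auto simp: vector_scalar_commute)
qed

lemma germs_zero:
  assumes "splits X E x \<gamma> \<alpha>" shows "(\<lambda>p. 0) \<in> germs E x t"
  unfolding germs_splits[OF assms] by (simp add: ord_ge_zero[OF RS])

lemma germs_sum:
  assumes "splits X E x \<gamma> \<alpha>" "\<And>i. i \<in> I \<Longrightarrow> s i \<in> germs E x t"
  shows "(\<lambda>p. \<Sum>i\<in>I. s i p) \<in> germs E x t"
  using assms(2)
  by (induction I rule: infinite_finite_induct) (auto intro: germs_add[OF assms(1)] germs_zero[OF assms(1)])

lemma germs_mono:
  assumes "splits X E x \<gamma> \<alpha>" "s \<in> germs E x t" "b \<le> t"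
  shows "s \<in> germs E x b"
  using germs_scale[OF assms(1,2) ord_ge_holo_germ[OF RS holo_germ_const[OF RS, of _ 1]]] assms(3) by simp

section \<open>Homomorphisms in split coordinates\<close>

lemma parabolic_hom_triv:
  assumes VB: "vector_bundle X (- D) (atlas E)" "vector_bundle X (- D) (atlas E')"
    and hom: "parabolic_hom X D E E' \<psi>"
    and U: "(U, g) \<in> atlas E" "(U', g') \<in> atlas E'" "p \<in> U" "p \<in> U'"
  shows "hmat X p (\<lambda>q. g' q ** \<psi> q ** matrix_inv (g q))"
  unfolding hmat_def
proof (intro allI)
  fix i j
  have "U \<subseteq> - D" using triv_in[OF VB(1) U(1)] by blast
  \<comment> \<open>\<open>\<psi>\<close> is known only through its action on sections; its matrix
    entries are the coordinates of the images of frame vectors.\<close>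
  then have "holo_section X (atlas E') U (\<lambda>q. \<psi> q *v (matrix_inv (g q) *v axis j 1))"
    using hom frame_section[OF VB(1) U(1)] unfolding parabolic_hom_def by blast
  then have "sgerm X (atlas E') p (\<lambda>q. \<psi> q *v (matrix_inv (g q) *v axis j 1))"
    unfolding section_iff[OF VB(2)] using U by blast
  then have "hvec X p (\<lambda>q. g' q *v (\<psi> q *v (matrix_inv (g q) *v axis j 1)))"
    using U unfolding sgerm_def by blast
  then have "holo_germ X p (\<lambda>q. (g' q *v (\<psi> q *v (matrix_inv (g q) *v axis j 1))) $ i)"
    unfolding hvec_def by blast
  then show "holo_germ X p (\<lambda>q. (g' q ** \<psi> q ** matrix_inv (g q)) $ i $ j)"
    by (simp add: matrix_vector_mul_assoc matrix_mul_assoc)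
qed

text \<open>The j-th column is the image of the j-th frame vector, a germ of parameter
  \<open>\<alpha> j\<close>. Its image has the same parameter, and the bound is read off in the
  coordinates of \<open>E'\<close>.\<close>

lemma parabolic_hom_splits:
  assumes hom: "parabolic_hom X D E E' \<psi>" and x: "x \<in> D"
    and sp: "splits X E x \<gamma> \<alpha>" "splits X E' x \<gamma>' \<alpha>'"
  shows "ord_ge X x \<lceil>\<alpha> j - \<alpha>' i\<rceil> (\<lambda>q. (\<gamma>' q ** \<psi> q ** matrix_inv (\<gamma> q)) $ i $ j)"
proof -
  have "(\<lambda>p. 1 *s (matrix_inv (\<gamma> p) *v axis j 1)) \<in> germs E x (\<alpha> j)"
    by (rule frame_germ[OF sp(1)]) (use ord_ge_holo_germ[OF RS holo_germ_const[OF RS]] in simp)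
  then have "(\<lambda>p. \<psi> p *v (matrix_inv (\<gamma> p) *v axis j 1)) \<in> germs E' x (\<alpha> j)"
    using hom x unfolding parabolic_hom_def by fastforce
  then have "ord_ge X x \<lceil>\<alpha> j - \<alpha>' i\<rceil> (\<lambda>p. (\<gamma>' p *v (\<psi> p *v (matrix_inv (\<gamma> p) *v axis j 1))) $ i)"
    unfolding germs_splits[OF sp(2)] by blast
  then show ?thesis by (simp add: matrix_vector_mul_assoc matrix_mul_assoc)
qed

text \<open>Converse of the two preceding lemmas. Both conditions are local, so at each point a
  single pair of frames suffices, and it may be chosen as convenient.\<close>

lemma parabolic_homI:
  assumes VB: "vector_bundle X (- D) (atlas E)" "vector_bundle X (- D) (atlas E')"
    and triv: "\<And>p. p \<notin> D \<Longrightarrow> \<exists>(U, g)\<in>atlas E. \<exists>(U', g')\<in>atlas E'. p \<in> U \<and> p \<in> U' \<and>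
      hmat X p (\<lambda>q. g' q ** \<psi> q ** matrix_inv (g q))"
    and sp: "\<And>x. x \<in> D \<Longrightarrow> \<exists>\<gamma> \<alpha> \<gamma>' \<alpha>'. splits X E x \<gamma> \<alpha> \<and> splits X E' x \<gamma>' \<alpha>' \<and>
      (\<forall>i j. ord_ge X x \<lceil>\<alpha> j - \<alpha>' i\<rceil> (\<lambda>q. (\<gamma>' q ** \<psi> q ** matrix_inv (\<gamma> q)) $ i $ j))"
  shows "parabolic_hom X D E E' \<psi>"
  unfolding parabolic_hom_def
proof (intro conjI allI impI ballI)
  fix W s assume W: "W \<subseteq> - D" "holo_section X (atlas E) W s"
  show "holo_section X (atlas E') W (\<lambda>p. \<psi> p *v s p)"
    unfolding section_iff[OF VB(2)]
  proof (intro conjI ballI)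
    show "open W" using W(2) unfolding section_iff[OF VB(1)] by blast
    fix p assume p: "p \<in> W"
    then obtain U g U' g' where *: "(U, g) \<in> atlas E" "(U', g') \<in> atlas E'" "p \<in> U" "p \<in> U'"
      "hmat X p (\<lambda>q. g' q ** \<psi> q ** matrix_inv (g q))" using triv[of p] W(1) by blast
    have "hvec X p (\<lambda>q. g q *v s q)"
      using W(2) p *(1,3) unfolding section_iff[OF VB(1)] sgerm_def by blast
    from hvec_mult[OF *(5) this]
    have "hvec X p (\<lambda>q. g' q *v (\<psi> q *v s q))"
    proof (rule hvec_transfer)
      show "\<forall>\<^sub>F q in nhds p. (g' q ** \<psi> q ** matrix_inv (g q)) *v (g q *v s q) = g' q *v (\<psi> q *v s q)"
        using eventually_triv[OF VB(1) *(1,3)] by eventually_elim (simp flip: matrix_vector_mul_assoc)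
    qed
    then show "sgerm X (atlas E') p (\<lambda>p. \<psi> p *v s p)"
      using compat_sgerm[OF VB(2) triv_compat[OF VB(2) *(2,4)]] by blast
  qed
next
  fix x t s assume x: "x \<in> D" and s: "s \<in> germs E x t"
  obtain \<gamma> \<alpha> \<gamma>' \<alpha>' where *: "splits X E x \<gamma> \<alpha>" "splits X E' x \<gamma>' \<alpha>'"
    "\<And>i j. ord_ge X x \<lceil>\<alpha> j - \<alpha>' i\<rceil> (\<lambda>q. (\<gamma>' q ** \<psi> q ** matrix_inv (\<gamma> q)) $ i $ j)"
    using sp[OF x] by blast
  show "(\<lambda>p. \<psi> p *v s p) \<in> germs E' x t"
    unfolding germs_splits[OF *(2)]
  proof
    fix i
    have "ord_ge X x \<lceil>t - \<alpha>' i\<rceil> (\<lambda>q. (\<gamma>' q ** \<psi> q ** matrix_inv (\<gamma> q)) $ i $ j * (\<gamma> q *v s q) $ j)" for j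
    proof -
      \<comment> \<open>The weight \<open>\<alpha> j\<close> cancels in the sum, and subadditivity
        of the ceiling yields the bound wanted for each product.\<close>
      have "ord_ge X x (\<lceil>\<alpha> j - \<alpha>' i\<rceil> + \<lceil>t - \<alpha> j\<rceil>) (\<lambda>q. (\<gamma>' q ** \<psi> q ** matrix_inv (\<gamma> q)) $ i $ j * (\<gamma> q *v s q) $ j)"
        using *(3) s[unfolded germs_splits[OF *(1)]] by (intro ord_ge_mult[OF RS]) auto
      then show ?thesis by (rule ord_ge_mono[OF RS]) linarith
    qed
    then have "ord_ge X x \<lceil>t - \<alpha>' i\<rceil> (\<lambda>q. \<Sum>j\<in>UNIV. (\<gamma>' q ** \<psi> q ** matrix_inv (\<gamma> q)) $ i $ j * (\<gamma> q *v s q) $ j)"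
      by (intro ord_ge_sum[OF RS])
    then have "ord_ge X x \<lceil>t - \<alpha>' i\<rceil> (\<lambda>q. ((\<gamma>' q ** \<psi> q ** matrix_inv (\<gamma> q)) *v (\<gamma> q *v s q)) $ i)"
      by (simp only: matrix_vector_mult_def[of "_ ** _"] vec_lambda_beta)
    moreover have "\<forall>\<^sub>F q in at x. ((\<gamma>' q ** \<psi> q ** matrix_inv (\<gamma> q)) *v (\<gamma> q *v s q)) $ i = (\<gamma>' q *v (\<psi> q *v s q)) $ i"
      using splits_invertible[OF *(1)] by eventually_elim (simp flip: matrix_vector_mul_assoc)
    ultimately show "ord_ge X x \<lceil>t - \<alpha>' i\<rceil> (\<lambda>q. (\<gamma>' q *v (\<psi> q *v s q)) $ i)"
      by (rule ord_ge_transfer)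
  qed
qed

end

section \<open>Tensor products, duals and pullbacks\<close>

lemma sum_prod_UNIV: "(\<Sum>x\<in>UNIV. F x) = (\<Sum>i\<in>UNIV. \<Sum>j\<in>UNIV. F (i, j))"
  for F :: "'a::finite \<times> 'b::finite \<Rightarrow> 'c::comm_monoid_add"
  by (simp add: sum.cartesian_product flip: UNIV_Times_UNIV)

lemma tensor_mat_vec: "tensor_mat g g' *v tensor_vec u v = tensor_vec (g *v u) (g' *v v)"
  for g :: "complex ^ 'r::finite ^ 'r" and g' :: "complex ^ 's::finite ^ 's"
  by (simp add: vec_eq_iff tensor_mat_def tensor_vec_def matrix_vector_mult_def sum_prod_UNIV
      sum_product mult_ac)

lemma tensor_mat_mult: "tensor_mat a a' ** tensor_mat b b' = tensor_mat (a ** b) (a' ** b')"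
  for a :: "complex ^ 'r::finite ^ 'r" and a' :: "complex ^ 's::finite ^ 's"
  by (simp add: vec_eq_iff tensor_mat_def matrix_matrix_mult_def sum_prod_UNIV sum_product mult_ac)

lemma tensor_mat_one: "tensor_mat (mat 1) (mat 1) = (mat 1 :: complex ^ ('r \<times> 's) ^ ('r::finite \<times> 's::finite))"
  by (simp add: vec_eq_iff tensor_mat_def mat_def prod_eq_iff)

lemma tensor_mat_inv:
  fixes a :: "complex ^ 'r::finite ^ 'r" and a' :: "complex ^ 's::finite ^ 's"
  assumes "invertible a" "invertible a'"
  shows "matrix_inv (tensor_mat a a') = tensor_mat (matrix_inv a) (matrix_inv a')"
    "invertible (tensor_mat a a')"
proof -
  have "tensor_mat (matrix_inv a) (matrix_inv a') ** tensor_mat a a' = mat 1"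
    using assms by (simp add: tensor_mat_mult matrix_inv_works tensor_mat_one)
  from matrix_inv_eqI[OF this] show "matrix_inv (tensor_mat a a') = tensor_mat (matrix_inv a) (matrix_inv a')"
    "invertible (tensor_mat a a')" by auto
qed

lemma tensor_vec_axis: "tensor_vec (axis i 1) (axis j 1) = axis (i, j) 1"
  by (auto simp: vec_eq_iff tensor_vec_def axis_def)

lemma tensor_vec_scale: "tensor_vec (c *s u) v = c *s tensor_vec u v" "tensor_vec u (c *s v) = c *s tensor_vec u v"
  by (auto simp: vec_eq_iff tensor_vec_def)

lemma tensor_vec_add: "tensor_vec (u + u') v = tensor_vec u v + tensor_vec u' v"
  "tensor_vec u (v + v') = tensor_vec u v + tensor_vec u v'"
  by (auto simp: vec_eq_iff tensor_vec_def algebra_simps)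

lemma tensor_vec_sum: "tensor_vec (\<Sum>i\<in>I. u i) v = (\<Sum>i\<in>I. tensor_vec (u i) v)"
  "tensor_vec v (\<Sum>i\<in>I. u i) = (\<Sum>i\<in>I. tensor_vec v (u i))"
  by (auto simp: vec_eq_iff tensor_vec_def sum_distrib_left sum_distrib_right)

text \<open>The contragredient matrix: the trivialization of the dual under which the pairing of
  fibres becomes the pairing of coordinate vectors.\<close>

definition dual_mat :: "complex ^ 'r ^ 'r \<Rightarrow> complex ^ 'r ^ 'r" where
  "dual_mat g = transpose (matrix_inv g)"

lemma dual_mat_works:
  fixes g :: "complex ^ 'r::finite ^ 'r"
  assumes "invertible g"
  shows "invertible (dual_mat g)" "matrix_inv (dual_mat g) = transpose g"
proof -
  have "transpose g ** dual_mat g = mat 1"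
    unfolding dual_mat_def using assms
    by (simp add: matrix_inv_works transpose_mat flip: matrix_transpose_mul)
  from matrix_inv_eqI[OF this] show "invertible (dual_mat g)" "matrix_inv (dual_mat g) = transpose g" by auto
qed

lemma dual_mat_transition: "invertible b \<Longrightarrow> dual_mat a ** matrix_inv (dual_mat b) = transpose (b ** matrix_inv a)"
  for a b :: "complex ^ 'r::finite ^ 'r"
  by (simp add: dual_mat_works matrix_transpose_mul) (simp add: dual_mat_def)

lemma pairing_dual:
  fixes g :: "complex ^ 'r::finite ^ 'r"
  assumes "invertible g"
  shows "pairing \<xi> v = pairing (dual_mat g *v \<xi>) (g *v v)"
proof -
  have adj: "pairing (transpose A *v \<xi>) v = pairing \<xi> (A *v v)" for A :: "complex ^ 'r ^ 'r" and \<xi> v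
    unfolding pairing_def matrix_vector_mult_def transpose_def vec_lambda_beta
    by (simp only: sum_distrib_left sum_distrib_right, subst sum.swap) (simp add: mult_ac)
  show ?thesis unfolding dual_mat_def adj using assms by simp
qed

lemma pairing_axis: "pairing \<xi> (axis i 1) = \<xi> $ i"
  by (simp add: pairing_def axis_def if_distrib cong: if_cong)

lemma compatI:
  assumes "(U, g) \<in> T" "p \<in> U" "\<forall>\<^sub>F q in nhds p. invertible (\<gamma> q)"
    "hmat X p (\<lambda>q. \<gamma> q ** matrix_inv (g q))" "hmat X p (\<lambda>q. g q ** matrix_inv (\<gamma> q))"
  shows "compat X T p \<gamma>"
  unfolding compat_def using assms by (intro conjI bexI[of _ "(U, g)"]) auto

lemma atlas_tensor: "atlas (parabolic_tensor E E') =
    {(U \<inter> U', \<lambda>p. tensor_mat (g p) (g' p)) | U g U' g'. (U, g) \<in> atlas E \<and> (U', g') \<in> atlas E'}"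
  by (simp add: parabolic_tensor_def)

lemma atlas_dual: "atlas (parabolic_dual X E) = {(U, \<lambda>p. dual_mat (g p)) | U g. (U, g) \<in> atlas E}"
  by (simp add: parabolic_dual_def dual_mat_def Let_def)

section \<open>Tensor products and duals of parabolic bundles\<close>

context
  fixes X :: "'x::t2_space chart set"
  assumes RS: "riemann_surface X"
begin

lemma hmat_tensor: "hmat X p M \<Longrightarrow> hmat X p N \<Longrightarrow> hmat X p (\<lambda>q. tensor_mat (M q) (N q))"
  unfolding hmat_def tensor_mat_def by (auto intro: holo_germ_mult[OF RS])

lemma hmat_transpose: "hmat X p M \<Longrightarrow> hmat X p (\<lambda>q. transpose (M q))"
  unfolding hmat_def transpose_def by auto

lemma hmat_tensor_transition:
  fixes a b :: "'x \<Rightarrow> complex ^ 'r::finite ^ 'r" and a' b' :: "'x \<Rightarrow> complex ^ 's::finite ^ 's"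
  assumes "hmat X p (\<lambda>q. a q ** matrix_inv (b q))" "hmat X p (\<lambda>q. a' q ** matrix_inv (b' q))"
    "\<forall>\<^sub>F q in nhds p. invertible (b q)" "\<forall>\<^sub>F q in nhds p. invertible (b' q)"
  shows "hmat X p (\<lambda>q. tensor_mat (a q) (a' q) ** matrix_inv (tensor_mat (b q) (b' q)))"
  using hmat_tensor[OF assms(1,2)]
  by (rule hmat_transfer[OF RS], use assms(3,4) in eventually_elim)
     (simp add: tensor_mat_inv tensor_mat_mult)

lemma hmat_dual_transition:
  fixes a b :: "'x \<Rightarrow> complex ^ 'r::finite ^ 'r"
  assumes "hmat X p (\<lambda>q. b q ** matrix_inv (a q))" "\<forall>\<^sub>F q in nhds p. invertible (b q)"
  shows "hmat X p (\<lambda>q. dual_mat (a q) ** matrix_inv (dual_mat (b q)))"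
  using hmat_transpose[OF assms(1)]
  by (rule hmat_transfer[OF RS], use assms(2) in eventually_elim)
     (simp add: dual_mat_transition)

lemma eventually_triv_invertible:
  "vector_bundle X S T \<Longrightarrow> (U, g) \<in> T \<Longrightarrow> p \<in> U \<Longrightarrow> \<forall>\<^sub>F q in nhds p. invertible (g q)"
  for T :: "('x, 'r::finite) bundle_atlas"
  using eventually_triv[OF RS, of S T U g p] by (auto elim: eventually_mono)

lemma vector_bundle_tensor:
  assumes V: "vector_bundle X S (atlas E)" "vector_bundle X S (atlas E')"
  shows "vector_bundle X S (atlas (parabolic_tensor E E'))"
  unfolding vector_bundle_iff[OF RS]
proof (intro conjI)
  show "(\<Union>(U, g)\<in>atlas (parabolic_tensor E E'). U) = S"
  proof safe
    fix x U g assume "(U, g) \<in> atlas (parabolic_tensor E E')" "x \<in> U"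
    then show "x \<in> S" using triv_in[OF RS V(1)] by (auto simp: atlas_tensor)
  next
    fix x assume "x \<in> S"
    then obtain U g U' g' where "(U, g) \<in> atlas E" "x \<in> U" "(U', g') \<in> atlas E'" "x \<in> U'"
      using triv_ex[OF RS V(1)] triv_ex[OF RS V(2)] by blast
    then show "x \<in> (\<Union>(U, g)\<in>atlas (parabolic_tensor E E'). U)"
      unfolding atlas_tensor by blast
  qed
  show "\<forall>(U, g)\<in>atlas (parabolic_tensor E E'). open U \<and> (\<forall>p\<in>U. invertible (g p))"
    unfolding atlas_tensor
    using triv_open[OF RS V(1)] triv_open[OF RS V(2)] triv_invertible[OF RS V(1)] triv_invertible[OF RS V(2)]
    by (auto intro!: tensor_mat_inv(2))
  show "\<forall>(U, g)\<in>atlas (parabolic_tensor E E'). \<forall>(U', g')\<in>atlas (parabolic_tensor E E'). \<forall>p\<in>U \<inter> U'.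
        hmat X p (\<lambda>q. g' q ** matrix_inv (g q))"
    unfolding atlas_tensor
    using triv_transition[OF RS V(1)] triv_transition[OF RS V(2)]
      eventually_triv_invertible[OF V(1)] eventually_triv_invertible[OF V(2)]
    by (auto intro!: hmat_tensor_transition)
qed

lemma vector_bundle_dual:
  assumes V: "vector_bundle X S (atlas E)"
  shows "vector_bundle X S (atlas (parabolic_dual X E))"
  unfolding vector_bundle_iff[OF RS]
proof (intro conjI)
  show "(\<Union>(U, g)\<in>atlas (parabolic_dual X E). U) = S"
    using triv_in[OF RS V] triv_ex[OF RS V] by (fastforce simp: atlas_dual)
  show "\<forall>(U, g)\<in>atlas (parabolic_dual X E). open U \<and> (\<forall>p\<in>U. invertible (g p))"
    unfolding atlas_dual using triv_open[OF RS V] triv_invertible[OF RS V] by (auto intro: dual_mat_works(1))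
  show "\<forall>(U, g)\<in>atlas (parabolic_dual X E). \<forall>(U', g')\<in>atlas (parabolic_dual X E). \<forall>p\<in>U \<inter> U'.
        hmat X p (\<lambda>q. g' q ** matrix_inv (g q))"
    unfolding atlas_dual using triv_transition[OF RS V] eventually_triv_invertible[OF V]
    by (auto intro!: hmat_dual_transition)
qed

lemma compat_tensor:
  assumes "compat X (atlas E) p \<gamma>" "compat X (atlas E') p \<gamma>'"
    and V: "vector_bundle X S (atlas E)" "vector_bundle X S (atlas E')"
  shows "compat X (atlas (parabolic_tensor E E')) p (\<lambda>q. tensor_mat (\<gamma> q) (\<gamma>' q))"
proof -
  obtain U g U' g' where *: "(U, g) \<in> atlas E" "p \<in> U" "(U', g') \<in> atlas E'" "p \<in> U'"
    using assms(1,2) by (auto simp: compat_def)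
  have i: "\<forall>\<^sub>F q in nhds p. invertible (\<gamma> q)" "\<forall>\<^sub>F q in nhds p. invertible (\<gamma>' q)"
    "\<forall>\<^sub>F q in nhds p. invertible (g q)" "\<forall>\<^sub>F q in nhds p. invertible (g' q)"
    using assms(1,2) eventually_triv[OF RS V(1) *(1,2)] eventually_triv[OF RS V(2) *(3,4)]
    by (auto simp: compat_def elim: eventually_mono)
  have "(U \<inter> U', \<lambda>p. tensor_mat (g p) (g' p)) \<in> atlas (parabolic_tensor E E')"
    using * by (auto simp: atlas_tensor)
  moreover have "p \<in> U \<inter> U'" using * by simp
  moreover have "\<forall>\<^sub>F q in nhds p. invertible (tensor_mat (\<gamma> q) (\<gamma>' q))"
    using i(1,2) by eventually_elim (rule tensor_mat_inv(2))
  moreover have "hmat X p (\<lambda>q. tensor_mat (\<gamma> q) (\<gamma>' q) ** matrix_inv (tensor_mat (g q) (g' q)))"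
    by (rule hmat_tensor_transition[OF compat_triv(1)[OF RS V(1) assms(1) *(1,2)]
          compat_triv(1)[OF RS V(2) assms(2) *(3,4)] i(3,4)])
  moreover have "hmat X p (\<lambda>q. tensor_mat (g q) (g' q) ** matrix_inv (tensor_mat (\<gamma> q) (\<gamma>' q)))"
    by (rule hmat_tensor_transition[OF compat_triv(2)[OF RS V(1) assms(1) *(1,2)]
          compat_triv(2)[OF RS V(2) assms(2) *(3,4)] i(1,2)])
  ultimately show ?thesis by (rule compatI)
qed

lemma compat_dual:
  assumes "compat X (atlas E) p \<gamma>" and V: "vector_bundle X S (atlas E)"
  shows "compat X (atlas (parabolic_dual X E)) p (\<lambda>q. dual_mat (\<gamma> q))"
proof -
  obtain U g where *: "(U, g) \<in> atlas E" "p \<in> U"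
    using assms(1) by (auto simp: compat_def)
  have i: "\<forall>\<^sub>F q in nhds p. invertible (\<gamma> q)" "\<forall>\<^sub>F q in nhds p. invertible (g q)"
    using assms(1) eventually_triv[OF RS V *] by (auto simp: compat_def elim: eventually_mono)
  have "(U, \<lambda>p. dual_mat (g p)) \<in> atlas (parabolic_dual X E)"
    using * by (auto simp: atlas_dual)
  moreover note *(2)
  moreover have "\<forall>\<^sub>F q in nhds p. invertible (dual_mat (\<gamma> q))"
    using i(1) by eventually_elim (rule dual_mat_works(1))
  moreover have "hmat X p (\<lambda>q. dual_mat (\<gamma> q) ** matrix_inv (dual_mat (g q)))"
    by (rule hmat_dual_transition[OF compat_triv(2)[OF RS V assms(1) *] i(2)])
  moreover have "hmat X p (\<lambda>q. dual_mat (g q) ** matrix_inv (dual_mat (\<gamma> q)))"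
    by (rule hmat_dual_transition[OF compat_triv(1)[OF RS V assms(1) *] i(1)])
  ultimately show ?thesis by (rule compatI)
qed

text \<open>In a product of germs the order bounds add, and subadditivity of the ceiling gives one
  inclusion. For the other, expansion in the product frame writes a germ as a finite sum of pure
  tensors with suitable parameters.\<close>

lemma splits_tensor:
  fixes E :: "('x, 'r::finite) filtered_bundle" and E' :: "('x, 's::finite) filtered_bundle"
  assumes sp: "splits X E x \<gamma> \<alpha>" "splits X E' x \<gamma>' \<alpha>'"
    and V: "vector_bundle X S (atlas E)" "vector_bundle X S (atlas E')"
  shows "splits X (parabolic_tensor E E') x (\<lambda>p. tensor_mat (\<gamma> p) (\<gamma>' p)) (\<lambda>ij. \<alpha> (fst ij) + \<alpha>' (snd ij))"
  unfolding splits_def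
proof (intro conjI allI)
  have "\<forall>\<^sub>F p in at x. compat X (atlas E) p \<gamma>" "\<forall>\<^sub>F p in at x. compat X (atlas E') p \<gamma>'"
    using sp by (auto simp: splits_def)
  then show "\<forall>\<^sub>F p in at x. compat X (atlas (parabolic_tensor E E')) p (\<lambda>q. tensor_mat (\<gamma> q) (\<gamma>' q))"
    by eventually_elim (rule compat_tensor[OF _ _ V])
next
  fix t s
  let ?c = "\<lambda>ij p. (tensor_mat (\<gamma> p) (\<gamma>' p) *v s p) $ ij"
  show "s \<in> germs (parabolic_tensor E E') x t \<longleftrightarrow>
      (\<forall>ij. ord_ge X x \<lceil>t - (\<alpha> (fst ij) + \<alpha>' (snd ij))\<rceil> (?c ij))" (is "_ \<longleftrightarrow> ?R")
  proof
    assume "s \<in> germs (parabolic_tensor E E') x t"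
    then obtain N :: nat and a u v where "\<forall>k<N. u k \<in> germs E x (a k) \<and> v k \<in> germs E' x (t - a k)"
      "\<forall>\<^sub>F p in at x. s p = (\<Sum>k<N. tensor_vec (u k p) (v k p))"
      unfolding parabolic_tensor_def by auto
    then have *: "\<And>k. k < N \<Longrightarrow> u k \<in> germs E x (a k)" "\<And>k. k < N \<Longrightarrow> v k \<in> germs E' x (t - a k)"
      "\<forall>\<^sub>F p in at x. s p = (\<Sum>k<N. tensor_vec (u k p) (v k p))" by blast+
    show ?R
    proof
      fix ij :: "'r \<times> 's"
      obtain i j where ij: "ij = (i, j)" by force
      have "ord_ge X x \<lceil>t - (\<alpha> i + \<alpha>' j)\<rceil> (\<lambda>p. \<Sum>k<N. (\<gamma> p *v u k p) $ i * (\<gamma>' p *v v k p) $ j)"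
      proof (rule ord_ge_sum[OF RS])
        fix k assume "k \<in> {..<N}"
        then have "ord_ge X x (\<lceil>a k - \<alpha> i\<rceil> + \<lceil>t - a k - \<alpha>' j\<rceil>) (\<lambda>p. (\<gamma> p *v u k p) $ i * (\<gamma>' p *v v k p) $ j)"
          using *(1)[of k, unfolded germs_splits[OF RS sp(1)]] *(2)[of k, unfolded germs_splits[OF RS sp(2)]]
          by (intro ord_ge_mult[OF RS]) auto
        then show "ord_ge X x \<lceil>t - (\<alpha> i + \<alpha>' j)\<rceil> (\<lambda>p. (\<gamma> p *v u k p) $ i * (\<gamma>' p *v v k p) $ j)"
          by (rule ord_ge_mono[OF RS]) linarith
      qed
      moreover have "\<forall>\<^sub>F p in at x. (\<Sum>k<N. (\<gamma> p *v u k p) $ i * (\<gamma>' p *v v k p) $ j) = ?c ij p"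
        using *(3)
        by eventually_elim (simp add: matrix_vector_sum tensor_mat_vec ij, simp add: tensor_vec_def)
      ultimately show "ord_ge X x \<lceil>t - (\<alpha> (fst ij) + \<alpha>' (snd ij))\<rceil> (?c ij)"
        unfolding ij fst_conv snd_conv by (rule ord_ge_transfer)
    qed
  next
    assume R: ?R
    obtain b :: "nat \<Rightarrow> 'r \<times> 's" where
      b: "\<And>F :: 'r \<times> 's \<Rightarrow> complex ^ ('r \<times> 's). (\<Sum>i\<in>UNIV. F i) = (\<Sum>k<CARD('r \<times> 's). F (b k))"
      using sum_nat_enum by blast
    \<comment> \<open>The whole coefficient is put on the first factor, which gets parameter
      \<open>t - \<alpha>' j\<close>; the second factor is the bare frame vector of parameter
      \<open>\<alpha>' j\<close>.\<close>
    define u where "u k p = ?c (b k) p *s (matrix_inv (\<gamma> p) *v axis (fst (b k)) 1)" for k p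
    define v where "v k p = 1 *s (matrix_inv (\<gamma>' p) *v axis (snd (b k)) 1)" for k p
    have "u k \<in> germs E x (t - \<alpha>' (snd (b k)))" for k
      unfolding u_def[abs_def]
      by (rule frame_germ[OF RS sp(1)]) (use R[rule_format, of "b k"] in \<open>simp add: diff_diff_eq add.commute\<close>)
    moreover have "v k \<in> germs E' x (t - (t - \<alpha>' (snd (b k))))" for k
      unfolding v_def[abs_def]
      by (rule frame_germ[OF RS sp(2)]) (use ord_ge_holo_germ[OF RS holo_germ_const[OF RS]] in simp)
    moreover have "\<forall>\<^sub>F p in at x. s p = (\<Sum>k<CARD('r \<times> 's). tensor_vec (u k p) (v k p))"
      using splits_invertible[OF RS sp(1)] splits_invertible[OF RS sp(2)]
    proof eventually_elim
      case (elim p)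
      note inv = tensor_mat_inv[OF elim]
      have "s p = matrix_inv (tensor_mat (\<gamma> p) (\<gamma>' p)) *v (tensor_mat (\<gamma> p) (\<gamma>' p) *v s p)"
        using inv(2) by simp
      also have "\<dots> = tensor_mat (matrix_inv (\<gamma> p)) (matrix_inv (\<gamma>' p)) *v (\<Sum>ij\<in>UNIV. ?c ij p *s axis ij 1)"
        unfolding inv(1) by (subst vec_eq_sum_axis) simp
      also have "(\<Sum>ij\<in>UNIV. ?c ij p *s axis ij 1) = (\<Sum>k<CARD('r \<times> 's). ?c (b k) p *s axis (b k) 1)"
        by (rule b)
      also have "tensor_mat (matrix_inv (\<gamma> p)) (matrix_inv (\<gamma>' p)) *v \<dots> = (\<Sum>k<CARD('r \<times> 's). tensor_vec (u k p) (v k p))"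
        unfolding matrix_vector_sum
      proof (rule sum.cong[OF refl])
        fix k
        have "axis (b k) 1 = tensor_vec (axis (fst (b k)) 1) (axis (snd (b k)) 1)"
          by (simp add: tensor_vec_axis)
        then show "tensor_mat (matrix_inv (\<gamma> p)) (matrix_inv (\<gamma>' p)) *v (?c (b k) p *s axis (b k) 1)
            = tensor_vec (u k p) (v k p)"
          by (simp add: u_def v_def tensor_vec_scale vector_scalar_commute tensor_mat_vec)
      qed
      finally show ?case .
    qed
    ultimately have "\<exists>(N::nat) a u v.
         (\<forall>k<N. u k \<in> germs E x (a k) \<and> v k \<in> germs E' x (t - a k)) \<and>
         (\<forall>\<^sub>F p in at x. s p = (\<Sum>k<N. tensor_vec (u k p) (v k p)))"
      by (intro exI[of _ "CARD('r \<times> 's)"] exI[of _ "\<lambda>k. t - \<alpha>' (snd (b k))"] exI[of _ u] exI[of _ v]) auto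
    then show "s \<in> germs (parabolic_tensor E E') x t"
      unfolding parabolic_tensor_def by simp
  qed
qed

lemma germs_dual: "\<xi> \<in> germs (parabolic_dual X E) x t \<longleftrightarrow>
    (\<exists>W. open W \<and> x \<in> W \<and> holo_section X (atlas (parabolic_dual X E)) (W - {x}) \<xi>) \<and>
    (\<forall>a. \<forall>s\<in>germs E x a. ord_ge X x \<lceil>a + t\<rceil> (\<lambda>p. pairing (\<xi> p) (s p)))"
  unfolding parabolic_dual_def Let_def ord_ge_def by simp

text \<open>Testing a functional on the frame vectors, the i-th of which has parameter
  \<open>\<alpha> i\<close>, bounds its coordinates. Conversely the pairing is the sum of the
  products of coordinates, where \<open>\<alpha> i\<close> and \<open>- \<alpha> i\<close>
  cancel.\<close>

lemma splits_dual:
  fixes E :: "('x, 'r::finite) filtered_bundle"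
  assumes sp: "splits X E x \<gamma> \<alpha>" and V: "vector_bundle X S (atlas E)"
  shows "splits X (parabolic_dual X E) x (\<lambda>p. dual_mat (\<gamma> p)) (\<lambda>i. - \<alpha> i)"
  unfolding splits_def
proof (intro conjI allI)
  have "\<forall>\<^sub>F p in at x. compat X (atlas E) p \<gamma>" using sp by (auto simp: splits_def)
  then show comp: "\<forall>\<^sub>F p in at x. compat X (atlas (parabolic_dual X E)) p (\<lambda>q. dual_mat (\<gamma> q))"
    by eventually_elim (rule compat_dual[OF _ V])
  fix t \<xi>
  let ?c = "\<lambda>i p. (dual_mat (\<gamma> p) *v \<xi> p) $ i"
  show "\<xi> \<in> germs (parabolic_dual X E) x t \<longleftrightarrow> (\<forall>i. ord_ge X x \<lceil>t - - \<alpha> i\<rceil> (?c i))" (is "_ \<longleftrightarrow> ?R")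
  proof
    assume *: "\<xi> \<in> germs (parabolic_dual X E) x t"
    show ?R
    proof
      fix i
      have "(\<lambda>p. 1 *s (matrix_inv (\<gamma> p) *v axis i 1)) \<in> germs E x (\<alpha> i)"
        by (rule frame_germ[OF RS sp]) (use ord_ge_holo_germ[OF RS holo_germ_const[OF RS]] in simp)
      then have "ord_ge X x \<lceil>\<alpha> i + t\<rceil> (\<lambda>p. pairing (\<xi> p) (1 *s (matrix_inv (\<gamma> p) *v axis i 1)))"
        using *[unfolded germs_dual, THEN conjunct2, rule_format] by simp
      moreover have "\<forall>\<^sub>F p in at x. pairing (\<xi> p) (1 *s (matrix_inv (\<gamma> p) *v axis i 1)) = ?c i p"
        using splits_invertible[OF RS sp]
      proof eventually_elim
        case (elim p)
        show ?case by (subst pairing_dual[OF elim]) (simp add: elim pairing_axis)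
      qed
      ultimately have "ord_ge X x \<lceil>\<alpha> i + t\<rceil> (?c i)" by (rule ord_ge_transfer)
      then show "ord_ge X x \<lceil>t - - \<alpha> i\<rceil> (?c i)" by (simp add: add.commute)
    qed
  next
    assume R: ?R
    have "\<forall>\<^sub>F p in at x. holo_germ X p (?c i)" for i
      by (rule ord_ge_eventually_holo_germ[OF RS R[rule_format]])
    then have "\<forall>\<^sub>F p in at x. hvec X p (\<lambda>p. dual_mat (\<gamma> p) *v \<xi> p)"
      by (simp add: hvec_def eventually_all_finite)
    with comp have "\<forall>\<^sub>F p in at x. sgerm X (atlas (parabolic_dual X E)) p \<xi>"
    proof eventually_elim
      case (elim p)
      then show ?case using compat_sgerm[OF RS vector_bundle_dual[OF V] elim(1), of \<xi>] by blast
    qed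
    then obtain W where W: "open W" "x \<in> W" "\<And>p. p \<in> W \<Longrightarrow> p \<noteq> x \<Longrightarrow> sgerm X (atlas (parabolic_dual X E)) p \<xi>"
      unfolding eventually_at_topological by blast
    \<comment> \<open>Holomorphy on a punctured neighbourhood, a separate clause in the definition
      of the dual, is contained in the order bounds.\<close>
    have "holo_section X (atlas (parabolic_dual X E)) (W - {x}) \<xi>"
      unfolding section_iff[OF RS vector_bundle_dual[OF V]] using W by (auto simp: open_delete)
    moreover have "ord_ge X x \<lceil>a + t\<rceil> (\<lambda>p. pairing (\<xi> p) (s p))" if "s \<in> germs E x a" for a s
    proof -
      have "ord_ge X x \<lceil>a + t\<rceil> (\<lambda>p. \<Sum>i\<in>UNIV. ?c i p * (\<gamma> p *v s p) $ i)"
      proof (rule ord_ge_sum[OF RS])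
        fix i
        have "ord_ge X x (\<lceil>t - - \<alpha> i\<rceil> + \<lceil>a - \<alpha> i\<rceil>) (\<lambda>p. ?c i p * (\<gamma> p *v s p) $ i)"
          using R that[unfolded germs_splits[OF RS sp]] by (intro ord_ge_mult[OF RS]) auto
        then show "ord_ge X x \<lceil>a + t\<rceil> (\<lambda>p. ?c i p * (\<gamma> p *v s p) $ i)"
          by (rule ord_ge_mono[OF RS]) linarith
      qed
      then show ?thesis
      proof (rule ord_ge_transfer)
        show "\<forall>\<^sub>F p in at x. (\<Sum>i\<in>UNIV. ?c i p * (\<gamma> p *v s p) $ i) = pairing (\<xi> p) (s p)"
          using splits_invertible[OF RS sp]
        proof eventually_elim
          case (elim p)
          show ?case by (subst pairing_dual[OF elim]) (simp add: pairing_def)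
        qed
      qed
    qed
    ultimately show "\<xi> \<in> germs (parabolic_dual X E) x t"
      unfolding germs_dual using W by blast
  qed
qed

end

section \<open>Pulled back bundles and their modules\<close>

context covering
begin

lemma atlas_pullback: "atlas (pullback_bundle Y X f E) = {(f -` U, g \<circ> f) | U g. (U, g) \<in> atlas E}"
  by (simp add: pullback_bundle_def)

lemma hmat_pull: "hmat X (f y) M \<Longrightarrow> hmat Y y (\<lambda>q. M (f q))"
  unfolding hmat_def using holo_germ_pull by (auto simp: o_def)

lemma hvec_pull: "hvec X (f y) v \<Longrightarrow> hvec Y y (\<lambda>q. v (f q))"
  unfolding hvec_def using holo_germ_pull by (auto simp: o_def)

lemma vector_bundle_pullback:
  assumes V: "vector_bundle X S (atlas E)"
  shows "vector_bundle Y (f -` S) (atlas (pullback_bundle Y X f E))"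
  unfolding vector_bundle_iff[OF RY]
proof (intro conjI)
  have cont: "open U \<Longrightarrow> open (f -` U)" for U
    using holo_f unfolding holo_map_def by (auto simp: continuous_on_open_vimage)
  show "(\<Union>(U, g)\<in>atlas (pullback_bundle Y X f E). U) = f -` S"
  proof (intro equalityI subsetI)
    fix y assume "y \<in> (\<Union>(U, g)\<in>atlas (pullback_bundle Y X f E). U)"
    then show "y \<in> f -` S" using triv_in[OF RX V] by (auto simp: atlas_pullback)
  next
    fix y assume "y \<in> f -` S"
    then have "f y \<in> S" by simp
    then obtain U g where "(U, g) \<in> atlas E" "f y \<in> U" using triv_ex[OF RX V] by blast
    then show "y \<in> (\<Union>(U, g)\<in>atlas (pullback_bundle Y X f E). U)"
      unfolding atlas_pullback by blast
  qed
  show "\<forall>(U, g)\<in>atlas (pullback_bundle Y X f E). open U \<and> (\<forall>p\<in>U. invertible (g p))"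
    unfolding atlas_pullback using triv_open[OF RX V] triv_invertible[OF RX V] cont by auto
  show "\<forall>(U, g)\<in>atlas (pullback_bundle Y X f E). \<forall>(U', g')\<in>atlas (pullback_bundle Y X f E). \<forall>p\<in>U \<inter> U'.
        hmat Y p (\<lambda>q. g' q ** matrix_inv (g q))"
    unfolding atlas_pullback
  proof (clarsimp)
    fix U g U' g' p assume "(U, g) \<in> atlas E" "(U', g') \<in> atlas E" "f p \<in> U" "f p \<in> U'"
    then show "hmat Y p (\<lambda>q. g' (f q) ** matrix_inv (g (f q)))"
      using hmat_pull[OF triv_transition[OF RX V]] by blast
  qed
qed

lemma compat_pullback:
  assumes "compat X (atlas E) (f y) \<gamma>"
  shows "compat Y (atlas (pullback_bundle Y X f E)) y (\<lambda>q. \<gamma> (f q))"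
proof -
  obtain U g where *: "(U, g) \<in> atlas E" "f y \<in> U" "hmat X (f y) (\<lambda>q. \<gamma> q ** matrix_inv (g q))"
    "hmat X (f y) (\<lambda>q. g q ** matrix_inv (\<gamma> q))" "\<forall>\<^sub>F q in nhds (f y). invertible (\<gamma> q)"
    using assms by (auto simp: compat_def)
  show ?thesis
  proof (rule compatI)
    show "(f -` U, \<lambda>q. g (f q)) \<in> atlas (pullback_bundle Y X f E)"
      using * by (auto simp: atlas_pullback o_def)
  qed (use eventually_nhds_f[OF *(5)] hmat_pull[OF *(3)] hmat_pull[OF *(4)] * in simp_all)
qed

lemma germs_pullback: "s \<in> germs (pullback_bundle Y X f E) y b \<longleftrightarrow> (\<exists>(N::nat) h k t u.
         (\<forall>i<N. holo_germ Y y (h i) \<and> u i \<in> germs E (f y) (t i) \<and>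
            b \<le> of_int (mult y) * t i + of_int (k i)) \<and>
         (\<forall>\<^sub>F p in at y. s p = (\<Sum>i<N. (h i p * coord Y y p powi k i) *s u i (f p))))"
  by (simp add: pullback_bundle_def)

text \<open>Pulling back multiplies the orders of coordinates by m = \<open>mult y\<close>, and m
  \<lceil>a\<rceil> is at least \<lceil>m a\<rceil>; this handles the generators. Conversely a germ
  with the stated orders is a combination of the pulled back frame vectors, which are generators
  with \<open>t = \<alpha> i\<close>.\<close>

lemma splits_pullback:
  fixes E :: "('x, 'r::finite) filtered_bundle"
  assumes sp: "splits X E (f y) \<gamma> \<alpha>"
  shows "splits Y (pullback_bundle Y X f E) y (\<lambda>q. \<gamma> (f q)) (\<lambda>i. of_int (mult y) * \<alpha> i)"
  unfolding splits_def
proof (intro conjI allI)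
  have "\<forall>\<^sub>F p in at (f y). compat X (atlas E) p \<gamma>" using sp by (auto simp: splits_def)
  from eventually_at_f[OF this]
  show "\<forall>\<^sub>F q in at y. compat Y (atlas (pullback_bundle Y X f E)) q (\<lambda>q. \<gamma> (f q))"
    by eventually_elim (rule compat_pullback)
  fix b s
  let ?c = "\<lambda>j q. (\<gamma> (f q) *v s q) $ j" and ?m = "of_int (mult y) :: real"
  show "s \<in> germs (pullback_bundle Y X f E) y b \<longleftrightarrow> (\<forall>j. ord_ge Y y \<lceil>b - ?m * \<alpha> j\<rceil> (?c j))" (is "_ \<longleftrightarrow> ?R")
  proof
    assume "s \<in> germs (pullback_bundle Y X f E) y b"
    then obtain N :: nat and h k t u where *: "\<And>i. i < N \<Longrightarrow> holo_germ Y y (h i)"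
      "\<And>i. i < N \<Longrightarrow> u i \<in> germs E (f y) (t i)" "\<And>i. i < N \<Longrightarrow> b \<le> ?m * t i + of_int (k i)"
      "\<forall>\<^sub>F p in at y. s p = (\<Sum>i<N. (h i p * coord Y y p powi k i) *s u i (f p))"
      unfolding germs_pullback by blast
    show ?R
    proof
      fix j
      have "ord_ge Y y \<lceil>b - ?m * \<alpha> j\<rceil> (\<lambda>q. \<Sum>i<N. (h i q * coord Y y q powi k i) * (\<gamma> (f q) *v u i (f q)) $ j)"
      proof (rule ord_ge_sum[OF RY])
        fix i assume i: "i \<in> {..<N}"
        then have "ord_ge X (f y) \<lceil>t i - \<alpha> j\<rceil> (\<lambda>p. (\<gamma> p *v u i p) $ j)"
          using *(2)[of i] unfolding germs_splits[OF RX sp] by auto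
        then have "ord_ge Y y (mult y * \<lceil>t i - \<alpha> j\<rceil>) (\<lambda>q. (\<gamma> (f q) *v u i (f q)) $ j)"
          using ord_ge_pull by (fastforce simp: o_def)
        then have o: "ord_ge Y y ((0 + k i) + mult y * \<lceil>t i - \<alpha> j\<rceil>)
            (\<lambda>q. (h i q * coord Y y q powi k i) * (\<gamma> (f q) *v u i (f q)) $ j)"
          using *(1) i by (intro ord_ge_mult ord_ge_holo_germ ord_ge_coord RY) auto
        have "?m * (t i - \<alpha> j) \<le> ?m * of_int \<lceil>t i - \<alpha> j\<rceil>"
          using mult_pos[of y] by (intro mult_left_mono) auto
        then have "b - ?m * \<alpha> j \<le> of_int ((0 + k i) + mult y * \<lceil>t i - \<alpha> j\<rceil>)"
          using *(3)[of i] i by (simp add: algebra_simps)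
        then have "\<lceil>b - ?m * \<alpha> j\<rceil> \<le> (0 + k i) + mult y * \<lceil>t i - \<alpha> j\<rceil>" by linarith
        with o show "ord_ge Y y \<lceil>b - ?m * \<alpha> j\<rceil> (\<lambda>q. (h i q * coord Y y q powi k i) * (\<gamma> (f q) *v u i (f q)) $ j)"
          by (rule ord_ge_mono[OF RY])
      qed
      then show "ord_ge Y y \<lceil>b - ?m * \<alpha> j\<rceil> (?c j)"
      proof (rule ord_ge_transfer)
        show "\<forall>\<^sub>F q in at y. (\<Sum>i<N. (h i q * coord Y y q powi k i) * (\<gamma> (f q) *v u i (f q)) $ j) = ?c j q"
          using *(4) by eventually_elim (simp add: matrix_vector_sum vector_scalar_commute)
      qed
    qed
  next
    assume R: ?R
    then have "\<forall>j. \<exists>h. holo_germ Y y h \<and> (\<forall>\<^sub>F q in at y. ?c j q = coord Y y q powi \<lceil>b - ?m * \<alpha> j\<rceil> * h q)"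
      unfolding ord_ge_def by blast
    from choice[OF this] obtain h where h: "\<And>j. holo_germ Y y (h j)"
      "\<And>j. \<forall>\<^sub>F q in at y. ?c j q = coord Y y q powi \<lceil>b - ?m * \<alpha> j\<rceil> * h j q" by blast
    have h2: "\<forall>\<^sub>F q in at y. \<forall>j. ?c j q = coord Y y q powi \<lceil>b - ?m * \<alpha> j\<rceil> * h j q"
      using h(2) by (simp add: eventually_all_finite)
    obtain e :: "nat \<Rightarrow> 'r" where
      e: "\<And>F :: 'r \<Rightarrow> complex ^ 'r. (\<Sum>i\<in>UNIV. F i) = (\<Sum>k<CARD('r). F (e k))"
      using sum_nat_enum by blast
    define u where "u k p = 1 *s (matrix_inv (\<gamma> p) *v axis (e k) 1)" for k p
    have "u k \<in> germs E (f y) (\<alpha> (e k))" for k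
      unfolding u_def[abs_def]
      by (rule frame_germ[OF RX sp]) (use ord_ge_holo_germ[OF RX holo_germ_const[OF RX]] in simp)
    \<comment> \<open>The exponent is the least integer that the generator condition allows for this
      frame vector.\<close>
    moreover have "b \<le> ?m * \<alpha> (e k) + of_int \<lceil>b - ?m * \<alpha> (e k)\<rceil>" for k by linarith
    moreover have "\<forall>\<^sub>F q in at y. s q = (\<Sum>k<CARD('r). (h (e k) q * coord Y y q powi \<lceil>b - ?m * \<alpha> (e k)\<rceil>) *s u k (f q))"
      using h2 eventually_at_f[OF splits_invertible[OF RX sp]]
    proof eventually_elim
      case (elim q)
      have "s q = matrix_inv (\<gamma> (f q)) *v (\<gamma> (f q) *v s q)"
        using elim(2) by simp
      also have "\<dots> = matrix_inv (\<gamma> (f q)) *v (\<Sum>j\<in>UNIV. ?c j q *s axis j 1)"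
        by (subst vec_eq_sum_axis) simp
      also have "\<dots> = (\<Sum>k<CARD('r). ?c (e k) q *s (matrix_inv (\<gamma> (f q)) *v axis (e k) 1))"
        unfolding e by (simp add: matrix_vector_sum vector_scalar_commute)
      also have "\<dots> = (\<Sum>k<CARD('r). (h (e k) q * coord Y y q powi \<lceil>b - ?m * \<alpha> (e k)\<rceil>) *s u k (f q))"
        using elim(1) by (intro sum.cong) (auto simp: u_def mult.commute)
      finally show ?case .
    qed
    ultimately show "s \<in> germs (pullback_bundle Y X f E) y b"
      unfolding germs_pullback using h(1)
      by (intro exI[of _ "CARD('r)"] exI[of _ "\<lambda>k. h (e k)"] exI[of _ "\<lambda>k. \<lceil>b - ?m * \<alpha> (e k)\<rceil>"]
          exI[of _ "\<lambda>k. \<alpha> (e k)"] exI[of _ u]) auto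
  qed
qed

end

section \<open>Split filtrations and flagged bundles\<close>

text \<open>Basis vectors are added from the zero end of the flag upwards, so that each
  \<open>F l\<close> is spanned by the basis vectors it contains; \<open>m\<close> counts the steps
  already treated.\<close>

lemma flag_adapted_basis:
  fixes F :: "nat \<Rightarrow> (complex ^ 'r::finite) set"
  assumes sub: "\<And>j. j \<in> {1..n + 1} \<Longrightarrow> vec.subspace (F j)"
    and dec: "\<And>j. j \<in> {1..n} \<Longrightarrow> F (j + 1) \<subseteq> F j"
    and last: "F (n + 1) = {0}" and m: "m \<le> n"
  shows "\<exists>B. vec.independent B \<and> B \<subseteq> F (n + 1 - m) \<and>
    (\<forall>l\<in>{n + 1 - m..n + 1}. F l \<subseteq> vec.span (B \<inter> F l))"
  using m
proof (induction m)
  case 0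
  show ?case using last by (intro exI[of _ "{}"]) (auto simp: vec.independent_empty)
next
  case (Suc m)
  define k where "k = n + 1 - Suc m"
  have k: "n + 1 - m = k + 1" "k \<in> {1..n}" using Suc.prems by (auto simp: k_def)
  obtain B where B: "vec.independent B" "B \<subseteq> F (k + 1)"
    "\<And>l. l \<in> {k + 1..n + 1} \<Longrightarrow> F l \<subseteq> vec.span (B \<inter> F l)"
    using Suc.IH Suc.prems unfolding k by auto
  have "B \<subseteq> F k" using B(2) dec[OF k(2)] by blast
  from vec.maximal_independent_subset_extend[OF this B(1)]
  obtain C where C: "B \<subseteq> C" "C \<subseteq> F k" "vec.independent C" "F k \<subseteq> vec.span C" by metis
  have "F l \<subseteq> vec.span (C \<inter> F l)" if l: "l \<in> {k..n + 1}" for l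
  proof (cases "l = k")
    case True
    then show ?thesis using C(2,4) by (simp add: Int_absorb2)
  next
    case False
    then have "F l \<subseteq> vec.span (B \<inter> F l)" using B(3) l by simp
    then show ?thesis using vec.span_mono[of "B \<inter> F l" "C \<inter> F l"] C(1) by blast
  qed
  then show ?case using C unfolding k_def by blast
qed

text \<open>\<open>A\<close> takes coordinates in a basis adapted to the flag, and
  \<open>lev i\<close> is the last step containing the i-th basis vector. A vector lies in
  \<open>F k\<close> iff only basis vectors of level at least \<open>k\<close> occur in its
  expansion.\<close>

lemma flag_coordinates:
  fixes F :: "nat \<Rightarrow> (complex ^ 'r::finite) set"
  assumes sub: "\<And>j. j \<in> {1..n + 1} \<Longrightarrow> vec.subspace (F j)"
    and dec: "\<And>j. j \<in> {1..n} \<Longrightarrow> F (j + 1) \<subseteq> F j"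
    and first: "F 1 = UNIV" and last: "F (n + 1) = {0}"
  shows "\<exists>(A :: complex ^ 'r ^ 'r) lev. invertible A \<and> (\<forall>i. lev i \<in> {1..n}) \<and>
    (\<forall>k\<in>{1..n + 1}. \<forall>v. v \<in> F k \<longleftrightarrow> (\<forall>i. lev i < k \<longrightarrow> (A *v v) $ i = 0))"
proof -
  obtain B where B: "vec.independent B" "\<And>l. l \<in> {1..n + 1} \<Longrightarrow> F l \<subseteq> vec.span (B \<inter> F l)"
    using flag_adapted_basis[OF sub dec last, of n] by auto
  have "vec.span B = UNIV"
    using B(2)[of 1] first by auto
  then have "card B = CARD('r)"
    using vec.dim_eq_card_independent[OF B(1)] vec.dim_span[of B] by (simp add: vec.dim_UNIV card_cart_basis)
  moreover have "finite B" using vec.finiteI_independent[OF B(1)] .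
  ultimately obtain e :: "'r \<Rightarrow> complex ^ 'r" where e: "bij_betw e UNIV B"
    using finite_same_card_bij[of "UNIV :: 'r set" B] by auto
  define M :: "complex ^ 'r ^ 'r" where "M = (\<chi> i j. e j $ i)"
  have M: "M *v v = (\<Sum>i\<in>UNIV. v $ i *s e i)" for v
    by (simp add: M_def vec_eq_iff matrix_vector_mult_def mult.commute)
  have "\<exists>A. A ** M = mat 1"
    unfolding matrix_left_invertible_ker
  proof (intro allI impI)
    fix v assume "M *v v = 0"
    then have "(\<Sum>b\<in>B. v $ (inv_into UNIV e b) *s b) = 0"
      unfolding M using e by (subst sum.reindex_bij_betw[OF e, symmetric])
        (simp add: bij_betw_def inv_into_f_f)
    then have "\<forall>b\<in>B. v $ (inv_into UNIV e b) = 0"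
      using vec.independentD[OF B(1) \<open>finite B\<close> subset_refl, of "\<lambda>b. v $ inv_into UNIV e b"] by simp
    then show "v = 0" using e unfolding vec_eq_iff bij_betw_def
      by (metis inv_into_f_f iso_tuple_UNIV_I rangeI zero_index)
  qed
  then obtain A where A: "A ** M = mat 1" by blast
  then have A': "M ** A = mat 1" using matrix_left_right_inverse by blast
  have Ae: "A *v e i = axis i 1" for i
  proof -
    have "e i = M *v axis i 1" unfolding M by (simp add: axis_def if_distrib if_distribR cong: if_cong)
    then show ?thesis using A by (simp add: matrix_vector_mul_assoc)
  qed
  have nz: "e i \<noteq> 0" for i using Ae[of i] by (metis axis_eq_0_iff matrix_vector_mult_0_right zero_neq_one)
  have mono: "F k \<subseteq> F l" if "1 \<le> l" "l \<le> k" "k \<le> n + 1" for k l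
    using that(2,3)
  proof (induction k rule: dec_induct)
    case (step j)
    then show ?case using dec[of j] that(1) by auto
  qed simp
  define lev where "lev i = Max {k\<in>{1..n}. e i \<in> F k}" for i
  \<comment> \<open>Otherwise \<open>F 1\<close> would be both the whole space and zero. So the
    maximum defining \<open>lev\<close> is taken over a set that contains 1.\<close>
  have n: "n \<ge> 1"
  proof (rule ccontr)
    assume "\<not> n \<ge> 1"
    then have "n = 0" by simp
    then have "e undefined \<in> {0}" using first last by auto
    then show False using nz by blast
  qed
  have S: "finite {k\<in>{1..n}. e i \<in> F k}" "{k\<in>{1..n}. e i \<in> F k} \<noteq> {}" for i
    using first n by auto
  have lev: "lev i \<in> {1..n}" "e i \<in> F (lev i)" for i
    using Max_in[OF S[of i]] by (auto simp: lev_def)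
  have levk: "e i \<in> F k \<longleftrightarrow> k \<le> lev i" if "k \<in> {1..n + 1}" for i k
  proof
    assume "e i \<in> F k"
    then have "k \<noteq> n + 1" using last nz by auto
    then show "k \<le> lev i" unfolding lev_def using that \<open>e i \<in> F k\<close> by (intro Max_ge) auto
  next
    assume "k \<le> lev i"
    then show "e i \<in> F k" using mono[of k "lev i"] lev[of i] that by auto
  qed
  show ?thesis
  proof (rule exI[of _ A], rule exI[of _ lev], intro conjI ballI allI)
    show "invertible A" using A A' by (auto simp: invertible_def)
    show "lev i \<in> {1..n}" for i by (rule lev)
    fix k v assume k: "k \<in> {1..n + 1}"
    show "v \<in> F k \<longleftrightarrow> (\<forall>i. lev i < k \<longrightarrow> (A *v v) $ i = 0)"
    proof
      assume "v \<in> F k"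
      then have v: "v \<in> vec.span (B \<inter> F k)" using B(2)[OF k] by blast
      have "vec.span (B \<inter> F k) \<subseteq> {v. \<forall>i. lev i < k \<longrightarrow> (A *v v) $ i = 0}"
      proof (rule vec.span_minimal)
        show "B \<inter> F k \<subseteq> {v. \<forall>i. lev i < k \<longrightarrow> (A *v v) $ i = 0}"
        proof clarify
          fix b i assume b: "b \<in> B" "b \<in> F k" "lev i < k"
          then obtain i' where "b = e i'" using e by (auto simp: bij_betw_def)
          then show "(A *v b) $ i = 0" using b levk[OF k, of i'] Ae by (auto simp: axis_def)
        qed
        show "vec.subspace {v. \<forall>i. lev i < k \<longrightarrow> (A *v v) $ i = 0}"
          by (auto simp: vec.subspace_def matrix_vector_right_distrib vector_scalar_commute)
      qed
      then show "\<forall>i. lev i < k \<longrightarrow> (A *v v) $ i = 0" using v by blast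
    next
      assume *: "\<forall>i. lev i < k \<longrightarrow> (A *v v) $ i = 0"
      have "v = M *v (A *v v)" using A' by (simp add: matrix_vector_mul_assoc)
      also have "\<dots> = (\<Sum>i\<in>UNIV. (A *v v) $ i *s e i)" by (rule M)
      also have "\<dots> \<in> F k"
      proof (rule vec.subspace_sum[OF sub[OF k]])
        fix i
        show "(A *v v) $ i *s e i \<in> F k"
        proof (cases "lev i < k")
          case True
          then show ?thesis using * vec.subspace_0[OF sub[OF k]] by simp
        next
          case False
          then show ?thesis using levk[OF k] by (intro vec.subspace_scale[OF sub[OF k]]) auto
        qed
      qed
      finally show "v \<in> F k" .
    qed
  qed
qed

text \<open>As the weights increase, the index is one more than the number of weights below
  \<open>\<tau>\<close>; it reaches \<open>steps V x + 1\<close> when all of them are.\<close>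

lemma flag_index_props:
  assumes "flagged_bundle X D V" "x \<in> D"
  shows "flag_index V x \<tau> \<in> {1..steps V x + 1}"
    "\<And>j. j \<in> {1..steps V x} \<Longrightarrow> j < flag_index V x \<tau> \<longleftrightarrow> wt V x j < \<tau>"
proof -
  let ?P = "\<lambda>j. 1 \<le> j \<and> (j \<le> steps V x \<longrightarrow> \<tau> \<le> wt V x j)"
  have P: "?P (steps V x + 1)" by simp
  have I: "?P (flag_index V x \<tau>)" unfolding flag_index_def by (rule LeastI[of ?P, OF P])
  have "flag_index V x \<tau> \<le> steps V x + 1" unfolding flag_index_def by (rule Least_le[of ?P, OF P])
  then show "flag_index V x \<tau> \<in> {1..steps V x + 1}" using I by simp
  fix j assume j: "j \<in> {1..steps V x}"
  have mono: "strict_mono_on {1..steps V x} (wt V x)"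
    using assms unfolding flagged_bundle_def by blast
  show "j < flag_index V x \<tau> \<longleftrightarrow> wt V x j < \<tau>"
  proof
    assume "j < flag_index V x \<tau>"
    then have "\<not> ?P j" unfolding flag_index_def by (rule not_less_Least)
    then show "wt V x j < \<tau>" using j by auto
  next
    assume *: "wt V x j < \<tau>"
    show "j < flag_index V x \<tau>"
    proof (rule ccontr)
      assume "\<not> j < flag_index V x \<tau>"
      then have "\<tau> \<le> wt V x (flag_index V x \<tau>)" "wt V x (flag_index V x \<tau>) \<le> wt V x j"
        using I j strict_mono_on_leD[OF mono, of "flag_index V x \<tau>" j] by auto
      then show False using * by simp
    qed
  qed
qed

section \<open>Flagged bundles in split coordinates\<close>

context
  fixes X :: "'x::t2_space chart set"
  assumes RS: "riemann_surface X"
begin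

lemma section_transfer:
  assumes V: "vector_bundle X S T" "vector_bundle X S' T'" and N: "open N" "p \<in> N" "p \<in> S"
    and eq: "\<And>W s. W \<subseteq> N \<Longrightarrow> holo_section X T W s \<Longrightarrow> holo_section X T' W s"
    and s: "sgerm X T p s"
  shows "sgerm X T' p s"
proof -
  have "\<forall>\<^sub>F q in nhds p. sgerm X T q s \<and> q \<in> N"
    using sgerm_eventually[OF RS V(1) s N(3)] eventually_nhds_in_open[OF N(1,2)] by eventually_elim simp
  then obtain W where W: "open W" "p \<in> W" "\<And>q. q \<in> W \<Longrightarrow> sgerm X T q s \<and> q \<in> N"
    unfolding eventually_nhds by blast
  have "holo_section X T W s" unfolding section_iff[OF RS V(1)] using W by blast
  then have "holo_section X T' W s" using eq W by blast
  then show ?thesis unfolding section_iff[OF RS V(2)] using W by blast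
qed

text \<open>Equality of holomorphic sections suffices to compare frames: the columns of a transition
  matrix are frame sections of one bundle in the coordinates of the other.\<close>

lemma compat_transfer:
  assumes V: "vector_bundle X S T" "vector_bundle X S' T'" and N: "open N" "p \<in> N" "p \<in> S" "p \<in> S'"
    and eq: "\<And>W s. W \<subseteq> N \<Longrightarrow> holo_section X T W s \<longleftrightarrow> holo_section X T' W s"
    and c: "compat X T p \<gamma>"
  shows "compat X T' p \<gamma>"
proof -
  obtain U g where U: "(U, g) \<in> T'" "p \<in> U" using triv_ex[OF RS V(2) N(4)] by blast
  have c': "compat X T' p g" by (rule triv_compat[OF RS V(2) U])
  have "hvec X p (\<lambda>q. g q *v (matrix_inv (\<gamma> q) *v axis j 1))" for j
    unfolding compat_sgerm[OF RS V(2) c', symmetric]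
    by (rule section_transfer[OF V N(1-3) _ sgerm_frame[OF RS V(1) c]]) (use eq in blast)
  then have "hmat X p (\<lambda>q. g q ** matrix_inv (\<gamma> q))"
    by (simp add: hvec_def hmat_def matrix_vector_mul_assoc)
  moreover have "hvec X p (\<lambda>q. \<gamma> q *v (matrix_inv (g q) *v axis j 1))" for j
    unfolding compat_sgerm[OF RS V(1) c, symmetric]
    by (rule section_transfer[OF V(2,1) N(1,2,4) _ sgerm_frame[OF RS V(2) c']]) (use eq in blast)
  then have "hmat X p (\<lambda>q. \<gamma> q ** matrix_inv (g q))"
    by (simp add: hvec_def hmat_def matrix_vector_mul_assoc)
  moreover have "\<forall>\<^sub>F q in nhds p. invertible (\<gamma> q)" using c by (simp add: compat_def)
  ultimately show ?thesis using U by (intro compatI)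
qed

lemma compat_mult:
  assumes V: "vector_bundle X S T" and c: "compat X T p \<gamma>"
    and M: "\<forall>\<^sub>F q in nhds p. N q ** M q = mat 1" "hmat X p M" "hmat X p N"
  shows "compat X T p (\<lambda>q. M q ** \<gamma> q)"
proof -
  obtain U g where U: "(U, g) \<in> T" "p \<in> U" using c unfolding compat_def by blast
  note tr = compat_triv[OF RS V c U]
  have iM: "\<forall>\<^sub>F q in nhds p. invertible (M q) \<and> matrix_inv (M q) = N q \<and> invertible (\<gamma> q)"
    using M(1) c[unfolded compat_def, THEN conjunct1] by eventually_elim (auto intro: matrix_inv_eqI)
  have inv: "\<forall>\<^sub>F q in nhds p. invertible (M q ** \<gamma> q) \<and> matrix_inv (M q ** \<gamma> q) = matrix_inv (\<gamma> q) ** N q"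
    using iM
  proof eventually_elim
    case (elim q)
    have "(matrix_inv (\<gamma> q) ** N q) ** (M q ** \<gamma> q) = matrix_inv (\<gamma> q) ** (N q ** M q) ** \<gamma> q"
      by (simp add: matrix_mul_assoc)
    also have "\<dots> = mat 1" using elim matrix_inv_works by (metis matrix_mul_rid)
    finally show ?case using matrix_inv_eqI by blast
  qed
  show ?thesis
  proof (rule compatI[OF U])
    show "\<forall>\<^sub>F q in nhds p. invertible (M q ** \<gamma> q)" using inv by (auto elim: eventually_mono)
    show "hmat X p (\<lambda>q. M q ** \<gamma> q ** matrix_inv (g q))"
      using hmat_mult[OF RS M(2) tr(1)] by (simp add: matrix_mul_assoc)
    show "hmat X p (\<lambda>q. g q ** matrix_inv (M q ** \<gamma> q))"
      by (rule hmat_transfer[OF RS hmat_mult[OF RS tr(2) M(3)]], use inv in eventually_elim)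
         (simp add: matrix_mul_assoc)
  qed
qed

text \<open>For \<open>\<alpha> i\<close> in [0,1) the number \<lceil>t - \<alpha> i\<rceil> is
  \<lfloor>t\<rfloor>, plus one exactly when \<open>\<alpha> i < frac t\<close>. The first part is
  the power of the coordinate in \<open>flag_germs\<close>; the extra one says that the i-th
  coordinate vanishes at \<open>x\<close>, as the flag demands.\<close>

lemma flag_germs_coordinates:
  fixes V :: "('x, 'r::finite) flagged_bundle"
  assumes V: "vector_bundle X UNIV (triv V)" and c: "compat X (triv V) x \<gamma>"
    and \<alpha>: "\<And>i. 0 \<le> \<alpha> i \<and> \<alpha> i < 1"
    and fl: "\<And>v. v \<in> flag V x (flag_index V x (frac t)) \<longleftrightarrow> (\<forall>i. \<alpha> i < frac t \<longrightarrow> (\<gamma> x *v v) $ i = 0)"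
  shows "s \<in> flag_germs X V x t \<longleftrightarrow> (\<forall>i. ord_ge X x \<lceil>t - \<alpha> i\<rceil> (\<lambda>p. (\<gamma> p *v s p) $ i))"
proof -
  define \<delta> :: "'r \<Rightarrow> int" where "\<delta> i = (if \<alpha> i < frac t then 1 else 0)" for i
  have ceil: "\<lceil>t - \<alpha> i\<rceil> = \<lfloor>t\<rfloor> + \<delta> i" for i
  proof -
    have "t = of_int \<lfloor>t\<rfloor> + frac t" by (simp add: frac_def)
    then have "\<lceil>t - \<alpha> i\<rceil> = \<lfloor>t\<rfloor> + \<lceil>frac t - \<alpha> i\<rceil>"
      using ceiling_add_of_int[of "frac t - \<alpha> i" "\<lfloor>t\<rfloor>"] by (simp add: algebra_simps)
    moreover have "\<lceil>frac t - \<alpha> i\<rceil> = \<delta> i"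
      using \<alpha>[of i] frac_ge_0[of t] frac_lt_1[of t] unfolding \<delta>_def
      by (cases "\<alpha> i < frac t"; simp only: if_True if_False; linarith)
    ultimately show ?thesis by simp
  qed
  show ?thesis
  proof
    assume "s \<in> flag_germs X V x t"
    then obtain W u where u: "x \<in> W" "holo_section X (triv V) W u" "u x \<in> flag V x (flag_index V x (frac t))"
      and su: "\<forall>\<^sub>F p in at x. s p = (coord X x p powi \<lfloor>t\<rfloor>) *s u p" by (auto simp: flag_germs_def)
    have "sgerm X (triv V) x u" using u unfolding section_iff[OF RS V] by blast
    then have h: "holo_germ X x (\<lambda>p. (\<gamma> p *v u p) $ i)" for i
      unfolding compat_sgerm[OF RS V c] hvec_def by blast
    have "ord_ge X x (\<delta> i) (\<lambda>p. (\<gamma> p *v u p) $ i)" for i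
      using u(3)[unfolded fl] h[of i] ord_ge_1_iff[OF RS h[of i]] ord_ge_holo_germ[OF RS h[of i]]
      by (simp add: \<delta>_def)
    then have o: "ord_ge X x (\<lfloor>t\<rfloor> + \<delta> i) (\<lambda>p. coord X x p powi \<lfloor>t\<rfloor> * (\<gamma> p *v u p) $ i)" for i
      by (rule ord_ge_shift[OF RS])
    show "\<forall>i. ord_ge X x \<lceil>t - \<alpha> i\<rceil> (\<lambda>p. (\<gamma> p *v s p) $ i)"
      unfolding ceil
      by (intro allI ord_ge_transfer[OF o], use su in eventually_elim) (simp add: vector_scalar_commute)
  next
    assume R: "\<forall>i. ord_ge X x \<lceil>t - \<alpha> i\<rceil> (\<lambda>p. (\<gamma> p *v s p) $ i)"
    \<comment> \<open>Dividing by the power of the coordinate leaves germs without pole; their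
      holomorphic extensions \<open>k i\<close> are the coordinates of the section \<open>u\<close>
      to be found.\<close>
    define c' where "c' i p = coord X x p powi (- \<lfloor>t\<rfloor>) * (\<gamma> p *v s p) $ i" for i p
    have c'1: "ord_ge X x (\<delta> i) (c' i)" for i
      using ord_ge_shift[OF RS R[rule_format, of i], of "- \<lfloor>t\<rfloor>"] unfolding ceil c'_def[abs_def] by simp
    have "\<exists>k. holo_germ X x k \<and> (\<forall>\<^sub>F p in at x. c' i p = k p) \<and> (\<alpha> i < frac t \<longrightarrow> k x = 0)" for i
    proof -
      have "0 \<le> \<delta> i" by (simp add: \<delta>_def)
      from ord_ge_0_imp[OF RS ord_ge_mono[OF RS c'1 this]]
      obtain k where k: "holo_germ X x k" "\<forall>\<^sub>F p in at x. c' i p = k p" by blast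
      have "k x = 0" if "\<alpha> i < frac t"
        using ord_ge_transfer[OF c'1 k(2)] that ord_ge_1_iff[OF RS k(1)] by (simp add: \<delta>_def)
      then show ?thesis using k by blast
    qed
    then obtain k where k: "\<And>i. holo_germ X x (k i)" "\<And>i. \<forall>\<^sub>F p in at x. c' i p = k i p"
      "\<And>i. \<alpha> i < frac t \<Longrightarrow> k i x = 0" by metis
    define u where "u p = matrix_inv (\<gamma> p) *v (\<chi> i. k i p)" for p
    have inv: "\<forall>\<^sub>F p in nhds x. invertible (\<gamma> p)" using c by (simp add: compat_def)
    have gu: "\<forall>\<^sub>F p in nhds x. \<gamma> p *v u p = (\<chi> i. k i p)"
      using inv by eventually_elim (simp add: u_def)
    have "hvec X x (\<lambda>p. \<gamma> p *v u p)"
      by (rule hvec_cong[OF RS gu, THEN iffD2]) (simp add: hvec_def k(1))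
    then have "sgerm X (triv V) x u" unfolding compat_sgerm[OF RS V c] .
    from sgerm_eventually[OF RS V this] obtain W where W: "open W" "x \<in> W" "\<forall>q\<in>W. sgerm X (triv V) q u"
      unfolding eventually_nhds by auto
    then have "holo_section X (triv V) W u" unfolding section_iff[OF RS V] by blast
    moreover have "u x \<in> flag V x (flag_index V x (frac t))"
      unfolding fl using k(3) eventually_nhds_x_imp_x[OF gu] by simp
    moreover have "\<forall>\<^sub>F p in at x. \<forall>i. c' i p = k i p" using k(2) by (simp add: eventually_all_finite)
    then have "\<forall>\<^sub>F p in at x. s p = (coord X x p powi \<lfloor>t\<rfloor>) *s u p"
      using eventually_nhds_at[OF inv] eventually_at_coord[OF RS, of x]
    proof eventually_elim
      case (elim p)
      have "(\<chi> i. k i p) = coord X x p powi (- \<lfloor>t\<rfloor>) *s (\<gamma> p *v s p)"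
        using elim(1) by (simp add: vec_eq_iff c'_def)
      then have "u p = coord X x p powi (- \<lfloor>t\<rfloor>) *s s p"
        using elim(2) by (simp add: u_def vector_scalar_commute)
      then show ?case using elim(3) by (simp add: vector_smult_assoc flip: power_int_add)
    qed
    ultimately show "s \<in> flag_germs X V x t" unfolding flag_germs_def using W(2) by blast
  qed
qed

lemma presents_compat:
  assumes P: "presents X D V E" and c: "compat X (triv V) p \<gamma>" and p: "p \<notin> D"
  shows "compat X (atlas E) p \<gamma>"
proof -
  have V: "vector_bundle X UNIV (triv V)" "vector_bundle X (- D) (atlas E)"
    using P by (auto simp: presents_def flagged_bundle_def)
  show ?thesis
    by (rule compat_transfer[OF V open_base[OF RS V(2)] _ _ _ _ c]) (use P p in \<open>auto simp: presents_def\<close>)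
qed

text \<open>A flag is a condition on values at \<open>x\<close> alone. So any trivialization becomes
  adapted to it after multiplication by a constant matrix, and the filtration of every presented
  bundle splits.\<close>

lemma presents_coordinates:
  fixes V :: "('x, 'r::finite) flagged_bundle"
  assumes P: "presents X D V E" and x: "x \<in> D"
  obtains \<gamma> lev where "compat X (triv V) x \<gamma>" "splits X E x \<gamma> (\<lambda>i. wt V x (lev i))"
    "\<And>i. lev i \<in> {1..steps V x}"
    "\<And>k v. k \<in> {1..steps V x + 1} \<Longrightarrow> v \<in> flag V x k \<longleftrightarrow> (\<forall>i. lev i < k \<longrightarrow> (\<gamma> x *v v) $ i = 0)"
proof -
  have FB: "flagged_bundle X D V" and VE: "vector_bundle X (- D) (atlas E)"
    using P by (auto simp: presents_def)
  note F = FB[unfolded flagged_bundle_def, THEN conjunct2, THEN conjunct2, THEN bspec, OF x]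
  have V: "vector_bundle X UNIV (triv V)" using FB by (simp add: flagged_bundle_def)
  from F have fl: "flag V x 1 = UNIV" "flag V x (steps V x + 1) = {0}" by simp_all
  from F have sub: "\<And>j. j \<in> {1..steps V x + 1} \<Longrightarrow> vec.subspace (flag V x j)" by simp
  from F have dec: "\<And>j. j \<in> {1..steps V x} \<Longrightarrow> flag V x (j + 1) \<subseteq> flag V x j"
    using psubset_imp_subset by metis
  from F have w: "\<And>j. j \<in> {1..steps V x} \<Longrightarrow> 0 \<le> wt V x j \<and> wt V x j < 1" by simp
  have "\<exists>(A :: complex ^ 'r ^ 'r) lev. invertible A \<and> (\<forall>i. lev i \<in> {1..steps V x}) \<and>
      (\<forall>k\<in>{1..steps V x + 1}. \<forall>v. v \<in> flag V x k \<longleftrightarrow> (\<forall>i. lev i < k \<longrightarrow> (A *v v) $ i = 0))"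
    using sub dec fl by (intro flag_coordinates)
  then obtain A :: "complex ^ 'r ^ 'r" and lev where
    AL: "invertible A \<and> (\<forall>i. lev i \<in> {1..steps V x}) \<and>
      (\<forall>k\<in>{1..steps V x + 1}. \<forall>v. v \<in> flag V x k \<longleftrightarrow> (\<forall>i. lev i < k \<longrightarrow> (A *v v) $ i = 0))"
    by (elim exE)
  have A: "invertible A" using AL by (rule conjunct1)
  have lev: "\<And>i. lev i \<in> {1..steps V x}"
    "\<And>k v. k \<in> {1..steps V x + 1} \<Longrightarrow> v \<in> flag V x k \<longleftrightarrow> (\<forall>i. lev i < k \<longrightarrow> (A *v v) $ i = 0)"
    using AL[THEN conjunct2, THEN conjunct1] AL[THEN conjunct2, THEN conjunct2] by simp_all
  obtain U g where U: "(U, g) \<in> triv V" "x \<in> U" using triv_ex[OF RS V] by blast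
  \<comment> \<open>The constant for which \<open>M ** g x\<close> is the adapted matrix
    \<open>A\<close>.\<close>
  define M where "M = A ** matrix_inv (g x)"
  define \<gamma> where "\<gamma> p = M ** g p" for p
  have gx: "invertible (g x)" by (rule triv_invertible[OF RS V U])
  have "invertible M" unfolding M_def
    using A gx matrix_inv_works[OF gx] by (intro invertible_mult) (auto simp: invertible_def)
  then have "compat X (triv V) x (\<lambda>q. M ** g q)"
    by (intro compat_mult[OF V triv_compat[OF RS V U], of "\<lambda>_. matrix_inv M"])
       (auto simp: matrix_inv_works hmat_const[OF RS])
  then have c: "compat X (triv V) x \<gamma>" unfolding \<gamma>_def[abs_def] .
  have \<gamma>x: "\<gamma> x = A" unfolding \<gamma>_def M_def
    using matrix_inv_works[OF gx] by (simp flip: matrix_mul_assoc)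
  have ev: "\<forall>\<^sub>F p in at x. p \<notin> D"
    by (rule eventually_notin_finite) (use FB in \<open>simp add: flagged_bundle_def\<close>)
  have "splits X E x \<gamma> (\<lambda>i. wt V x (lev i))"
    unfolding splits_def
  proof (intro conjI allI)
    show "\<forall>\<^sub>F p in at x. compat X (atlas E) p \<gamma>"
      using eventually_nhds_at[OF compat_eventually[OF RS V c]] ev
      by eventually_elim (rule presents_compat[OF P])
    fix t s
    have "germs E x t = flag_germs X V x t" using P x by (simp add: presents_def)
    moreover have "s \<in> flag_germs X V x t \<longleftrightarrow> (\<forall>i. ord_ge X x \<lceil>t - wt V x (lev i)\<rceil> (\<lambda>p. (\<gamma> p *v s p) $ i))"
    proof (rule flag_germs_coordinates[OF V c])
      show "0 \<le> wt V x (lev i) \<and> wt V x (lev i) < 1" for i using w lev(1) by blast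
      show "v \<in> flag V x (flag_index V x (frac t)) \<longleftrightarrow> (\<forall>i. wt V x (lev i) < frac t \<longrightarrow> (\<gamma> x *v v) $ i = 0)" for v
        using lev(2)[OF flag_index_props(1)[OF FB x], of v] flag_index_props(2)[OF FB x lev(1)] \<gamma>x by simp
    qed
    ultimately show "s \<in> germs E x t \<longleftrightarrow> (\<forall>i. ord_ge X x \<lceil>t - wt V x (lev i)\<rceil> (\<lambda>p. (\<gamma> p *v s p) $ i))"
      by simp
  qed
  then show thesis using that c lev \<gamma>x by metis
qed

end

section \<open>From a split filtration to a flagged bundle\<close>

definition diag :: "('r \<Rightarrow> complex) \<Rightarrow> complex ^ 'r ^ 'r" where
  "diag d = (\<chi> i j. if i = j then d i else 0)"

lemma diag_vec: "(diag d *v v) $ i = d i * v $ (i :: 'r::finite)"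
  by (simp add: diag_def matrix_vector_mult_def if_distrib[where f = "\<lambda>c. c * _"] cong: if_cong)

lemma diag_mult: "diag a ** diag b = diag (\<lambda>i :: 'r::finite. a i * b i)"
  by (simp add: diag_def matrix_matrix_mult_def vec_eq_iff if_distrib[where f = "\<lambda>c. c * _"] cong: if_cong)

lemma diag_one: "diag (\<lambda>i. 1) = mat 1"
  by (simp add: diag_def mat_def)

context
  fixes X :: "'x::t2_space chart set"
  assumes RS: "riemann_surface X"
begin

text \<open>Rescaling the i-th coordinate by a power of the local coordinate shifts its weight by an
  integer. The rescaling may vanish or blow up at \<open>x\<close>, since \<open>splits\<close> asks
  for an admissible frame only on a punctured neighbourhood.\<close>

lemma splits_normalize:
  fixes E :: "('x, 'r::finite) filtered_bundle"
  assumes sp: "splits X E x \<gamma> \<alpha>" and VE: "vector_bundle X S (atlas E)"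
  shows "\<exists>\<gamma>'. splits X E x \<gamma>' (\<lambda>i. frac (\<alpha> i))"
proof -
  define M where "M p = diag (\<lambda>i. coord X x p powi \<lfloor>\<alpha> i\<rfloor>)" for p
  define N where "N p = diag (\<lambda>i. coord X x p powi (- \<lfloor>\<alpha> i\<rfloor>))" for p
  have "\<forall>\<^sub>F p in at x. compat X (atlas E) p \<gamma>" using sp by (simp add: splits_def)
  then have "\<forall>\<^sub>F p in at x. compat X (atlas E) p (\<lambda>q. M q ** \<gamma> q)"
    using eventually_at_nhds[OF eventually_coord_germ[OF RS, of x]]
  proof eventually_elim
    case (elim p)
    then have nz: "\<forall>\<^sub>F q in nhds p. coord X x q \<noteq> 0" and p: "coord X x p \<noteq> 0" "holo_germ X p (coord X x)"
      by (auto elim: eventually_mono dest: eventually_nhds_x_imp_x)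
    have "holo_germ X p (\<lambda>q. coord X x q powi n)" for n
      using p by (intro holo_germ_powi[OF RS]) auto
    then have h: "hmat X p M" "hmat X p N"
      unfolding hmat_def M_def N_def diag_def vec_lambda_beta
      by (intro allI, case_tac "i = j", simp_all add: holo_germ_const[OF RS])+
    have "\<forall>\<^sub>F q in nhds p. N q ** M q = mat 1"
      using nz by eventually_elim (simp add: N_def M_def diag_mult diag_one flip: power_int_add)
    then show ?case by (rule compat_mult[OF RS VE elim(1) _ h])
  qed
  moreover have "s \<in> germs E x t \<longleftrightarrow> (\<forall>i. ord_ge X x \<lceil>t - frac (\<alpha> i)\<rceil> (\<lambda>p. (M p ** \<gamma> p *v s p) $ i))" for t s
  proof -
    have "ord_ge X x \<lceil>t - frac (\<alpha> i)\<rceil> (\<lambda>p. (M p ** \<gamma> p *v s p) $ i) \<longleftrightarrow>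
        ord_ge X x \<lceil>t - \<alpha> i\<rceil> (\<lambda>p. (\<gamma> p *v s p) $ i)" for i
    proof -
      have "t - frac (\<alpha> i) = (t - \<alpha> i) + of_int \<lfloor>\<alpha> i\<rfloor>" by (simp add: frac_def)
      then have "\<lceil>t - frac (\<alpha> i)\<rceil> = \<lfloor>\<alpha> i\<rfloor> + \<lceil>t - \<alpha> i\<rceil>" by (simp only: ceiling_add_of_int add.commute)
      then show ?thesis
        using ord_ge_shift_iff[OF RS, of x "\<lfloor>\<alpha> i\<rfloor>" "\<lceil>t - \<alpha> i\<rceil>" "\<lambda>p. (\<gamma> p *v s p) $ i"]
        by (simp add: M_def diag_vec flip: matrix_vector_mul_assoc)
    qed
    then show ?thesis unfolding germs_splits[OF RS sp] by simp
  qed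
  ultimately show ?thesis unfolding splits_def by (intro exI[of _ "\<lambda>q. M q ** \<gamma> q"]) blast
qed

lemma compat_cong:
  assumes c: "compat X T p \<gamma>" and e: "\<forall>\<^sub>F q in nhds p. \<gamma> q = \<gamma>' q"
  shows "compat X T p \<gamma>'"
proof -
  obtain U g where U: "(U, g) \<in> T" "p \<in> U" "hmat X p (\<lambda>q. \<gamma> q ** matrix_inv (g q))"
    "hmat X p (\<lambda>q. g q ** matrix_inv (\<gamma> q))" and i: "\<forall>\<^sub>F q in nhds p. invertible (\<gamma> q)"
    using c unfolding compat_def by blast
  show ?thesis
  proof (rule compatI[OF U(1,2)])
    show "\<forall>\<^sub>F q in nhds p. invertible (\<gamma>' q)" using i e by eventually_elim simp
    show "hmat X p (\<lambda>q. \<gamma>' q ** matrix_inv (g q))"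
      by (rule hmat_transfer[OF RS U(3)], use e in eventually_elim) simp
    show "hmat X p (\<lambda>q. g q ** matrix_inv (\<gamma>' q))"
      by (rule hmat_transfer[OF RS U(4)], use e in eventually_elim) simp
  qed
qed

text \<open>
  The bundle is extended over \<open>D\<close> by gluing in the split coordinates, after multiplication by powers
  of the coordinate to make the weights lie in \<open>[0, 1)\<close>.
\<close>

lemma splits_imp_parabolic:
  fixes E :: "('x, 'r::finite) filtered_bundle"
  assumes D: "finite D" and VE: "vector_bundle X (- D) (atlas E)"
    and ex: "\<And>x. x \<in> D \<Longrightarrow> \<exists>\<gamma> \<alpha>. splits X E x \<gamma> \<alpha>"
  shows "parabolic_bundle X D E"
proof -
  have "\<forall>x\<in>D. \<exists>\<gamma> \<alpha>. splits X E x \<gamma> \<alpha> \<and> (\<forall>i. 0 \<le> \<alpha> i \<and> \<alpha> i < 1)"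
  proof
    fix x assume "x \<in> D"
    then obtain \<gamma> \<alpha> where "splits X E x \<gamma> \<alpha>" using ex by blast
    from splits_normalize[OF this VE] obtain \<gamma>' where "splits X E x \<gamma>' (\<lambda>i. frac (\<alpha> i))" by blast
    then show "\<exists>\<gamma> \<alpha>. splits X E x \<gamma> \<alpha> \<and> (\<forall>i. 0 \<le> \<alpha> i \<and> \<alpha> i < 1)"
      by (intro exI[of _ \<gamma>'] exI[of _ "\<lambda>i. frac (\<alpha> i)"]) (simp add: frac_lt_1)
  qed
  from bchoice[OF this] obtain G where "\<forall>x\<in>D. \<exists>\<alpha>. splits X E x (G x) \<alpha> \<and> (\<forall>i. 0 \<le> \<alpha> i \<and> \<alpha> i < 1)" by blast
  from bchoice[OF this] obtain al where al: "\<forall>x\<in>D. splits X E x (G x) (al x) \<and> (\<forall>i. 0 \<le> al x i \<and> al x i < 1)" by blast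
  then have sp: "\<And>x. x \<in> D \<Longrightarrow> splits X E x (G x) (al x)" by blast
  have "\<forall>x\<in>D. \<exists>W. open W \<and> x \<in> W \<and> (\<forall>p\<in>W. p \<noteq> x \<longrightarrow> compat X (atlas E) p (G x))"
  proof
    fix x assume "x \<in> D"
    then have "\<forall>\<^sub>F p in at x. compat X (atlas E) p (G x)" using sp by (simp add: splits_def)
    then show "\<exists>W. open W \<and> x \<in> W \<and> (\<forall>p\<in>W. p \<noteq> x \<longrightarrow> compat X (atlas E) p (G x))"
      unfolding eventually_at_topological by simp
  qed
  from bchoice[OF this] obtain W where W: "\<forall>x\<in>D. open (W x) \<and> x \<in> W x \<and>
      (\<forall>p\<in>W x. p \<noteq> x \<longrightarrow> compat X (atlas E) p (G x))" by blast
  \<comment> \<open>The splitting gives information off \<open>x\<close>, so the value at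
    \<open>x\<close> is free to choose. The identity labels the new fibre by the split coordinates
    themselves, and flags become coordinate flags.\<close>
  define g where "g x p = (if p = x then mat 1 else G x p)" for x p
  define ws where "ws x = sorted_list_of_set (range (al x))" for x
  \<comment> \<open>List positions start at 0, steps at 1. Step \<open>j\<close> consists of the
    vectors whose coordinates of weight below the j-th weight vanish; beyond the list all
    coordinates vanish, which gives the final zero step.\<close>
  define V where "V = \<lparr>triv = atlas E \<union> {(W x, g x) | x. x \<in> D},
    steps = (\<lambda>x. length (ws x)),
    flag = (\<lambda>x j. {v. \<forall>i. j > length (ws x) \<or> al x i < ws x ! (j - 1) \<longrightarrow> v $ i = 0}),
    wt = (\<lambda>x j. ws x ! (j - 1))\<rparr>"
  have gc: "compat X (atlas E) p (g x)" if "x \<in> D" "p \<in> W x" "p \<noteq> x" for x p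
  proof (rule compat_cong)
    show "compat X (atlas E) p (G x)" using W that by blast
    have "\<forall>\<^sub>F q in nhds p. q \<noteq> x" using that(3) by (rule t1_space_nhds)
    then show "\<forall>\<^sub>F q in nhds p. G x q = g x q" by eventually_elim (simp add: g_def)
  qed
  \<comment> \<open>An admissible frame exists only over \<open>- D\<close>, so \<open>W x\<close>
    meets \<open>D\<close> in \<open>x\<close> alone. Hence just one trivialization contains
    \<open>x\<close>, and new overlaps arise only where \<open>G x\<close> is already known to be
    admissible.\<close>
  have Wcap: "p \<notin> D" if "x \<in> D" "p \<in> W x" "p \<noteq> x" for x p
    using compat_base[OF RS VE gc[OF that]] by simp
  have ginv: "invertible (g x p)" if "x \<in> D" "p \<in> W x" for x p
  proof (cases "p = x")
    case True
    then show ?thesis by (auto simp: g_def invertible_def intro!: exI[of _ "mat 1"])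
  next
    case False
    then show ?thesis using compat_invertible[OF RS VE gc[OF that]] by simp
  qed
  have VB: "vector_bundle X UNIV (triv V)"
    unfolding vector_bundle_iff[OF RS]
  proof (intro conjI)
    show "(\<Union>(U, g)\<in>triv V. U) = UNIV"
    proof (intro equalityI subsetI UNIV_I)
      fix p
      show "p \<in> (\<Union>(U, g)\<in>triv V. U)"
      proof (cases "p \<in> D")
        case True
        then have "(W p, g p) \<in> triv V" "p \<in> W p" using W by (auto simp: V_def)
        then show ?thesis by blast
      next
        case False
        then obtain U h where "(U, h) \<in> atlas E" "p \<in> U" using triv_ex[OF RS VE] by blast
        then show ?thesis by (auto simp: V_def)
      qed
    qed
    show "\<forall>(U, g)\<in>triv V. open U \<and> (\<forall>p\<in>U. invertible (g p))"
      using triv_open[OF RS VE] triv_invertible[OF RS VE] W ginv by (auto simp: V_def)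
    show "\<forall>(U, h)\<in>triv V. \<forall>(U', h')\<in>triv V. \<forall>p\<in>U \<inter> U'. hmat X p (\<lambda>q. h' q ** matrix_inv (h q))"
    proof clarify
      fix U h U' h' p assume h: "(U, h) \<in> triv V" "(U', h') \<in> triv V" "p \<in> U" "p \<in> U'"
      have cc: "compat X (atlas E) p k" if "(Q, k) \<in> triv V" "p \<in> Q" "p \<notin> D" for Q k
        using that gc triv_compat[OF RS VE] by (auto simp: V_def)
      show "hmat X p (\<lambda>q. h' q ** matrix_inv (h q))"
      proof (cases "p \<in> D")
        case False
        then show ?thesis using compat_change[OF RS VE cc cc] h by blast
      next
        case True
        have eq: "Q = W p \<and> k = g p" if "(Q, k) \<in> triv V" "p \<in> Q" for Q k
          using that True Wcap triv_in[OF RS VE] by (auto simp: V_def)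
        have "\<forall>\<^sub>F q in nhds p. q \<in> W p" using W True by (intro eventually_nhds_in_open) auto
        then have "\<forall>\<^sub>F q in nhds p. mat 1 = h' q ** matrix_inv (h q)"
          using eq[OF h(1,3)] eq[OF h(2,4)]
          by (auto elim!: eventually_mono simp: matrix_inv_works(1)[OF ginv[OF True]])
        from hmat_transfer[OF RS _ this] show ?thesis by (simp add: hmat_const[OF RS])
      qed
    qed
  qed
  have ws: "sorted_wrt (<) (ws x)" "set (ws x) = range (al x)" for x
    by (simp_all add: ws_def)
  have al_ws: "\<exists>j\<in>{1..length (ws x)}. al x i = ws x ! (j - 1)" for x i
  proof -
    have "al x i \<in> set (ws x)" using ws(2) by blast
    then obtain k where "k < length (ws x)" "ws x ! k = al x i" by (auto simp: in_set_conv_nth)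
    then show ?thesis by (intro bexI[of _ "k + 1"]) auto
  qed
  have ws_al: "\<exists>i. al x i = ws x ! (j - 1)" if "j \<in> {1..length (ws x)}" for x j
  proof -
    have "ws x ! (j - 1) \<in> set (ws x)" using that by (intro nth_mem) auto
    then show ?thesis using ws(2)[of x] by (metis imageE)
  qed
  have mono: "strict_mono_on {1..length (ws x)} (\<lambda>j. ws x ! (j - 1))" for x
    by (intro strict_mono_onI sorted_wrt_nth_less[OF ws(1)]) auto
  have FB: "flagged_bundle X D V"
    unfolding flagged_bundle_def
  proof (intro conjI ballI D VB)
    fix x assume x: "x \<in> D"
    \<comment> \<open>Index types are nonempty, so at least one weight occurs and the flag has a
      step.\<close>
    obtain i0 :: 'r where True by simp
    show "1 \<le> steps V x" using al_ws[of x i0] by (auto simp: V_def)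
    show "flag V x (steps V x + 1) = {0}" by (auto simp: V_def vec_eq_iff)
    show "flag V x 1 = UNIV"
    proof -
      have "\<not> (1 > length (ws x) \<or> al x i < ws x ! (1 - 1))" for i
      proof -
        obtain j where j: "j \<in> {1..length (ws x)}" "al x i = ws x ! (j - 1)" using al_ws by blast
        then have "ws x ! (1 - 1) \<le> ws x ! (j - 1)"
          using strict_mono_on_leD[OF mono[of x], of 1 j] by simp
        then show ?thesis using j by auto
      qed
      then show ?thesis by (auto simp: V_def)
    qed
    show "strict_mono_on {1..steps V x} (wt V x)" using mono[of x] by (simp add: V_def)
    fix j
    show "vec.subspace (flag V x j)" by (auto simp: V_def vec.subspace_def)
    assume j: "j \<in> {1..steps V x}"
    then have j': "j \<in> {1..length (ws x)}" by (simp add: V_def)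
    obtain i where i: "al x i = ws x ! (j - 1)" using ws_al[OF j'] by blast
    show "0 \<le> wt V x j" "wt V x j < 1"
      using al x i[symmetric] by (simp_all add: V_def)
    show "flag V x (j + 1) \<subset> flag V x j"
    proof
      show "flag V x (j + 1) \<subseteq> flag V x j"
      proof
        fix v assume v: "v \<in> flag V x (j + 1)"
        have "v $ i = 0" if "j > length (ws x) \<or> al x i < ws x ! (j - 1)" for i
        proof -
          have "al x i < ws x ! (j - 1)" using that j' by auto
          moreover have "ws x ! (j - 1) \<le> ws x ! (j + 1 - 1)" if "j + 1 \<le> length (ws x)"
            using strict_mono_on_leD[OF mono[of x], of j "j + 1"] j' that by simp
          ultimately show ?thesis using v by (force simp: V_def)
        qed
        then show "v \<in> flag V x j" by (simp add: V_def)
      qed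
      \<comment> \<open>\<open>i\<close> is a coordinate carrying the j-th weight; its axis is the
        vector lost in the next step, so the inclusion is strict.\<close>
      have "axis i 1 \<in> flag V x j" using i j' by (auto simp: V_def axis_def)
      moreover have "axis i 1 \<notin> flag V x (j + 1)"
      proof
        assume "axis i 1 \<in> flag V x (j + 1)"
        then have "j + 1 > length (ws x) \<or> al x i < ws x ! (j + 1 - 1) \<Longrightarrow> axis i (1 :: complex) $ i = 0"
          unfolding V_def flagged_bundle.simps mem_Collect_eq by blast
        then have "\<not> (j + 1 > length (ws x) \<or> al x i < ws x ! (j + 1 - 1))"
          by (auto simp: axis_def)
        moreover have "ws x ! (j - 1) < ws x ! (j + 1 - 1)" if "j + 1 \<le> length (ws x)"
          using strict_mono_onD[OF mono[of x], of j "j + 1"] j' that by simp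
        ultimately show False using i by auto
      qed
      ultimately show "flag V x (j + 1) \<noteq> flag V x j" by blast
    qed
  qed
  have "presents X D V E"
    unfolding presents_def
  proof (intro conjI FB VE allI impI ballI)
    fix Q s assume Q: "Q \<subseteq> - D"
    have "sgerm X (triv V) p s \<longleftrightarrow> sgerm X (atlas E) p s" if "p \<notin> D" for p
    proof
      assume "sgerm X (triv V) p s"
      then show "sgerm X (atlas E) p s" by (auto simp: sgerm_def V_def)
    next
      assume s: "sgerm X (atlas E) p s"
      have "hvec X p (\<lambda>q. g x q *v s q)" if "x \<in> D" "p \<in> W x" for x
        using compat_sgerm[OF RS VE gc[OF that]] s that \<open>p \<notin> D\<close> by blast
      then show "sgerm X (triv V) p s" using s by (auto simp: sgerm_def V_def)
    qed
    then show "holo_section X (triv V) Q s \<longleftrightarrow> holo_section X (atlas E) Q s"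
      unfolding section_iff[OF RS VB] section_iff[OF RS VE] using Q by blast
  next
    fix x t assume x: "x \<in> D"
    have c: "compat X (triv V) x (g x)"
      by (rule triv_compat[OF RS VB, of "W x"]) (use W x in \<open>auto simp: V_def\<close>)
    have "s \<in> germs E x t \<longleftrightarrow> s \<in> flag_germs X V x t" for s
    proof -
      have fi: "v \<in> flag V x (flag_index V x (frac t)) \<longleftrightarrow> (\<forall>i. al x i < frac t \<longrightarrow> (g x x *v v) $ i = 0)" for v
      proof -
        define k where "k = flag_index V x (frac t)"
        have k: "k \<in> {1..length (ws x) + 1}"
          using flag_index_props(1)[OF FB x] by (simp add: V_def k_def)
        have flagV: "v \<in> flag V x k \<longleftrightarrow> (\<forall>i. k > length (ws x) \<or> al x i < ws x ! (k - 1) \<longrightarrow> v $ i = 0)"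
          by (simp add: V_def)
        have gx: "g x x *v v = v" by (simp add: g_def)
        \<comment> \<open>The position of a weight in the sorted list precedes
          \<open>flag_index\<close> exactly when the weight is below \<open>frac t\<close>. This
          turns the flag, indexed by positions, into the condition on weights used for
          splittings.\<close>
        have "(k > length (ws x) \<or> al x i < ws x ! (k - 1)) \<longleftrightarrow> al x i < frac t" for i
        proof -
          obtain j where j: "j \<in> {1..length (ws x)}" "al x i = ws x ! (j - 1)" using al_ws by blast
          have "al x i < frac t \<longleftrightarrow> j < k"
            using flag_index_props(2)[OF FB x, of j "frac t"] j by (simp add: V_def k_def)
          moreover have "k \<le> length (ws x) \<longrightarrow> (ws x ! (j - 1) < ws x ! (k - 1) \<longleftrightarrow> j < k)"
            using strict_mono_on_less[OF mono[of x], of j k] j k by simp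
          moreover have "k > length (ws x) \<longrightarrow> j < k" using j by simp
          ultimately show ?thesis unfolding j(2) by linarith
        qed
        then show ?thesis unfolding k_def[symmetric] flagV gx by presburger
      qed
      have "s \<in> flag_germs X V x t \<longleftrightarrow> (\<forall>i. ord_ge X x \<lceil>t - al x i\<rceil> (\<lambda>p. (g x p *v s p) $ i))"
        by (rule flag_germs_coordinates[OF RS VB c _ fi]) (use al x in blast)
      also have "\<dots> \<longleftrightarrow> (\<forall>i. ord_ge X x \<lceil>t - al x i\<rceil> (\<lambda>p. (G x p *v s p) $ i))"
        by (intro iff_allI ord_ge_cong, rule eventually_mono[OF eventually_neq_at_within[of x x UNIV]])
           (simp add: g_def)
      also have "\<dots> \<longleftrightarrow> s \<in> germs E x t" using germs_splits[OF RS sp[OF x]] by simp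
      finally show ?thesis by simp
    qed
    then show "germs E x t = flag_germs X V x t" by blast
  qed
  then show ?thesis unfolding parabolic_bundle_def by blast
qed

lemma parabolic_bundle_splits:
  assumes "parabolic_bundle X D E"
  shows "finite D" "vector_bundle X (- D) (atlas E)" "\<And>x. x \<in> D \<Longrightarrow> \<exists>\<gamma> \<alpha>. splits X E x \<gamma> \<alpha>"
proof -
  obtain V where P: "presents X D V E" using assms by (auto simp: parabolic_bundle_def)
  then show "finite D" "vector_bundle X (- D) (atlas E)" by (auto simp: presents_def flagged_bundle_def)
  show "\<exists>\<gamma> \<alpha>. splits X E x \<gamma> \<alpha>" if "x \<in> D" for x
    using presents_coordinates[OF RS P that] by metis
qed

end

section \<open>Pullback of parabolic bundles, homomorphisms and forms\<close>

context covering
begin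

text \<open>By compactness an infinite fibre would have an accumulation point, while near every
  point of \<open>Y\<close> a given value is avoided off that point.\<close>

lemma finite_fibre:
  assumes "compact (UNIV :: 'y set)" shows "finite (f -` {x})"
proof (rule ccontr)
  assume "infinite (f -` {x})"
  from Heine_Borel_imp_Bolzano_Weierstrass[OF assms this] obtain y where y: "y islimpt f -` {x}" by auto
  have "\<forall>\<^sub>F q in at y. f q \<noteq> x"
  proof (cases "f y = x")
    case True
    then show ?thesis using eventually_f_neq[of y] by simp
  next
    case False
    then show ?thesis by (intro eventually_nhds_at tendsto_imp_eventually_ne[OF tendsto_f])
  qed
  then show False using y unfolding islimpt_iff_eventually by (auto elim: eventually_mono)
qed

lemma finite_vimage_f:
  assumes "compact (UNIV :: 'y set)" "finite P" shows "finite (f -` P)"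
proof -
  have "f -` P = (\<Union>x\<in>P. f -` {x})" by auto
  then show ?thesis using finite_fibre[OF assms(1)] assms(2) by auto
qed

lemma parabolic_pullback:
  assumes "compact (UNIV :: 'y set)" "parabolic_bundle X D E"
  shows "parabolic_bundle Y (f -` D) (pullback_bundle Y X f E)"
proof (rule splits_imp_parabolic[OF RY])
  note P = parabolic_bundle_splits[OF RX assms(2)]
  show "finite (f -` D)" by (rule finite_vimage_f[OF assms(1) P(1)])
  show "vector_bundle Y (- f -` D) (atlas (pullback_bundle Y X f E))"
    using vector_bundle_pullback[OF P(2)] by (simp add: vimage_Compl)
  fix y assume "y \<in> f -` D"
  then show "\<exists>\<gamma> \<alpha>. splits Y (pullback_bundle Y X f E) y \<gamma> \<alpha>"
    using P(3) splits_pullback by blast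
qed

text \<open>Of \<open>F\<close> and \<open>F'\<close> only the atlases and the split coordinates
  over \<open>D\<close> are prescribed. This is the form in which tensor products and duals, built
  on \<open>Y\<close> from pulled back bundles, can take their place. Orders of matrix entries are
  multiplied by m, as are all differences of weights.\<close>

lemma parabolic_hom_pullback:
  fixes E :: "('x, 'r::finite) filtered_bundle" and E' :: "('x, 's::finite) filtered_bundle"
  assumes hom: "parabolic_hom X D E E' \<psi>"
    and V: "vector_bundle X (- D) (atlas E)" "vector_bundle X (- D) (atlas E')"
    and F: "atlas F = atlas (pullback_bundle Y X f E)" "atlas F' = atlas (pullback_bundle Y X f E')"
    and sp: "\<And>y. f y \<in> D \<Longrightarrow> \<exists>\<gamma> \<alpha> \<gamma>' \<alpha>'. splits X E (f y) \<gamma> \<alpha> \<and> splits X E' (f y) \<gamma>' \<alpha>' \<and>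
      splits Y F y (\<lambda>q. \<gamma> (f q)) (\<lambda>i. of_int (mult y) * \<alpha> i) \<and>
      splits Y F' y (\<lambda>q. \<gamma>' (f q)) (\<lambda>i. of_int (mult y) * \<alpha>' i)"
  shows "parabolic_hom Y (f -` D) F F' (\<lambda>q. \<psi> (f q))"
proof (rule parabolic_homI[OF RY])
  show "vector_bundle Y (- f -` D) (atlas F)" "vector_bundle Y (- f -` D) (atlas F')"
    unfolding F using vector_bundle_pullback[OF V(1)] vector_bundle_pullback[OF V(2)] by (simp_all add: vimage_Compl)
next
  fix p assume "p \<notin> f -` D"
  then obtain U g U' g' where *: "(U, g) \<in> atlas E" "f p \<in> U" "(U', g') \<in> atlas E'" "f p \<in> U'"
    using triv_ex[OF RX V(1)] triv_ex[OF RX V(2)] by (metis Compl_iff vimage_eq)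
  have h: "hmat Y p (\<lambda>q. g' (f q) ** \<psi> (f q) ** matrix_inv (g (f q)))"
    using hmat_pull[OF parabolic_hom_triv[OF RX V hom *(1,3,2,4)]] .
  show "\<exists>(U, g)\<in>atlas F. \<exists>(U', g')\<in>atlas F'. p \<in> U \<and> p \<in> U' \<and>
      hmat Y p (\<lambda>q. g' q ** \<psi> (f q) ** matrix_inv (g q))"
  proof (rule bexI[of _ "(f -` U, g \<circ> f)"], rule case_prodI, rule bexI[of _ "(f -` U', g' \<circ> f)"], rule case_prodI)
    show "(f -` U, g \<circ> f) \<in> atlas F" "(f -` U', g' \<circ> f) \<in> atlas F'"
      using * unfolding F atlas_pullback by blast+
  qed (use * h in \<open>simp add: o_def\<close>)
next
  fix y assume "y \<in> f -` D"
  then have y: "f y \<in> D" by simp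
  then obtain \<gamma> \<alpha> \<gamma>' \<alpha>' where s: "splits X E (f y) \<gamma> \<alpha>" "splits X E' (f y) \<gamma>' \<alpha>'"
    "splits Y F y (\<lambda>q. \<gamma> (f q)) (\<lambda>i. of_int (mult y) * \<alpha> i)"
    "splits Y F' y (\<lambda>q. \<gamma>' (f q)) (\<lambda>i. of_int (mult y) * \<alpha>' i)" using sp by blast
  have "ord_ge Y y \<lceil>of_int (mult y) * \<alpha> j - of_int (mult y) * \<alpha>' i\<rceil>
      (\<lambda>q. (\<gamma>' (f q) ** \<psi> (f q) ** matrix_inv (\<gamma> (f q))) $ i $ j)" for i j
  proof -
    have "ord_ge Y y (mult y * \<lceil>\<alpha> j - \<alpha>' i\<rceil>) (\<lambda>q. (\<gamma>' (f q) ** \<psi> (f q) ** matrix_inv (\<gamma> (f q))) $ i $ j)"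
      using ord_ge_pull[OF parabolic_hom_splits[OF RX hom y s(1,2), of j i]] by (simp add: o_def)
    moreover have "of_int (mult y) * (\<alpha> j - \<alpha>' i) \<le> of_int (mult y) * of_int \<lceil>\<alpha> j - \<alpha>' i\<rceil>"
      using mult_pos[of y] by (intro mult_left_mono) auto
    then have "\<lceil>of_int (mult y) * \<alpha> j - of_int (mult y) * \<alpha>' i\<rceil> \<le> mult y * \<lceil>\<alpha> j - \<alpha>' i\<rceil>"
      by (simp add: ceiling_le_iff algebra_simps)
    ultimately show ?thesis by (rule ord_ge_mono[OF RY])
  qed
  then show "\<exists>\<gamma> \<alpha> \<gamma>' \<alpha>'. splits Y F y \<gamma> \<alpha> \<and> splits Y F' y \<gamma>' \<alpha>' \<and>
      (\<forall>i j. ord_ge Y y \<lceil>\<alpha> j - \<alpha>' i\<rceil> (\<lambda>q. (\<gamma>' q ** \<psi> (f q) ** matrix_inv (\<gamma> q)) $ i $ j))"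
    using s(3,4) by (intro exI[of _ "\<lambda>q. \<gamma> (f q)"] exI[of _ "\<lambda>i. of_int (mult y) * \<alpha> i"]
        exI[of _ "\<lambda>q. \<gamma>' (f q)"] exI[of _ "\<lambda>i. of_int (mult y) * \<alpha>' i"]) blast
qed

text \<open>The two atlases agree as sets of trivializations, which is the hypothesis on
  \<open>F\<close> in \<open>parabolic_hom_pullback\<close>; the modules are compared through their
  weights.\<close>

lemma atlas_pullback_tensor: "atlas (pullback_bundle Y X f (parabolic_tensor E E')) =
    atlas (parabolic_tensor (pullback_bundle Y X f E) (pullback_bundle Y X f E'))"
proof (intro equalityI subsetI)
  fix z assume "z \<in> atlas (pullback_bundle Y X f (parabolic_tensor E E'))"
  then obtain U g U' g' where *: "(U, g) \<in> atlas E" "(U', g') \<in> atlas E'"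
    "z = (f -` (U \<inter> U'), (\<lambda>p. tensor_mat (g p) (g' p)) \<circ> f)"
    unfolding atlas_pullback atlas_tensor by blast
  have "z = (f -` U \<inter> f -` U', \<lambda>p. tensor_mat ((g \<circ> f) p) ((g' \<circ> f) p))"
    unfolding *(3) by (simp add: o_def)
  then show "z \<in> atlas (parabolic_tensor (pullback_bundle Y X f E) (pullback_bundle Y X f E'))"
    using *(1,2) unfolding atlas_tensor atlas_pullback by blast
next
  fix z assume "z \<in> atlas (parabolic_tensor (pullback_bundle Y X f E) (pullback_bundle Y X f E'))"
  then obtain U g U' g' where *: "(U, g) \<in> atlas E" "(U', g') \<in> atlas E'"
    "z = (f -` U \<inter> f -` U', \<lambda>p. tensor_mat ((g \<circ> f) p) ((g' \<circ> f) p))"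
    unfolding atlas_tensor atlas_pullback by blast
  have "z = (f -` (U \<inter> U'), (\<lambda>p. tensor_mat (g p) (g' p)) \<circ> f)"
    unfolding *(3) by (simp add: o_def)
  then show "z \<in> atlas (pullback_bundle Y X f (parabolic_tensor E E'))"
    using *(1,2) unfolding atlas_tensor atlas_pullback by blast
qed

lemma atlas_pullback_dual: "atlas (pullback_bundle Y X f (parabolic_dual X E)) =
    atlas (parabolic_dual Y (pullback_bundle Y X f E))"
proof (intro equalityI subsetI)
  fix z assume "z \<in> atlas (pullback_bundle Y X f (parabolic_dual X E))"
  then obtain U g where *: "(U, g) \<in> atlas E" "z = (f -` U, (\<lambda>p. dual_mat (g p)) \<circ> f)"
    unfolding atlas_pullback atlas_dual by blast
  have "z = (f -` U, \<lambda>p. dual_mat ((g \<circ> f) p))" unfolding *(2) by (simp add: o_def)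
  then show "z \<in> atlas (parabolic_dual Y (pullback_bundle Y X f E))"
    using *(1) unfolding atlas_dual atlas_pullback by blast
next
  fix z assume "z \<in> atlas (parabolic_dual Y (pullback_bundle Y X f E))"
  then obtain U g where *: "(U, g) \<in> atlas E" "z = (f -` U, \<lambda>p. dual_mat ((g \<circ> f) p))"
    unfolding atlas_dual atlas_pullback by blast
  have "z = (f -` U, (\<lambda>p. dual_mat (g p)) \<circ> f)" unfolding *(2) by (simp add: o_def)
  then show "z \<in> atlas (pullback_bundle Y X f (parabolic_dual X E))"
    using *(1) unfolding atlas_dual atlas_pullback by blast
qed

lemma nondegenerate_pullback:
  fixes E :: "('x, 'r::finite) filtered_bundle"
  assumes E: "parabolic_bundle X D E" and L: "parabolic_bundle X D L"
    and nd: "nondegenerate_form X D E L \<phi>"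
  shows "nondegenerate_form Y (f -` D) (pullback_bundle Y X f E) (pullback_bundle Y X f L) (pullback_form f \<phi>)"
proof -
  let ?E = "pullback_bundle Y X f E" and ?L = "pullback_bundle Y X f L"
  let ?T = "parabolic_tensor (parabolic_dual X E) L" and ?T' = "parabolic_tensor (parabolic_dual Y ?E) ?L"
  note VE = parabolic_bundle_splits(2)[OF RX E] and VL = parabolic_bundle_splits(2)[OF RX L]
  note VD = vector_bundle_dual[OF RX VE]
  have VE': "vector_bundle Y (- f -` D) (atlas ?E)" and VL': "vector_bundle Y (- f -` D) (atlas ?L)"
    using vector_bundle_pullback[OF VE] vector_bundle_pullback[OF VL] by (simp_all add: vimage_Compl)
  note VD' = vector_bundle_dual[OF RY VE']
  have EE: "parabolic_hom X D (parabolic_tensor E E) L \<phi>"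
    and iso: "parabolic_iso X D E ?T (adjoint_form \<phi>)"
    using nd by (auto simp: nondegenerate_form_def)
  have sE: "\<exists>\<gamma> \<alpha>. splits X E (f y) \<gamma> \<alpha>" and sL: "\<exists>\<gamma> \<alpha>. splits X L (f y) \<gamma> \<alpha>" if "f y \<in> D" for y
    using parabolic_bundle_splits(3)[OF RX E that] parabolic_bundle_splits(3)[OF RX L that] by auto
  have sE': "\<exists>\<gamma> \<alpha>. splits X E (f y) \<gamma> \<alpha> \<and>
      splits Y ?E y (\<lambda>q. \<gamma> (f q)) (\<lambda>i. of_int (mult y) * \<alpha> i)" if "f y \<in> D" for y
    using sE[OF that] splits_pullback by blast
  have sL': "\<exists>\<gamma> \<alpha>. splits X L (f y) \<gamma> \<alpha> \<and>
      splits Y ?L y (\<lambda>q. \<gamma> (f q)) (\<lambda>i. of_int (mult y) * \<alpha> i)" if "f y \<in> D" for y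
    using sL[OF that] splits_pullback by blast
  \<comment> \<open>Weights are computed once on \<open>X\<close> and once on \<open>Y\<close>. They
    match because multiplication by \<open>mult y\<close> is additive; in \<open>sD\<close> it also
    commutes with the sign change of the dual.\<close>
  have sT: "\<exists>\<gamma> \<alpha>. splits X (parabolic_tensor E E) (f y) \<gamma> \<alpha> \<and>
      splits Y (parabolic_tensor ?E ?E) y (\<lambda>q. \<gamma> (f q)) (\<lambda>i. of_int (mult y) * \<alpha> i)" if y: "f y \<in> D" for y
  proof -
    obtain \<gamma> \<alpha> where s: "splits X E (f y) \<gamma> \<alpha>" using sE[OF y] by blast
    note s' = splits_pullback[OF s]
    show ?thesis using splits_tensor[OF RX s s VE VE] splits_tensor[OF RY s' s' VE' VE']
      by (intro exI[of _ "\<lambda>p. tensor_mat (\<gamma> p) (\<gamma> p)"] exI[of _ "\<lambda>ij. \<alpha> (fst ij) + \<alpha> (snd ij)"])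
         (simp add: distrib_left)
  qed
  have sD: "\<exists>\<gamma> \<alpha>. splits X ?T (f y) \<gamma> \<alpha> \<and>
      splits Y ?T' y (\<lambda>q. \<gamma> (f q)) (\<lambda>i. of_int (mult y) * \<alpha> i)" if y: "f y \<in> D" for y
  proof -
    obtain \<gamma> \<alpha> where s: "splits X E (f y) \<gamma> \<alpha>" using sE[OF y] by blast
    obtain \<kappa> \<beta> where l: "splits X L (f y) \<kappa> \<beta>" using sL[OF y] by blast
    note s' = splits_pullback[OF s] and l' = splits_pullback[OF l]
    show ?thesis
      using splits_tensor[OF RX splits_dual[OF RX s VE] l VD VL]
        splits_tensor[OF RY splits_dual[OF RY s' VE'] l' VD' VL']
      by (intro exI[of _ "\<lambda>p. tensor_mat (dual_mat (\<gamma> p)) (\<kappa> p)"] exI[of _ "\<lambda>ij. - \<alpha> (fst ij) + \<beta> (snd ij)"])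
         (simp add: distrib_left right_diff_distrib)
  qed
  have 1: "parabolic_hom Y (f -` D) (parabolic_tensor ?E ?E) ?L (\<lambda>q. \<phi> (f q))"
    by (rule parabolic_hom_pullback[OF EE vector_bundle_tensor[OF RX VE VE] VL atlas_pullback_tensor[symmetric] refl])
       (use sT sL' in blast)
  have T: "atlas ?T' = atlas (pullback_bundle Y X f ?T)"
    unfolding atlas_pullback_tensor unfolding atlas_tensor atlas_pullback_dual ..
  have 2: "parabolic_hom Y (f -` D) ?E ?T' (\<lambda>q. adjoint_form \<phi> (f q))"
  proof (rule parabolic_hom_pullback[OF _ VE vector_bundle_tensor[OF RX VD VL] refl T])
    show "parabolic_hom X D E ?T (adjoint_form \<phi>)" using iso by (simp add: parabolic_iso_def)
  qed (use sD sE' in blast)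
  \<comment> \<open>The inverse is itself a homomorphism of parabolic bundles, so it pulls back by
    the same lemma and inverts the pulled back map fibre by fibre.\<close>
  obtain \<eta> where \<eta>: "parabolic_hom X D ?T E \<eta>"
    "\<forall>p. p \<notin> D \<longrightarrow> \<eta> p ** adjoint_form \<phi> p = mat 1 \<and> adjoint_form \<phi> p ** \<eta> p = mat 1"
    using iso unfolding parabolic_iso_def by blast
  have 3: "parabolic_hom Y (f -` D) ?T' ?E (\<lambda>q. \<eta> (f q))"
    by (rule parabolic_hom_pullback[OF \<eta>(1) vector_bundle_tensor[OF RX VD VL] VE T refl])
       (use sD sE' in blast)
  have eq: "adjoint_form (pullback_form f \<phi>) = (\<lambda>q. adjoint_form \<phi> (f q))"
    "pullback_form f \<phi> = (\<lambda>q. \<phi> (f q))"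
    by (simp_all add: fun_eq_iff adjoint_form_def pullback_form_def)
  have "\<forall>q. q \<notin> f -` D \<longrightarrow> \<eta> (f q) ** adjoint_form \<phi> (f q) = mat 1 \<and>
      adjoint_form \<phi> (f q) ** \<eta> (f q) = mat 1"
    using \<eta>(2) by simp
  then have "parabolic_iso Y (f -` D) ?E ?T' (\<lambda>q. adjoint_form \<phi> (f q))"
    unfolding parabolic_iso_def by (intro conjI 2 exI[of _ "\<lambda>q. \<eta> (f q)"] 3)
  then show ?thesis
    unfolding nondegenerate_form_def eq(1) unfolding eq(2) using 1 by (intro conjI)
qed

end

section \<open>Connections and their pullbacks\<close>

lemma column_axis: "column i A = A *v axis i (1 :: complex)"
  by (simp add: vec_eq_iff column_def)

section \<open>Connections as operators on germs\<close>

context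
  fixes X :: "'x::t2_space chart set"
  assumes RS: "riemann_surface X"
begin

text \<open>The axioms of \<open>holo_connection\<close> quantify over sections on open sets.
  Representing a germ by a section on a small enough set turns each axiom into a statement at a
  single point.\<close>

lemma sgerm_section:
  assumes V: "vector_bundle X S T" and s: "sgerm X T p s" and N: "open N" "p \<in> N" "p \<in> S"
  obtains W where "open W" "p \<in> W" "W \<subseteq> N" "W \<subseteq> S" "holo_section X T W s"
proof -
  have "\<forall>\<^sub>F q in nhds p. sgerm X T q s \<and> q \<in> N \<and> q \<in> S"
    using sgerm_eventually[OF RS V s N(3)] eventually_nhds_in_open[OF N(1,2)]
      eventually_nhds_in_open[OF open_base[OF RS V] N(3)] by eventually_elim simp
  then obtain W where W: "open W" "p \<in> W" "\<And>q. q \<in> W \<Longrightarrow> sgerm X T q s \<and> q \<in> N \<and> q \<in> S"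
    unfolding eventually_nhds by blast
  then have "holo_section X T W s" unfolding section_iff[OF RS V] by blast
  then show thesis using that[of W] W by blast
qed

lemma sgerm_section':
  assumes "vector_bundle X S T" "sgerm X T p s" "p \<in> S"
  obtains W where "open W" "p \<in> W" "W \<subseteq> S" "holo_section X T W s"
  by (rule sgerm_section[OF assms(1,2) open_UNIV UNIV_I assms(3)]) (rule that)

context
  fixes S :: "'x set" and T :: "('x, 'r::finite) bundle_atlas" and nab :: "('x, 'r) connection"
  assumes V: "vector_bundle X S T" and H: "holo_connection X S T nab"
begin

lemmas conn = H[unfolded holo_connection_def, THEN spec, THEN spec, THEN mp, THEN mp]

lemma nab_sgerm:
  assumes "sgerm X T p s" "p \<in> S" "c \<in> X" "p \<in> fst c"
  shows "sgerm X T p (nab c s)"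
proof -
  obtain W where W: "open W" "p \<in> W" "W \<subseteq> S" "holo_section X T W s"
    by (rule sgerm_section'[OF V assms(1) assms(2)])
  have "holo_section X T (W \<inter> fst c) (nab c s)"
    using conn[OF W(3,4), THEN conjunct1] assms(3) by blast
  then show ?thesis unfolding section_iff[OF RS V] using W assms(4) by blast
qed

lemma nab_cong:
  assumes "sgerm X T p s" "p \<in> S" "c \<in> X" "p \<in> fst c" "\<forall>\<^sub>F q in nhds p. s' q = s q"
  shows "nab c s' p = nab c s p"
proof -
  obtain N where N: "open N" "p \<in> N" "\<forall>q\<in>N. s' q = s q" using assms(5) unfolding eventually_nhds by blast
  obtain W where W: "open W" "p \<in> W" "W \<subseteq> N" "W \<subseteq> S" "holo_section X T W s"
    by (rule sgerm_section[OF V assms(1) N(1,2) assms(2)])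
  have "\<forall>q\<in>W. s' q = s q" using W(3) N(3) by blast
  then have "\<forall>c\<in>X. \<forall>q\<in>W \<inter> fst c. nab c s' q = nab c s q"
    using conn[OF W(4,5), THEN conjunct2, THEN conjunct1, THEN spec, THEN mp] by blast
  then show ?thesis using W(2) assms(3,4) by blast
qed

lemma nab_add:
  assumes "sgerm X T p s" "sgerm X T p s'" "p \<in> S" "c \<in> X" "p \<in> fst c"
  shows "nab c (\<lambda>q. s q + s' q) p = nab c s p + nab c s' p"
proof -
  obtain N where N: "open N" "p \<in> N" "N \<subseteq> S" "holo_section X T N s"
    by (rule sgerm_section'[OF V assms(1) assms(3)])
  obtain W where W: "open W" "p \<in> W" "W \<subseteq> N" "W \<subseteq> S" "holo_section X T W s'"
    by (rule sgerm_section[OF V assms(2) N(1,2) assms(3)])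
  have "holo_section X T W s" using N(4) W unfolding section_iff[OF RS V] by blast
  have "\<forall>c\<in>X. \<forall>p\<in>W \<inter> fst c. nab c (\<lambda>q. s q + s' q) p = nab c s p + nab c s' p"
    using conn[OF W(4) \<open>holo_section X T W s\<close>, THEN conjunct2, THEN conjunct2, THEN conjunct1, THEN spec, THEN mp, OF W(5)] .
  then show ?thesis using W(2) assms(4,5) by blast
qed

lemma nab_scale:
  assumes "sgerm X T p s" "holo_germ X p h" "p \<in> S" "c \<in> X" "p \<in> fst c"
  shows "nab c (\<lambda>q. h q *s s q) p = chart_deriv c h p *s s p + h p *s nab c s p"
proof -
  obtain N where N: "p \<in> N" "open N" "holo X N h" using assms(2) unfolding holo_germ_def holo_def by blast
  obtain W where W: "open W" "p \<in> W" "W \<subseteq> N" "W \<subseteq> S" "holo_section X T W s"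
    by (rule sgerm_section[OF V assms(1) N(2,1) assms(3)])
  have "holo X W h" using N(3) W unfolding holo_iff[OF RS] by blast
  then have "\<forall>c\<in>X. \<forall>p\<in>W \<inter> fst c. nab c (\<lambda>q. h q *s s q) p = chart_deriv c h p *s s p + h p *s nab c s p"
    by (rule conn[OF W(4,5), THEN conjunct2, THEN conjunct2, THEN conjunct2, THEN conjunct1, THEN spec, THEN mp])
  then show ?thesis using W(2) assms(4,5) by blast
qed

lemma nab_change:
  assumes "sgerm X T p s" "p \<in> S" "c \<in> X" "p \<in> fst c" "c' \<in> X" "p \<in> fst c'"
  shows "nab c' s p = chart_deriv c' (snd c) p *s nab c s p"
proof -
  obtain W where W: "open W" "p \<in> W" "W \<subseteq> S" "holo_section X T W s"
    by (rule sgerm_section'[OF V assms(1) assms(2)])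
  have "\<forall>c\<in>X. \<forall>c'\<in>X. \<forall>p\<in>W \<inter> fst c \<inter> fst c'. nab c' s p = chart_deriv c' (snd c) p *s nab c s p"
    by (rule conn[OF W(3,4), THEN conjunct2, THEN conjunct2, THEN conjunct2, THEN conjunct2])
  then show ?thesis using W(2) assms(3-6) by blast
qed

lemma sgerm_zero: "sgerm X T p (\<lambda>q. 0)"
  by (simp add: sgerm_def hvec_const[OF RS])

lemma nab_zero: "p \<in> S \<Longrightarrow> c \<in> X \<Longrightarrow> p \<in> fst c \<Longrightarrow> nab c (\<lambda>q. 0) p = 0"
  using nab_scale[OF sgerm_zero holo_germ_const[OF RS, of _ 0], of p c] by simp

lemma nab_sum:
  assumes "\<And>i. i \<in> I \<Longrightarrow> sgerm X T p (s i)" "p \<in> S" "c \<in> X" "p \<in> fst c"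
  shows "nab c (\<lambda>q. \<Sum>i\<in>I. s i q) p = (\<Sum>i\<in>I. nab c (s i) p)"
  using assms(1)
proof (induction I rule: infinite_finite_induct)
  case (insert i I)
  then show ?case
    using nab_add[OF _ sgerm_sum[OF RS V] assms(2-4), of "s i" I s] by simp
qed (simp_all add: nab_zero[OF assms(2-4)])

end

text \<open>All axioms are local, so their pointwise forms imply them; this is how the pulled back
  connection is recognized.\<close>

lemma holo_connectionI:
  fixes T :: "('x, 'r::finite) bundle_atlas"
  assumes V: "vector_bundle X S T"
    and h: "\<And>p c s. p \<in> S \<Longrightarrow> c \<in> X \<Longrightarrow> p \<in> fst c \<Longrightarrow> sgerm X T p s \<Longrightarrow> sgerm X T p (nab c s)"
    and cong: "\<And>p c s s'. p \<in> S \<Longrightarrow> c \<in> X \<Longrightarrow> p \<in> fst c \<Longrightarrow> sgerm X T p s \<Longrightarrow>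
       \<forall>\<^sub>F q in nhds p. s' q = s q \<Longrightarrow> nab c s' p = nab c s p"
    and add: "\<And>p c s s'. p \<in> S \<Longrightarrow> c \<in> X \<Longrightarrow> p \<in> fst c \<Longrightarrow> sgerm X T p s \<Longrightarrow> sgerm X T p s' \<Longrightarrow>
       nab c (\<lambda>q. s q + s' q) p = nab c s p + nab c s' p"
    and scale: "\<And>p c s h. p \<in> S \<Longrightarrow> c \<in> X \<Longrightarrow> p \<in> fst c \<Longrightarrow> sgerm X T p s \<Longrightarrow> holo_germ X p h \<Longrightarrow>
       nab c (\<lambda>q. h q *s s q) p = chart_deriv c h p *s s p + h p *s nab c s p"
    and change: "\<And>p c c' s. p \<in> S \<Longrightarrow> c \<in> X \<Longrightarrow> c' \<in> X \<Longrightarrow> p \<in> fst c \<Longrightarrow> p \<in> fst c' \<Longrightarrow> sgerm X T p s \<Longrightarrow>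
       nab c' s p = chart_deriv c' (snd c) p *s nab c s p"
  shows "holo_connection X S T nab"
  unfolding holo_connection_def
proof (intro allI impI)
  fix W s assume W: "W \<subseteq> S" and "holo_section X T W s"
  then have o: "open W" and s: "\<And>p. p \<in> W \<Longrightarrow> sgerm X T p s" unfolding section_iff[OF RS V] by auto
  show "(\<forall>c\<in>X. holo_section X T (W \<inter> fst c) (nab c s)) \<and>
        (\<forall>s'. (\<forall>p\<in>W. s' p = s p) \<longrightarrow> (\<forall>c\<in>X. \<forall>p\<in>W \<inter> fst c. nab c s' p = nab c s p)) \<and>
        (\<forall>s'. holo_section X T W s' \<longrightarrow>
           (\<forall>c\<in>X. \<forall>p\<in>W \<inter> fst c. nab c (\<lambda>q. s q + s' q) p = nab c s p + nab c s' p)) \<and>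
        (\<forall>h. holo X W h \<longrightarrow> (\<forall>c\<in>X. \<forall>p\<in>W \<inter> fst c.
              nab c (\<lambda>q. h q *s s q) p = chart_deriv c h p *s s p + h p *s nab c s p)) \<and>
        (\<forall>c\<in>X. \<forall>c'\<in>X. \<forall>p\<in>W \<inter> fst c \<inter> fst c'. nab c' s p = chart_deriv c' (snd c) p *s nab c s p)"
  proof (intro conjI allI impI ballI)
    fix c assume c: "c \<in> X"
    show "holo_section X T (W \<inter> fst c) (nab c s)"
      unfolding section_iff[OF RS V] using o chart_props(1)[OF RS c] h[OF _ c _ s] W by blast
  next
    fix s' c p assume "\<forall>p\<in>W. s' p = s p" "c \<in> X" "p \<in> W \<inter> fst c"
    moreover from this have "\<forall>\<^sub>F q in nhds p. s' q = s q"
      using eventually_nhds_in_open[OF o, of p] by (auto elim: eventually_mono)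
    ultimately show "nab c s' p = nab c s p" using cong[OF _ _ _ s] W by blast
  next
    fix s' c p assume "holo_section X T W s'" "c \<in> X" "p \<in> W \<inter> fst c"
    then show "nab c (\<lambda>q. s q + s' q) p = nab c s p + nab c s' p"
      using add[OF _ _ _ s] W unfolding section_iff[OF RS V] by blast
  next
    fix h c p assume "holo X W h" "c \<in> X" "p \<in> W \<inter> fst c"
    then show "nab c (\<lambda>q. h q *s s q) p = chart_deriv c h p *s s p + h p *s nab c s p"
      using scale[OF _ _ _ s] W unfolding holo_iff[OF RS] by blast
  next
    fix c c' p assume "c \<in> X" "c' \<in> X" "p \<in> W \<inter> fst c \<inter> fst c'"
    then show "nab c' s p = chart_deriv c' (snd c) p *s nab c s p"
      using change[OF _ _ _ _ _ s] W by blast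
  qed
qed

text \<open>The axioms see a bundle only through its holomorphic sections, and over
  \<open>- D\<close> these are the same for both atlases.\<close>

lemma holo_connection_presents:
  assumes "presents X D V E"
  shows "holo_connection X (- D) (triv V) nab \<longleftrightarrow> holo_connection X (- D) (atlas E) nab"
proof -
  have eq: "W \<subseteq> - D \<Longrightarrow> holo_section X (triv V) W s \<longleftrightarrow> holo_section X (atlas E) W s" for W s
    using assms by (simp add: presents_def)
  have eq': "W \<subseteq> - D \<Longrightarrow> holo_section X (triv V) (W \<inter> Q) s \<longleftrightarrow> holo_section X (atlas E) (W \<inter> Q) s" for W Q s
    using eq[of "W \<inter> Q"] by blast
  show ?thesis unfolding holo_connection_def by (simp add: eq eq' cong: imp_cong)
qed

end

section \<open>The pulled back connection\<close>

context covering
begin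

context
  fixes D :: "'x set" and E :: "('x, 'r::finite) filtered_bundle" and nab :: "('x, 'r) connection"
  assumes VE: "vector_bundle X (- D) (atlas E)" and H: "holo_connection X (- D) (atlas E) nab"
begin

abbreviation (input) "nab' \<equiv> pullback_connection X f E nab"

lemma triv_at_props:
  assumes "p \<notin> D"
  shows "compat X (atlas E) p (snd (triv_at (atlas E) p))"
proof -
  have "\<exists>c. c \<in> atlas E \<and> p \<in> fst c" using triv_ex[OF RX VE, of p] assms by force
  from someI_ex[OF this] have "triv_at (atlas E) p \<in> atlas E" "p \<in> fst (triv_at (atlas E) p)"
    unfolding triv_at_def by auto
  then show ?thesis using triv_compat[OF RX VE, of "fst (triv_at (atlas E) p)" "snd (triv_at (atlas E) p)" p] by simp
qed

lemma pullback_connection_eq: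
  "pullback_connection X f E nab c s y =
     (let g = snd (triv_at (atlas E) (f y)); cX = chart_at X (f y) in
      \<Sum>i\<in>UNIV. chart_deriv c (\<lambda>q. (g (f q) *v s q) $ i) y *s (matrix_inv (g (f y)) *v axis i 1)
           + ((g (f y) *v s y) $ i * chart_deriv c (snd cX \<circ> f) y) *s
              nab cX (\<lambda>p. matrix_inv (g p) *v axis i 1) (f y))"
  unfolding pullback_connection_def Let_def by (simp add: column_axis)

context
  fixes y :: 'y and c :: "'y chart"
  assumes y: "f y \<notin> D" and c: "c \<in> Y" "y \<in> fst c"
begin

lemma pull_sgerm: "sgerm X (atlas E) (f y) e \<Longrightarrow> sgerm Y (atlas (pullback_bundle Y X f E)) y (\<lambda>q. e (f q))"
  unfolding sgerm_def atlas_pullback using hvec_pull by fastforce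

lemma pullback_vb: "vector_bundle Y (- f -` D) (atlas (pullback_bundle Y X f E))"
  using vector_bundle_pullback[OF VE] by (simp add: vimage_Compl)

lemma pull_coordinates:
  assumes "compat X (atlas E) (f y) \<gamma>" "sgerm Y (atlas (pullback_bundle Y X f E)) y s"
  shows "holo_germ Y y (\<lambda>q. (\<gamma> (f q) *v s q) $ i)"
  using assms(2) unfolding compat_sgerm[OF RY pullback_vb compat_pullback[OF assms(1)]] hvec_def by blast

lemma pb_cong:
  assumes "\<forall>\<^sub>F q in nhds y. s' q = s q"
  shows "nab' c s' y = nab' c s y"
proof -
  have "chart_deriv c (\<lambda>q. (g (f q) *v s' q) $ i) y = chart_deriv c (\<lambda>q. (g (f q) *v s q) $ i) y"
    for g :: "'x \<Rightarrow> complex ^ 'r ^ 'r" and i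
    by (rule chart_deriv_eqI[OF RY c]) (use assms in \<open>auto elim: eventually_mono\<close>)
  then show ?thesis unfolding pullback_connection_eq Let_def
    using eventually_nhds_x_imp_x[OF assms] by simp
qed

lemma pb_add:
  assumes "sgerm Y (atlas (pullback_bundle Y X f E)) y s" "sgerm Y (atlas (pullback_bundle Y X f E)) y s'"
  shows "nab' c (\<lambda>q. s q + s' q) y = nab' c s y + nab' c s' y"
  unfolding pullback_connection_eq Let_def
  by (simp add: matrix_vector_right_distrib chart_deriv_add[OF RY c]
      pull_coordinates[OF triv_at_props[OF y]] assms)
     (simp add: vec_eq_iff sum.distrib[symmetric] algebra_simps)

text \<open>In particular the frame and the chart in the definition of the pulled back connection do not matter.\<close>

lemma pb_pull:
  assumes e: "sgerm X (atlas E) (f y) e" and a: "holo_germ Y y a" and cX: "cX \<in> X" "f y \<in> fst cX"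
  shows "nab' c (\<lambda>q. a q *s e (f q)) y =
    chart_deriv c a y *s e (f y) + (a y * chart_deriv c (snd cX \<circ> f) y) *s nab cX e (f y)"
proof -
  define g where "g = snd (triv_at (atlas E) (f y))"
  define c0 where "c0 = chart_at X (f y)"
  define e0 where "e0 i p = matrix_inv (g p) *v axis i 1" for i p
  \<comment> \<open>Coefficients of \<open>e\<close> in the frame \<open>e0\<close> that the
    definition of the pullback selects at \<open>f y\<close>.\<close>
  define t where "t i p = (g p *v e p) $ i" for i p
  define dz where "dz = chart_deriv c (snd c0 \<circ> f) y"
  have c0: "c0 \<in> X" "f y \<in> fst c0" using chart_at[OF RX] by (auto simp: c0_def)
  have g: "compat X (atlas E) (f y) g" unfolding g_def by (rule triv_at_props[OF y])
  have S: "f y \<in> - D" using y by simp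
  have e0: "sgerm X (atlas E) (f y) (e0 i)" for i
    unfolding e0_def[abs_def] by (rule sgerm_frame[OF RX VE g])
  have t: "holo_germ X (f y) (t i)" for i
    using e unfolding compat_sgerm[OF RX VE g] hvec_def t_def[abs_def] by blast
  have inv: "\<forall>\<^sub>F p in nhds (f y). invertible (g p)" using g by (simp add: compat_def)
  have e_eq: "\<forall>\<^sub>F p in nhds (f y). e p = (\<Sum>i\<in>UNIV. t i p *s e0 i p)"
    using inv
  proof eventually_elim
    case (elim p)
    have "e p = matrix_inv (g p) *v (g p *v e p)" using elim by simp
    also have "\<dots> = matrix_inv (g p) *v (\<Sum>i\<in>UNIV. t i p *s axis i 1)"
      unfolding t_def by (subst vec_eq_sum_axis) simp
    also have "\<dots> = (\<Sum>i\<in>UNIV. t i p *s e0 i p)"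
      by (simp add: matrix_vector_sum vector_scalar_commute e0_def)
    finally show ?case .
  qed
  have nab_e: "nab c0 e (f y) = (\<Sum>i\<in>UNIV. chart_deriv c0 (t i) (f y) *s e0 i (f y) + t i (f y) *s nab c0 (e0 i) (f y))"
  proof -
    have sg: "sgerm X (atlas E) (f y) (\<lambda>q. t i q *s e0 i q)" for i
      by (rule sgerm_scale[OF RX VE t e0])
    have "nab c0 e (f y) = nab c0 (\<lambda>q. \<Sum>i\<in>UNIV. t i q *s e0 i q) (f y)"
      by (rule nab_cong[OF RX VE H sgerm_sum[OF RX VE sg] S c0 e_eq])
    also have "\<dots> = (\<Sum>i\<in>UNIV. nab c0 (\<lambda>q. t i q *s e0 i q) (f y))"
      by (rule nab_sum[OF RX VE H sg S c0])
    also have "\<dots> = (\<Sum>i\<in>UNIV. chart_deriv c0 (t i) (f y) *s e0 i (f y) + t i (f y) *s nab c0 (e0 i) (f y))"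
      by (intro sum.cong[OF refl] nab_scale[OF RX VE H e0 t S c0])
    finally show ?thesis .
  qed
  have cd: "chart_deriv c (\<lambda>q. (g (f q) *v (a q *s e (f q))) $ i) y
      = chart_deriv c a y * t i (f y) + a y * (chart_deriv c0 (t i) (f y) * dz)" for i
  proof -
    have "chart_deriv c (\<lambda>q. (g (f q) *v (a q *s e (f q))) $ i) y = chart_deriv c (\<lambda>q. a q * (t i \<circ> f) q) y"
      by (simp add: t_def vector_scalar_commute)
    also have "\<dots> = chart_deriv c a y * (t i \<circ> f) y + a y * chart_deriv c (t i \<circ> f) y"
      by (rule chart_deriv_mult[OF RY c a holo_germ_pull[OF t]])
    also have "chart_deriv c (t i \<circ> f) y = chart_deriv c0 (t i) (f y) * dz"
      unfolding dz_def by (rule chart_deriv_pull[OF c0 c t])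
    finally show ?thesis by simp
  qed
  have "nab' c (\<lambda>q. a q *s e (f q)) y = (\<Sum>i\<in>UNIV.
      (chart_deriv c a y * t i (f y) + a y * (chart_deriv c0 (t i) (f y) * dz)) *s e0 i (f y)
      + (a y * t i (f y) * dz) *s nab c0 (e0 i) (f y))"
    unfolding pullback_connection_eq Let_def g_def[symmetric] c0_def[symmetric] cd dz_def[symmetric]
      e0_def[symmetric] by (simp add: t_def vector_scalar_commute e0_def[abs_def])
  also have "\<dots> = chart_deriv c a y *s (\<Sum>i\<in>UNIV. t i (f y) *s e0 i (f y))
      + (a y * dz) *s (\<Sum>i\<in>UNIV. chart_deriv c0 (t i) (f y) *s e0 i (f y) + t i (f y) *s nab c0 (e0 i) (f y))"
    by (simp add: vec_eq_iff sum_distrib_left sum.distrib[symmetric] algebra_simps)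
  also have "\<dots> = chart_deriv c a y *s e (f y) + (a y * dz) *s nab c0 e (f y)"
    unfolding nab_e[symmetric] eventually_nhds_x_imp_x[OF e_eq, symmetric] ..
  \<comment> \<open>The derivative of one chart of \<open>X\<close> by the other occurs once in
    \<open>dz\<close> and once in \<open>nab cX\<close>; moving it across expresses that a one-form
    is pulled back.\<close>
  also have "(a y * dz) *s nab c0 e (f y) = (a y * chart_deriv c (snd cX \<circ> f) y) *s nab cX e (f y)"
  proof -
    have "dz = chart_deriv cX (snd c0) (f y) * chart_deriv c (snd cX \<circ> f) y"
      unfolding dz_def by (rule chart_deriv_pull[OF cX c holo_germ_chart[OF RX c0]])
    moreover have "nab cX e (f y) = chart_deriv cX (snd c0) (f y) *s nab c0 e (f y)"
      by (rule nab_change[OF RX VE H e S c0 cX])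
    ultimately show ?thesis by (simp add: vector_smult_assoc mult_ac)
  qed
  finally show ?thesis .
qed

lemma pb_sum:
  assumes "\<And>i. i \<in> I \<Longrightarrow> sgerm Y (atlas (pullback_bundle Y X f E)) y (s i)"
  shows "nab' c (\<lambda>q. \<Sum>i\<in>I. s i q) y = (\<Sum>i\<in>I. nab' c (s i) y)"
  using assms
proof (induction I rule: infinite_finite_induct)
  case (insert i I)
  then show ?case
    using pb_add[OF _ sgerm_sum[OF RY pullback_vb], of "s i" I s] by simp
qed (simp_all add: pullback_connection_eq Let_def chart_deriv_const[OF RY])

end

lemma pull_frame:
  assumes \<gamma>: "compat X (atlas E) (f y) \<gamma>"
  shows "\<forall>\<^sub>F q in nhds y. s q = (\<Sum>i\<in>UNIV. (\<gamma> (f q) *v s q) $ i *s (matrix_inv (\<gamma> (f q)) *v axis i 1))"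
proof -
  have "\<forall>\<^sub>F p in nhds (f y). invertible (\<gamma> p)" using \<gamma> by (simp add: compat_def)
  from eventually_nhds_f[OF this] show ?thesis
  proof eventually_elim
    case (elim q)
    have "s q = matrix_inv (\<gamma> (f q)) *v (\<gamma> (f q) *v s q)" using elim by simp
    also have "\<dots> = matrix_inv (\<gamma> (f q)) *v (\<Sum>i\<in>UNIV. (\<gamma> (f q) *v s q) $ i *s axis i 1)"
      by (subst vec_eq_sum_axis) simp
    finally show ?case by (simp add: matrix_vector_sum vector_scalar_commute)
  qed
qed

text \<open>The definition selects a frame and a chart anew at every point. To see that the result
  varies holomorphically, one frame \<open>\<gamma>\<close> and one chart \<open>cX\<close> must
  serve all points of a neighbourhood.\<close>

lemma pb_expand:
  assumes y: "f y \<notin> D" and c: "c \<in> Y" "y \<in> fst c" and \<gamma>: "compat X (atlas E) (f y) \<gamma>"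
    and cX: "cX \<in> X" "f y \<in> fst cX" and s: "sgerm Y (atlas (pullback_bundle Y X f E)) y s"
  shows "nab' c s y = (\<Sum>i\<in>UNIV. chart_deriv c (\<lambda>q. (\<gamma> (f q) *v s q) $ i) y *s (matrix_inv (\<gamma> (f y)) *v axis i 1)
     + ((\<gamma> (f y) *v s y) $ i * chart_deriv c (snd cX \<circ> f) y) *s nab cX (\<lambda>p. matrix_inv (\<gamma> p) *v axis i 1) (f y))"
proof -
  let ?a = "\<lambda>i q. (\<gamma> (f q) *v s q) $ i" and ?e = "\<lambda>i p. matrix_inv (\<gamma> p) *v axis i 1"
  have e: "sgerm X (atlas E) (f y) (?e i)" for i by (rule sgerm_frame[OF RX VE \<gamma>])
  have a: "holo_germ Y y (?a i)" for i by (rule pull_coordinates[OF y c \<gamma> s])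
  have "nab' c s y = nab' c (\<lambda>q. \<Sum>i\<in>UNIV. ?a i q *s ?e i (f q)) y"
    by (rule pb_cong[OF y c pull_frame[OF \<gamma>]])
  also have "\<dots> = (\<Sum>i\<in>UNIV. nab' c (\<lambda>q. ?a i q *s ?e i (f q)) y)"
    by (rule pb_sum[OF y c]) (rule sgerm_scale[OF RY pullback_vb[OF y c] a pull_sgerm[OF y c e]])
  also have "\<dots> = (\<Sum>i\<in>UNIV. chart_deriv c (?a i) y *s ?e i (f y)
     + (?a i y * chart_deriv c (snd cX \<circ> f) y) *s nab cX (?e i) (f y))"
    by (intro sum.cong[OF refl] pb_pull[OF y c e a cX])
  finally show ?thesis .
qed

lemma pullback_holo_connection:
  "holo_connection Y (- f -` D) (atlas (pullback_bundle Y X f E)) nab'"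
proof (rule holo_connectionI[OF RY])
  show VP: "vector_bundle Y (- f -` D) (atlas (pullback_bundle Y X f E))"
    using vector_bundle_pullback[OF VE] by (simp add: vimage_Compl)
  fix y c and s :: "'y \<Rightarrow> complex ^ 'r"
  assume "y \<in> - f -` D" and c: "c \<in> Y" "y \<in> fst c" and s: "sgerm Y (atlas (pullback_bundle Y X f E)) y s"
  then have y: "f y \<notin> D" by simp
  define \<gamma> where "\<gamma> = snd (triv_at (atlas E) (f y))"
  define cX where "cX = chart_at X (f y)"
  have \<gamma>: "compat X (atlas E) (f y) \<gamma>" unfolding \<gamma>_def by (rule triv_at_props[OF y])
  have cX: "cX \<in> X" "f y \<in> fst cX" using chart_at[OF RX] by (auto simp: cX_def)
  let ?a = "\<lambda>i q. (\<gamma> (f q) *v s q) $ i" and ?e = "\<lambda>i p. matrix_inv (\<gamma> p) *v axis i 1"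
  have a: "holo_germ Y y (?a i)" for i by (rule pull_coordinates[OF y c \<gamma> s])
  have S: "f y \<in> - D" using y by simp
  have z: "holo_germ Y y (chart_deriv c (snd cX \<circ> f))"
    by (rule holo_germ_chart_deriv[OF RY c holo_germ_chart_f[OF cX]])
  note e = sgerm_frame[OF RX VE \<gamma>]
  show "sgerm Y (atlas (pullback_bundle Y X f E)) y (nab' c s)"
  proof -
    have "\<forall>\<^sub>F q in nhds y. f q \<in> - D \<and> q \<in> fst c \<and> compat X (atlas E) (f q) \<gamma> \<and> f q \<in> fst cX \<and>
        sgerm Y (atlas (pullback_bundle Y X f E)) q s"
      using eventually_nhds_f[OF eventually_nhds_in_open[OF open_base[OF RX VE] S]]
        eventually_chart_domain[OF RY c] eventually_nhds_f[OF compat_eventually[OF RX VE \<gamma>]]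
        eventually_nhds_f[OF eventually_chart_domain[OF RX cX]] sgerm_eventually[OF RY VP s]
        \<open>y \<in> - f -` D\<close> by (simp add: eventually_conj_iff)
    then have ev: "\<forall>\<^sub>F q in nhds y. nab' c s q = (\<Sum>i\<in>UNIV. chart_deriv c (?a i) q *s ?e i (f q)
        + (?a i q * chart_deriv c (snd cX \<circ> f) q) *s nab cX (?e i) (f q))"
      by eventually_elim (rule pb_expand, use c cX in auto)
    have "sgerm Y (atlas (pullback_bundle Y X f E)) y (\<lambda>q. \<Sum>i\<in>UNIV. chart_deriv c (?a i) q *s ?e i (f q)
        + (?a i q * chart_deriv c (snd cX \<circ> f) q) *s nab cX (?e i) (f q))"
      by (intro sgerm_sum[OF RY VP] sgerm_add[OF RY VP] sgerm_scale[OF RY VP] pull_sgerm[OF y c]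
          holo_germ_mult[OF RY] holo_germ_chart_deriv[OF RY c] a e z nab_sgerm[OF RX VE H] S cX)
    then show ?thesis using sgerm_cong[OF RY VP ev] by blast
  qed
  show "nab' c s' y = nab' c s y" if "\<forall>\<^sub>F q in nhds y. s' q = s q" for s'
    by (rule pb_cong[OF y c that])
  show "nab' c (\<lambda>q. s q + s' q) y = nab' c s y + nab' c s' y"
    if "sgerm Y (atlas (pullback_bundle Y X f E)) y s'" for s'
    by (rule pb_add[OF y c s that])
  show "nab' c (\<lambda>q. h q *s s q) y = chart_deriv c h y *s s y + h y *s nab' c s y" if h: "holo_germ Y y h" for h
  proof -
    have hs: "sgerm Y (atlas (pullback_bundle Y X f E)) y (\<lambda>q. h q *s s q)"
      by (rule sgerm_scale[OF RY VP h s])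
    have "chart_deriv c (\<lambda>q. (\<gamma> (f q) *v (h q *s s q)) $ i) y = chart_deriv c h y * ?a i y + h y * chart_deriv c (?a i) y" for i
      using chart_deriv_mult[OF RY c h a] by (simp add: vector_scalar_commute)
    then have "nab' c (\<lambda>q. h q *s s q) y = (\<Sum>i\<in>UNIV. (chart_deriv c h y * ?a i y + h y * chart_deriv c (?a i) y) *s ?e i (f y)
        + (h y * ?a i y * chart_deriv c (snd cX \<circ> f) y) *s nab cX (?e i) (f y))"
      unfolding pb_expand[OF y c \<gamma> cX hs] by (simp add: vector_scalar_commute)
    also have "\<dots> = chart_deriv c h y *s (\<Sum>i\<in>UNIV. ?a i y *s ?e i (f y)) + h y *s (\<Sum>i\<in>UNIV. chart_deriv c (?a i) y *s ?e i (f y)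
        + (?a i y * chart_deriv c (snd cX \<circ> f) y) *s nab cX (?e i) (f y))"
      by (simp add: vec_eq_iff sum_distrib_left sum.distrib[symmetric] algebra_simps)
    also have "\<dots> = chart_deriv c h y *s s y + h y *s nab' c s y"
      using eventually_nhds_x_imp_x[OF pull_frame[OF \<gamma>, of s]] pb_expand[OF y c \<gamma> cX s] by simp
    finally show ?thesis .
  qed
  show "nab' c' s y = chart_deriv c' (snd c) y *s nab' c s y" if c': "c' \<in> Y" "y \<in> fst c'" for c'
    unfolding pb_expand[OF y c \<gamma> cX s] pb_expand[OF y c' \<gamma> cX s]
      chart_deriv_change[OF RY c(1) c'(1) c(2) c'(2) a] chart_deriv_change[OF RY c(1) c'(1) c(2) c'(2) holo_germ_chart_f[OF cX]]
    by (simp add: vec_eq_iff sum_distrib_left algebra_simps)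
qed

end

end

section \<open>Logarithmic connections and residues\<close>

text \<open>The operator \<open>z \<nabla>\<^bsub>d/dz\<^esub>\<close>, whose value at \<open>x\<close> is the residue.\<close>

definition euler :: "'x chart set \<Rightarrow> ('x, 'r) connection \<Rightarrow> 'x \<Rightarrow> ('x \<Rightarrow> complex ^ 'r) \<Rightarrow> 'x \<Rightarrow> complex ^ 'r" where
  "euler X nab x s p = coord X x p *s nab (chart_at X x) s p"

section \<open>The Euler operator on germs\<close>

context
  fixes X :: "'x::t2_space chart set"
  assumes RS: "riemann_surface X"
begin

lemma splits_sgerm:
  assumes sp: "splits X E x \<gamma> \<alpha>" and VE: "vector_bundle X S (atlas E)" and s: "s \<in> germs E x t"
  shows "\<forall>\<^sub>F p in at x. sgerm X (atlas E) p s"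
proof -
  have "\<forall>\<^sub>F p in at x. holo_germ X p (\<lambda>p. (\<gamma> p *v s p) $ i)" for i
    by (rule ord_ge_eventually_holo_germ[OF RS s[unfolded germs_splits[OF RS sp], rule_format]])
  then have "\<forall>\<^sub>F p in at x. \<forall>i. holo_germ X p (\<lambda>p. (\<gamma> p *v s p) $ i)"
    by (simp add: eventually_all_finite)
  moreover have "\<forall>\<^sub>F p in at x. compat X (atlas E) p \<gamma>" using sp by (simp add: splits_def)
  ultimately show ?thesis
  proof eventually_elim
    case (elim p)
    then show ?case using compat_sgerm[OF RS VE elim(2), of s] unfolding hvec_def by blast
  qed
qed

context
  fixes D :: "'x set" and E :: "('x, 'r::finite) filtered_bundle" and nab :: "('x, 'r) connection"
  assumes D: "finite D" and VE: "vector_bundle X (- D) (atlas E)"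
    and H: "holo_connection X (- D) (atlas E) nab"
begin

text \<open>Leibniz rule on punctured neighbourhoods. The coefficient \<open>c\<close> may have a
  pole at \<open>x\<close>, as powers of the coordinate do.\<close>

lemma euler_scale:
  assumes s: "\<forall>\<^sub>F p in at x. s p = c p *s u p" and c: "\<forall>\<^sub>F p in at x. holo_germ X p c"
    and u: "\<forall>\<^sub>F p in at x. sgerm X (atlas E) p u"
  shows "\<forall>\<^sub>F p in at x. euler X nab x s p =
    (coord X x p * chart_deriv (chart_at X x) c p) *s u p + c p *s euler X nab x u p"
  using eventually_at_nhds[OF s] c u eventually_notin_finite[OF D, of x] eventually_at_coord[OF RS, of x]
proof eventually_elim
  case (elim p)
  then have p: "p \<in> - D" "chart_at X x \<in> X" "p \<in> fst (chart_at X x)" using chart_at[OF RS] by auto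
  have "nab (chart_at X x) s p = nab (chart_at X x) (\<lambda>q. c q *s u q) p"
    using elim by (intro nab_cong[OF RS VE H _ p] sgerm_scale[OF RS VE]) auto
  also have "\<dots> = chart_deriv (chart_at X x) c p *s u p + c p *s nab (chart_at X x) u p"
    using elim by (intro nab_scale[OF RS VE H _ _ p]) auto
  finally show ?case by (simp add: euler_def vec_eq_iff algebra_simps)
qed

lemma euler_add:
  assumes s: "\<forall>\<^sub>F p in at x. s p = a p + b p" and a: "\<forall>\<^sub>F p in at x. sgerm X (atlas E) p a"
    and b: "\<forall>\<^sub>F p in at x. sgerm X (atlas E) p b"
  shows "\<forall>\<^sub>F p in at x. euler X nab x s p = euler X nab x a p + euler X nab x b p"
  using eventually_at_nhds[OF s] a b eventually_notin_finite[OF D, of x] eventually_at_coord[OF RS, of x]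
proof eventually_elim
  case (elim p)
  then have p: "p \<in> - D" "chart_at X x \<in> X" "p \<in> fst (chart_at X x)" using chart_at[OF RS] by auto
  have "nab (chart_at X x) s p = nab (chart_at X x) (\<lambda>q. a q + b q) p"
    using elim by (intro nab_cong[OF RS VE H _ p] sgerm_add[OF RS VE]) auto
  also have "\<dots> = nab (chart_at X x) a p + nab (chart_at X x) b p"
    using elim by (intro nab_add[OF RS VE H _ _ p]) auto
  finally show ?case by (simp add: euler_def vec_eq_iff algebra_simps)
qed

lemma euler_zero: "\<forall>\<^sub>F p in at x. euler X nab x (\<lambda>_. 0) p = 0"
  using eventually_notin_finite[OF D, of x] eventually_at_coord[OF RS, of x]
proof eventually_elim
  case (elim p)
  then have p: "p \<in> - D" "chart_at X x \<in> X" "p \<in> fst (chart_at X x)" using chart_at[OF RS] by auto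
  show ?case using nab_zero[OF RS VE H p] by (simp add: euler_def)
qed

end

text \<open>In a frame at \<open>x\<close> all coordinates of \<open>d\<close> vanish and are
  divisible by the local coordinate. This is what lets the residue depend on the value of a section
  at \<open>x\<close> alone.\<close>

lemma section_divide:
  fixes T :: "('x, 'r::finite) bundle_atlas"
  assumes V: "vector_bundle X UNIV T" and d: "sgerm X T x d" "d x = 0"
  shows "\<exists>r. sgerm X T x r \<and> (\<forall>\<^sub>F p in at x. d p = coord X x p *s r p)"
proof -
  obtain U g where U: "(U, g) \<in> T" "x \<in> U" using triv_ex[OF RS V] by blast
  note c = triv_compat[OF RS V U]
  have h: "holo_germ X x (\<lambda>p. (g p *v d p) $ i)" for i
    using d(1) unfolding compat_sgerm[OF RS V c] hvec_def by blast
  have "ord_ge X x 1 (\<lambda>p. (g p *v d p) $ i)" for i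
    using ord_ge_1_iff[OF RS h] d(2) by simp
  then have "\<forall>i. \<exists>k. holo_germ X x k \<and> (\<forall>\<^sub>F p in at x. (g p *v d p) $ i = coord X x p powi 1 * k p)"
    unfolding ord_ge_def by blast
  from choice[OF this] obtain k where k: "\<And>i. holo_germ X x (k i)"
    "\<And>i. \<forall>\<^sub>F p in at x. (g p *v d p) $ i = coord X x p powi 1 * k i p" by blast
  define r where "r p = matrix_inv (g p) *v (\<chi> i. k i p)" for p
  have inv: "\<forall>\<^sub>F p in nhds x. invertible (g p)" using c by (simp add: compat_def)
  have gr: "\<forall>\<^sub>F p in nhds x. g p *v r p = (\<chi> i. k i p)"
    using inv by eventually_elim (simp add: r_def)
  have "hvec X x (\<lambda>p. g p *v r p)"
    by (rule hvec_cong[OF RS gr, THEN iffD2]) (simp add: hvec_def k(1))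
  then have "sgerm X T x r" unfolding compat_sgerm[OF RS V c] .
  moreover have "\<forall>\<^sub>F p in at x. \<forall>i. (g p *v d p) $ i = coord X x p powi 1 * k i p"
    using k(2) by (simp add: eventually_all_finite)
  then have "\<forall>\<^sub>F p in at x. d p = coord X x p *s r p"
    using eventually_nhds_at[OF inv]
  proof eventually_elim
    case (elim p)
    have "d p = matrix_inv (g p) *v (g p *v d p)" using elim by simp
    also have "g p *v d p = coord X x p *s (\<chi> i. k i p)" using elim by (simp add: vec_eq_iff)
    finally show ?case by (simp add: r_def vector_scalar_commute)
  qed
  ultimately show ?thesis by blast
qed

lemma section_value:
  fixes T :: "('x, 'r::finite) bundle_atlas"
  assumes V: "vector_bundle X UNIV T" and s: "sgerm X T x a" "sgerm X T x b" "\<forall>\<^sub>F p in at x. a p = b p"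
  shows "a x = b x"
proof -
  obtain U g where U: "(U, g) \<in> T" "x \<in> U" using triv_ex[OF RS V] by blast
  note c = triv_compat[OF RS V U]
  have "(g x *v a x) $ i = (g x *v b x) $ i" for i
  proof (rule holo_germ_at_eqD(1)[OF RS])
    show "holo_germ X x (\<lambda>p. (g p *v a p) $ i)" "holo_germ X x (\<lambda>p. (g p *v b p) $ i)"
      using s(1,2) unfolding compat_sgerm[OF RS V c] hvec_def by blast+
  qed (use s(3) in \<open>auto elim: eventually_mono\<close>)
  then have "g x *v a x = g x *v b x" by (simp add: vec_eq_iff)
  then show ?thesis using matrix_inv_vector(2)[OF compat_invertible[OF RS V c]] by metis
qed

lemma section_through:
  fixes T :: "('x, 'r::finite) bundle_atlas"
  assumes V: "vector_bundle X UNIV T"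
  shows "\<exists>s. sgerm X T x s \<and> s x = v"
proof -
  obtain U g where U: "(U, g) \<in> T" "x \<in> U" using triv_ex[OF RS V] by blast
  note c = triv_compat[OF RS V U]
  show ?thesis
    using sgerm_frame[OF RS V c, of "g x *v v"] compat_invertible[OF RS V c]
    by (intro exI[of _ "\<lambda>q. matrix_inv (g q) *v (g x *v v)"]) simp
qed

lemma flag_germs_iff:
  fixes V :: "('x, 'r::finite) flagged_bundle"
  assumes VV: "vector_bundle X UNIV (triv V)"
  shows "s \<in> flag_germs X V x t \<longleftrightarrow> (\<exists>u. sgerm X (triv V) x u \<and> u x \<in> flag V x (flag_index V x (frac t)) \<and>
    (\<forall>\<^sub>F p in at x. s p = (coord X x p powi \<lfloor>t\<rfloor>) *s u p))"
proof
  assume "s \<in> flag_germs X V x t"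
  then show "\<exists>u. sgerm X (triv V) x u \<and> u x \<in> flag V x (flag_index V x (frac t)) \<and>
    (\<forall>\<^sub>F p in at x. s p = (coord X x p powi \<lfloor>t\<rfloor>) *s u p)"
    unfolding flag_germs_def section_iff[OF RS VV] by blast
next
  assume "\<exists>u. sgerm X (triv V) x u \<and> u x \<in> flag V x (flag_index V x (frac t)) \<and>
    (\<forall>\<^sub>F p in at x. s p = (coord X x p powi \<lfloor>t\<rfloor>) *s u p)"
  then obtain u where u: "sgerm X (triv V) x u" "u x \<in> flag V x (flag_index V x (frac t))"
    "\<forall>\<^sub>F p in at x. s p = (coord X x p powi \<lfloor>t\<rfloor>) *s u p" by blast
  obtain W where "open W" "x \<in> W" "W \<subseteq> UNIV" "holo_section X (triv V) W u"
    by (rule sgerm_section'[OF RS VV u(1) UNIV_I])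
  then show "s \<in> flag_germs X V x t" unfolding flag_germs_def using u by blast
qed

section \<open>Residues and invariance of the filtration\<close>

context
  fixes D :: "'x set" and V :: "('x, 'r::finite) flagged_bundle" and E :: "('x, 'r) filtered_bundle"
    and nab :: "('x, 'r) connection"
  assumes P: "presents X D V E"
begin

lemma presents_bundles: "finite D" "vector_bundle X UNIV (triv V)" "vector_bundle X (- D) (atlas E)" "flagged_bundle X D V"
  using P by (auto simp: presents_def flagged_bundle_def)

lemma presents_flag:
  assumes "x \<in> D" "j \<in> {1..steps V x + 1}" shows "vec.subspace (flag V x j)"
  using presents_bundles(4) assms unfolding flagged_bundle_def by blast

lemma presents_sgerm: "p \<notin> D \<Longrightarrow> sgerm X (triv V) p s \<longleftrightarrow> sgerm X (atlas E) p s"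
proof -
  assume p: "p \<notin> D"
  note B = presents_bundles
  have eq: "W \<subseteq> - D \<Longrightarrow> holo_section X (triv V) W s \<longleftrightarrow> holo_section X (atlas E) W s" for W s
    using P by (simp add: presents_def)
  show ?thesis
    using section_transfer[OF RS B(2,3) open_base[OF RS B(3)], of p s]
      section_transfer[OF RS B(3,2) open_base[OF RS B(3)], of p s] eq p by blast
qed

lemma sgerm_near: "sgerm X (triv V) x s \<Longrightarrow> \<forall>\<^sub>F p in at x. sgerm X (atlas E) p s"
  using eventually_nhds_at[OF sgerm_eventually[OF RS presents_bundles(2) _ UNIV_I]]
    eventually_notin_finite[OF presents_bundles(1), of x]
  by (rule eventually_elim2) (simp_all add: presents_sgerm)

lemma presents_germs: "x \<in> D \<Longrightarrow> germs E x t = flag_germs X V x t"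
  using P by (simp add: presents_def)

lemma log_connection_iff:
  "log_connection X D (triv V) nab \<longleftrightarrow> holo_connection X (- D) (atlas E) nab \<and>
    (\<forall>x\<in>D. \<forall>s. sgerm X (triv V) x s \<longrightarrow>
       (\<exists>s'. sgerm X (triv V) x s' \<and> (\<forall>\<^sub>F p in at x. s' p = euler X nab x s p)))"
  unfolding log_connection_def holo_connection_presents[OF RS P]
proof (rule conj_cong[OF refl], intro ball_cong refl iffI allI impI)
  fix x s assume L: "\<forall>W s. x \<in> W \<longrightarrow> holo_section X (triv V) W s \<longrightarrow>
        (\<exists>W' s'. x \<in> W' \<and> holo_section X (triv V) W' s' \<and>
           (\<forall>\<^sub>F p in at x. s' p = coord X x p *s nab (chart_at X x) s p))" and s: "sgerm X (triv V) x s"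
  obtain W where "open W" "x \<in> W" "W \<subseteq> UNIV" "holo_section X (triv V) W s"
    by (rule sgerm_section'[OF RS presents_bundles(2) s UNIV_I])
  then obtain W' s' where "x \<in> W'" "holo_section X (triv V) W' s'"
    "\<forall>\<^sub>F p in at x. s' p = coord X x p *s nab (chart_at X x) s p" using L by blast
  then show "\<exists>s'. sgerm X (triv V) x s' \<and> (\<forall>\<^sub>F p in at x. s' p = euler X nab x s p)"
    unfolding section_iff[OF RS presents_bundles(2)] euler_def by blast
next
  fix x W s assume L: "\<forall>s. sgerm X (triv V) x s \<longrightarrow>
       (\<exists>s'. sgerm X (triv V) x s' \<and> (\<forall>\<^sub>F p in at x. s' p = euler X nab x s p))"
    and "x \<in> W" "holo_section X (triv V) W s"
  then obtain s' where s': "sgerm X (triv V) x s'" "\<forall>\<^sub>F p in at x. s' p = euler X nab x s p"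
    unfolding section_iff[OF RS presents_bundles(2)] by blast
  obtain W' where "open W'" "x \<in> W'" "W' \<subseteq> UNIV" "holo_section X (triv V) W' s'"
    by (rule sgerm_section'[OF RS presents_bundles(2) s'(1) UNIV_I])
  then show "\<exists>W' s'. x \<in> W' \<and> holo_section X (triv V) W' s' \<and>
           (\<forall>\<^sub>F p in at x. s' p = coord X x p *s nab (chart_at X x) s p)"
    using s'(2) unfolding euler_def by blast
qed

context
  assumes L: "log_connection X D (triv V) nab"
begin

lemma log_H: "holo_connection X (- D) (atlas E) nab"
  and log_ex: "x \<in> D \<Longrightarrow> sgerm X (triv V) x s \<Longrightarrow>
    \<exists>s'. sgerm X (triv V) x s' \<and> (\<forall>\<^sub>F p in at x. s' p = euler X nab x s p)"
  using L unfolding log_connection_iff by blast+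

text \<open>With z the coordinate, the difference of the two sections is z r. The Euler operator
  sends it to z times the sum of \<open>r\<close> and its Euler derivative, which vanishes at
  \<open>x\<close> because the connection is logarithmic on \<open>r\<close>.\<close>

lemma residue_unique:
  assumes x: "x \<in> D" and u: "sgerm X (triv V) x u" "sgerm X (triv V) x u2" "u x = u2 x"
    and s: "sgerm X (triv V) x s" "sgerm X (triv V) x s2"
    and e: "\<forall>\<^sub>F p in at x. s p = euler X nab x u p" "\<forall>\<^sub>F p in at x. s2 p = euler X nab x u2 p"
  shows "s x = s2 x"
proof -
  note VV = presents_bundles(2) and eu = presents_bundles(1,3) log_H
  define d where "d p = u p + (- 1) *s u2 p" for p
  have m: "sgerm X (triv V) x (\<lambda>p. (- 1) *s u2 p)"
    by (rule sgerm_scale[OF RS VV holo_germ_const[OF RS] u(2)])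
  have d: "sgerm X (triv V) x d" unfolding d_def[abs_def] by (rule sgerm_add[OF RS VV u(1) m])
  have "d x = 0" using u(3) by (simp add: d_def vec_eq_iff)
  from section_divide[OF VV d this] obtain r where
    r: "sgerm X (triv V) x r" "\<forall>\<^sub>F p in at x. d p = coord X x p *s r p" by blast
  from log_ex[OF x r(1)] obtain r' where r': "sgerm X (triv V) x r'" "\<forall>\<^sub>F p in at x. r' p = euler X nab x r p"
    by blast
  have e1: "\<forall>\<^sub>F p in at x. euler X nab x d p = euler X nab x u p + euler X nab x (\<lambda>p. (- 1) *s u2 p) p"
    by (rule euler_add[OF eu _ sgerm_near[OF u(1)] sgerm_near[OF m]]) (simp add: d_def)
  have e2: "\<forall>\<^sub>F p in at x. euler X nab x (\<lambda>p. (- 1) *s u2 p) p =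
      (coord X x p * chart_deriv (chart_at X x) (\<lambda>p. - 1) p) *s u2 p + (- 1) *s euler X nab x u2 p"
    by (rule euler_scale[OF eu _ _ sgerm_near[OF u(2)]]) (simp_all add: holo_germ_const[OF RS])
  have "\<forall>\<^sub>F p in at x. holo_germ X p (coord X x)"
    using eventually_coord_germ[OF RS, of x] by eventually_elim simp
  then have e3: "\<forall>\<^sub>F p in at x. euler X nab x d p =
      (coord X x p * chart_deriv (chart_at X x) (coord X x) p) *s r p + coord X x p *s euler X nab x r p"
    by (rule euler_scale[OF eu r(2) _ sgerm_near[OF r(1)]])
  define a where "a p = s p + (- 1) *s s2 p" for p
  define b where "b p = coord X x p *s (r p + r' p)" for p
  have "a x = b x"
  proof (rule section_value[OF VV])
    show "sgerm X (triv V) x a" unfolding a_def[abs_def]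
      by (intro sgerm_add[OF RS VV] sgerm_scale[OF RS VV] holo_germ_const[OF RS] s)
    show "sgerm X (triv V) x b" unfolding b_def[abs_def]
      by (intro sgerm_add[OF RS VV] sgerm_scale[OF RS VV] holo_germ_coord[OF RS] chart_at[OF RS] r r')
    show "\<forall>\<^sub>F p in at x. a p = b p"
      using e e1 e2 e3 r'(2) eventually_at_coord[OF RS, of x]
      by eventually_elim (simp add: a_def b_def chart_deriv_const[OF RS] chart_deriv_coord[OF RS] vec_eq_iff algebra_simps)
  qed
  then show ?thesis by (simp add: a_def b_def coord_self[OF RS] vec_eq_iff)
qed

text \<open>\<open>residue_map\<close> is a definite description. Existence comes from shrinking
  both sections to a common neighbourhood, uniqueness from the preceding lemma.\<close>

lemma residue_eq:
  assumes x: "x \<in> D" and u: "sgerm X (triv V) x u" "u x = v" and s: "sgerm X (triv V) x s"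
    and e: "\<forall>\<^sub>F p in at x. s p = euler X nab x u p"
  shows "residue_map X (triv V) nab x v = s x"
  unfolding residue_map_def
proof (rule the_equality)
  note VV = presents_bundles(2)
  obtain W1 where W1: "open W1" "x \<in> W1" "W1 \<subseteq> UNIV" "holo_section X (triv V) W1 u"
    by (rule sgerm_section'[OF RS VV u(1) UNIV_I])
  obtain W where W: "open W" "x \<in> W" "W \<subseteq> W1" "W \<subseteq> UNIV" "holo_section X (triv V) W s"
    by (rule sgerm_section[OF RS VV s W1(1,2) UNIV_I])
  have "holo_section X (triv V) W u" using W1(4) W(1,3) unfolding section_iff[OF RS VV] by blast
  then show "\<exists>W s0 s'. x \<in> W \<and> holo_section X (triv V) W s0 \<and> holo_section X (triv V) W s' \<and>
      (\<forall>\<^sub>F p in at x. s' p = coord X x p *s nab (chart_at X x) s0 p) \<and> s0 x = v \<and> s' x = s x"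
    using W(2,5) u(2) e unfolding euler_def by blast
next
  fix v' assume "\<exists>W s0 s'. x \<in> W \<and> holo_section X (triv V) W s0 \<and> holo_section X (triv V) W s' \<and>
      (\<forall>\<^sub>F p in at x. s' p = coord X x p *s nab (chart_at X x) s0 p) \<and> s0 x = v \<and> s' x = v'"
  then obtain s0 s' where w: "sgerm X (triv V) x s0" "sgerm X (triv V) x s'" "s0 x = v" "s' x = v'"
    "\<forall>\<^sub>F p in at x. s' p = euler X nab x s0 p"
    unfolding section_iff[OF RS presents_bundles(2)] euler_def by blast
  have "s' x = s x"
    by (rule residue_unique[OF x w(1) u(1) _ w(2) s w(5) e]) (use w(3) u(2) in simp)
  then show "v' = s x" using w(4) by simp
qed

lemma residue_zero: "x \<in> D \<Longrightarrow> residue_map X (triv V) nab x 0 = 0"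
proof -
  note B = presents_bundles
  have z: "sgerm X (triv V) x (\<lambda>_. 0)" by (simp add: sgerm_def hvec_const[OF RS])
  have "\<forall>\<^sub>F p in at x. 0 = euler X nab x (\<lambda>_. 0) p"
    using euler_zero[OF B(1,3) log_H, of x] by eventually_elim simp
  then show "x \<in> D \<Longrightarrow> residue_map X (triv V) nab x 0 = 0" using residue_eq[OF _ z _ z] by simp
qed

text \<open>As z d/dz multiplies z^n by n, the operator acts on z^n u as n plus the operator on
  \<open>u\<close>, here with n = \<lfloor>t\<rfloor>; at \<open>x\<close> the operator on
  \<open>u\<close> is the residue.\<close>

lemma germ_euler:
  assumes x: "x \<in> D" and s: "s \<in> germs E x t"
  obtains u s' where "sgerm X (triv V) x u" "u x \<in> flag V x (flag_index V x (frac t))"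
    "\<forall>\<^sub>F p in at x. s p = (coord X x p powi \<lfloor>t\<rfloor>) *s u p"
    "sgerm X (triv V) x s'" "s' x = residue_map X (triv V) nab x (u x)"
    "\<forall>\<^sub>F p in at x. euler X nab x s p = (coord X x p powi \<lfloor>t\<rfloor>) *s (of_int \<lfloor>t\<rfloor> *s u p + s' p)"
proof -
  obtain u where u: "sgerm X (triv V) x u" "u x \<in> flag V x (flag_index V x (frac t))"
    "\<forall>\<^sub>F p in at x. s p = (coord X x p powi \<lfloor>t\<rfloor>) *s u p"
    using s unfolding presents_germs[OF x] flag_germs_iff[OF presents_bundles(2)] by blast
  from log_ex[OF x u(1)] obtain s' where s': "sgerm X (triv V) x s'" "\<forall>\<^sub>F p in at x. s' p = euler X nab x u p"
    by blast
  have "\<forall>\<^sub>F p in at x. holo_germ X p (\<lambda>p. coord X x p powi \<lfloor>t\<rfloor>)"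
    using eventually_coord_germ[OF RS, of x] by eventually_elim (simp add: holo_germ_powi[OF RS])
  from euler_scale[OF presents_bundles(1,3) log_H u(3) this sgerm_near[OF u(1)]] s'(2)
    eventually_coord_germ[OF RS, of x] eventually_at_coord[OF RS, of x]
  have "\<forall>\<^sub>F p in at x. euler X nab x s p = (coord X x p powi \<lfloor>t\<rfloor>) *s (of_int \<lfloor>t\<rfloor> *s u p + s' p)"
  proof eventually_elim
    case (elim p)
    have "coord X x p * chart_deriv (chart_at X x) (\<lambda>p. coord X x p powi \<lfloor>t\<rfloor>) p = of_int \<lfloor>t\<rfloor> * coord X x p powi \<lfloor>t\<rfloor>"
      using elim chart_deriv_powi[OF RS chart_at(1)[OF RS], of p x "coord X x" "\<lfloor>t\<rfloor>"] chart_deriv_coord[OF RS, of p x]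
      by (simp add: power_int_diff)
    then show ?case using elim by (simp add: vec_eq_iff algebra_simps)
  qed
  moreover have "s' x = residue_map X (triv V) nab x (u x)"
    using residue_eq[OF x u(1) refl s'] by simp
  ultimately show thesis using that u s'(1) by blast
qed

end

text \<open>
  The condition on the right does not mention the flagged bundle, which is what makes it easy to
  pull back.
\<close>

lemma quasiparabolic_iff:
  "log_connection X D (triv V) nab \<and>
     (\<forall>x\<in>D. \<forall>j\<in>{1..steps V x}. residue_map X (triv V) nab x ` flag V x j \<subseteq> flag V x j) \<longleftrightarrow>
   holo_connection X (- D) (atlas E) nab \<and> (\<forall>x\<in>D. \<forall>t. \<forall>s\<in>germs E x t. euler X nab x s \<in> germs E x t)"
  (is "?A \<longleftrightarrow> ?B")
proof
  assume A: ?A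
  then have L: "log_connection X D (triv V) nab" by blast
  have "euler X nab x s \<in> germs E x t" if x: "x \<in> D" and s: "s \<in> germs E x t" for x t s
  proof -
    obtain u s' where u: "sgerm X (triv V) x u" "u x \<in> flag V x (flag_index V x (frac t))"
      "\<forall>\<^sub>F p in at x. s p = (coord X x p powi \<lfloor>t\<rfloor>) *s u p"
      "sgerm X (triv V) x s'" "s' x = residue_map X (triv V) nab x (u x)"
      "\<forall>\<^sub>F p in at x. euler X nab x s p = (coord X x p powi \<lfloor>t\<rfloor>) *s (of_int \<lfloor>t\<rfloor> *s u p + s' p)"
      by (rule germ_euler[OF L x s])
    define k where "k = flag_index V x (frac t)"
    have k: "k \<in> {1..steps V x + 1}" unfolding k_def by (rule flag_index_props(1)[OF presents_bundles(4) x])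
    have "s' x \<in> flag V x k"
    proof (cases "k \<in> {1..steps V x}")
      case True
      then show ?thesis using A x u(2,5) unfolding k_def by blast
    next
      \<comment> \<open>The hypothesis covers the steps up to \<open>steps V x\<close>. At the last
        index the flag is zero, and the residue of zero is zero.\<close>
      case False
      then have "flag V x k = {0}" using k presents_bundles(4) x unfolding flagged_bundle_def by (auto simp: le_Suc_eq)
      then show ?thesis using u(2,5) residue_zero[OF L x] unfolding k_def by simp
    qed
    then have fl: "of_int \<lfloor>t\<rfloor> *s u x + s' x \<in> flag V x k"
      using u(2) presents_flag[OF x k] unfolding k_def by (auto simp: vec.subspace_def)
    have "sgerm X (triv V) x (\<lambda>p. of_int \<lfloor>t\<rfloor> *s u p + s' p)"
      by (intro sgerm_add[OF RS presents_bundles(2)] sgerm_scale[OF RS presents_bundles(2)] holo_germ_const[OF RS] u)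
    then show ?thesis
      unfolding presents_germs[OF x] flag_germs_iff[OF presents_bundles(2)]
      using fl u(6) unfolding k_def by blast
  qed
  then show ?B using log_H[OF L] by blast
next
  assume B: ?B
  have zero: "flag_index V x (frac 0) \<le> j" if "x \<in> D" "j \<in> {1..steps V x}" for x j
  proof -
    have "0 \<le> wt V x j" using presents_bundles(4) that unfolding flagged_bundle_def by blast
    then show ?thesis using flag_index_props(2)[OF presents_bundles(4) that, of 0] by (simp add: not_less)
  qed
  have euler_section: "\<exists>s'. sgerm X (triv V) x s' \<and> s' x \<in> flag V x j \<and> (\<forall>\<^sub>F p in at x. s' p = euler X nab x s p)"
    if x: "x \<in> D" and j: "j \<in> {1..steps V x}" and s: "sgerm X (triv V) x s" "s x \<in> flag V x j" for x s j
  proof -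
    have w: "0 \<le> wt V x j" "wt V x j < 1" using presents_bundles(4) x j unfolding flagged_bundle_def by blast+
    then have w': "frac (wt V x j) = wt V x j" "\<lfloor>wt V x j\<rfloor> = 0" by (auto simp: frac_eq floor_eq_iff)
    \<comment> \<open>For \<open>t\<close> equal to the j-th weight the module consists of the
      sections with value in \<open>flag V x j\<close>, so its invariance gives that of this
      step.\<close>
    have "flag_index V x (wt V x j) = j"
    proof (rule antisym)
      show "flag_index V x (wt V x j) \<le> j"
        using flag_index_props(2)[OF presents_bundles(4) x j, of "wt V x j"] by simp
      show "j \<le> flag_index V x (wt V x j)"
      proof (rule ccontr)
        let ?k = "flag_index V x (wt V x j)"
        assume "\<not> j \<le> ?k"
        then have "?k \<in> {1..steps V x}" "?k < j" using flag_index_props(1)[OF presents_bundles(4) x, of "wt V x j"] j by auto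
        moreover from this have "wt V x ?k < wt V x j"
          using presents_bundles(4)[unfolded flagged_bundle_def, THEN conjunct2, THEN conjunct2, THEN bspec, OF x]
            strict_mono_onD[of "{1..steps V x}" "wt V x" ?k j] j by blast
        ultimately show False using flag_index_props(2)[OF presents_bundles(4) x, of ?k "wt V x j"] by simp
      qed
    qed
    then have "s \<in> germs E x (wt V x j)"
      unfolding presents_germs[OF x] flag_germs_iff[OF presents_bundles(2)]
      using s by (intro exI[of _ s]) (simp add: w')
    then have "euler X nab x s \<in> germs E x (wt V x j)" using B x by blast
    then show ?thesis
      unfolding presents_germs[OF x] flag_germs_iff[OF presents_bundles(2)] w'
      using \<open>flag_index V x (wt V x j) = j\<close> by (auto elim!: eventually_mono)
  qed
  have L: "log_connection X D (triv V) nab"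
    unfolding log_connection_iff
  proof (intro conjI ballI allI impI)
    show "holo_connection X (- D) (atlas E) nab" using B by blast
    fix x s assume x: "x \<in> D" and s: "sgerm X (triv V) x s"
    \<comment> \<open>The first step is the whole fibre, so its case is the logarithmic
      condition.\<close>
    have "1 \<in> {1..steps V x}" "s x \<in> flag V x 1" using presents_bundles(4) x unfolding flagged_bundle_def by auto
    from euler_section[OF x this(1) s this(2)]
    show "\<exists>s'. sgerm X (triv V) x s' \<and> (\<forall>\<^sub>F p in at x. s' p = euler X nab x s p)" by blast
  qed
  moreover have "residue_map X (triv V) nab x v \<in> flag V x j" if xj: "x \<in> D" "j \<in> {1..steps V x}" and v: "v \<in> flag V x j" for x j v
  proof -
    obtain s where s: "sgerm X (triv V) x s" "s x = v" using section_through[OF presents_bundles(2)] by blast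
    then obtain s' where "sgerm X (triv V) x s'" "s' x \<in> flag V x j" "\<forall>\<^sub>F p in at x. s' p = euler X nab x s p"
      using euler_section[OF xj s(1)] v by blast
    then show ?thesis using residue_eq[OF L xj(1) s] by simp
  qed
  ultimately show ?A by blast
qed

end

end

section \<open>Line bundles: residues equal to weights\<close>

lemma flagged_line_bundle:
  fixes V :: "('x::t2_space, 1) flagged_bundle"
  assumes FB: "flagged_bundle X D V" and x: "x \<in> D"
  shows "steps V x = 1"
proof (rule ccontr)
  assume *: "steps V x \<noteq> 1"
  note F = FB[unfolded flagged_bundle_def, THEN conjunct2, THEN conjunct2, THEN bspec, OF x]
  have n: "steps V x \<ge> 2" using F * by simp
  have dec: "flag V x (j + 1) \<subset> flag V x j" if "j \<in> {1..steps V x}" for j using F that by simp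
  have sub: "vec.subspace (flag V x j)" if "j \<in> {1..steps V x + 1}" for j using F that by simp
  have "flag V x (2 + 1) \<subset> flag V x 2" using dec[of 2] n by simp
  moreover have "0 \<in> flag V x (2 + 1)" using vec.subspace_0[OF sub[of 3]] n by simp
  ultimately obtain v where v: "v \<in> flag V x 2" "v \<noteq> 0" by blast
  \<comment> \<open>In dimension one a nonzero vector spans, so the second step would be the whole
    fibre and not a proper subspace.\<close>
  have "u \<in> flag V x 2" for u
  proof -
    have "v $ 1 \<noteq> 0" using v(2) by (simp add: vec_eq_iff forall_1)
    then have "u = (u $ 1 / v $ 1) *s v" by (simp add: vec_eq_iff forall_1)
    moreover have "(u $ 1 / v $ 1) *s v \<in> flag V x 2"
      using vec.subspace_scale[OF sub[of 2] v(1)] n by simp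
    ultimately show ?thesis by simp
  qed
  moreover have "flag V x (1 + 1) \<subset> flag V x 1" using dec[of 1] n by simp
  ultimately show False by (auto simp: numeral_2_eq_2)
qed

context
  fixes X :: "'x::t2_space chart set"
  assumes RS: "riemann_surface X"
begin

lemma line_coordinates:
  fixes V :: "('x, 1) flagged_bundle"
  assumes P: "presents X D V L" and x: "x \<in> D"
  obtains \<gamma> where "compat X (triv V) x \<gamma>" "splits X L x \<gamma> (\<lambda>_. wt V x 1)"
proof -
  show thesis
  proof (rule presents_coordinates[OF RS P x])
    fix \<gamma> lev assume *: "compat X (triv V) x \<gamma>" "splits X L x \<gamma> (\<lambda>i. wt V x (lev i))"
      "\<And>i. lev i \<in> {1..steps V x}"
    have "lev i = 1" for i
      using *(3)[of i] flagged_line_bundle[OF presents_bundles(4)[OF RS P] x] by simp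
    then show thesis using that[OF *(1)] *(2) by simp
  qed
qed

text \<open>The modules jump exactly at the numbers weight + n with n an integer. Between jumps a
  larger \<open>t'\<close> defines the same module, and the condition on the right asks for
  invariance only. At a jump t the operator acts on the leading coefficient as n plus the residue,
  and a larger parameter is reached iff this number is t.\<close>

lemma canonical_iff:
  fixes V :: "('x, 1) flagged_bundle"
  assumes P: "presents X D V L"
  shows "log_connection X D (triv V) nab \<and>
     (\<forall>x\<in>D. \<forall>v. residue_map X (triv V) nab x v = complex_of_real (wt V x 1) *s v) \<longleftrightarrow>
   holo_connection X (- D) (atlas L) nab \<and>
     (\<forall>x\<in>D. \<forall>t. \<forall>s\<in>germs L x t. \<exists>t'>t. (\<lambda>p. euler X nab x s p - complex_of_real t *s s p) \<in> germs L x t')"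
  (is "?A \<longleftrightarrow> ?B")
proof
  note B = presents_bundles[OF RS P]
  assume A: ?A
  then have L: "log_connection X D (triv V) nab" by blast
  have "\<exists>t'>t. (\<lambda>p. euler X nab x s p - complex_of_real t *s s p) \<in> germs L x t'"
    if x: "x \<in> D" and s: "s \<in> germs L x t" for x t s
  proof -
    obtain \<gamma> where c: "compat X (triv V) x \<gamma>" and sp: "splits X L x \<gamma> (\<lambda>_. wt V x 1)"
      by (rule line_coordinates[OF P x])
    define \<beta> where "\<beta> = wt V x 1"
    have \<beta>: "0 \<le> \<beta>" "\<beta> < 1" using B(4) x unfolding flagged_bundle_def \<beta>_def by auto
    obtain u s' where u: "sgerm X (triv V) x u" "u x \<in> flag V x (flag_index V x (frac t))"
      "\<forall>\<^sub>F p in at x. s p = (coord X x p powi \<lfloor>t\<rfloor>) *s u p"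
      "sgerm X (triv V) x s'" "s' x = residue_map X (triv V) nab x (u x)"
      "\<forall>\<^sub>F p in at x. euler X nab x s p = (coord X x p powi \<lfloor>t\<rfloor>) *s (of_int \<lfloor>t\<rfloor> *s u p + s' p)"
      by (rule germ_euler[OF RS P L x s])
    have s'x: "s' x = complex_of_real \<beta> *s u x" using A x u(5) by (simp add: \<beta>_def)
    \<comment> \<open>Up to the power \<lfloor>t\<rfloor> of the coordinate, \<open>r\<close> is the
      operator minus \<open>t\<close> applied to \<open>s\<close>; the integral part of
      \<open>t\<close> has cancelled.\<close>
    define r where "r p = s' p + (- complex_of_real (frac t)) *s u p" for p
    have r: "sgerm X (triv V) x r" unfolding r_def[abs_def]
      by (intro sgerm_add[OF RS B(2)] sgerm_scale[OF RS B(2)] holo_germ_const[OF RS] u)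
    have h: "holo_germ X x (\<lambda>p. (\<gamma> p *v u p) $ i)" "holo_germ X x (\<lambda>p. (\<gamma> p *v r p) $ i)" for i
      using u(1) r unfolding compat_sgerm[OF RS B(2) c] hvec_def by blast+
    have t: "t = of_int \<lfloor>t\<rfloor> + frac t" by (simp add: frac_def)
    have tc: "complex_of_real t = of_int \<lfloor>t\<rfloor> + complex_of_real (frac t)"
      by (subst t) (simp only: of_real_add of_real_of_int_eq)
    have eu: "\<forall>\<^sub>F p in at x. euler X nab x s p - complex_of_real t *s s p = (coord X x p powi \<lfloor>t\<rfloor>) *s r p"
      using u(3,6) by eventually_elim (simp add: r_def vec_eq_iff tc algebra_simps)
    have mem: "(\<lambda>p. euler X nab x s p - complex_of_real t *s s p) \<in> germs L x (\<beta> + of_int (\<lfloor>t\<rfloor> + d))"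
      if d: "\<And>i. ord_ge X x d (\<lambda>p. (\<gamma> p *v r p) $ i)" for d
      unfolding germs_splits[OF RS sp]
    proof
      fix i
      have "ord_ge X x (\<lfloor>t\<rfloor> + d) (\<lambda>p. (\<gamma> p *v (euler X nab x s p - complex_of_real t *s s p)) $ i)"
        by (rule ord_ge_transfer[OF ord_ge_shift[OF RS d[of i]]], use eu in eventually_elim)
           (simp add: vector_scalar_commute)
      then show "ord_ge X x \<lceil>\<beta> + of_int (\<lfloor>t\<rfloor> + d) - wt V x 1\<rceil> (\<lambda>p. (\<gamma> p *v (euler X nab x s p - complex_of_real t *s s p)) $ i)"
        unfolding \<beta>_def by simp
    qed
    show ?thesis
    \<comment> \<open>If \<open>frac t < \<beta>\<close>, the jump
      \<open>\<beta> + \<lfloor>t\<rfloor>\<close> already lies above \<open>t\<close>; otherwise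
      the next one must be reached, for which \<open>r\<close> has to vanish at
      \<open>x\<close>.\<close>
    proof (cases "frac t < \<beta>")
      case True
      then have "t < \<beta> + of_int (\<lfloor>t\<rfloor> + 0)" using t by simp
      then show ?thesis using mem[OF ord_ge_holo_germ[OF RS h(2)]] by blast
    next
      case False
      have "(\<gamma> x *v r x) $ i = 0" for i
      proof (cases "frac t = \<beta>")
        case True
        then have "r x = 0" using s'x by (simp add: r_def vec_eq_iff)
        then show ?thesis by simp
      next
        case ne: False
        \<comment> \<open>Strictly above the jump, the bound on \<open>s\<close> exceeds the power
          already split off. So \<open>u\<close> vanishes at \<open>x\<close>, and \<open>r\<close>
          with it.\<close>
        have "ord_ge X x \<lceil>t - \<beta>\<rceil> (\<lambda>p. (\<gamma> p *v s p) $ i)"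
          using s[unfolded germs_splits[OF RS sp]] unfolding \<beta>_def by blast
        moreover have "\<lfloor>t\<rfloor> + 1 \<le> \<lceil>t - \<beta>\<rceil>" using ne False t by linarith
        ultimately have "ord_ge X x (\<lfloor>t\<rfloor> + 1) (\<lambda>p. (\<gamma> p *v s p) $ i)" by (rule ord_ge_mono[OF RS])
        then have "ord_ge X x (\<lfloor>t\<rfloor> + 1) (\<lambda>p. coord X x p powi \<lfloor>t\<rfloor> * (\<gamma> p *v u p) $ i)"
          by (rule ord_ge_transfer, use u(3) in eventually_elim) (simp add: vector_scalar_commute)
        then have "(\<gamma> x *v u x) $ i = 0"
          unfolding ord_ge_shift_iff[OF RS] ord_ge_1_iff[OF RS h(1)] .
        moreover have "r x = (complex_of_real \<beta> - complex_of_real (frac t)) *s u x"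
          by (simp add: r_def s'x vec_eq_iff algebra_simps)
        ultimately show ?thesis
          by (simp only: vector_scalar_commute vector_smult_component mult_zero_right)
      qed
      then have "ord_ge X x 1 (\<lambda>p. (\<gamma> p *v r p) $ i)" for i
        using ord_ge_1_iff[OF RS h(2)] by blast
      from mem[OF this] have "(\<lambda>p. euler X nab x s p - complex_of_real t *s s p) \<in> germs L x (\<beta> + of_int (\<lfloor>t\<rfloor> + 1))" .
      moreover have "t < \<beta> + of_int (\<lfloor>t\<rfloor> + 1)" using \<beta>(1) by linarith
      ultimately show ?thesis by blast
    qed
  qed
  then show ?B using log_H[OF RS P L] by blast
next
  note B = presents_bundles[OF RS P]
  assume R: ?B
  have "euler X nab x s \<in> germs L x t" if x: "x \<in> D" and s: "s \<in> germs L x t" for x t s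
  proof -
    obtain \<gamma> where sp: "splits X L x \<gamma> (\<lambda>_. wt V x 1)" by (rule line_coordinates[OF P x])
    obtain t' where t': "t' > t" "(\<lambda>p. euler X nab x s p - complex_of_real t *s s p) \<in> germs L x t'" using R x s by blast
    have "(\<lambda>p. euler X nab x s p - complex_of_real t *s s p) \<in> germs L x t"
      using germs_mono[OF RS sp t'(2)] t'(1) by simp
    moreover have "(\<lambda>p. complex_of_real t *s s p) \<in> germs L x t"
      using germs_scale[OF RS sp s ord_ge_holo_germ[OF RS holo_germ_const[OF RS]]] by simp
    ultimately show ?thesis using germs_add[OF RS sp] by fastforce
  qed
  then have L: "log_connection X D (triv V) nab"
    using R quasiparabolic_iff[OF RS P, of nab] by blast
  have "residue_map X (triv V) nab x v = complex_of_real (wt V x 1) *s v" if x: "x \<in> D" for x v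
  proof -
    obtain \<gamma> where c: "compat X (triv V) x \<gamma>" and sp: "splits X L x \<gamma> (\<lambda>_. wt V x 1)"
      by (rule line_coordinates[OF P x])
    obtain s where s: "sgerm X (triv V) x s" "s x = v" using section_through[OF RS B(2)] by blast
    obtain s' where s': "sgerm X (triv V) x s'" "\<forall>\<^sub>F p in at x. s' p = euler X nab x s p"
      using log_ex[OF RS P L x s(1)] by blast
    define r where "r p = s' p + (- complex_of_real (wt V x 1)) *s s p" for p
    have r: "sgerm X (triv V) x r" unfolding r_def[abs_def]
      by (intro sgerm_add[OF RS B(2)] sgerm_scale[OF RS B(2)] holo_germ_const[OF RS] s s')
    have h: "holo_germ X x (\<lambda>p. (\<gamma> p *v s p) $ i)" "holo_germ X x (\<lambda>p. (\<gamma> p *v r p) $ i)" for i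
      using s(1) r unfolding compat_sgerm[OF RS B(2) c] hvec_def by blast+
    \<comment> \<open>The condition is tested at the weight itself: germs of any larger parameter
      vanish to first order in the frame, so residue minus weight annihilates the fibre.\<close>
    have "s \<in> germs L x (wt V x 1)"
      unfolding germs_splits[OF RS sp] using ord_ge_holo_germ[OF RS h(1)] by simp
    then obtain t' where t': "t' > wt V x 1"
      "(\<lambda>p. euler X nab x s p - complex_of_real (wt V x 1) *s s p) \<in> germs L x t'" using R x by blast
    have "(\<gamma> x *v r x) $ i = 0" for i
    proof -
      have "ord_ge X x \<lceil>t' - wt V x 1\<rceil> (\<lambda>p. (\<gamma> p *v (euler X nab x s p - complex_of_real (wt V x 1) *s s p)) $ i)"
        using t'(2)[unfolded germs_splits[OF RS sp]] by blast
      then have "ord_ge X x 1 (\<lambda>p. (\<gamma> p *v (euler X nab x s p - complex_of_real (wt V x 1) *s s p)) $ i)"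
        by (rule ord_ge_mono[OF RS]) (use t'(1) in linarith)
      then have "ord_ge X x 1 (\<lambda>p. (\<gamma> p *v r p) $ i)"
        by (rule ord_ge_transfer, use s'(2) in eventually_elim) (simp add: r_def)
      then show ?thesis using ord_ge_1_iff[OF RS h(2)] by blast
    qed
    then have "\<gamma> x *v r x = 0" by (simp add: vec_eq_iff)
    then have "r x = 0" using matrix_inv_vector(2)[OF compat_invertible[OF RS B(2) c], of "r x"] by simp
    then have "s' x = complex_of_real (wt V x 1) *s v" using s(2) by (simp add: r_def vec_eq_iff)
    then show ?thesis using residue_eq[OF RS P L x s s'] by simp
  qed
  then show ?A using L by blast
qed

end

section \<open>Pulling back the residue conditions\<close>

context covering
begin

lemma germs_pull_term:
  assumes sp: "splits X E (f y) \<gamma> \<alpha>" and u: "u \<in> germs E (f y) t" and c: "ord_ge Y y k c"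
    and b: "b \<le> of_int (mult y) * t + of_int k"
  shows "(\<lambda>q. c q *s u (f q)) \<in> germs (pullback_bundle Y X f E) y b"
proof -
  have "(\<lambda>q. u (f q)) \<in> germs (pullback_bundle Y X f E) y (of_int (mult y) * t)"
    unfolding germs_pullback using u
    by (intro exI[of _ "1::nat"] exI[of _ "\<lambda>_ _. 1"] exI[of _ "\<lambda>_. 0"] exI[of _ "\<lambda>_. t"] exI[of _ "\<lambda>_. u"])
       (simp add: holo_germ_const[OF RY])
  then show ?thesis using germs_scale[OF RY splits_pullback[OF sp] _ c b] by simp
qed

context
  fixes D :: "'x set" and E :: "('x, 'r::finite) filtered_bundle" and nab :: "('x, 'r) connection"
  assumes D: "finite D" and VE: "vector_bundle X (- D) (atlas E)"
    and H: "holo_connection X (- D) (atlas E) nab"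
begin

text \<open>Term by term: the Euler operator on \<open>Y\<close> differentiates the coefficient
  \<open>c i\<close>, and on the pulled back germ it acts, by the chain rule, as \<open>v\<close>
  times the Euler operator on \<open>X\<close>.\<close>

lemma euler_pullback:
  fixes N :: nat
  assumes sp: "splits X E (f y) \<gamma> \<alpha>"
    and u: "\<And>i. i < N \<Longrightarrow> u i \<in> germs E (f y) (t i)" and c: "\<And>i. i < N \<Longrightarrow> ord_ge Y y (k i) (c i)"
    and s: "\<forall>\<^sub>F q in at y. s q = (\<Sum>i<N. c i q *s u i (f q))"
    and v: "\<forall>\<^sub>F q in at y. coord Y y q * chart_deriv (chart_at Y y) (coord X (f y) \<circ> f) q
        = v q * coord X (f y) (f q)"
  shows "\<forall>\<^sub>F q in at y. euler Y (pullback_connection X f E nab) y s q = (\<Sum>i<N.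
    (coord Y y q * chart_deriv (chart_at Y y) (c i) q) *s u i (f q) +
    (c i q * v q) *s euler X nab (f y) (u i) (f q))"
proof -
  let ?F = "pullback_bundle Y X f E" and ?n = "pullback_connection X f E nab"
  have VF: "vector_bundle Y (- f -` D) (atlas ?F)"
    using vector_bundle_pullback[OF VE] by (simp add: vimage_Compl)
  have u': "\<forall>\<^sub>F q in at y. \<forall>i\<in>{..<N}. sgerm X (atlas E) (f q) (u i)"
    using eventually_at_f[OF splits_sgerm[OF RX sp VE u]] by (simp add: eventually_ball_finite_distrib)
  have c': "\<forall>\<^sub>F q in at y. \<forall>i\<in>{..<N}. holo_germ Y q (c i)"
    using ord_ge_eventually_holo_germ[OF RY c] by (simp add: eventually_ball_finite_distrib)
  have z: "\<forall>\<^sub>F q in at y. f q \<in> fst (chart_at X (f y))"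
    using eventually_nhds_at[OF eventually_nhds_f[OF eventually_chart_domain[OF RX chart_at[OF RX]]]] .
  show ?thesis
    using eventually_at_nhds[OF s] u' c' z eventually_at_f[OF eventually_notin_finite[OF D]]
      eventually_at_coord[OF RY, of y] v
  proof eventually_elim
    case (elim q)
    define cY where "cY = chart_at Y y"
    define cX where "cX = chart_at X (f y)"
    have q: "f q \<notin> D" "cY \<in> Y" "q \<in> fst cY" using elim chart_at[OF RY] by (auto simp: cY_def)
    have cX: "cX \<in> X" "f q \<in> fst cX" using elim chart_at[OF RX] by (auto simp: cX_def)
    have us: "sgerm X (atlas E) (f q) (u i)" and cs: "holo_germ Y q (c i)" if "i \<in> {..<N}" for i
      using elim that by blast+
    have sg: "sgerm Y (atlas ?F) q (\<lambda>q. c i q *s u i (f q))" if "i \<in> {..<N}" for i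
      by (rule sgerm_scale[OF RY VF cs[OF that] pull_sgerm[OF VE H q us[OF that]]])
    have "?n cY s q = ?n cY (\<lambda>q. \<Sum>i<N. c i q *s u i (f q)) q"
      by (rule pb_cong[OF VE H q]) (use elim in blast)
    also have "\<dots> = (\<Sum>i<N. ?n cY (\<lambda>q. c i q *s u i (f q)) q)"
      by (rule pb_sum[OF VE H q sg])
    also have "\<dots> = (\<Sum>i<N. chart_deriv cY (c i) q *s u i (f q)
        + (c i q * chart_deriv cY (snd cX \<circ> f) q) *s nab cX (u i) (f q))"
      by (intro sum.cong[OF refl] pb_pull[OF VE H q us cs cX])
    finally have n: "?n cY s q = (\<Sum>i<N. chart_deriv cY (c i) q *s u i (f q)
        + (c i q * chart_deriv cY (snd cX \<circ> f) q) *s nab cX (u i) (f q))" .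
    have "chart_deriv cY (coord X (f y) \<circ> f) q = chart_deriv cY (\<lambda>q. (snd cX \<circ> f) q - snd cX (f y)) q"
      by (simp add: coord_def o_def cX_def)
    also have "\<dots> = chart_deriv cY (snd cX \<circ> f) q"
      using chart_deriv_diff[OF RY q(2,3) holo_germ_chart_f[OF cX] holo_germ_const[OF RY]]
      by (simp add: chart_deriv_const[OF RY])
    finally have "coord Y y q * chart_deriv cY (snd cX \<circ> f) q = v q * coord X (f y) (f q)"
      using elim by (simp add: cY_def)
    then have m: "coord Y y q * (c i q * (chart_deriv cY (snd cX \<circ> f) q * r)) = c i q * (v q * (coord X (f y) (f q) * r))" for i r
      by (metis mult.assoc mult.left_commute)
    show ?case
      unfolding euler_def cY_def[symmetric] cX_def[symmetric] n
      by (simp add: vec_eq_iff sum_distrib_left distrib_left mult.assoc m)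
  qed
qed

text \<open>On a generator both contributions stay in the module: differentiating the coefficient by
  w d/dw keeps its order, and \<open>v\<close> is holomorphic while \<open>u i\<close> keeps its
  parameter under the operator on \<open>X\<close>.\<close>

lemma euler_pullback_preserves:
  assumes sp: "splits X E (f y) \<gamma> \<alpha>"
    and pr: "\<And>t s. s \<in> germs E (f y) t \<Longrightarrow> euler X nab (f y) s \<in> germs E (f y) t"
    and s: "s \<in> germs (pullback_bundle Y X f E) y b"
  shows "euler Y (pullback_connection X f E nab) y s \<in> germs (pullback_bundle Y X f E) y b"
proof -
  obtain N :: nat and h k t u where h: "\<And>i. i < N \<Longrightarrow> holo_germ Y y (h i)"
    and u: "\<And>i. i < N \<Longrightarrow> u i \<in> germs E (f y) (t i)" and b: "\<And>i. i < N \<Longrightarrow> b \<le> of_int (mult y) * t i + of_int (k i)"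
    and s: "\<forall>\<^sub>F p in at y. s p = (\<Sum>i<N. (h i p * coord Y y p powi k i) *s u i (f p))"
    using s unfolding germs_pullback by blast
  obtain v where v: "holo_germ Y y v" "v y = of_int (mult y)"
    "\<forall>\<^sub>F q in at y. coord Y y q * chart_deriv (chart_at Y y) (coord X (f y) \<circ> f) q
        = v q * coord X (f y) (f q)" by (rule coord_f_log_deriv)
  let ?c = "\<lambda>i p. h i p * coord Y y p powi k i"
  have c: "ord_ge Y y (k i) (?c i)" if "i < N" for i
    by (rule ord_ge_holo_mult[OF RY h[OF that] ord_ge_coord[OF RY]])
  note e = euler_pullback[OF sp u c s v(3)]
  note sp' = splits_pullback[OF sp]
  have "(\<lambda>q. \<Sum>i<N. (coord Y y q * chart_deriv (chart_at Y y) (?c i) q) *s u i (f q) +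
    (?c i q * v q) *s euler X nab (f y) (u i) (f q)) \<in> germs (pullback_bundle Y X f E) y b"
  proof (rule germs_sum[OF RY sp'])
    fix i assume "i \<in> {..<N}"
    then have i: "i < N" by simp
    have "ord_ge Y y (k i + 0) (\<lambda>q. ?c i q * v q)"
      by (rule ord_ge_mult[OF RY c[OF i] ord_ge_holo_germ[OF RY v(1)]])
    then show "(\<lambda>q. (coord Y y q * chart_deriv (chart_at Y y) (?c i) q) *s u i (f q) +
      (?c i q * v q) *s euler X nab (f y) (u i) (f q)) \<in> germs (pullback_bundle Y X f E) y b"
      using b[OF i]
      by (intro germs_add[OF RY sp'] germs_pull_term[OF sp u[OF i] ord_ge_deriv[OF RY c[OF i]]]
          germs_pull_term[OF sp pr[OF u[OF i]]]) auto
  qed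
  then show ?thesis using germs_cong[OF RY sp' e] by simp
qed

end

lemma quasiparabolic_pullback:
  fixes E :: "('x, 'r::finite) filtered_bundle"
  assumes cY: "compact (UNIV :: 'y set)" and q: "quasiparabolic_connection X D E nab"
  shows "quasiparabolic_connection Y (f -` D) (pullback_bundle Y X f E) (pullback_connection X f E nab)"
proof -
  obtain V where P: "presents X D V E" and V: "log_connection X D (triv V) nab \<and>
        (\<forall>x\<in>D. \<forall>j\<in>{1..steps V x}. residue_map X (triv V) nab x ` flag V x j \<subseteq> flag V x j)"
    using q unfolding quasiparabolic_connection_def by blast
  note Q = V[unfolded quasiparabolic_iff[OF RX P]]
  note B = presents_bundles[OF RX P]
  have E: "parabolic_bundle X D E" using P by (auto simp: parabolic_bundle_def)
  from parabolic_pullback[OF cY E] obtain V' where P': "presents Y (f -` D) V' (pullback_bundle Y X f E)"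
    by (auto simp: parabolic_bundle_def)
  have "log_connection Y (f -` D) (triv V') (pullback_connection X f E nab) \<and>
        (\<forall>y\<in>f -` D. \<forall>j\<in>{1..steps V' y}. residue_map Y (triv V') (pullback_connection X f E nab) y ` flag V' y j \<subseteq> flag V' y j)"
    unfolding quasiparabolic_iff[OF RY P']
  proof (intro conjI ballI allI)
    show "holo_connection Y (- f -` D) (atlas (pullback_bundle Y X f E)) (pullback_connection X f E nab)"
      using pullback_holo_connection[OF B(3)] Q by blast
    fix y b s assume "y \<in> f -` D" and s: "s \<in> germs (pullback_bundle Y X f E) y b"
    then have y: "f y \<in> D" by simp
    obtain \<gamma> \<alpha> where sp: "splits X E (f y) \<gamma> \<alpha>" using parabolic_bundle_splits(3)[OF RX E y] by blast
    show "euler Y (pullback_connection X f E nab) y s \<in> germs (pullback_bundle Y X f E) y b"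
      by (rule euler_pullback_preserves[OF B(1,3) _ sp _ s]) (use Q y in blast)+
  qed
  then show ?thesis unfolding quasiparabolic_connection_def using P' by blast
qed

text \<open>A gain is produced on each generator h w^k u with \<open>u\<close> of parameter t. Its
  leading coefficient is multiplied by m t + k - b, which vanishes when b = m t + k; if b is
  smaller, the room left is the gain. The error term of the connection on \<open>X\<close> gains m
  (t' - t).\<close>

lemma canonical_pullback:
  fixes L :: "('x, 1) filtered_bundle"
  assumes cY: "compact (UNIV :: 'y set)" and P: "presents X D V L" and L: "log_connection X D (triv V) nab"
    and res: "\<forall>x\<in>D. \<forall>v. residue_map X (triv V) nab x v = complex_of_real (wt V x 1) *s v"
    and P': "presents Y (f -` D) V' (pullback_bundle Y X f L)"
  shows "log_connection Y (f -` D) (triv V') (pullback_connection X f L nab) \<and>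
    (\<forall>y\<in>f -` D. \<forall>v. residue_map Y (triv V') (pullback_connection X f L nab) y v = complex_of_real (wt V' y 1) *s v)"
  unfolding canonical_iff[OF RY P']
proof (intro conjI ballI allI)
  note B = presents_bundles[OF RX P]
  have R: "holo_connection X (- D) (atlas L) nab \<and>
     (\<forall>x\<in>D. \<forall>t. \<forall>s\<in>germs L x t. \<exists>t'>t. (\<lambda>p. euler X nab x s p - complex_of_real t *s s p) \<in> germs L x t')"
    using canonical_iff[OF RX P, of nab] L res by blast
  then have H: "holo_connection X (- D) (atlas L) nab" by blast
  show "holo_connection Y (- f -` D) (atlas (pullback_bundle Y X f L)) (pullback_connection X f L nab)"
    using pullback_holo_connection[OF B(3) H] .
  fix y b s assume "y \<in> f -` D" and s: "s \<in> germs (pullback_bundle Y X f L) y b"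
  then have y: "f y \<in> D" by simp
  let ?F = "pullback_bundle Y X f L" and ?m = "of_int (mult y) :: real"
  obtain \<gamma> where sp: "splits X L (f y) \<gamma> (\<lambda>_. wt V (f y) 1)" by (rule line_coordinates[OF RX P y])
  note sp' = splits_pullback[OF sp]
  obtain N :: nat and h k t u where h: "\<And>i. i < N \<Longrightarrow> holo_germ Y y (h i)"
    and u: "\<And>i. i < N \<Longrightarrow> u i \<in> germs L (f y) (t i)" and b: "\<And>i. i < N \<Longrightarrow> b \<le> ?m * t i + of_int (k i)"
    and s: "\<forall>\<^sub>F p in at y. s p = (\<Sum>i<N. (h i p * coord Y y p powi k i) *s u i (f p))"
    using s unfolding germs_pullback by blast
  obtain v where v: "holo_germ Y y v" "v y = of_int (mult y)"
    "\<forall>\<^sub>F q in at y. coord Y y q * chart_deriv (chart_at Y y) (coord X (f y) \<circ> f) q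
        = v q * coord X (f y) (f q)" by (rule coord_f_log_deriv)
  let ?c = "\<lambda>i p. h i p * coord Y y p powi k i" and ?d = "chart_deriv (chart_at Y y)"
  have c: "ord_ge Y y (k i) (?c i)" if "i < N" for i
    by (rule ord_ge_holo_mult[OF RY h[OF that] ord_ge_coord[OF RY]])
  let ?T = "\<lambda>i q. (coord Y y q * ?d (?c i) q) *s u i (f q) +
    (?c i q * v q) *s euler X nab (f y) (u i) (f q) + (- complex_of_real b * ?c i q) *s u i (f q)"
  have e0: "\<forall>\<^sub>F q in at y. euler Y (pullback_connection X f L nab) y s q = (\<Sum>i<N.
    (coord Y y q * ?d (?c i) q) *s u i (f q) + (?c i q * v q) *s euler X nab (f y) (u i) (f q))"
    by (rule euler_pullback[OF B(1,3) H sp u c s v(3)])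
  have e: "\<forall>\<^sub>F q in at y. euler Y (pullback_connection X f L nab) y s q - complex_of_real b *s s q = (\<Sum>i<N. ?T i q)"
    using e0 s
    by eventually_elim (simp add: vec_eq_iff sum.distrib sum_distrib_left sum_subtractf mult.assoc)
  have ex: "\<exists>b'>b. ?T i \<in> germs ?F y b'" if i: "i < N" for i
  proof -
    obtain t' where t': "t' > t i" "(\<lambda>p. euler X nab (f y) (u i) p - complex_of_real (t i) *s u i p) \<in> germs L (f y) t'"
      using R y u[OF i] by blast
    define r where "r p = euler X nab (f y) (u i) p - complex_of_real (t i) *s u i p" for p
    \<comment> \<open>Coefficient of \<open>u i\<close> once its Euler derivative is replaced by
      \<open>t i\<close> times \<open>u i\<close> plus the error \<open>r\<close>, and the power
      \<open>k i\<close> of the coordinate is split off.\<close>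
    define a where "a q = of_int (k i) * h i q + coord Y y q * ?d (h i) q
        + (v q * complex_of_real (t i) - complex_of_real b) * h i q" for q
    have a: "holo_germ Y y a" unfolding a_def[abs_def] using h[OF i] v(1)
      by (intro holo_germ_add holo_germ_mult holo_germ_diff holo_germ_const holo_germ_chart_deriv
          holo_germ_coord RY chart_at)
    have ay: "a y = complex_of_real (of_int (k i) + ?m * t i - b) * h i y"
      by (simp add: a_def coord_self[OF RY] v(2) algebra_simps)
    have T: "\<forall>\<^sub>F q in at y. ?T i q = (coord Y y q powi k i * a q) *s u i (f q) + (?c i q * v q) *s r (f q)"
      using eventually_nhds_at[OF holo_germ_eventually[OF RY h[OF i]]] eventually_coord_germ[OF RY, of y]
        eventually_at_coord[OF RY, of y]
    proof eventually_elim
      case (elim q)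
      have q: "chart_at Y y \<in> Y" "q \<in> fst (chart_at Y y)" using elim chart_at[OF RY] by auto
      have "?d (?c i) q = ?d (h i) q * coord Y y q powi k i + h i q * ?d (\<lambda>q. coord Y y q powi k i) q"
        using elim by (intro chart_deriv_mult[OF RY q] holo_germ_powi[OF RY]) auto
      also have "?d (\<lambda>q. coord Y y q powi k i) q = of_int (k i) * coord Y y q powi (k i - 1)"
        using elim chart_deriv_powi[OF RY q, of "coord Y y" "k i"] chart_deriv_coord[OF RY q(2)] by simp
      finally have "coord Y y q * ?d (?c i) q = coord Y y q powi k i * (of_int (k i) * h i q + coord Y y q * ?d (h i) q)"
        using elim by (simp add: power_int_diff algebra_simps)
      then show ?case unfolding a_def r_def by (simp add: vec_eq_iff algebra_simps)
    qed
    \<comment> \<open>One extra zero in the tight case, where \<open>a y\<close> vanishes; in the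
      other case the inequality is already strict.\<close>
    define e where "e = (if b < ?m * t i + of_int (k i) then 0 else 1 :: int)"
    have "ord_ge Y y e a"
    proof (cases "b < ?m * t i + of_int (k i)")
      case True
      then show ?thesis using ord_ge_holo_germ[OF RY a] by (simp add: e_def)
    next
      case False
      then have "of_int (k i) + ?m * t i - b = 0" using b[OF i] by linarith
      then have "a y = 0" unfolding ay by (simp only: of_real_0 mult_zero_left)
      then show ?thesis using False ord_ge_1_iff[OF RY a] by (simp add: e_def)
    qed
    then have o1: "ord_ge Y y (k i + e) (\<lambda>q. coord Y y q powi k i * a q)" by (rule ord_ge_shift[OF RY])
    have o2: "ord_ge Y y (k i + 0) (\<lambda>q. ?c i q * v q)"
      by (rule ord_ge_mult[OF RY c[OF i] ord_ge_holo_germ[OF RY v(1)]])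
    define b' where "b' = min (?m * t i + of_int (k i + e)) (?m * t' + of_int (k i + 0))"
    have "?m * t i < ?m * t'" using t'(1) mult_pos[of y] by simp
    then have "b < b'" using b[OF i] by (auto simp: b'_def e_def)
    moreover have "(\<lambda>q. (coord Y y q powi k i * a q) *s u i (f q) + (?c i q * v q) *s r (f q)) \<in> germs ?F y b'"
      by (intro germs_add[OF RY sp'] germs_pull_term[OF sp u[OF i] o1] germs_pull_term[OF sp t'(2)[folded r_def] o2])
         (auto simp: b'_def)
    then have "?T i \<in> germs ?F y b'" using germs_cong[OF RY sp' T] by blast
    ultimately show ?thesis by blast
  qed
  \<comment> \<open>The minimum is a common parameter for finitely many terms; the start value
    \<open>b + 1\<close> serves the empty sum.\<close>
  have "\<exists>b'>b. \<forall>i<n. ?T i \<in> germs ?F y b'" if "n \<le> N" for n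
    using that
  proof (induction n)
    case 0
    show ?case by (intro exI[of _ "b + 1"]) simp
  next
    case (Suc n)
    then obtain b1 where b1: "b1 > b" "\<forall>i<n. ?T i \<in> germs ?F y b1" by auto
    obtain b2 where b2: "b2 > b" "?T n \<in> germs ?F y b2" using ex[of n] Suc.prems by auto
    have "?T i \<in> germs ?F y (min b1 b2)" if "i < Suc n" for i
    proof (cases "i = n")
      case True
      then show ?thesis using germs_mono[OF RY sp' b2(2), of "min b1 b2"] by simp
    next
      case False
      then have "?T i \<in> germs ?F y b1" using b1(2) that by simp
      then show ?thesis by (rule germs_mono[OF RY sp']) simp
    qed
    then show ?case using b1(1) b2(1) by (intro exI[of _ "min b1 b2"]) simp
  qed
  then obtain b' where b': "b' > b" "\<forall>i<N. ?T i \<in> germs ?F y b'" by blast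
  have "(\<lambda>q. \<Sum>i<N. ?T i q) \<in> germs ?F y b'"
    by (rule germs_sum[OF RY sp']) (use b'(2) in simp)
  then have "(\<lambda>q. euler Y (pullback_connection X f L nab) y s q - complex_of_real b *s s q) \<in> germs ?F y b'"
    using germs_cong[OF RY sp' e] by blast
  then show "\<exists>b'>b. (\<lambda>q. euler Y (pullback_connection X f L nab) y s q - complex_of_real b *s s q) \<in> germs ?F y b'"
    using b'(1) by blast
qed

end

section \<open>Compatibility and monodromy\<close>

lemma tensor_vec_sum2:
  "tensor_vec (\<Sum>i\<in>I. u i) (\<Sum>j\<in>J. v j) = (\<Sum>i\<in>I. \<Sum>j\<in>J. tensor_vec (u i) (v j))"
  by (simp only: tensor_vec_sum(1)) (simp only: tensor_vec_sum(2))

context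
  fixes X :: "'x::t2_space chart set"
  assumes RS: "riemann_surface X"
begin

lemma sgerm_tensor:
  assumes "sgerm X (atlas E) p u" "sgerm X (atlas E') p v"
    and V: "vector_bundle X S (atlas E)" "vector_bundle X S (atlas E')" and p: "p \<in> S"
  shows "sgerm X (atlas (parabolic_tensor E E')) p (\<lambda>q. tensor_vec (u q) (v q))"
  unfolding sgerm_def
proof clarify
  fix Q h assume "(Q, h) \<in> atlas (parabolic_tensor E E')" "p \<in> Q"
  then obtain U g U' g' where *: "(U, g) \<in> atlas E" "(U', g') \<in> atlas E'" "p \<in> U" "p \<in> U'"
    "h = (\<lambda>q. tensor_mat (g q) (g' q))" unfolding atlas_tensor by blast
  have "hvec X p (\<lambda>q. g q *v u q)" "hvec X p (\<lambda>q. g' q *v v q)"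
    using assms(1,2) * by (auto simp: sgerm_def)
  then show "hvec X p (\<lambda>q. h q *v tensor_vec (u q) (v q))"
    unfolding *(5) tensor_mat_vec unfolding hvec_def tensor_vec_def by (auto intro: holo_germ_mult[OF RS])
qed

lemma hom_sgerm:
  assumes hom: "parabolic_hom X D E E' \<psi>" and V: "vector_bundle X (- D) (atlas E)" "vector_bundle X (- D) (atlas E')"
    and p: "p \<notin> D" and s: "sgerm X (atlas E) p s"
  shows "sgerm X (atlas E') p (\<lambda>q. \<psi> q *v s q)"
proof -
  have p': "p \<in> - D" using p by simp
  obtain W where W: "open W" "p \<in> W" "W \<subseteq> - D" "holo_section X (atlas E) W s"
    by (rule sgerm_section'[OF RS V(1) s p'])
  then have "holo_section X (atlas E') W (\<lambda>q. \<psi> q *v s q)"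
    using hom unfolding parabolic_hom_def by blast
  then show ?thesis unfolding section_iff[OF RS V(2)] using W by blast
qed

lemma compatible_germ:
  assumes comp: "compatible_connection X D E \<phi> nab nabL" and VE: "vector_bundle X (- D) (atlas E)"
    and p: "p \<notin> D" and u: "sgerm X (atlas E) p u" "sgerm X (atlas E) p v" and c: "c \<in> X" "p \<in> fst c"
  shows "\<phi> p *v tensor_vec (nab c u p) (v p) + \<phi> p *v tensor_vec (u p) (nab c v p)
             = nabL c (\<lambda>q. \<phi> q *v tensor_vec (u q) (v q)) p"
proof -
  have p': "p \<in> - D" using p by simp
  obtain W1 where W1: "open W1" "p \<in> W1" "W1 \<subseteq> - D" "holo_section X (atlas E) W1 u"
    by (rule sgerm_section'[OF RS VE u(1) p'])
  obtain W where W: "open W" "p \<in> W" "W \<subseteq> W1" "W \<subseteq> - D" "holo_section X (atlas E) W v"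
    by (rule sgerm_section[OF RS VE u(2) W1(1,2) p'])
  have "holo_section X (atlas E) W u" using W1(4) W(1,3) unfolding section_iff[OF RS VE] by blast
  from comp[unfolded compatible_connection_def, rule_format, OF W(4) this W(5) c(1)] show ?thesis
    using W(2) c(2) by blast
qed

end

context covering
begin

text \<open>Both sides obey the same Leibniz rule in the coefficients, so the comparison reduces to
  the pulled back frame. There the identity is compatibility on \<open>X\<close> applied to
  \<open>e i\<close> and \<open>e j\<close>.\<close>

lemma compatible_pullback:
  fixes E :: "('x, 'r::finite) filtered_bundle" and L :: "('x, 1) filtered_bundle"
  assumes comp: "compatible_connection X D E \<phi> nab nabL"
    and VE: "vector_bundle X (- D) (atlas E)" and VL: "vector_bundle X (- D) (atlas L)"
    and H: "holo_connection X (- D) (atlas E) nab" and HL: "holo_connection X (- D) (atlas L) nabL"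
    and hom: "parabolic_hom X D (parabolic_tensor E E) L \<phi>"
  shows "compatible_connection Y (f -` D) (pullback_bundle Y X f E) (pullback_form f \<phi>)
    (pullback_connection X f E nab) (pullback_connection X f L nabL)"
  unfolding compatible_connection_def
proof (intro allI impI ballI)
  let ?F = "pullback_bundle Y X f E"
  have VF: "vector_bundle Y (- f -` D) (atlas ?F)"
    using vector_bundle_pullback[OF VE] by (simp add: vimage_Compl)
  have VFL: "vector_bundle Y (- f -` D) (atlas (pullback_bundle Y X f L))"
    using vector_bundle_pullback[OF VL] by (simp add: vimage_Compl)
  fix W u v c y assume W: "W \<subseteq> - f -` D" and uv: "holo_section Y (atlas ?F) W u" "holo_section Y (atlas ?F) W v"
    and "c \<in> Y" "y \<in> W \<inter> fst c"
  then have c: "c \<in> Y" "y \<in> fst c" and y: "f y \<notin> D" and u: "sgerm Y (atlas ?F) y u" and v: "sgerm Y (atlas ?F) y v"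
    unfolding section_iff[OF RY VF] by auto
  define \<gamma> where "\<gamma> = snd (triv_at (atlas E) (f y))"
  define cX where "cX = chart_at X (f y)"
  define dz where "dz = chart_deriv c (snd cX \<circ> f) y"
  have \<gamma>: "compat X (atlas E) (f y) \<gamma>" unfolding \<gamma>_def by (rule triv_at_props[OF VE H y])
  have cX: "cX \<in> X" "f y \<in> fst cX" using chart_at[OF RX] by (auto simp: cX_def)
  define e where "e i p = matrix_inv (\<gamma> p) *v axis i 1" for i p
  define a where "a i q = (\<gamma> (f q) *v u q) $ i" for i q
  define b where "b i q = (\<gamma> (f q) *v v q) $ i" for i q
  \<comment> \<open>The values of the form on pairs of frame vectors are sections of
    \<open>L\<close> on \<open>X\<close>; hence \<open>pb_pull\<close> expresses their derivatives
    through \<open>nabL\<close>.\<close>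
  define \<psi> where "\<psi> i j p = \<phi> p *v tensor_vec (e i p) (e j p)" for i j p
  have e: "sgerm X (atlas E) (f y) (e i)" for i unfolding e_def[abs_def] by (rule sgerm_frame[OF RX VE \<gamma>])
  have a: "holo_germ Y y (a i)" for i unfolding a_def[abs_def] by (rule pull_coordinates[OF VE H y c \<gamma> u])
  have b: "holo_germ Y y (b i)" for i unfolding b_def[abs_def] by (rule pull_coordinates[OF VE H y c \<gamma> v])
  have \<psi>: "sgerm X (atlas L) (f y) (\<psi> i j)" for i j
    unfolding \<psi>_def[abs_def]
    by (rule hom_sgerm[OF RX hom vector_bundle_tensor[OF RX VE VE] VL y sgerm_tensor[OF RX e e VE VE]]) (use y in simp)
  have nu: "pullback_connection X f E nab c u y = (\<Sum>i\<in>UNIV. chart_deriv c (a i) y *s e i (f y) + (a i y * dz) *s nab cX (e i) (f y))"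
    unfolding a_def[abs_def] e_def[abs_def] dz_def by (rule pb_expand[OF VE H y c \<gamma> cX u])
  have nv: "pullback_connection X f E nab c v y = (\<Sum>i\<in>UNIV. chart_deriv c (b i) y *s e i (f y) + (b i y * dz) *s nab cX (e i) (f y))"
    unfolding b_def[abs_def] e_def[abs_def] dz_def by (rule pb_expand[OF VE H y c \<gamma> cX v])
  have ua: "\<forall>\<^sub>F q in nhds y. u q = (\<Sum>i\<in>UNIV. a i q *s e i (f q))"
    unfolding a_def e_def by (rule pull_frame[OF VE H \<gamma>])
  have vb: "\<forall>\<^sub>F q in nhds y. v q = (\<Sum>i\<in>UNIV. b i q *s e i (f q))"
    unfolding b_def e_def by (rule pull_frame[OF VE H \<gamma>])
  have uy: "u y = (\<Sum>i\<in>UNIV. a i y *s e i (f y))" and vy: "v y = (\<Sum>i\<in>UNIV. b i y *s e i (f y))"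
    using eventually_nhds_x_imp_x[OF ua] eventually_nhds_x_imp_x[OF vb] by auto
  have "pullback_connection X f L nabL c (\<lambda>q. \<phi> (f q) *v tensor_vec (u q) (v q)) y =
      pullback_connection X f L nabL c (\<lambda>q. \<Sum>i\<in>UNIV. \<Sum>j\<in>UNIV. (a i q * b j q) *s \<psi> i j (f q)) y"
  proof (rule pb_cong[OF VL HL y c])
    show "\<forall>\<^sub>F q in nhds y. \<phi> (f q) *v tensor_vec (u q) (v q) = (\<Sum>i\<in>UNIV. \<Sum>j\<in>UNIV. (a i q * b j q) *s \<psi> i j (f q))"
      using ua vb
      by eventually_elim (simp only: tensor_vec_sum2 tensor_vec_scale matrix_vector_sum vector_scalar_commute \<psi>_def
          vector_smult_assoc mult.commute)
  qed
  also have "\<dots> = (\<Sum>i\<in>UNIV. pullback_connection X f L nabL c (\<lambda>q. \<Sum>j\<in>UNIV. (a i q * b j q) *s \<psi> i j (f q)) y)"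
    by (intro pb_sum[OF VL HL y c] sgerm_sum[OF RY VFL] sgerm_scale[OF RY VFL] holo_germ_mult[OF RY] a b
        pull_sgerm[OF VL HL y c] \<psi>)
  also have "\<dots> = (\<Sum>i\<in>UNIV. \<Sum>j\<in>UNIV. pullback_connection X f L nabL c (\<lambda>q. (a i q * b j q) *s \<psi> i j (f q)) y)"
    by (intro sum.cong[OF refl] pb_sum[OF VL HL y c] sgerm_scale[OF RY VFL] holo_germ_mult[OF RY] a b
        pull_sgerm[OF VL HL y c] \<psi>)
  also have "\<dots> = (\<Sum>i\<in>UNIV. \<Sum>j\<in>UNIV. chart_deriv c (\<lambda>q. a i q * b j q) y *s \<psi> i j (f y)
      + (a i y * b j y * dz) *s nabL cX (\<psi> i j) (f y))"
    unfolding dz_def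
    by (intro sum.cong[OF refl] pb_pull[OF VL HL y c \<psi> holo_germ_mult[OF RY a b] cX])
  also have "\<dots> = (\<Sum>i\<in>UNIV. \<Sum>j\<in>UNIV. (chart_deriv c (a i) y * b j y + a i y * chart_deriv c (b j) y) *s \<psi> i j (f y)
      + (a i y * b j y * dz) *s (\<phi> (f y) *v tensor_vec (nab cX (e i) (f y)) (e j (f y))
         + \<phi> (f y) *v tensor_vec (e i (f y)) (nab cX (e j) (f y))))"
    unfolding chart_deriv_mult[OF RY c a b] compatible_germ[OF RX comp VE y e e cX] \<psi>_def[abs_def] ..
  finally have R: "pullback_connection X f L nabL c (\<lambda>q. \<phi> (f q) *v tensor_vec (u q) (v q)) y = \<dots>" .
  let ?N = "\<lambda>i. nab cX (e i) (f y)" and ?P = "\<lambda>s t. \<phi> (f y) *v tensor_vec s t"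
  have P1: "?P (\<Sum>i\<in>UNIV. s i) (\<Sum>j\<in>UNIV. t j) = (\<Sum>i\<in>UNIV. \<Sum>j\<in>UNIV. ?P (s i) (t j))" for s t :: "'r \<Rightarrow> complex ^ 'r"
    by (simp only: tensor_vec_sum2 matrix_vector_sum)
  have "?P (pullback_connection X f E nab c u y) (v y) + ?P (u y) (pullback_connection X f E nab c v y)
      = (\<Sum>i\<in>UNIV. \<Sum>j\<in>UNIV. ?P (chart_deriv c (a i) y *s e i (f y) + (a i y * dz) *s ?N i) (b j y *s e j (f y))
        + ?P (a i y *s e i (f y)) (chart_deriv c (b j) y *s e j (f y) + (b j y * dz) *s ?N j))"
    unfolding nu nv uy vy P1 sum.distrib[symmetric] ..
  also have "\<dots> = (\<Sum>i\<in>UNIV. \<Sum>j\<in>UNIV. (chart_deriv c (a i) y * b j y + a i y * chart_deriv c (b j) y) *s \<psi> i j (f y)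
      + (a i y * b j y * dz) *s (?P (?N i) (e j (f y)) + ?P (e i (f y)) (?N j)))"
    by (intro sum.cong[OF refl])
       (simp only: tensor_vec_add tensor_vec_scale matrix_vector_right_distrib vector_scalar_commute \<psi>_def,
        simp add: vec_eq_iff algebra_simps)
  finally show "pullback_form f \<phi> y *v tensor_vec (pullback_connection X f E nab c u y) (v y) +
      pullback_form f \<phi> y *v tensor_vec (u y) (pullback_connection X f E nab c v y) =
      pullback_connection X f L nabL c (\<lambda>q. pullback_form f \<phi> q *v tensor_vec (u q) (v q)) y"
    unfolding pullback_form_def o_def R by simp
qed

end

section \<open>Flat sections of line bundles\<close>

context
  fixes X :: "'x::t2_space chart set"
  assumes RS: "riemann_surface X"
begin

text \<open>One integrates the connection form of a local frame.\<close>

lemma local_flat_section: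
  fixes T :: "('x, 1) bundle_atlas"
  assumes V: "vector_bundle X S T" and H: "holo_connection X S T nab" and x: "x \<in> S"
  obtains s where "sgerm X T x s" "s x \<noteq> 0" "\<forall>\<^sub>F p in nhds x. \<forall>c\<in>X. p \<in> fst c \<longrightarrow> nab c s p = 0"
proof -
  obtain U g where U: "(U, g) \<in> T" "x \<in> U" using triv_ex[OF RS V x] by blast
  note cg = triv_compat[OF RS V U]
  define e where "e q = matrix_inv (g q) *v axis 1 1" for q
  define c where "c = chart_at X x"
  have c: "c \<in> X" "x \<in> fst c" using chart_at[OF RS] by (auto simp: c_def)
  have e: "sgerm X T x e" unfolding e_def[abs_def] by (rule sgerm_frame[OF RS V cg])
  \<comment> \<open>The connection form in the frame \<open>e\<close>: in the chart \<open>c\<close>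
    the derivative of \<open>e\<close> is \<open>a\<close> times \<open>e\<close>.\<close>
  define a where "a q = (g q *v nab c e q) $ 1" for q
  have a: "holo_germ X x a"
    using nab_sgerm[OF RS V H e x c] unfolding compat_sgerm[OF RS V cg] hvec_def a_def[abs_def] by blast
  have ee: "v = (g q *v v) $ 1 *s e q" if "invertible (g q)" for q v
  proof -
    have "(g q *v v) $ 1 *s axis 1 1 = g q *v v" by (simp add: vec_eq_iff forall_1 axis_def)
    then have "(g q *v v) $ 1 *s e q = matrix_inv (g q) *v (g q *v v)"
      unfolding e_def by (metis vector_scalar_commute)
    then show ?thesis using that by simp
  qed
  obtain r where r: "r > 0" "(a \<circ> ich c) holomorphic_on ball (snd c x) r"
    using a holo_germ_iff[OF RS c] analytic_at_ball by metis
  obtain A where A: "\<And>w. w \<in> ball (snd c x) r \<Longrightarrow> (A has_field_derivative (a \<circ> ich c) w) (at w within ball (snd c x) r)"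
    using holomorphic_convex_primitive'[OF convex_ball open_ball r(2)] by blast
  then have A': "(A has_field_derivative (a \<circ> ich c) w) (at w)" if "w \<in> ball (snd c x) r" for w
    using that by (metis at_within_open open_ball)
  have Ahol: "A holomorphic_on ball (snd c x) r"
    using A' by (meson field_differentiable_at_within field_differentiable_def holomorphic_onI)
  \<comment> \<open>With \<open>A\<close> a primitive of the connection form, \<open>F\<close>
    solves F' = - a F, the equation for \<open>F\<close> times \<open>e\<close> to be flat.\<close>
  define F where "F w = exp (- A w)" for w
  have Fan: "F analytic_on {w}" if "w \<in> ball (snd c x) r" for w
  proof (rule holomorphic_on_imp_analytic_at[OF _ open_ball that])
    show "F holomorphic_on ball (snd c x) r" unfolding F_def[abs_def] by (intro holomorphic_intros Ahol)
  qed
  have dF: "deriv F w = - (a \<circ> ich c) w * F w" if "w \<in> ball (snd c x) r" for w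
    unfolding F_def[abs_def] by (intro DERIV_imp_deriv) (auto intro!: derivative_eq_intros A'[OF that])
  define s where "s q = F (snd c q) *s e q" for q
  have Fg: "holo_germ X p (\<lambda>q. F (snd c q))" if "p \<in> fst c" "snd c p \<in> ball (snd c x) r" for p
    by (rule holo_germ_compose[OF RS holo_germ_chart[OF RS c(1) that(1)] Fan[OF that(2)]])
  have "sgerm X T x s" unfolding s_def[abs_def]
    by (rule sgerm_scale[OF RS V Fg[OF c(2)] e]) (use r(1) in simp)
  moreover have "s x \<noteq> 0"
  proof
    assume "s x = 0"
    then have "e x = 0" by (simp add: s_def F_def)
    then have "g x *v e x = 0" by simp
    then show False using triv_invertible[OF RS V U] by (simp add: e_def axis_eq_0_iff)
  qed
  moreover have "\<forall>\<^sub>F p in nhds x. snd c p \<in> ball (snd c x) r"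
    using tendsto_chart[OF RS c] r(1) eventually_nhds_in_open[OF open_ball, of "snd c x" "snd c x" r]
    by (auto simp: filterlim_iff)
  then have "\<forall>\<^sub>F p in nhds x. \<forall>c\<in>X. p \<in> fst c \<longrightarrow> nab c s p = 0"
    using eventually_chart_domain[OF RS c] sgerm_eventually[OF RS V e x] eventually_triv[OF RS V U]
      eventually_nhds_in_open[OF open_base[OF RS V] x]
  proof eventually_elim
    case (elim p)
    have p: "p \<in> S" "c \<in> X" "p \<in> fst c" using elim c by auto
    have "nab c s p = chart_deriv c (\<lambda>q. F (snd c q)) p *s e p + F (snd c p) *s nab c e p"
      unfolding s_def[abs_def] using elim by (intro nab_scale[OF RS V H _ Fg p]) auto
    also have "chart_deriv c (\<lambda>q. F (snd c q)) p = - a p * F (snd c p)"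
      using chart_deriv_compose[OF RS p(2,3) holo_germ_chart[OF RS p(2,3)] Fan[OF elim(1)]] dF[OF elim(1)]
        chart_deriv_self[OF RS p(2,3)] ich_chart[OF RS p(2,3)] by simp
    also have "nab c e p = a p *s e p" unfolding a_def by (rule ee) (use elim in simp)
    finally have 0: "nab c s p = 0" by (simp add: vec_eq_iff)
    have sp: "sgerm X T p s" unfolding s_def[abs_def]
      using elim by (intro sgerm_scale[OF RS V Fg]) auto
    show ?case
    proof (intro ballI impI)
      fix c' assume "c' \<in> X" "p \<in> fst c'"
      then show "nab c' s p = 0" using nab_change[OF RS V H sp p, of c'] 0 by simp
    qed
  qed
  ultimately show thesis using that by blast
qed

lemma chart_deriv_zero_const:
  assumes c: "c \<in> X" "x \<in> fst c" and h: "holo_germ X x h" and d: "\<forall>\<^sub>F p in nhds x. chart_deriv c h p = 0"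
  shows "\<forall>\<^sub>F p in nhds x. h p = h x"
proof -
  have dw: "\<forall>\<^sub>F w in nhds (snd c x). deriv (h \<circ> ich c) w = 0"
    using d[unfolded eventually_nhds_chart[OF RS c]] eventually_chart_image[OF RS c]
    by eventually_elim (simp add: chart_deriv_def chart_ich[OF RS])
  obtain S where S: "open S" "snd c x \<in> S" "(h \<circ> ich c) holomorphic_on S"
    using h holo_germ_iff[OF RS c] analytic_at by metis
  have "\<forall>\<^sub>F w in nhds (snd c x). deriv (h \<circ> ich c) w = 0 \<and> w \<in> S"
    using dw eventually_nhds_in_open[OF S(1,2)] by eventually_elim simp
  then obtain r where r: "r > 0" "\<And>w. w \<in> ball (snd c x) r \<Longrightarrow> deriv (h \<circ> ich c) w = 0 \<and> w \<in> S"
    unfolding eventually_nhds_metric by (auto simp: dist_commute)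
  have "\<exists>k. \<forall>w\<in>ball (snd c x) r. (h \<circ> ich c) w = k"
  proof (rule has_field_derivative_zero_constant[OF convex_ball])
    fix w assume w: "w \<in> ball (snd c x) r"
    have "((h \<circ> ich c) has_field_derivative 0) (at w)"
      using holomorphic_derivI[OF S(3,1)] r(2)[OF w] by metis
    then show "((h \<circ> ich c) has_field_derivative 0) (at w within ball (snd c x) r)"
      by (rule has_field_derivative_at_within)
  qed
  then have k: "(h \<circ> ich c) w = h x" if "w \<in> ball (snd c x) r" for w
    using that r(1) ich_chart[OF RS c] by (metis centre_in_ball comp_apply)
  have "\<forall>\<^sub>F w in nhds (snd c x). w \<in> ball (snd c x) r"
    using r(1) by (intro eventually_nhds_in_open) auto
  then have "\<forall>\<^sub>F w in nhds (snd c x). h (ich c w) = h x"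
    by eventually_elim (use k in simp)
  then show ?thesis using eventually_nhds_chart[OF RS c, where P = "\<lambda>p. h p = h x"] by blast
qed

end

section \<open>Monodromy of the pullback\<close>

context covering
begin

text \<open>
  A flat section of the pullback of a line bundle is locally a constant multiple of a pulled back
  flat section; hence parallel transport along \<open>\<gamma>\<close> is parallel transport along \<open>f \<circ> \<gamma>\<close>.
\<close>

lemma unitary_pullback:
  fixes L :: "('x, 1) filtered_bundle"
  assumes VL: "vector_bundle X (- D) (atlas L)" and H: "holo_connection X (- D) (atlas L) nab"
    and un: "unitary_monodromy X (- D) (atlas L) nab"
  shows "unitary_monodromy Y (- f -` D) (atlas (pullback_bundle Y X f L)) (pullback_connection X f L nab)"
  unfolding unitary_monodromy_def
proof (intro allI impI)
  let ?F = "atlas (pullback_bundle Y X f L)"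
  have VF: "vector_bundle Y (- f -` D) ?F"
    using vector_bundle_pullback[OF VL] by (simp add: vimage_Compl)
  fix \<gamma> \<sigma> assume path: "path \<gamma>" and im: "path_image \<gamma> \<subseteq> - f -` D" and loop: "pathstart \<gamma> = pathfinish \<gamma>"
    and par: "parallel_along Y (- f -` D) ?F (pullback_connection X f L nab) \<gamma> \<sigma>"
  have "parallel_along X (- D) (atlas L) nab (f \<circ> \<gamma>) \<sigma>"
    unfolding parallel_along_def
  proof
    fix t :: real assume t: "t \<in> {0..1}"
    define y where "y = \<gamma> t"
    from par t obtain W s d where W: "y \<in> W" "W \<subseteq> - f -` D" "holo_section Y ?F W s"
      and flat: "\<forall>c\<in>Y. \<forall>p\<in>W \<inter> fst c. pullback_connection X f L nab c s p = 0"
      and d: "d > 0" "\<forall>t'\<in>{0..1}. \<bar>t' - t\<bar> < d \<longrightarrow> \<gamma> t' \<in> W \<and> \<sigma> t' = s (\<gamma> t')"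
      unfolding parallel_along_def y_def by meson
    have o: "open W" and s: "\<And>q. q \<in> W \<Longrightarrow> sgerm Y ?F q s" using W(3) unfolding section_iff[OF RY VF] by auto
    have y: "f y \<in> - D" using W(1,2) by auto
    obtain e where e: "sgerm X (atlas L) (f y) e" "e (f y) \<noteq> 0"
      "\<forall>\<^sub>F p in nhds (f y). \<forall>c\<in>X. p \<in> fst c \<longrightarrow> nab c e p = 0"
      by (rule local_flat_section[OF RX VL H y])
    obtain U g where U: "(U, g) \<in> atlas L" "f y \<in> U" using triv_ex[OF RX VL y] by blast
    note cg = triv_compat[OF RX VL U]
    define c where "c = chart_at Y y"
    have c: "c \<in> Y" "y \<in> fst c" using chart_at[OF RY] by (auto simp: c_def)
    define \<epsilon> where "\<epsilon> p = (g p *v e p) $ 1" for p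
    define \<tau> where "\<tau> q = (g (f q) *v s q) $ 1" for q
    have y': "f y \<notin> D" using y by simp
    have \<epsilon>: "holo_germ X (f y) \<epsilon>"
      using e(1) unfolding compat_sgerm[OF RX VL cg] hvec_def \<epsilon>_def[abs_def] by blast
    have \<tau>: "holo_germ Y y \<tau>" unfolding \<tau>_def[abs_def]
      by (rule pull_coordinates[OF VL H y' c cg s[OF W(1)]])
    have \<epsilon>0: "\<epsilon> (f y) \<noteq> 0"
    proof
      assume "\<epsilon> (f y) = 0"
      then have "g (f y) *v e (f y) = 0" by (simp add: \<epsilon>_def vec_eq_iff forall_1)
      then show False using e(2) matrix_inv_vector(2)[OF triv_invertible[OF RX VL U], of "e (f y)"] by simp
    qed
    \<comment> \<open>The quotient of the flat section \<open>s\<close> by the pullback of the flat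
      section \<open>e\<close>. Flatness of both and the Leibniz rule force its derivative to
      vanish, so it is constant near \<open>y\<close>.\<close>
    define k where "k q = \<tau> q * inverse ((\<epsilon> \<circ> f) q)" for q
    have k: "holo_germ Y y k" unfolding k_def[abs_def]
      using \<epsilon>0 by (intro holo_germ_mult holo_germ_inverse holo_germ_pull \<epsilon> \<tau> RY) auto
    have \<epsilon>n: "\<forall>\<^sub>F q in nhds y. \<epsilon> (f q) \<noteq> 0"
      by (rule eventually_nhds_f[OF holo_germ_eventually_nonzero[OF RX \<epsilon> \<epsilon>0]])
    have sk: "\<forall>\<^sub>F q in nhds y. s q = k q *s e (f q)"
      using \<epsilon>n eventually_nhds_f[OF eventually_triv[OF RX VL U]]
    proof eventually_elim
      case (elim q)
      have "g (f q) *v s q = g (f q) *v (k q *s e (f q))"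
        using elim by (simp add: vec_eq_iff forall_1 vector_scalar_commute k_def \<tau>_def \<epsilon>_def)
      then have "matrix_inv (g (f q)) *v (g (f q) *v s q) = matrix_inv (g (f q)) *v (g (f q) *v (k q *s e (f q)))" by simp
      then show ?case using elim by simp
    qed
    have "\<forall>\<^sub>F q in nhds y. chart_deriv c k q = 0"
      using eventually_eventually[THEN iffD2, OF sk] \<epsilon>n eventually_nhds_f[OF e(3)] eventually_chart_domain[OF RY c]
        eventually_nhds_f[OF sgerm_eventually[OF RX VL e(1) y]] holo_germ_eventually[OF RY k]
        eventually_nhds_in_open[OF o W(1)]
    proof eventually_elim
      case (elim q)
      have q: "f q \<notin> D" "c \<in> Y" "q \<in> fst c" using elim c W(2) by auto
      define cX where "cX = chart_at X (f q)"
      have cX: "cX \<in> X" "f q \<in> fst cX" using chart_at[OF RX] by (auto simp: cX_def)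
      have "0 = pullback_connection X f L nab c s q" using flat elim q by simp
      also have "\<dots> = pullback_connection X f L nab c (\<lambda>q. k q *s e (f q)) q"
        by (rule pb_cong[OF VL H q elim(1)])
      also have "\<dots> = chart_deriv c k q *s e (f q) + (k q * chart_deriv c (snd cX \<circ> f) q) *s nab cX e (f q)"
        by (rule pb_pull[OF VL H q elim(5,6) cX])
      also have "nab cX e (f q) = 0" using elim(3) cX by blast
      finally have "chart_deriv c k q *s e (f q) = 0" by simp
      moreover have "e (f q) \<noteq> 0" using elim(2) by (auto simp: \<epsilon>_def)
      ultimately show ?case by (simp add: vec_eq_iff forall_1)
    qed
    from chart_deriv_zero_const[OF RY c k this]
    have sK: "\<forall>\<^sub>F q in nhds y. s q = k y *s e (f q)"
      using sk by eventually_elim simp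
    \<comment> \<open>A flat section on \<open>X\<close> whose pullback is \<open>s\<close> near
      \<open>y\<close>; it carries the parallel transport along the image path.\<close>
    define E where "E p = k y *s e p" for p
    have E: "sgerm X (atlas L) (f y) E" unfolding E_def[abs_def]
      by (rule sgerm_scale[OF RX VL holo_germ_const[OF RX] e(1)])
    have "\<forall>\<^sub>F p in nhds (f y). (\<forall>c\<in>X. p \<in> fst c \<longrightarrow> nab c E p = 0)"
      using e(3) sgerm_eventually[OF RX VL e(1) y] eventually_nhds_in_open[OF open_base[OF RX VL] y]
    proof eventually_elim
      case (elim p)
      show ?case
      proof (intro ballI impI)
        fix c' assume c': "c' \<in> X" "p \<in> fst c'"
        show "nab c' E p = 0"
          using nab_scale[OF RX VL H elim(2) holo_germ_const[OF RX] elim(3) c', of "k y"] elim(1) c'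
          by (simp add: E_def[abs_def] chart_deriv_const[OF RX])
      qed
    qed
    then obtain Q where Q: "open Q" "f y \<in> Q" "\<forall>p\<in>Q. \<forall>c\<in>X. p \<in> fst c \<longrightarrow> nab c E p = 0"
      unfolding eventually_nhds by blast
    obtain Z where Z: "open Z" "f y \<in> Z" "Z \<subseteq> Q" "Z \<subseteq> - D" "holo_section X (atlas L) Z E"
      by (rule sgerm_section[OF RX VL E Q(1,2) y])
    have "\<forall>\<^sub>F q in nhds y. s q = E (f q) \<and> f q \<in> Z"
      using sK eventually_nhds_f[OF eventually_nhds_in_open[OF Z(1,2)]] by eventually_elim (simp add: E_def)
    then obtain N where N: "open N" "y \<in> N" "\<forall>q\<in>N. s q = E (f q) \<and> f q \<in> Z" unfolding eventually_nhds by blast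
    have "continuous_on {0..1} \<gamma>" using path by (simp add: path_def)
    then have "(\<gamma> \<longlongrightarrow> \<gamma> t) (at t within {0..1})" using t by (simp add: continuous_on_def)
    then have "\<forall>\<^sub>F t' in at t within {0..1}. \<gamma> t' \<in> N" using N(1,2) unfolding tendsto_def y_def by blast
    then obtain d' where d': "d' > 0" "\<forall>t'\<in>{0..1}. t' \<noteq> t \<and> dist t' t < d' \<longrightarrow> \<gamma> t' \<in> N"
      unfolding eventually_at by blast
    show "\<exists>W s. (f \<circ> \<gamma>) t \<in> W \<and> W \<subseteq> - D \<and> holo_section X (atlas L) W s \<and>
        (\<forall>c\<in>X. \<forall>p\<in>W \<inter> fst c. nab c s p = 0) \<and>
        (\<exists>e>0. \<forall>t'\<in>{0..1}. \<bar>t' - t\<bar> < e \<longrightarrow> (f \<circ> \<gamma>) t' \<in> W \<and> \<sigma> t' = s ((f \<circ> \<gamma>) t'))"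
    proof (intro exI[of _ Z] exI[of _ E] exI[of _ "min d d'"] conjI ballI impI)
      show "(f \<circ> \<gamma>) t \<in> Z" using Z(2) by (simp add: y_def)
      fix t' assume t': "t' \<in> {0..1}" "\<bar>t' - t\<bar> < min d d'"
      have "\<gamma> t' \<in> N"
      proof (cases "t' = t")
        case True
        then show ?thesis using N(2) by (simp add: y_def)
      next
        case False
        then show ?thesis using d'(2) t' by (simp add: dist_real_def)
      qed
      then show "(f \<circ> \<gamma>) t' \<in> Z" "\<sigma> t' = E ((f \<circ> \<gamma>) t')"
        using N(3) d(2) t' by simp_all
    qed (use Z Q d(1) d'(1) in auto)
  qed
  moreover have "path (f \<circ> \<gamma>)"
    using path holo_f by (intro path_continuous_image) (auto simp: holo_map_def intro: continuous_on_subset)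
  moreover have "path_image (f \<circ> \<gamma>) \<subseteq> - D" using im by (auto simp: path_image_def)
  moreover have "pathstart (f \<circ> \<gamma>) = pathfinish (f \<circ> \<gamma>)"
    using loop by (simp add: pathstart_def pathfinish_def)
  ultimately show "norm (\<sigma> 1) = norm (\<sigma> 0)"
    using un unfolding unitary_monodromy_def by blast
qed

end

section \<open>The degree of the pullback\<close>

text \<open>Taking an m-th root of the unit gives F = H^m with H injective near \<open>w0\<close>.
  So the fibres of F in \<open>V\<close> correspond to the roots of z^m, and its derivative, m times
  H^(m-1) times H', vanishes only where F does.\<close>

lemma local_power_fibre:
  fixes U :: "complex \<Rightarrow> complex"
  assumes U: "U analytic_on {w0}" "U w0 \<noteq> 0" and m: "m > 0" and N: "open N" "w0 \<in> N"
  defines "F \<equiv> \<lambda>w. (w - w0) ^ m * U w"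
  shows "\<exists>V \<delta>. open V \<and> w0 \<in> V \<and> V \<subseteq> N \<and> \<delta> > 0 \<and> (\<forall>w\<in>V. F w = 0 \<longrightarrow> w = w0) \<and>
    (\<forall>\<zeta>. \<zeta> \<noteq> 0 \<longrightarrow> norm \<zeta> < \<delta> \<longrightarrow> card {w\<in>V. F w = \<zeta>} = m) \<and> (\<forall>w\<in>V. F w \<noteq> 0 \<longrightarrow> deriv F w \<noteq> 0)"
proof -
  obtain S where S: "open S" "w0 \<in> S" "U holomorphic_on S" using U(1) analytic_at by metis
  have "\<forall>\<^sub>F w in nhds w0. U w \<noteq> 0"
    using analytic_at_neq_imp_eventually_neq[OF U] U(2) by (auto simp: eventually_at_filter elim: eventually_mono)
  then have "\<forall>\<^sub>F w in nhds w0. U w \<noteq> 0 \<and> w \<in> S \<and> w \<in> N"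
    using eventually_nhds_in_open[OF S(1,2)] eventually_nhds_in_open[OF N] by eventually_elim simp
  then obtain r where r: "r > 0" "\<And>w. w \<in> ball w0 r \<Longrightarrow> U w \<noteq> 0 \<and> w \<in> S \<and> w \<in> N"
    unfolding eventually_nhds_metric by (auto simp: dist_commute)
  have Uh: "U holomorphic_on ball w0 r" using S(3) r(2) by (meson holomorphic_on_subset subsetI)
  have "simply_connected (ball w0 r)" by (simp add: convex_imp_simply_connected)
  then obtain g where g: "g holomorphic_on ball w0 r" "\<forall>w\<in>ball w0 r. U w = exp (g w)"
    using simply_connected_eq_holomorphic_log[OF open_ball, of w0 r] Uh r(2) by blast
  \<comment> \<open>An m-th root of \<open>U\<close>, from a logarithm on the disc.\<close>
  define R where "R w = exp (g w / of_nat m)" for w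
  define H where "H w = (w - w0) * R w" for w
  have Rh: "R holomorphic_on ball w0 r" unfolding R_def[abs_def] using m by (intro holomorphic_intros g) auto
  have Hh: "H holomorphic_on ball w0 r" unfolding H_def[abs_def] by (intro holomorphic_intros Rh)
  have FH: "F w = H w ^ m" if "w \<in> ball w0 r" for w
    using that g(2) m by (simp add: F_def H_def R_def power_mult_distrib flip: exp_of_nat_mult)
  have w0: "w0 \<in> ball w0 r" using r(1) by simp
  have "(H has_field_derivative R w0) (at w0)"
    using holomorphic_derivI[OF Rh open_ball w0] unfolding H_def[abs_def]
    by (auto intro!: derivative_eq_intros)
  then have "deriv H w0 \<noteq> 0" by (simp add: DERIV_imp_deriv R_def)
  from has_complex_derivative_locally_invertible[OF Hh w0 open_ball this]
  obtain r2 where r2: "r2 > 0" "ball w0 r2 \<subseteq> ball w0 r" "open (H ` ball w0 r2)" "inj_on H (ball w0 r2)" by blast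
  have "0 \<in> H ` ball w0 r2" using r2(1) by (intro image_eqI[of _ _ w0]) (auto simp: H_def)
  then obtain d where d: "d > 0" "ball 0 d \<subseteq> H ` ball w0 r2" using r2(3) open_contains_ball by blast
  \<comment> \<open>The full preimage of a disc in the image of \<open>H\<close>: every m-th root of
    a sufficiently small number is attained inside \<open>V\<close>.\<close>
  define V where "V = ball w0 r2 \<inter> H -` ball 0 d"
  have Hh2: "H holomorphic_on ball w0 r2" using Hh r2(2) holomorphic_on_subset by blast
  have "open V" unfolding V_def
    by (intro continuous_open_preimage holomorphic_on_imp_continuous_on Hh2) auto
  moreover have "w0 \<in> V" using r2(1) d(1) by (simp add: V_def H_def)
  moreover have Vr: "V \<subseteq> ball w0 r" using r2(2) by (auto simp: V_def)
  then have "V \<subseteq> N" using r(2) by blast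
  moreover have "d ^ m > 0" using d(1) by simp
  moreover have H0: "w = w0" if "w \<in> V" "H w = 0" for w
    using that r2(1,4) by (auto simp: V_def H_def R_def)
  then have "\<forall>w\<in>V. F w = 0 \<longrightarrow> w = w0" using FH Vr by auto
  moreover have "card {w\<in>V. F w = \<zeta>} = m" if \<zeta>: "\<zeta> \<noteq> 0" "norm \<zeta> < d ^ m" for \<zeta>
  proof -
    have "bij_betw H {w\<in>V. F w = \<zeta>} {z. z ^ m = \<zeta>}"
      unfolding bij_betw_def
    proof (intro conjI equalityI subsetI)
      show "inj_on H {w\<in>V. F w = \<zeta>}" using r2(4) by (rule inj_on_subset) (auto simp: V_def)
      show "z \<in> {z. z ^ m = \<zeta>}" if "z \<in> H ` {w\<in>V. F w = \<zeta>}" for z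
        using that FH Vr by auto
      fix z assume "z \<in> {z. z ^ m = \<zeta>}"
      then have z: "z ^ m = \<zeta>" by simp
      then have "norm z ^ m < d ^ m" using \<zeta>(2) by (simp add: norm_power[symmetric])
      then have "norm z < d" using power_less_imp_less_base d(1) by (metis less_imp_le)
      then obtain w where "w \<in> ball w0 r2" "z = H w" using d(2) by fastforce
      then show "z \<in> H ` {w\<in>V. F w = \<zeta>}"
        using \<open>norm z < d\<close> z FH r2(2) by (intro image_eqI[of _ _ w]) (auto simp: V_def)
    qed
    then show ?thesis using card_nth_roots[OF \<zeta>(1) m] by (simp add: bij_betw_same_card)
  qed
  moreover have "deriv F w \<noteq> 0" if w: "w \<in> V" "F w \<noteq> 0" for w
  proof -
    have wr: "w \<in> ball w0 r" "w \<in> ball w0 r2" using w Vr by (auto simp: V_def)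
    have "\<forall>\<^sub>F w in nhds w. F w = H w ^ m"
      using eventually_nhds_in_open[OF open_ball wr(1)] by eventually_elim (rule FH)
    then have "deriv F w = deriv (\<lambda>w. H w ^ m) w" by (rule deriv_cong_ev) simp
    also have "\<dots> = of_nat m * H w ^ (m - 1) * deriv H w"
      using holomorphic_derivI[OF Hh open_ball wr(1)]
      by (intro DERIV_imp_deriv) (auto intro!: derivative_eq_intros)
    finally have "deriv F w = of_nat m * H w ^ (m - 1) * deriv H w" .
    moreover have "deriv H w \<noteq> 0"
      by (rule holomorphic_injective_imp_regular[OF Hh2 open_ball r2(4) wr(2)])
    moreover have "H w \<noteq> 0" using w FH[OF wr(1)] m by auto
    ultimately show ?thesis using m by simp
  qed
  ultimately show ?thesis by (intro exI[of _ V] exI[of _ "d ^ m"]) blast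
qed

section \<open>Multiplicities in fibres\<close>

context covering
begin

text \<open>If the multiplicity were at least 2, the local form w^m u would have zero derivative at
  \<open>y\<close>, and by the chain rule so would every pulled back germ.\<close>

lemma mult_eq_1:
  assumes c: "c \<in> Y" "y \<in> fst c" and z: "holo_germ X (f y) z" and d: "chart_deriv c (z \<circ> f) y \<noteq> 0"
  shows "mult y = 1"
proof (rule ccontr)
  assume m: "mult y \<noteq> 1"
  define cX where "cX = chart_at X (f y)"
  define cY where "cY = chart_at Y y"
  have cX: "cX \<in> X" "f y \<in> fst cX" using chart_at[OF RX] by (auto simp: cX_def)
  have cY: "cY \<in> Y" "y \<in> fst cY" using chart_at[OF RY] by (auto simp: cY_def)
  obtain u where u: "holo_germ Y y u" "u y \<noteq> 0" "mult y > 0"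
    "\<forall>\<^sub>F q in nhds y. coord X (f y) (f q) = coord Y y q ^ nat (mult y) * u q"
    by (rule coord_f_factor)
  \<comment> \<open>Chosen so that the local form is \<open>coord Y y\<close> times a factor
    \<open>a\<close> that still vanishes at \<open>y\<close>.\<close>
  define n where "n = nat (mult y) - 2"
  have n: "nat (mult y) = Suc (Suc n)" using m u(3) by (simp add: n_def)
  define a where "a q = coord Y y q ^ Suc n * u q" for q
  have a: "holo_germ Y y a" unfolding a_def[abs_def]
    by (intro holo_germ_mult holo_germ_power holo_germ_coord u(1) RY chart_at)
  have "chart_deriv cY (snd cX \<circ> f) y = chart_deriv cY (\<lambda>q. coord Y y q * a q + snd cX (f y)) y"
  proof (rule chart_deriv_eqI[OF RY cY])
    show "\<forall>\<^sub>F q in nhds y. (snd cX \<circ> f) q = coord Y y q * a q + snd cX (f y)"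
      using u(4) by eventually_elim (simp add: n a_def coord_def cX_def algebra_simps)
  qed
  also have "\<dots> = chart_deriv cY (coord Y y) y * a y + coord Y y y * chart_deriv cY a y"
    using a chart_at[OF RY] by (simp add: chart_deriv_add[OF RY cY] chart_deriv_mult[OF RY cY] holo_germ_mult[OF RY]
        holo_germ_coord[OF RY] holo_germ_const[OF RY] chart_deriv_const[OF RY])
  also have "\<dots> = 0" by (simp add: a_def coord_self[OF RY])
  finally have "chart_deriv cY (z \<circ> f) y = 0"
    using chart_deriv_pull[OF cX cY z] by simp
  then show False
    using d chart_deriv_change[OF RY cY(1) c(1) cY(2) c(2) holo_germ_pull[OF z]] by simp
qed

text \<open>Over \<open>f y\<close> the only preimage in \<open>V\<close> is \<open>y\<close>, with
  its full multiplicity. Over nearby points there are \<open>mult y\<close> preimages, each of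
  multiplicity one since the derivative of the local form is nonzero there. The prescribed
  \<open>N\<close> allows disjoint choices of \<open>V\<close> for the points of a fibre.\<close>

lemma local_fibre:
  assumes N: "open N" "y \<in> N"
  shows "\<exists>V Q. open V \<and> y \<in> V \<and> V \<subseteq> N \<and> open Q \<and> f y \<in> Q \<and>
    (\<forall>x\<in>Q. finite {p\<in>V. f p = x} \<and> (\<Sum>p\<in>{p\<in>V. f p = x}. mult p) = mult y)"
proof -
  define cX where "cX = chart_at X (f y)"
  define cY where "cY = chart_at Y y"
  define z where "z = coord X (f y)"
  define w0 where "w0 = snd cY y"
  have cX: "cX \<in> X" "f y \<in> fst cX" using chart_at[OF RX] by (auto simp: cX_def)
  have cY: "cY \<in> Y" "y \<in> fst cY" using chart_at[OF RY] by (auto simp: cY_def)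
  obtain u where u: "holo_germ Y y u" "u y \<noteq> 0" "mult y > 0"
    "\<forall>\<^sub>F q in nhds y. z (f q) = coord Y y q ^ nat (mult y) * u q"
    unfolding z_def by (rule coord_f_factor)
  define m where "m = nat (mult y)"
  have "\<forall>\<^sub>F q in nhds y. z (f q) = coord Y y q ^ m * u q \<and> q \<in> N \<and> q \<in> fst cY \<and> f q \<in> fst cX"
    using u(4) eventually_nhds_in_open[OF N] eventually_chart_domain[OF RY cY]
      eventually_nhds_f[OF eventually_chart_domain[OF RX cX]]
    by eventually_elim (simp add: m_def)
  then obtain N' where N': "open N'" "y \<in> N'"
    "\<And>q. q \<in> N' \<Longrightarrow> z (f q) = coord Y y q ^ m * u q \<and> q \<in> N \<and> q \<in> fst cY \<and> f q \<in> fst cX"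
    unfolding eventually_nhds by blast
  define U where "U = u \<circ> ich cY"
  have U: "U analytic_on {w0}" unfolding U_def w0_def using u(1) holo_germ_iff[OF RY cY] by blast
  have U0: "U w0 \<noteq> 0" unfolding U_def w0_def using u(2) ich_chart[OF RY cY] by simp
  have img: "open (snd cY ` (fst cY \<inter> N'))" by (rule open_chart_image[OF RY cY(1) N'(1)])
  have w0: "w0 \<in> snd cY ` (fst cY \<inter> N')" using cY N' by (simp add: w0_def)
  have "m > 0" using u(3) by (simp add: m_def)
  from local_power_fibre[OF U U0 this img w0] obtain Vw \<delta> where Vw: "open Vw" "w0 \<in> Vw"
    "Vw \<subseteq> snd cY ` (fst cY \<inter> N')" "\<delta> > 0" "\<forall>w\<in>Vw. (w - w0) ^ m * U w = 0 \<longrightarrow> w = w0"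
    "\<forall>\<zeta>. \<zeta> \<noteq> 0 \<longrightarrow> norm \<zeta> < \<delta> \<longrightarrow> card {w\<in>Vw. (w - w0) ^ m * U w = \<zeta>} = m"
    "\<forall>w\<in>Vw. (w - w0) ^ m * U w \<noteq> 0 \<longrightarrow> deriv (\<lambda>w. (w - w0) ^ m * U w) w \<noteq> 0" by blast
  let ?F = "\<lambda>w. (w - w0) ^ m * U w"
  define V where "V = fst cY \<inter> N' \<inter> snd cY -` Vw"
  have "continuous_on (fst cY) (snd cY)"
    using chart_props(3)[OF RY cY(1)] by (simp add: homeomorphism_def)
  then have "continuous_on (fst cY \<inter> N') (snd cY)"
    by (rule continuous_on_subset) auto
  then have oV: "open V" unfolding V_def
    by (rule continuous_open_preimage) (use chart_props(1)[OF RY cY(1)] N'(1) Vw(1) in auto)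
  have yV: "y \<in> V" using cY N' Vw(2) by (simp add: V_def w0_def)
  define Q where "Q = fst cX \<inter> z -` ball 0 \<delta>"
  have zg: "holo_germ X p z" if "p \<in> fst cX" for p
    unfolding z_def by (rule holo_germ_coord[OF RX]) (use that in \<open>simp add: cX_def\<close>)
  have oQ: "open Q"
  proof (rule open_subopen[THEN iffD2], clarify)
    fix p assume p: "p \<in> Q"
    then have "\<forall>\<^sub>F q in nhds p. z q \<in> ball 0 \<delta>"
      using holo_germ_tendsto[OF RX zg, of p] eventually_nhds_in_open[OF open_ball, of "z p" 0 \<delta>]
      unfolding filterlim_iff Q_def by auto
    then have "\<forall>\<^sub>F q in nhds p. q \<in> Q"
      using eventually_nhds_in_open[OF chart_props(1)[OF RX cX(1)], of p] p
      by (auto simp: Q_def elim: eventually_elim2)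
    then show "\<exists>T. open T \<and> p \<in> T \<and> T \<subseteq> Q" unfolding eventually_nhds by blast
  qed
  have yQ: "f y \<in> Q" using cX(2) Vw(4) coord_self[OF RX] by (simp add: Q_def z_def)
  have zF: "z (f p) = ?F (snd cY p)" if "p \<in> V" for p
    using N'(3)[of p] that ich_chart[OF RY cY(1)] by (simp add: V_def coord_def U_def w0_def cY_def)
  have zinj: "f p = x \<longleftrightarrow> z (f p) = z x" if "p \<in> V" "x \<in> fst cX" for p x
  proof
    assume "z (f p) = z x"
    then have "snd cX (f p) = snd cX x" by (simp add: z_def coord_def cX_def)
    moreover have "f p \<in> fst cX" using that(1) N'(3) by (simp add: V_def)
    ultimately show "f p = x" using ich_chart[OF RX cX(1)] that(2) by metis
  qed simp
  have bij: "bij_betw (snd cY) {p\<in>V. f p = x} {w\<in>Vw. ?F w = z x}" if x: "x \<in> Q" for x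
    unfolding bij_betw_def
  proof (intro conjI equalityI subsetI)
    show "inj_on (snd cY) {p\<in>V. f p = x}"
      by (rule inj_on_inverseI[of _ "ich cY"]) (use ich_chart[OF RY cY(1)] in \<open>auto simp: V_def\<close>)
    show "w \<in> {w\<in>Vw. ?F w = z x}" if "w \<in> snd cY ` {p\<in>V. f p = x}" for w
      using that zF by (auto simp: V_def)
    fix w assume w: "w \<in> {w\<in>Vw. ?F w = z x}"
    then obtain p where p: "p \<in> fst cY" "p \<in> N'" "w = snd cY p" using Vw(3) by blast
    then have "p \<in> V" using w by (simp add: V_def)
    then have "f p = x" using zinj[of p x] zF[of p] w p(3) x by (simp add: Q_def)
    then show "w \<in> snd cY ` {p\<in>V. f p = x}" using \<open>p \<in> V\<close> p(3) by blast
  qed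
  have "finite {p\<in>V. f p = x} \<and> (\<Sum>p\<in>{p\<in>V. f p = x}. mult p) = mult y" if x: "x \<in> Q" for x
  proof (cases "x = f y")
    case True
    have "{w\<in>Vw. ?F w = z x} = {w0}"
      using Vw(2,5) True coord_self[OF RX] \<open>m > 0\<close> by (auto simp: z_def)
    moreover have "bij_betw (snd cY) {p\<in>V. f p = x} {w\<in>Vw. ?F w = z x}" by (rule bij[OF x])
    ultimately have "card {p\<in>V. f p = x} = 1" by (simp add: bij_betw_same_card)
    moreover have "y \<in> {p\<in>V. f p = x}" using yV True by simp
    ultimately have "{p\<in>V. f p = x} = {y}" by (metis card_1_singletonE singletonD)
    then show ?thesis by simp
  next
    case False
    have zx: "z x \<noteq> 0" using coord_nonzero[OF RX] x False by (auto simp: z_def Q_def cX_def)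
    have card: "card {p\<in>V. f p = x} = m"
      using bij_betw_same_card[OF bij[OF x]] Vw(6) zx x by (simp add: Q_def)
    have "mult p = 1" if p: "p \<in> {p\<in>V. f p = x}" for p
    proof (rule mult_eq_1[of cY p z])
      show pc: "cY \<in> Y" "p \<in> fst cY" using p cY by (auto simp: V_def)
      show "holo_germ X (f p) z" using zg p x by (simp add: Q_def)
      have "\<forall>\<^sub>F w in nhds (snd cY p). (z \<circ> f \<circ> ich cY) w = ?F w"
        unfolding o_def
      proof -
        have "\<forall>\<^sub>F q in nhds p. z (f q) = ?F (snd cY q) \<and> q \<in> fst cY"
          using eventually_nhds_in_open[OF oV, of p] p by (auto elim!: eventually_mono simp: zF V_def)
        then show "\<forall>\<^sub>F w in nhds (snd cY p). z (f (ich cY w)) = ?F w"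
          unfolding eventually_nhds_chart[OF RY pc] using eventually_chart_image[OF RY pc]
          by eventually_elim (simp add: chart_ich[OF RY])
      qed
      then have "chart_deriv cY (z \<circ> f) p = deriv ?F (snd cY p)"
        unfolding chart_deriv_def by (intro deriv_cong_ev) auto
      then show "chart_deriv cY (z \<circ> f) p \<noteq> 0"
        using Vw(7) p zF zx by (auto simp: V_def)
    qed
    then have "(\<Sum>p\<in>{p\<in>V. f p = x}. mult p) = int m" using card by simp
    moreover have "finite {p\<in>V. f p = x}" using card \<open>m > 0\<close> card_ge_0_finite by metis
    ultimately show ?thesis using u(3) by (simp add: m_def)
  qed
  moreover have "V \<subseteq> N" using N'(3) by (auto simp: V_def)
  ultimately show ?thesis using oV yV oQ yQ by (intro exI[of _ V] exI[of _ Q]) blast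
qed

text \<open>The sum is locally constant on a connected space. Small disjoint neighbourhoods of the
  points of a fibre catch all nearby fibres, because no preimage can escape from a compact
  \<open>Y\<close>.\<close>

lemma fibre_mult_const:
  assumes cY: "compact (UNIV :: 'y set)" and cX: "connected (UNIV :: 'x set)"
  shows "(\<Sum>p\<in>f -` {x}. mult p) = (\<Sum>p\<in>f -` {x'}. mult p)"
proof (rule connected_local_const[OF cX UNIV_I UNIV_I], intro ballI)
  fix x0 :: 'x
  define A where "A = f -` {x0}"
  have fin: "finite A" unfolding A_def by (rule finite_fibre[OF cY])
  have "\<exists>PQ. fst yy \<noteq> snd yy \<longrightarrow> open (fst PQ) \<and> open (snd PQ) \<and> fst yy \<in> fst PQ \<and>
      snd yy \<in> snd PQ \<and> fst PQ \<inter> snd PQ = {}" for yy :: "'y \<times> 'y"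
  proof (cases "fst yy = snd yy")
    case False
    from hausdorff[OF this] obtain P Q where "open P" "open Q" "fst yy \<in> P" "snd yy \<in> Q" "P \<inter> Q = {}" by blast
    then show ?thesis by (intro exI[of _ "(P, Q)"]) simp
  qed simp
  then have "\<forall>yy :: 'y \<times> 'y. \<exists>PQ. fst yy \<noteq> snd yy \<longrightarrow> open (fst PQ) \<and> open (snd PQ) \<and> fst yy \<in> fst PQ \<and>
      snd yy \<in> snd PQ \<and> fst PQ \<inter> snd PQ = {}" by blast
  from choice[OF this] obtain PQ :: "'y \<times> 'y \<Rightarrow> 'y set \<times> 'y set" where
    PQ: "\<And>y y'. y \<noteq> y' \<Longrightarrow> open (fst (PQ (y, y'))) \<and> open (snd (PQ (y, y'))) \<and> y \<in> fst (PQ (y, y')) \<and>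
      y' \<in> snd (PQ (y, y')) \<and> fst (PQ (y, y')) \<inter> snd (PQ (y, y')) = {}" by force
  \<comment> \<open>Ordered pairs of points are separated once and for all; letting \<open>y\<close>
    play both roles in the intersection makes the sets \<open>N y\<close> pairwise disjoint on
    \<open>A\<close>.\<close>
  define N where "N y = (\<Inter>y'\<in>A - {y}. fst (PQ (y, y')) \<inter> snd (PQ (y', y)))" for y
  have N: "open (N y)" "y \<in> N y" for y
  proof -
    have o: "open (fst (PQ (y, y')))" "open (snd (PQ (y', y)))" "y \<in> fst (PQ (y, y'))" "y \<in> snd (PQ (y', y))"
      if "y' \<in> A - {y}" for y'
      using PQ[of y y'] PQ[of y' y] that by auto
    show "open (N y)" unfolding N_def using fin o(1,2) by (intro open_INT open_Int ballI) auto
    show "y \<in> N y" unfolding N_def using o(3,4) by blast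
  qed
  have Ndisj: "N y \<inter> N y' = {}" if "y \<in> A" "y' \<in> A" "y \<noteq> y'" for y y'
  proof -
    have "N y \<subseteq> fst (PQ (y, y'))" "N y' \<subseteq> snd (PQ (y, y'))" using that by (auto simp: N_def)
    then show ?thesis using PQ[OF that(3)] by blast
  qed
  have "\<forall>y. \<exists>VQ. open (fst VQ) \<and> y \<in> fst VQ \<and> fst VQ \<subseteq> N y \<and> open (snd VQ) \<and> f y \<in> snd VQ \<and>
    (\<forall>x\<in>snd VQ. finite {p\<in>fst VQ. f p = x} \<and> (\<Sum>p\<in>{p\<in>fst VQ. f p = x}. mult p) = mult y)"
    using local_fibre[OF N] by (simp add: split_paired_Ex)
  from choice[OF this] obtain VQ where VQ: "\<And>y. open (fst (VQ y)) \<and> y \<in> fst (VQ y) \<and> fst (VQ y) \<subseteq> N y \<and>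
      open (snd (VQ y)) \<and> f y \<in> snd (VQ y) \<and> (\<forall>x\<in>snd (VQ y). finite {p\<in>fst (VQ y). f p = x} \<and>
      (\<Sum>p\<in>{p\<in>fst (VQ y). f p = x}. mult p) = mult y)" by blast
  define V where "V y = fst (VQ y)" for y
  define Q where "Q y = snd (VQ y)" for y
  have V: "open (V y)" "y \<in> V y" "V y \<subseteq> N y" "open (Q y)" "f y \<in> Q y" for y
    using VQ[of y] by (auto simp: V_def Q_def)
  have VQs: "finite {p\<in>V y. f p = x}" "(\<Sum>p\<in>{p\<in>V y. f p = x}. mult p) = mult y" if "x \<in> Q y" for x y
    using VQ[of y] that by (auto simp: V_def Q_def)
  \<comment> \<open>\<open>K\<close> is compact, so its image is closed; it misses
    \<open>x0\<close>, hence the fibres near \<open>x0\<close> lie in the union of the sets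
    \<open>V y\<close>.\<close>
  define K where "K = UNIV - (\<Union>y\<in>A. V y)"
  have "closed K" unfolding K_def using V(1) by (intro closed_Diff) auto
  then have "compact K" using cY by (metis compact_Int_closed Int_UNIV_left)
  then have "compact (f ` K)"
    using holo_f continuous_on_subset by (intro compact_continuous_image) (auto simp: holo_map_def)
  then have "closed (f ` K)" by (rule compact_imp_closed)
  moreover have "x0 \<notin> f ` K" using V(2) by (auto simp: K_def A_def)
  ultimately have "\<forall>\<^sub>F x in nhds x0. x \<in> - f ` K" by (intro eventually_nhds_in_open) auto
  moreover have "\<forall>\<^sub>F x in nhds x0. \<forall>y\<in>A. x \<in> Q y"
    using fin V(4,5) by (auto intro!: eventually_ball_finite eventually_nhds_in_open simp: A_def)
  ultimately have "\<forall>\<^sub>F x in nhds x0. (\<Sum>p\<in>A. mult p) = (\<Sum>p\<in>f -` {x}. mult p)"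
  proof eventually_elim
    case (elim x)
    have "f -` {x} = (\<Union>y\<in>A. {p\<in>V y. f p = x})" using elim(1) by (auto simp: K_def)
    then have "(\<Sum>p\<in>f -` {x}. mult p) = (\<Sum>p\<in>(\<Union>y\<in>A. {p\<in>V y. f p = x}). mult p)" by simp
    also have "\<dots> = (\<Sum>y\<in>A. \<Sum>p\<in>{p\<in>V y. f p = x}. mult p)"
      using fin VQs(1) elim(2) Ndisj V(3) by (intro sum.UNION_disjoint) blast+
    also have "\<dots> = (\<Sum>y\<in>A. mult y)"
      using VQs(2) elim(2) by (intro sum.cong) auto
    finally show ?case by simp
  qed
  then show "\<forall>\<^sub>F x in at x0 within UNIV. (\<Sum>p\<in>f -` {x0}. mult p) = (\<Sum>p\<in>f -` {x}. mult p)"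
    unfolding A_def by (rule eventually_nhds_at)
qed

end

text \<open>The order in terms of some admissible frame. In contrast to the expression with
  \<open>triv_at\<close> in \<open>has_degree\<close>, it is free of a selected trivialization and
  can be transported to the pullback.\<close>

definition section_order ::
  "'x::t2_space chart set \<Rightarrow> ('x, 1) bundle_atlas \<Rightarrow> 'x \<Rightarrow> ('x \<Rightarrow> complex ^ 1) \<Rightarrow> int \<Rightarrow> bool" where
  "section_order X T x s n \<longleftrightarrow> (\<exists>\<gamma> k. compat X T x \<gamma> \<and> holo_germ X x k \<and> k x \<noteq> 0 \<and>
     (\<forall>\<^sub>F p in at x. (\<gamma> p *v s p) $ 1 = coord X x p powi n * k p))"

lemma mat1_mult: "(A ** B) $ 1 $ 1 = A $ 1 $ 1 * (B :: complex ^ 1 ^ 1) $ 1 $ 1"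
  by (simp add: matrix_matrix_mult_def sum_1)

lemma mat1_vec: "(A *v v) $ 1 = A $ 1 $ 1 * v $ 1" for A :: "complex ^ 1 ^ 1"
  by (simp add: matrix_vector_mult_def sum_1)

lemma mat1_inv: "invertible (A :: complex ^ 1 ^ 1) \<Longrightarrow> A $ 1 $ 1 \<noteq> 0 \<and> matrix_inv A $ 1 $ 1 = inverse (A $ 1 $ 1)"
proof -
  assume "invertible A"
  then have "(A ** matrix_inv A) $ 1 $ 1 = 1" by (simp add: matrix_inv_works mat_def)
  then show ?thesis unfolding mat1_mult by (metis inverse_unique mult_zero_left zero_neq_one)
qed

section \<open>Orders of sections of line bundles\<close>

context
  fixes X :: "'x::t2_space chart set"
  assumes RS: "riemann_surface X"
begin

text \<open>Two frames at \<open>x\<close> differ by a unit, so the order is the same in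
  each.\<close>

lemma section_order_in:
  fixes T :: "('x, 1) bundle_atlas"
  assumes V: "vector_bundle X S T" and o: "section_order X T x s n" and c: "compat X T x \<gamma>'"
  obtains k where "holo_germ X x k" "k x \<noteq> 0" "\<forall>\<^sub>F p in at x. (\<gamma>' p *v s p) $ 1 = coord X x p powi n * k p"
proof -
  obtain \<gamma> k where k: "compat X T x \<gamma>" "holo_germ X x k" "k x \<noteq> 0"
    "\<forall>\<^sub>F p in at x. (\<gamma> p *v s p) $ 1 = coord X x p powi n * k p" using o by (auto simp: section_order_def)
  define t where "t p = (\<gamma>' p ** matrix_inv (\<gamma> p)) $ 1 $ 1" for p
  have t: "holo_germ X x t"
    using compat_change[OF RS V k(1) c] unfolding hmat_def t_def[abs_def] by blast
  have inv: "\<forall>\<^sub>F p in nhds x. invertible (\<gamma> p)" "invertible (\<gamma> x)" "invertible (\<gamma>' x)"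
    using k(1) compat_invertible[OF RS V] c by (auto simp: compat_def)
  have "t x \<noteq> 0" using mat1_inv[OF inv(2)] mat1_inv[OF inv(3)] by (simp add: t_def mat1_mult)
  moreover have "\<forall>\<^sub>F p in at x. (\<gamma>' p *v s p) $ 1 = coord X x p powi n * (t p * k p)"
    using eventually_nhds_at[OF inv(1)] k(4)
    by eventually_elim (use mat1_inv in \<open>simp add: t_def mat1_mult mat1_vec field_simps\<close>)
  ultimately show thesis using that[of "\<lambda>p. t p * k p"] holo_germ_mult[OF RS t k(2)] k(3) by simp
qed

text \<open>Connects the flexible notion of order with the selected trivialization in the definition
  of the degree.\<close>

lemma order_at_section:
  fixes T :: "('x, 1) bundle_atlas"
  assumes V: "vector_bundle X UNIV T" and o: "section_order X T x s n"
  shows "order_at X (\<lambda>p. (snd (triv_at T x) p *v s p) $ 1) x = n"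
proof -
  have "\<exists>c. c \<in> T \<and> x \<in> fst c" using triv_ex[OF RS V, of x] by force
  from someI_ex[OF this] have c: "compat X T x (snd (triv_at T x))"
    using triv_compat[OF RS V, of "fst (triv_at T x)" "snd (triv_at T x)" x] unfolding triv_at_def by simp
  obtain k where "holo_germ X x k" "k x \<noteq> 0"
    "\<forall>\<^sub>F p in at x. (snd (triv_at T x) p *v s p) $ 1 = coord X x p powi n * k p"
    by (rule section_order_in[OF V o c])
  then show ?thesis by (rule order_at_eqI[OF RS])
qed

lemma section_order_meromorphic:
  fixes T :: "('x, 1) bundle_atlas"
  assumes V: "vector_bundle X UNIV T" and o: "section_order X T x s n"
  shows "\<exists>(N::nat) W u. x \<in> W \<and> holo_section X T W u \<and> (\<forall>\<^sub>F p in at x. coord X x p ^ N *s s p = u p)"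
proof -
  obtain \<gamma> k where k: "compat X T x \<gamma>" "holo_germ X x k" "k x \<noteq> 0"
    "\<forall>\<^sub>F p in at x. (\<gamma> p *v s p) $ 1 = coord X x p powi n * k p" using o by (auto simp: section_order_def)
  \<comment> \<open>The least power of the coordinate that clears the pole, if there is one.\<close>
  define N where "N = nat (- n)"
  define h where "h p = coord X x p powi (int N + n) * k p" for p
  define u where "u p = h p *s (matrix_inv (\<gamma> p) *v axis 1 1)" for p
  have h: "holo_germ X x h" unfolding h_def[abs_def]
    using k(2) chart_at[OF RS] by (intro holo_germ_mult holo_germ_powi holo_germ_coord RS) (auto simp: N_def)
  have u: "sgerm X T x u" unfolding u_def[abs_def]
    by (rule sgerm_scale[OF RS V h sgerm_frame[OF RS V k(1)]])
  obtain W where "open W" "x \<in> W" "W \<subseteq> UNIV" "holo_section X T W u"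
    by (rule sgerm_section'[OF RS V u UNIV_I])
  moreover have "\<forall>\<^sub>F p in nhds x. invertible (\<gamma> p)" using k(1) by (simp add: compat_def)
  then have "\<forall>\<^sub>F p in at x. coord X x p ^ N *s s p = u p"
    using eventually_nhds_at k(4) eventually_at_coord[OF RS, of x]
  proof -
    assume "\<forall>\<^sub>F p in nhds x. invertible (\<gamma> p)"
    from eventually_nhds_at[OF this] k(4) eventually_at_coord[OF RS, of x]
    show ?thesis
    proof eventually_elim
      case (elim p)
      have "\<gamma> p *v (coord X x p ^ N *s s p) = \<gamma> p *v u p"
        using elim
        by (simp add: vec_eq_iff forall_1 vector_scalar_commute u_def h_def axis_def power_int_add power_int_of_nat)
      then have "matrix_inv (\<gamma> p) *v (\<gamma> p *v (coord X x p ^ N *s s p)) = matrix_inv (\<gamma> p) *v (\<gamma> p *v u p)" by simp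
      then show ?case using elim by simp
    qed
  qed
  ultimately show ?thesis by blast
qed

lemma section_order_nonzero:
  fixes T :: "('x, 1) bundle_atlas"
  assumes V: "vector_bundle X S T" and s: "sgerm X T x s" "s x \<noteq> 0" and x: "x \<in> S"
  shows "section_order X T x s 0"
proof -
  obtain U g where U: "(U, g) \<in> T" "x \<in> U" using triv_ex[OF RS V x] by blast
  note c = triv_compat[OF RS V U]
  have "holo_germ X x (\<lambda>p. (g p *v s p) $ 1)" using s(1) unfolding compat_sgerm[OF RS V c] hvec_def by blast
  moreover have "(g x *v s x) $ 1 \<noteq> 0"
    using mat1_inv[OF triv_invertible[OF RS V U]] s(2) by (simp add: mat1_vec vec_eq_iff forall_1)
  ultimately show ?thesis unfolding section_order_def using c by (intro exI[of _ g] exI conjI) auto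
qed

text \<open>That \<open>s\<close> has no zeros off \<open>x\<close> excludes the zero germ, so the
  cleared section factors as a power of the coordinate times a unit; subtracting \<open>N\<close>
  gives the order of \<open>s\<close>.\<close>

lemma section_order_ex:
  fixes T :: "('x, 1) bundle_atlas"
  assumes V: "vector_bundle X UNIV T" and u: "holo_section X T W u" "x \<in> W"
    and s: "\<forall>\<^sub>F p in at x. coord X x p ^ N *s s p = u p" and nz: "\<forall>\<^sub>F p in at x. s p \<noteq> 0"
  shows "\<exists>n. section_order X T x s n"
proof -
  obtain U g where U: "(U, g) \<in> T" "x \<in> U" using triv_ex[OF RS V] by blast
  note c = triv_compat[OF RS V U]
  have su: "sgerm X T x u" using u unfolding section_iff[OF RS V] by blast
  have h: "holo_germ X x (\<lambda>p. (g p *v u p) $ 1)" using su unfolding compat_sgerm[OF RS V c] hvec_def by blast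
  have "\<not> (\<forall>\<^sub>F p in at x. (g p *v u p) $ 1 = 0)"
  proof
    assume "\<forall>\<^sub>F p in at x. (g p *v u p) $ 1 = 0"
    then have "\<forall>\<^sub>F p in at x. False"
      using s nz eventually_at_coord[OF RS, of x] eventually_nhds_at[OF eventually_triv[OF RS V U]]
    proof eventually_elim
      case (elim p)
      have "g p $ 1 $ 1 \<noteq> 0" using mat1_inv elim by blast
      then have "u p $ 1 = 0" using elim(1) by (simp add: mat1_vec)
      then have "s p $ 1 = 0" using elim(2,4) by (auto simp: vec_eq_iff forall_1)
      then show ?case using elim(3) by (simp add: vec_eq_iff forall_1)
    qed
    then show False using at_nontrivial[OF RS] eventually_False by blast
  qed
  then obtain k j where k: "holo_germ X x k" "k x \<noteq> 0"
    "\<forall>\<^sub>F p in nhds x. (g p *v u p) $ 1 = coord X x p ^ j * k p"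
    "order_at X (\<lambda>p. (g p *v u p) $ 1) x = int j"
    by (rule holo_germ_factor[OF RS h])
  have "\<forall>\<^sub>F p in at x. (g p *v s p) $ 1 = coord X x p powi (int j - int N) * k p"
    using eventually_nhds_at[OF k(3)] s eventually_at_coord[OF RS, of x]
  proof eventually_elim
    case (elim p)
    have "coord X x p ^ N * (g p *v s p) $ 1 = (g p *v u p) $ 1"
      using elim(2)[symmetric] by (simp add: vector_scalar_commute)
    then show ?case using elim by (simp add: power_int_diff power_int_of_nat field_simps)
  qed
  then show ?thesis unfolding section_order_def using c k(1,2) by blast
qed

text \<open>The transition function and its inverse have orders at least \<lceil>\<beta> -
  \<beta>'\<rceil> and \<lceil>\<beta>' - \<beta>\<rceil>. Their product is 1, so these bounds add
  up to zero; this happens only if the difference of the weights is an integer, and then the bounds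
  are attained.\<close>

lemma splits_compare:
  fixes L :: "('x, 1) filtered_bundle"
  assumes sp: "splits X L x \<gamma> (\<lambda>_. \<beta>)" "splits X L x \<gamma>' (\<lambda>_. \<beta>')"
  obtains n h where "of_int n = \<beta> - \<beta>'" "holo_germ X x h" "h x \<noteq> 0"
    "\<forall>\<^sub>F p in at x. (\<gamma>' p ** matrix_inv (\<gamma> p)) $ 1 $ 1 = coord X x p powi n * h p"
proof -
  have main: "ord_ge X x \<lceil>b - b'\<rceil> (\<lambda>p. (g' p ** matrix_inv (g p)) $ 1 $ 1)"
    if s: "splits X L x g (\<lambda>_. b)" "splits X L x g' (\<lambda>_. b')" for g g' b b'
  proof -
    have "(\<lambda>p. 1 *s (matrix_inv (g p) *v axis 1 1)) \<in> germs L x b"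
      by (rule frame_germ[OF RS s(1)]) (use ord_ge_holo_germ[OF RS holo_germ_const[OF RS]] in simp)
    then have "ord_ge X x \<lceil>b - b'\<rceil> (\<lambda>p. (g' p *v (1 *s (matrix_inv (g p) *v axis 1 1))) $ 1)"
      unfolding germs_splits[OF RS s(2)] by blast
    then show ?thesis by (simp add: matrix_vector_mul_assoc)
  qed
  define n where "n = \<lceil>\<beta> - \<beta>'\<rceil>"
  define n' where "n' = \<lceil>\<beta>' - \<beta>\<rceil>"
  obtain h where h: "holo_germ X x h" "\<forall>\<^sub>F p in at x. (\<gamma>' p ** matrix_inv (\<gamma> p)) $ 1 $ 1 = coord X x p powi n * h p"
    using main[OF sp] unfolding ord_ge_def n_def by blast
  obtain h' where h': "holo_germ X x h'" "\<forall>\<^sub>F p in at x. (\<gamma> p ** matrix_inv (\<gamma>' p)) $ 1 $ 1 = coord X x p powi n' * h' p"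
    using main[OF sp(2,1)] unfolding ord_ge_def n'_def by blast
  have one: "\<forall>\<^sub>F p in at x. coord X x p powi (n + n') * (h p * h' p) = 1"
    using h(2) h'(2) splits_invertible[OF RS sp(1)] splits_invertible[OF RS sp(2)] eventually_at_coord[OF RS, of x]
  proof eventually_elim
    case (elim p)
    have "coord X x p powi (n + n') * (h p * h' p) = (coord X x p powi n * h p) * (coord X x p powi n' * h' p)"
      using elim(5) by (simp add: power_int_add)
    also have "\<dots> = 1"
      unfolding elim(1,2)[symmetric] mat1_mult using mat1_inv[OF elim(3)] mat1_inv[OF elim(4)]
      by (simp add: field_simps)
    finally show ?case .
  qed
  have nn: "n + n' \<ge> 0" unfolding n_def n'_def by linarith
  have hh: "holo_germ X x (\<lambda>p. coord X x p powi (n + n') * (h p * h' p))"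
    using h(1) h'(1) nn chart_at[OF RS] by (intro holo_germ_mult holo_germ_powi holo_germ_coord RS) auto
  have val: "coord X x x powi (n + n') * (h x * h' x) = 1"
    by (rule holo_germ_at_eqD(1)[OF RS hh holo_germ_const[OF RS] one])
  \<comment> \<open>A positive power of the coordinate would vanish at \<open>x\<close>, where the
    product has value 1.\<close>
  then have "n + n' = 0" "h x \<noteq> 0" by (auto simp: coord_self[OF RS] power_int_0_left_if split: if_splits)
  moreover from this have "of_int n = \<beta> - \<beta>'" unfolding n_def n'_def by linarith
  ultimately show thesis using that h by blast
qed

lemma weight_sum_line:
  fixes V :: "('x, 1) flagged_bundle"
  assumes "flagged_bundle X D V"
  shows "weight_sum D V = (\<Sum>x\<in>D. wt V x 1)"
  unfolding weight_sum_def
proof (rule sum.cong[OF refl])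
  fix x assume x: "x \<in> D"
  have 1: "steps V x = 1" by (rule flagged_line_bundle[OF assms x])
  have "flag V x 1 = UNIV" "flag V x (1 + 1) = {0}"
    using assms x 1 unfolding flagged_bundle_def by fastforce+
  then have "real (vec.dim (flag V x 1)) - real (vec.dim (flag V x (1 + 1))) = 1"
    by (simp add: vec.dim_UNIV card_cart_basis)
  then show "(\<Sum>j=1..steps V x. wt V x j * (real (vec.dim (flag V x j)) - real (vec.dim (flag V x (j + 1))))) = wt V x 1"
    unfolding 1 by simp
qed

end

section \<open>Multiplication of the parabolic degree\<close>

context covering
begin

text \<open>Over \<open>D\<close> the pulled back split coordinate has weight \<open>mult y\<close>
  times the old one, and the flagged bundle on \<open>Y\<close> replaces it by a number differing by
  an integer. The order of the section absorbs this integer, so it is order plus weight that gets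
  multiplied.\<close>

lemma section_order_pullback:
  assumes P: "presents X D V L" and P': "presents Y (f -` D) V' (pullback_bundle Y X f L)"
    and o: "section_order X (triv V) (f y) s n"
  shows "\<exists>n'. section_order Y (triv V') y (\<lambda>q. s (f q)) n' \<and>
    of_int n' + (if f y \<in> D then wt V' y 1 else 0) = of_int (mult y) * (of_int n + (if f y \<in> D then wt V (f y) 1 else 0))"
proof -
  note B = presents_bundles[OF RX P] and B' = presents_bundles[OF RY P']
  have lift: "\<exists>k'. holo_germ Y y k' \<and> k' y \<noteq> 0 \<and>
      (\<forall>\<^sub>F q in at y. (\<gamma> (f q) *v s (f q)) $ 1 = coord Y y q powi (mult y * n) * k' q)"
    if \<gamma>: "compat X (triv V) (f y) \<gamma>" for \<gamma>
  proof -
    obtain k where k: "holo_germ X (f y) k" "k (f y) \<noteq> 0"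
      "\<forall>\<^sub>F p in at (f y). (\<gamma> p *v s p) $ 1 = coord X (f y) p powi n * k p"
      by (rule section_order_in[OF RX B(2) o \<gamma>])
    obtain u where u: "holo_germ Y y u" "u y \<noteq> 0" "mult y > 0"
      "\<forall>\<^sub>F q in nhds y. coord X (f y) (f q) = coord Y y q ^ nat (mult y) * u q"
      by (rule coord_f_factor)
    show ?thesis
    proof (intro exI conjI)
      show "holo_germ Y y (\<lambda>q. u q powi n * (k \<circ> f) q)"
        using u(1,2) k(1) by (intro holo_germ_mult holo_germ_powi holo_germ_pull RY) auto
      show "u y powi n * (k \<circ> f) y \<noteq> 0" using u(2) k(2) by simp
      show "\<forall>\<^sub>F q in at y. (\<gamma> (f q) *v s (f q)) $ 1 = coord Y y q powi (mult y * n) * (u q powi n * (k \<circ> f) q)"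
        using eventually_at_f[OF k(3)] eventually_nhds_at[OF u(4)]
      proof eventually_elim
        case (elim q)
        have "coord Y y q ^ nat (mult y) = coord Y y q powi mult y" using u(3) by (simp add: power_int_def)
        then show ?case using elim by (simp add: power_int_mult_distrib power_int_mult)
      qed
    qed
  qed
  show ?thesis
  proof (cases "f y \<in> D")
    case True
    then have y: "y \<in> f -` D" by simp
    obtain \<gamma> where \<gamma>: "compat X (triv V) (f y) \<gamma>" "splits X L (f y) \<gamma> (\<lambda>_. wt V (f y) 1)"
      by (rule line_coordinates[OF RX P True])
    obtain \<gamma>' where \<gamma>': "compat Y (triv V') y \<gamma>'" "splits Y (pullback_bundle Y X f L) y \<gamma>' (\<lambda>_. wt V' y 1)"
      by (rule line_coordinates[OF RY P' y])
    obtain m h where m: "of_int m = of_int (mult y) * wt V (f y) 1 - wt V' y 1" "holo_germ Y y h" "h y \<noteq> 0"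
      "\<forall>\<^sub>F q in at y. (\<gamma>' q ** matrix_inv (\<gamma> (f q))) $ 1 $ 1 = coord Y y q powi m * h q"
      by (rule splits_compare[OF RY splits_pullback[OF \<gamma>(2)] \<gamma>'(2)])
    obtain k' where k': "holo_germ Y y k'" "k' y \<noteq> 0"
      "\<forall>\<^sub>F q in at y. (\<gamma> (f q) *v s (f q)) $ 1 = coord Y y q powi (mult y * n) * k' q" using lift[OF \<gamma>(1)] by blast
    have "section_order Y (triv V') y (\<lambda>q. s (f q)) (m + mult y * n)"
      unfolding section_order_def
    proof (intro exI conjI)
      show "compat Y (triv V') y \<gamma>'" by (rule \<gamma>'(1))
      show "holo_germ Y y (\<lambda>q. h q * k' q)" by (rule holo_germ_mult[OF RY m(2) k'(1)])
      show "h y * k' y \<noteq> 0" using m(3) k'(2) by simp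
      show "\<forall>\<^sub>F q in at y. (\<gamma>' q *v s (f q)) $ 1 = coord Y y q powi (m + mult y * n) * (h q * k' q)"
        using m(4) k'(3) eventually_at_f[OF splits_invertible[OF RX \<gamma>(2)]] eventually_at_coord[OF RY, of y]
      proof eventually_elim
        case (elim q)
        have "(\<gamma>' q *v s (f q)) $ 1 = ((\<gamma>' q ** matrix_inv (\<gamma> (f q))) *v (\<gamma> (f q) *v s (f q))) $ 1"
          using elim(3) by (simp flip: matrix_vector_mul_assoc)
        also have "\<dots> = (coord Y y q powi m * h q) * (coord Y y q powi (mult y * n) * k' q)"
          unfolding mat1_vec[of "_ ** _"] elim(1,2) ..
        finally show ?case using elim(4) by (simp add: power_int_add)
      qed
    qed
    then show ?thesis using m(1) True
      by (intro exI[of _ "m + mult y * n"]) (simp add: algebra_simps)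
  next
    case False
    then have y: "y \<notin> f -` D" "y \<in> - f -` D" by simp_all
    obtain U g where U: "(U, g) \<in> triv V" "f y \<in> U" using triv_ex[OF RX B(2)] by blast
    note c = triv_compat[OF RX B(2) U]
    have c': "compat Y (atlas (pullback_bundle Y X f L)) y (\<lambda>q. g (f q))"
      by (rule compat_pullback[OF presents_compat[OF RX P c False]])
    have "compat Y (triv V') y (\<lambda>q. g (f q))"
      by (rule compat_transfer[OF RY B'(3,2) open_base[OF RY B'(3)] y(2) y(2) UNIV_I _ c'])
         (use P' in \<open>simp add: presents_def\<close>)
    then have "section_order Y (triv V') y (\<lambda>q. s (f q)) (mult y * n)"
      unfolding section_order_def using lift[OF c] by blast
    then show ?thesis using False by (intro exI[of _ "mult y * n"]) simp
  qed
qed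

text \<open>For a line bundle the parabolic degree is a sum of order plus weight over points. The
  pullback of a meromorphic section multiplies each summand by the ramification index.\<close>

lemma parabolic_degree_pullback:
  fixes L :: "('x, 1) filtered_bundle"
  assumes cpt: "compact (UNIV :: 'y set)" and con: "connected (UNIV :: 'x set)"
    and L: "parabolic_line_bundle_deg0 X D L"
  shows "parabolic_line_bundle_deg0 Y (f -` D) (pullback_bundle Y X f L)"
proof -
  obtain V d where P: "presents X D V L" and deg: "has_degree X (triv V) d" and d0: "of_int d + weight_sum D V = 0"
    using L by (auto simp: parabolic_line_bundle_deg0_def)
  obtain V' where P': "presents Y (f -` D) V' (pullback_bundle Y X f L)"
    using parabolic_pullback[OF cpt] P unfolding parabolic_bundle_def by blast
  note B = presents_bundles[OF RX P] and B' = presents_bundles[OF RY P']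
  let ?o = "\<lambda>x s. order_at X (\<lambda>p. (snd (triv_at (triv V) x) p *v s p) $ 1) x"
  obtain s P0 where s: "finite P0" "holo_section X (triv V) (- P0) s" "\<forall>p. p \<notin> P0 \<longrightarrow> s p \<noteq> 0"
    "\<forall>x\<in>P0. \<exists>(n::nat) W u. x \<in> W \<and> holo_section X (triv V) W u \<and>
           (\<forall>\<^sub>F p in at x. coord X x p ^ n *s s p = u p)" "d = (\<Sum>x\<in>P0. ?o x s)"
    using deg unfolding has_degree_def by blast
  have ord0: "section_order X (triv V) x s 0" if "x \<notin> P0" for x
    using section_order_nonzero[OF RX B(2) _ _ UNIV_I, of x s] s(2,3) that
    unfolding section_iff[OF RX B(2)] by blast
  have "\<exists>n. section_order X (triv V) x s n" for x
  proof (cases "x \<in> P0")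
    case True
    have "\<forall>\<^sub>F p in at x. s p \<noteq> 0"
      using eventually_notin_finite[OF s(1)] by eventually_elim (use s(3) in blast)
    then show ?thesis using s(4) True section_order_ex[OF RX B(2)] by blast
  next
    case False
    then show ?thesis using ord0 by blast
  qed
  then have o: "section_order X (triv V) x s (?o x s)" for x
    using order_at_section[OF RX B(2)] by metis
  \<comment> \<open>Orders and weights are summed over a common set: points outside
    \<open>P0\<close> have order 0, and \<open>\<beta>\<close> is 0 outside
    \<open>D\<close>.\<close>
  define P1 where "P1 = P0 \<union> D"
  have P1: "finite P1" using s(1) B(1) by (simp add: P1_def)
  have d1: "d = (\<Sum>x\<in>P1. ?o x s)"
    unfolding s(5) P1_def using s(1) B(1) order_at_section[OF RX B(2) ord0]
    by (intro sum.mono_neutral_left) auto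
  define \<beta> where "\<beta> x = (if x \<in> D then wt V x 1 else 0)" for x
  define \<beta>' where "\<beta>' y = (if f y \<in> D then wt V' y 1 else 0)" for y
  have w: "weight_sum D V = (\<Sum>x\<in>P1. \<beta> x)"
    unfolding weight_sum_line[OF RX B(4)] using P1
    by (intro sum.mono_neutral_cong_left) (auto simp: P1_def \<beta>_def)
  let ?s = "\<lambda>q. s (f q)"
  let ?o' = "\<lambda>y. order_at Y (\<lambda>q. (snd (triv_at (triv V') y) q *v ?s q) $ 1) y"
  have ex': "\<exists>n'. section_order Y (triv V') y ?s n' \<and> of_int n' + \<beta>' y = of_int (mult y) * (of_int (?o (f y) s) + \<beta> (f y))" for y
    using section_order_pullback[OF P P' o] unfolding \<beta>_def \<beta>'_def .
  have o': "section_order Y (triv V') y ?s (?o' y)"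
    and oo: "of_int (?o' y) + \<beta>' y = of_int (mult y) * (of_int (?o (f y) s) + \<beta> (f y))" for y
    using ex'[of y] order_at_section[OF RY B'(2), of y ?s] by auto
  define P2 where "P2 = f -` P1"
  have P2: "finite P2" unfolding P2_def by (rule finite_vimage_f[OF cpt P1])
  have w': "weight_sum (f -` D) V' = (\<Sum>y\<in>P2. \<beta>' y)"
    unfolding weight_sum_line[OF RY B'(4)] using P2
    by (intro sum.mono_neutral_cong_left) (auto simp: P1_def P2_def \<beta>'_def)
  have hd: "has_degree Y (triv V') (\<Sum>y\<in>P2. ?o' y)"
    unfolding has_degree_def
  proof (intro exI conjI)
    show "finite P2" by (rule P2)
    have sub: "- P2 \<subseteq> - f -` D" by (auto simp: P2_def P1_def)
    have "holo_section X (triv V) (- P1) s"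
      using s(2) P1 unfolding section_iff[OF RX B(2)] 
      by (auto simp: P1_def intro!: open_Int open_Compl finite_imp_closed)
    then have sX: "sgerm X (atlas L) x s" if "x \<notin> P1" for x
      using that presents_sgerm[OF RX P, of x s] unfolding section_iff[OF RX B(2)] by (auto simp: P1_def)
    have "sgerm Y (atlas (pullback_bundle Y X f L)) y ?s" if "y \<notin> P2" for y
      using sX[of "f y"] that hvec_pull unfolding sgerm_def atlas_pullback P2_def by fastforce
    then have "holo_section Y (atlas (pullback_bundle Y X f L)) (- P2) ?s"
      unfolding section_iff[OF RY B'(3)] using P2 by (simp add: finite_imp_closed open_Compl)
    then show "holo_section Y (triv V') (- P2) ?s" using P' sub unfolding presents_def by blast
    show "\<forall>p. p \<notin> P2 \<longrightarrow> ?s p \<noteq> 0" using s(3) by (auto simp: P2_def P1_def)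
    show "\<forall>y\<in>P2. \<exists>(n::nat) W u. y \<in> W \<and> holo_section Y (triv V') W u \<and>
           (\<forall>\<^sub>F p in at y. coord Y y p ^ n *s ?s p = u p)"
      using section_order_meromorphic[OF RY B'(2) o'] by blast
  qed simp
  \<comment> \<open>The degree of \<open>f\<close>; any base point may serve, since all fibre sums
    agree.\<close>
  define M where "M = (\<Sum>p\<in>f -` {undefined}. mult p)"
  have M: "(\<Sum>p\<in>f -` {x}. mult p) = M" for x unfolding M_def by (rule fibre_mult_const[OF cpt con])
  have "of_int (\<Sum>y\<in>P2. ?o' y) + weight_sum (f -` D) V' = (\<Sum>y\<in>P2. of_int (mult y) * (of_int (?o (f y) s) + \<beta> (f y)))"
    unfolding w' oo[symmetric] by (simp add: sum.distrib)
  also have "\<dots> = (\<Sum>x\<in>P1. \<Sum>y\<in>{y\<in>P2. f y = x}. of_int (mult y) * (of_int (?o (f y) s) + \<beta> (f y)))"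
    by (rule sum.group[OF P2 P1, symmetric]) (auto simp: P2_def)
  also have "\<dots> = (\<Sum>x\<in>P1. of_int M * (of_int (?o x s) + \<beta> x))"
  proof (rule sum.cong[OF refl])
    fix x assume "x \<in> P1"
    then have "{y\<in>P2. f y = x} = f -` {x}" by (auto simp: P2_def)
    then have "(\<Sum>y\<in>{y\<in>P2. f y = x}. of_int (mult y) * (of_int (?o (f y) s) + \<beta> (f y)))
        = (\<Sum>y\<in>f -` {x}. of_int (mult y) * (of_int (?o x s) + \<beta> x))" by (intro sum.cong) auto
    also have "\<dots> = of_int (\<Sum>y\<in>f -` {x}. mult y) * (of_int (?o x s) + \<beta> x)"
      by (simp add: sum_distrib_right)
    finally show "(\<Sum>y\<in>{y\<in>P2. f y = x}. of_int (mult y) * (of_int (?o (f y) s) + \<beta> (f y)))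
        = of_int M * (of_int (?o x s) + \<beta> x)" unfolding M .
  qed
  also have "\<dots> = of_int M * (of_int d + weight_sum D V)"
    unfolding d1 w by (simp add: sum_distrib_left sum.distrib distrib_left)
  finally have "of_int (\<Sum>y\<in>P2. ?o' y) + weight_sum (f -` D) V' = 0" using d0 by simp
  then show ?thesis unfolding parabolic_line_bundle_deg0_def using P' hd by blast
qed

end

section \<open>Assembly of the pulled back structures\<close>

context covering
begin

lemma quasiparabolic_on_pullback:
  fixes E :: "('x, 'r::finite) filtered_bundle" and L :: "('x, 1) filtered_bundle"
  assumes cpt: "compact (UNIV :: 'y set)" and E: "parabolic_bundle X D E" and L: "parabolic_bundle X D L"
    and q: "quasiparabolic_connection_on X D E L \<phi> nab" and nd: "nondegenerate_form X D E L \<phi>"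
  shows "quasiparabolic_connection_on Y (f -` D) (pullback_bundle Y X f E) (pullback_bundle Y X f L)
    (pullback_form f \<phi>) (pullback_connection X f E nab)"
proof -
  obtain nabL where qc: "quasiparabolic_connection X D E nab" and can: "canonical_connection X D L nabL"
    and comp: "compatible_connection X D E \<phi> nab nabL"
    using q unfolding quasiparabolic_connection_on_def by blast
  obtain VE where PE: "presents X D VE E" and LE: "log_connection X D (triv VE) nab"
    using qc unfolding quasiparabolic_connection_def by blast
  obtain VL where PL: "presents X D VL L" and LL: "log_connection X D (triv VL) nabL"
    and res: "\<forall>x\<in>D. \<forall>v. residue_map X (triv VL) nabL x v = complex_of_real (wt VL x 1) *s v"
    and un: "unitary_monodromy X (- D) (atlas L) nabL"
    using can unfolding canonical_connection_def by blast
  note H = log_H[OF RX PE LE] and HL = log_H[OF RX PL LL]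
  note BE = presents_bundles(3)[OF RX PE] and BL = presents_bundles(3)[OF RX PL]
  obtain V' where P': "presents Y (f -` D) V' (pullback_bundle Y X f L)"
    using parabolic_pullback[OF cpt L] by (auto simp: parabolic_bundle_def)
  \<comment> \<open>The definition only asks that some canonical connection on the line bundle be
    compatible; the pullback of \<open>nabL\<close> is the witness, and it must itself be recognized
    as canonical.\<close>
  have "canonical_connection Y (f -` D) (pullback_bundle Y X f L) (pullback_connection X f L nabL)"
    unfolding canonical_connection_def
    using P' canonical_pullback[OF cpt PL LL res P'] unitary_pullback[OF BL HL un] by blast
  moreover have "compatible_connection Y (f -` D) (pullback_bundle Y X f E) (pullback_form f \<phi>)
    (pullback_connection X f E nab) (pullback_connection X f L nabL)"
    by (rule compatible_pullback[OF comp BE BL H HL]) (use nd in \<open>simp add: nondegenerate_form_def\<close>)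
  ultimately show ?thesis
    unfolding quasiparabolic_connection_on_def using quasiparabolic_pullback[OF cpt qc] by blast
qed

end

theorem lemma4p5:
  fixes X :: "'x::t2_space chart set" and Y :: "'y::t2_space chart set"
    and D :: "'x set" and f :: "'y \<Rightarrow> 'x"
    and E :: "('x, 'r::finite) filtered_bundle" and L :: "('x, 1) filtered_bundle"
    and \<phi> :: "'x \<Rightarrow> complex ^ ('r \<times> 'r) ^ 1" and nab :: "('x, 'r) connection"
  assumes "compact_connected_riemann_surface X" and "compact_connected_riemann_surface Y"
    and "holo_map Y X f" and "\<not> f constant_on UNIV"
    and "finite D"
    and "parabolic_bundle X D E"
    and "parabolic_line_bundle_deg0 X D L"
    and "quasiparabolic_connection_on X D E L \<phi> nab"
  shows "(symplectic_structure X D E L \<phi> \<longrightarrow>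
            symplectic_structure Y (f -` D) (pullback_bundle Y X f E) (pullback_bundle Y X f L)
              (pullback_form f \<phi>) \<and>
            quasiparabolic_connection_on Y (f -` D) (pullback_bundle Y X f E) (pullback_bundle Y X f L)
              (pullback_form f \<phi>) (pullback_connection X f E nab)) \<and>
         (orthogonal_structure X D E L \<phi> \<longrightarrow>
            orthogonal_structure Y (f -` D) (pullback_bundle Y X f E) (pullback_bundle Y X f L)
              (pullback_form f \<phi>) \<and>
            quasiparabolic_connection_on Y (f -` D) (pullback_bundle Y X f E) (pullback_bundle Y X f L)
              (pullback_form f \<phi>) (pullback_connection X f E nab))"
proof -
  interpret covering X Y f
    using assms(1-4) by unfold_locales (auto simp: compact_connected_riemann_surface_def)
  have cpt: "compact (UNIV :: 'y set)" and con: "connected (UNIV :: 'x set)"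
    using assms(1,2) by (auto simp: compact_connected_riemann_surface_def)
  have L: "parabolic_bundle X D L"
    using assms(7) by (auto simp: parabolic_line_bundle_deg0_def parabolic_bundle_def)
  note E' = parabolic_pullback[OF cpt assms(6)] and L' = parabolic_degree_pullback[OF cpt con assms(7)]
  note nd' = nondegenerate_pullback[OF assms(6) L]
    and q' = quasiparabolic_on_pullback[OF cpt assms(6) L assms(8)]
  show ?thesis
  proof (intro conjI impI)
    assume S: "symplectic_structure X D E L \<phi>"
    then have nd: "nondegenerate_form X D E L \<phi>"
      and sym: "\<And>p u v. p \<notin> D \<Longrightarrow> \<phi> p *v tensor_vec u v = - (\<phi> p *v tensor_vec v u)"
      unfolding symplectic_structure_def by blast+
    show "symplectic_structure Y (f -` D) (pullback_bundle Y X f E) (pullback_bundle Y X f L) (pullback_form f \<phi>)"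
      unfolding symplectic_structure_def pullback_form_def o_def
    proof (intro conjI E' L' allI impI nd'[OF nd, unfolded pullback_form_def o_def])
      fix y u v assume "y \<notin> f -` D"
      then have "f y \<notin> D" by simp
      then show "\<phi> (f y) *v tensor_vec u v = - (\<phi> (f y) *v tensor_vec v u)" by (rule sym)
    qed
    show "quasiparabolic_connection_on Y (f -` D) (pullback_bundle Y X f E) (pullback_bundle Y X f L)
        (pullback_form f \<phi>) (pullback_connection X f E nab)" by (rule q'[OF nd])
  next
    assume S: "orthogonal_structure X D E L \<phi>"
    then have nd: "nondegenerate_form X D E L \<phi>"
      and sym: "\<And>p u v. p \<notin> D \<Longrightarrow> \<phi> p *v tensor_vec u v = \<phi> p *v tensor_vec v u"
      unfolding orthogonal_structure_def by blast+
    show "orthogonal_structure Y (f -` D) (pullback_bundle Y X f E) (pullback_bundle Y X f L) (pullback_form f \<phi>)"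
      unfolding orthogonal_structure_def pullback_form_def o_def
    proof (intro conjI E' L' allI impI nd'[OF nd, unfolded pullback_form_def o_def])
      fix y u v assume "y \<notin> f -` D"
      then have "f y \<notin> D" by simp
      then show "\<phi> (f y) *v tensor_vec u v = \<phi> (f y) *v tensor_vec v u" by (rule sym)
    qed
    show "quasiparabolic_connection_on Y (f -` D) (pullback_bundle Y X f E) (pullback_bundle Y X f L)
        (pullback_form f \<phi>) (pullback_connection X f E nab)" by (rule q'[OF nd])
  qed
qed

end
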